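(* Let $p$ be a prime number and $(R,\mathfrak m,k)$ a Henselian $F$-finite Noetherian local ring of characteristic $p$ and dimension $d$. Let $\delta=d+\log_p[k:k^p]$. Let $M$ be a nonzero finitely generated $R$-module. Assume that the Frobenius limit $$\operatorname{FL}([M])=\lim_{e\to\infty}\frac{1}{p^{\delta e}}[{}^eM]\in\Theta(R)$$ exists. Then $$s_R(M)=\lim_{e\to\infty}\frac{\operatorname{surj}_M({}^eM)}{p^{\delta e}}=\operatorname{asn}_M(\operatorname{FL}([M])).$$
   Context: For finitely generated $R$-modules $M,N$ with $N\ne0$: $\operatorname{surj}_N(M)$ is the largest $n\ge0$ such that there is a surjective $R$-linear map $M\to N^{\oplus n}$. ${}^eM$ denotes $M$ viewed as an $R$-module via the $e$-th iterate of the Frobenius map. The dual $F$-signature is $s_R(M):=\limsup_{e\to\infty}\operatorname{surj}_M({}^eM)/p^{\delta e}$. $\Theta(R):=\mathbb R\otimes_{\mathbb Z}\bigl(\bigoplus_M\mathbb Z\cdot M\bigr)/(M-M_1-M_2\mid M\cong M_1\oplus M_2)$, where $M,M_1,M_2$ run over finitely generated $R$-modules; $[M]$ is the class of $M$. The classes of the set $\operatorname{Ind}(R)$ of isomorphism classes of indecomposable finitely generated modules form an $\mathbb R$-basis of $\Theta(R)$, so each $\alpha\in\Theta(R)$ is uniquely $\alpha=\sum_{W\in\operatorname{Ind}(R)}c_W[W]$ with $c_W\in\mathbb R$. The norm is $\|\alpha\|=\sum_W|c_W|\mu_R(W)$, where $\mu_R$ is the minimal number of generators; limits in $\Theta(R)$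 are with respect to this norm. Put $\langle\alpha\rangle=\sum_W\max(0,\lfloor c_W\rfloor)[W]$; there is a unique (up to isomorphism) finitely generated module $M_\alpha$ with $\langle\alpha\rangle=[M_\alpha]$, and for $N\neq0$ one sets $\operatorname{surj}_N\alpha:=\operatorname{surj}_N M_\alpha$ and $\operatorname{asn}_N(\alpha):=\lim_{t\to\infty}\frac1t\operatorname{surj}_N(t\alpha)$ (this limit exists). *)

theory Defs
  imports
    "HOL-Library.Extended_Nat"
    "HOL-Library.Extended_Real"
    "HOL-Library.Liminf_Limsup"
    "HOL-Library.Poly_Mapping"
    "HOL-Algebra.Algebra"
begin

section \<open>Rings\<close>

definition local_ring :: "('a, 'r) ring_scheme \<Rightarrow> bool"
  where "local_ring R \<longleftrightarrow> cring R \<and> (\<exists>!I. maximalideal I R)"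

definition max_ideal :: "('a, 'r) ring_scheme \<Rightarrow> 'a set"
  where "max_ideal R = (THE I. maximalideal I R)"

definition residue_field :: "('a, 'r) ring_scheme \<Rightarrow> 'a set ring"
  where "residue_field R = R Quot (max_ideal R)"

definition has_characteristic :: "('a, 'r) ring_scheme \<Rightarrow> nat \<Rightarrow> bool"
  where "has_characteristic R p \<longleftrightarrow> (\<forall>n::nat. [n] \<cdot>\<^bsub>R\<^esub> \<one>\<^bsub>R\<^esub> = \<zero>\<^bsub>R\<^esub> \<longleftrightarrow> p dvd n)"

definition krull_dim :: "('a, 'r) ring_scheme \<Rightarrow> enat"
  where "krull_dim R = Sup {enat n | n. \<exists>P :: nat \<Rightarrow> 'a set.
    (\<forall>i\<le>n. primeideal (P i) R) \<and> (\<forall>i<n. P i \<subset> P (Suc i))}"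

definition monic_poly :: "('a, 'r) ring_scheme \<Rightarrow> 'a list \<Rightarrow> bool"
  where "monic_poly R f \<longleftrightarrow>
    f \<in> carrier (univ_poly R (carrier R)) \<and> f \<noteq> [] \<and> lead_coeff f = \<one>\<^bsub>R\<^esub>"

definition comaximal :: "('a, 'r) ring_scheme \<Rightarrow> 'a \<Rightarrow> 'a \<Rightarrow> bool"
  where "comaximal S a b \<longleftrightarrow>
    (\<exists>u\<in>carrier S. \<exists>v\<in>carrier S. u \<otimes>\<^bsub>S\<^esub> a \<oplus>\<^bsub>S\<^esub> v \<otimes>\<^bsub>S\<^esub> b = \<one>\<^bsub>S\<^esub>)"

text \<open>Only applied to monic polynomials over a local ring, whose leading coefficient does not
  vanish in the residue field; hence no normalization of the coefficient list is needed.\<close>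
definition reduce_poly :: "('a, 'r) ring_scheme \<Rightarrow> 'a list \<Rightarrow> 'a set list"
  where "reduce_poly R f = map (\<lambda>a. max_ideal R +>\<^bsub>R\<^esub> a) f"

text \<open>Hensel's lemma: coprime monic factorizations over the residue field lift.\<close>
definition henselian :: "('a, 'r) ring_scheme \<Rightarrow> bool"
  where "henselian R \<longleftrightarrow> local_ring R \<and>
    (let k = residue_field R; kX = univ_poly k (carrier k); RX = univ_poly R (carrier R) in
      \<forall>f g0 h0. monic_poly R f \<longrightarrow> monic_poly k g0 \<longrightarrow> monic_poly k h0 \<longrightarrow>
        comaximal kX g0 h0 \<longrightarrow> reduce_poly R f = g0 \<otimes>\<^bsub>kX\<^esub> h0 \<longrightarrow>
        (\<exists>g h. monic_poly R g \<and> monic_poly R h \<and> f = g \<otimes>\<^bsub>RX\<^esub> h \<and>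
               reduce_poly R g = g0 \<and> reduce_poly R h = h0))"

section \<open>Modules\<close>

text \<open>The module record inherits the fields \<open>mult\<close> and \<open>one\<close> from rings; the locale \<open>module\<close>
  ignores them, and they are left undefined below.\<close>

definition regular_module :: "('a, 'r) ring_scheme \<Rightarrow> ('a, 'a) module"
  where "regular_module R =
    \<lparr>carrier = carrier R, monoid.mult = undefined, monoid.one = undefined,
     ring.zero = \<zero>\<^bsub>R\<^esub>, ring.add = (\<oplus>\<^bsub>R\<^esub>), smult = (\<otimes>\<^bsub>R\<^esub>)\<rparr>"

definition direct_sum ::
    "('a, 'b, 'm) module_scheme \<Rightarrow> ('a, 'c, 'n) module_scheme \<Rightarrow> ('a, 'b \<times> 'c) module"
  where "direct_sum M N =
    \<lparr>carrier = carrier M \<times> carrier N, monoid.mult = undefined, monoid.one = undefined,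
     ring.zero = (\<zero>\<^bsub>M\<^esub>, \<zero>\<^bsub>N\<^esub>),
     ring.add = (\<lambda>x y. (fst x \<oplus>\<^bsub>M\<^esub> fst y, snd x \<oplus>\<^bsub>N\<^esub> snd y)),
     smult = (\<lambda>r x. (r \<odot>\<^bsub>M\<^esub> fst x, r \<odot>\<^bsub>N\<^esub> snd x))\<rparr>"

definition direct_power ::
    "('a, 'b, 'm) module_scheme \<Rightarrow> nat \<Rightarrow> ('a, nat \<Rightarrow> 'b) module"
  where "direct_power N n =
    \<lparr>carrier = {..<n} \<rightarrow>\<^sub>E carrier N, monoid.mult = undefined, monoid.one = undefined,
     ring.zero = (\<lambda>i\<in>{..<n}. \<zero>\<^bsub>N\<^esub>),
     ring.add = (\<lambda>x y. \<lambda>i\<in>{..<n}. x i \<oplus>\<^bsub>N\<^esub> y i),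
     smult = (\<lambda>r x. \<lambda>i\<in>{..<n}. r \<odot>\<^bsub>N\<^esub> x i)\<rparr>"

definition module_hom :: "('a, 'r) ring_scheme \<Rightarrow> ('a, 'b, 'm) module_scheme \<Rightarrow>
    ('a, 'c, 'n) module_scheme \<Rightarrow> ('b \<Rightarrow> 'c) set"
  where "module_hom R M N = {f \<in> carrier M \<rightarrow> carrier N.
    (\<forall>x\<in>carrier M. \<forall>y\<in>carrier M. f (x \<oplus>\<^bsub>M\<^esub> y) = f x \<oplus>\<^bsub>N\<^esub> f y) \<and>
    (\<forall>r\<in>carrier R. \<forall>x\<in>carrier M. f (r \<odot>\<^bsub>M\<^esub> x) = r \<odot>\<^bsub>N\<^esub> f x)}"

definition module_isomorphic :: "('a, 'r) ring_scheme \<Rightarrow> ('a, 'b, 'm) module_scheme \<Rightarrow>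
    ('a, 'c, 'n) module_scheme \<Rightarrow> bool"
  where "module_isomorphic R M N \<longleftrightarrow>
    (\<exists>f\<in>module_hom R M N. bij_betw f (carrier M) (carrier N))"

definition module_span ::
    "('a, 'r) ring_scheme \<Rightarrow> ('a, 'b, 'm) module_scheme \<Rightarrow> 'b set \<Rightarrow> 'b set"
  where "module_span R M A = \<Inter>{N. submodule N R M \<and> A \<subseteq> N}"

definition fg_module :: "('a, 'r) ring_scheme \<Rightarrow> ('a, 'b, 'm) module_scheme \<Rightarrow> bool"
  where "fg_module R M \<longleftrightarrow> module R M \<and>
    (\<exists>A\<subseteq>carrier M. finite A \<and> module_span R M A = carrier M)"

definition zero_module :: "('a, 'b, 'm) module_scheme \<Rightarrow> bool"
  where "zero_module M \<longleftrightarrow> carrier M = {\<zero>\<^bsub>M\<^esub>}"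

definition min_gens :: "('a, 'r) ring_scheme \<Rightarrow> ('a, 'b, 'm) module_scheme \<Rightarrow> nat"
  where "min_gens R M = (LEAST n. \<exists>A\<subseteq>carrier M.
    finite A \<and> card A = n \<and> module_span R M A = carrier M)"

definition surj_num :: "('a, 'r) ring_scheme \<Rightarrow> ('a, 'b, 'm) module_scheme \<Rightarrow>
    ('a, 'c, 'n) module_scheme \<Rightarrow> nat"
  where "surj_num R N M = (GREATEST n. \<exists>f\<in>module_hom R M (direct_power N n).
    f ` carrier M = carrier (direct_power N n))"

section \<open>Frobenius\<close>

definition frob_module :: "('a, 'r) ring_scheme \<Rightarrow> nat \<Rightarrow> nat \<Rightarrow>
    ('a, 'b, 'm) module_scheme \<Rightarrow> ('a, 'b, 'm) module_scheme"
  where "frob_module R p e M = M\<lparr>smult := (\<lambda>r x. (r [^]\<^bsub>R\<^esub> (p ^ e)) \<odot>\<^bsub>M\<^esub> x)\<rparr>"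

definition F_finite :: "('a, 'r) ring_scheme \<Rightarrow> nat \<Rightarrow> bool"
  where "F_finite R p \<longleftrightarrow> fg_module R (frob_module R p 1 (regular_module R))"

text \<open>The degree of a field \<open>k\<close> over its subfield of \<open>p\<close>-th powers.\<close>
definition p_degree :: "('a, 'r) ring_scheme \<Rightarrow> nat \<Rightarrow> nat"
  where "p_degree k p = ring.dim k {x [^]\<^bsub>k\<^esub> p | x. x \<in> carrier k} (carrier k)"

definition frob_delta :: "('a, 'r) ring_scheme \<Rightarrow> nat \<Rightarrow> real"
  where "frob_delta R p =
    real (the_enat (krull_dim R)) + log (real p) (real (p_degree (residue_field R) p))"

definition dual_F_signature ::
    "('a, 'r) ring_scheme \<Rightarrow> nat \<Rightarrow> ('a, 'b, 'm) module_scheme \<Rightarrow> ereal"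
  where "dual_F_signature R p M = limsup (\<lambda>e. ereal
    (real (surj_num R M (frob_module R p e M)) / real p powr (frob_delta R p * real e)))"

section \<open>Real scalar extension of an abelian group\<close>

text \<open>For an abelian group \<open>G\<close> (written multiplicatively), the tensor product of the additive
  group of reals with \<open>G\<close> over the integers is the free abelian group on the pairs \<open>(a, g)\<close>
  modulo the biadditivity relations. A real \<open>c\<close> acts by sending the class of \<open>(a, g)\<close> to that of
  \<open>(c * a, g)\<close>; the union in \<open>smult\<close> is over equal cosets.\<close>

definition tensor_free :: "('g, 'm) monoid_scheme \<Rightarrow> ((real \<times> 'g) \<Rightarrow>\<^sub>0 int) monoid"
  where "tensor_free G = free_Abelian_group (UNIV \<times> carrier G)"

definition tensor_rel :: "('g, 'm) monoid_scheme \<Rightarrow> ((real \<times> 'g) \<Rightarrow>\<^sub>0 int) set"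
  where "tensor_rel G = generate (tensor_free G)
    ({frag_of (a + b, g) - frag_of (a, g) - frag_of (b, g) | a b g. g \<in> carrier G} \<union>
     {frag_of (a, g \<otimes>\<^bsub>G\<^esub> h) - frag_of (a, g) - frag_of (a, h) | a g h.
        g \<in> carrier G \<and> h \<in> carrier G})"

definition pure_tensor ::
    "('g, 'm) monoid_scheme \<Rightarrow> real \<Rightarrow> 'g \<Rightarrow> ((real \<times> 'g) \<Rightarrow>\<^sub>0 int) set"
  where "pure_tensor G a g = tensor_rel G #>\<^bsub>tensor_free G\<^esub> frag_of (a, g)"

definition real_tensor ::
    "('g, 'm) monoid_scheme \<Rightarrow> (real, ((real \<times> 'g) \<Rightarrow>\<^sub>0 int) set) module"
  where "real_tensor G = (let Q = tensor_free G Mod tensor_rel G in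
    \<lparr>carrier = carrier Q, monoid.mult = undefined, monoid.one = undefined,
     ring.zero = \<one>\<^bsub>Q\<^esub>, ring.add = (\<otimes>\<^bsub>Q\<^esub>),
     smult = (\<lambda>c Y. \<Union>y\<in>Y. tensor_rel G #>\<^bsub>tensor_free G\<^esub>
                frag_extend (\<lambda>(a, g). frag_of (c * a, g)) y)\<rparr>)"

section \<open>The space Theta\<close>

text \<open>Every finitely generated \<open>R\<close>-module is isomorphic to one whose elements are lists over \<open>R\<close>
  (choose for each element a list of coefficients with respect to fixed generators), so the
  modules with carrier in \<open>'a list\<close> represent all isomorphism classes.\<close>
definition fg_modules :: "('a, 'r) ring_scheme \<Rightarrow> ('a, 'a list) module set"
  where "fg_modules R = {M. fg_module R M}"

text \<open>The isomorphic copy in the universe \<open>fg_modules R\<close>.\<close>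
definition module_copy ::
    "('a, 'r) ring_scheme \<Rightarrow> ('a, 'b, 'm) module_scheme \<Rightarrow> ('a, 'a list) module"
  where "module_copy R M = (SOME M'. M' \<in> fg_modules R \<and> module_isomorphic R M M')"

definition theta_rel :: "('a, 'r) ring_scheme \<Rightarrow> (('a, 'a list) module \<Rightarrow>\<^sub>0 int) set"
  where "theta_rel R = generate (free_Abelian_group (fg_modules R))
    {frag_of M - frag_of M1 - frag_of M2 | M M1 M2.
       M \<in> fg_modules R \<and> M1 \<in> fg_modules R \<and> M2 \<in> fg_modules R \<and>
       module_isomorphic R M (direct_sum M1 M2)}"

type_synonym 'a theta_int = "(('a, 'a list) module \<Rightarrow>\<^sub>0 int) set"
type_synonym 'a theta = "((real \<times> 'a theta_int) \<Rightarrow>\<^sub>0 int) set"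

definition Theta_int :: "('a, 'r) ring_scheme \<Rightarrow> 'a theta_int monoid"
  where "Theta_int R = free_Abelian_group (fg_modules R) Mod theta_rel R"

definition Theta :: "('a, 'r) ring_scheme \<Rightarrow> (real, 'a theta) module"
  where "Theta R = real_tensor (Theta_int R)"

definition theta_class :: "('a, 'r) ring_scheme \<Rightarrow> ('a, 'b, 'm) module_scheme \<Rightarrow> 'a theta"
  where "theta_class R M = pure_tensor (Theta_int R) 1
    (theta_rel R #>\<^bsub>free_Abelian_group (fg_modules R)\<^esub> frag_of (module_copy R M))"

definition indecomposable :: "('a, 'r) ring_scheme \<Rightarrow> ('a, 'a list) module \<Rightarrow> bool"
  where "indecomposable R M \<longleftrightarrow> \<not> zero_module M \<and>
    (\<forall>M1\<in>fg_modules R. \<forall>M2\<in>fg_modules R.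
       module_isomorphic R M (direct_sum M1 M2) \<longrightarrow> zero_module M1 \<or> zero_module M2)"

definition Ind :: "('a, 'r) ring_scheme \<Rightarrow> ('a, 'a list) module set set"
  where "Ind R = {M \<in> fg_modules R. indecomposable R M} //
    {(M, N). M \<in> fg_modules R \<and> N \<in> fg_modules R \<and> module_isomorphic R M N}"

definition class_rep :: "('a, 'a list) module set \<Rightarrow> ('a, 'a list) module"
  where "class_rep W = (SOME M. M \<in> W)"

text \<open>The coordinates of \<open>\<alpha>\<close> with respect to the basis of classes of \<open>Ind R\<close>.\<close>
definition theta_coeff ::
    "('a, 'r) ring_scheme \<Rightarrow> 'a theta \<Rightarrow> ('a, 'a list) module set \<Rightarrow> real"
  where "theta_coeff R \<alpha> = (THE c. {W. c W \<noteq> 0} \<subseteq> Ind R \<and> finite {W. c W \<noteq> 0} \<and>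
    \<alpha> = (\<Oplus>\<^bsub>Theta R\<^esub>W\<in>{W. c W \<noteq> 0}. c W \<odot>\<^bsub>Theta R\<^esub> theta_class R (class_rep W)))"

definition theta_norm :: "('a, 'r) ring_scheme \<Rightarrow> 'a theta \<Rightarrow> real"
  where "theta_norm R \<alpha> =
    (\<Sum>W\<in>{W. theta_coeff R \<alpha> W \<noteq> 0}. \<bar>theta_coeff R \<alpha> W\<bar> * real (min_gens R (class_rep W)))"

definition theta_floor :: "('a, 'r) ring_scheme \<Rightarrow> 'a theta \<Rightarrow> 'a theta"
  where "theta_floor R \<alpha> = (\<Oplus>\<^bsub>Theta R\<^esub>W\<in>{W. theta_coeff R \<alpha> W \<noteq> 0}.
    real_of_int (max 0 \<lfloor>theta_coeff R \<alpha> W\<rfloor>) \<odot>\<^bsub>Theta R\<^esub> theta_class R (class_rep W))"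

definition theta_module :: "('a, 'r) ring_scheme \<Rightarrow> 'a theta \<Rightarrow> ('a, 'a list) module"
  where "theta_module R \<alpha> = (SOME M. M \<in> fg_modules R \<and> theta_class R M = theta_floor R \<alpha>)"

definition theta_surj ::
    "('a, 'r) ring_scheme \<Rightarrow> ('a, 'b, 'm) module_scheme \<Rightarrow> 'a theta \<Rightarrow> nat"
  where "theta_surj R N \<alpha> = surj_num R N (theta_module R \<alpha>)"

definition asn ::
    "('a, 'r) ring_scheme \<Rightarrow> ('a, 'b, 'm) module_scheme \<Rightarrow> 'a theta \<Rightarrow> real"
  where "asn R N \<alpha> =
    Lim at_top (\<lambda>t::real. (1 / t) * real (theta_surj R N (t \<odot>\<^bsub>Theta R\<^esub> \<alpha>)))"

definition theta_tendsto :: "('a, 'r) ring_scheme \<Rightarrow> (nat \<Rightarrow> 'a theta) \<Rightarrow> 'a theta \<Rightarrow> bool"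
  where "theta_tendsto R s \<alpha> \<longleftrightarrow> \<alpha> \<in> carrier (Theta R) \<and>
    (\<lambda>e. theta_norm R (s e \<ominus>\<^bsub>Theta R\<^esub> \<alpha>)) \<longlonglongrightarrow> 0"

definition frob_sequence ::
    "('a, 'r) ring_scheme \<Rightarrow> nat \<Rightarrow> ('a, 'b, 'm) module_scheme \<Rightarrow> nat \<Rightarrow> 'a theta"
  where "frob_sequence R p M e =
    (1 / real p powr (frob_delta R p * real e)) \<odot>\<^bsub>Theta R\<^esub> theta_class R (frob_module R p e M)"

definition FL :: "('a, 'r) ring_scheme \<Rightarrow> nat \<Rightarrow> ('a, 'b, 'm) module_scheme \<Rightarrow> 'a theta"
  where "FL R p M = (THE \<alpha>. theta_tendsto R (frob_sequence R p M) \<alpha>)"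

end

theory Submission
  imports Defs
begin

text \<open>If a finitely generated module \<open>U\<close> splits as \<open>A \<oplus> B\<close>, then
  \<open>surj\<^sub>N A + surj\<^sub>N B \<le> surj\<^sub>N U \<le> surj\<^sub>N A + \<mu> B\<close>, because over a local ring each additional generator
  yields at most one additional copy of \<open>N\<close>. By Hensel's lemma every endomorphism \<open>f\<close> of an
  indecomposable module is bijective or \<open>1 - f\<close> is, so Krull--Schmidt holds: the coordinates of
  \<open>[M]\<close> in Theta are the multiplicities of the indecomposable summands of \<open>M\<close>, and \<open>surj\<^sub>N\<close> is
  Lipschitz with respect to the norm of Theta. Superadditivity (Fekete) gives the limit defining
  \<open>asn\<^sub>N \<alpha>\<close>. Comparing \<open>surj\<^sub>M\<close> of the \<open>e\<close>-th Frobenius pushforward of \<open>M\<close> with \<open>surj\<^sub>M (p ^ (\<delta> e) \<alpha>)\<close> for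
  \<open>\<alpha> = FL [M]\<close>, the error is at most \<open>p ^ (\<delta> e)\<close> times the distance of the normalized class from \<open>\<alpha>\<close>,
  plus a constant caused by rounding. This is \<open>o(p ^ (\<delta> e))\<close> if \<open>\<delta> > 0\<close>; if \<open>\<delta> = 0\<close>, both sides are
  eventually \<open>1\<close> or \<open>0\<close> according to whether \<open>\<mm> M = 0\<close>.\<close>


section \<open>Linear maps and isomorphisms\<close>

text \<open>\<open>Theta R\<close> is a quotient of a free abelian group, so the independence of the
  classes of indecomposables is not visible in it. It is obtained from functionals: each
  multiplicity is additive on direct sums, hence descends to the quotient, and its linear extension
  reads off one coordinate. The rounding constant shapes the final argument. It disappears after
  division by \<open>p^(\<delta> e)\<close> only if these numbers are unbounded. For
  \<open>\<delta> = 0\<close> no division takes place; instead the pushforwards have natural numbers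
  as coordinates, so convergence makes them eventually constant, and the limit is the class of one
  module \<open>E\<close> killed by \<open>\<mm>\<close>. Then \<open>asn\<close> is computed from
  the direct powers of \<open>E\<close>. Generators are always removed one at a time, and conditions
  such as \<open>N + \<mm> M = M\<close> are expressed through all submodules containing
  \<open>N\<close> and \<open>\<mm> M\<close>, so the submodule \<open>\<mm> M\<close> is never
  formed.\<close>

lemma module_homI:
  assumes "\<And>x. x \<in> carrier M \<Longrightarrow> f x \<in> carrier N"
    and "\<And>x y. \<lbrakk>x \<in> carrier M; y \<in> carrier M\<rbrakk> \<Longrightarrow> f (x \<oplus>\<^bsub>M\<^esub> y) = f x \<oplus>\<^bsub>N\<^esub> f y"
    and "\<And>r x. \<lbrakk>r \<in> carrier R; x \<in> carrier M\<rbrakk> \<Longrightarrow> f (r \<odot>\<^bsub>M\<^esub> x) = r \<odot>\<^bsub>N\<^esub> f x"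
  shows "f \<in> module_hom R M N"
  using assms by (auto simp: module_hom_def)

lemma module_homE:
  assumes "f \<in> module_hom R M N"
  shows module_hom_closed: "x \<in> carrier M \<Longrightarrow> f x \<in> carrier N"
    and module_hom_add: "\<lbrakk>x \<in> carrier M; y \<in> carrier M\<rbrakk> \<Longrightarrow> f (x \<oplus>\<^bsub>M\<^esub> y) = f x \<oplus>\<^bsub>N\<^esub> f y"
    and module_hom_smult: "\<lbrakk>r \<in> carrier R; x \<in> carrier M\<rbrakk> \<Longrightarrow> f (r \<odot>\<^bsub>M\<^esub> x) = r \<odot>\<^bsub>N\<^esub> f x"
  using assms by (auto simp: module_hom_def)

lemma module_hom_id: "id \<in> module_hom R M M" "(\<lambda>x. x) \<in> module_hom R M M"
  by (auto simp: module_hom_def)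

lemma module_hom_compose:
  assumes "f \<in> module_hom R M N" "g \<in> module_hom R N P"
  shows "(\<lambda>x. g (f x)) \<in> module_hom R M P"
  using module_homE[OF assms(1)] module_homE[OF assms(2)] by (intro module_homI) auto

lemma module_hom_cong:
  assumes "f \<in> module_hom R M N" "\<And>x. x \<in> carrier M \<Longrightarrow> f x = g x" "module R M"
  shows "g \<in> module_hom R M N"
proof -
  interpret module R M by fact
  show ?thesis
    using assms(1,2) by (intro module_homI) (auto dest: module_homE simp flip: assms(2))
qed

context
  fixes R :: "('a, 'r) ring_scheme" and M :: "('a, 'b, 'm) module_scheme"
    and N :: "('a, 'c, 'n) module_scheme"
  assumes M: "module R M" and N: "module R N"
begin

interpretation M: module R M by (rule M)
interpretation N: module R N by (rule N)

lemma module_hom_zero: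
  assumes "f \<in> module_hom R M N"
  shows "f \<zero>\<^bsub>M\<^esub> = \<zero>\<^bsub>N\<^esub>"
  using module_hom_smult[OF assms, of "\<zero>\<^bsub>R\<^esub>" "\<zero>\<^bsub>M\<^esub>"] module_hom_closed[OF assms] by simp

lemma module_hom_a_inv:
  assumes "f \<in> module_hom R M N" "x \<in> carrier M"
  shows "f (\<ominus>\<^bsub>M\<^esub> x) = \<ominus>\<^bsub>N\<^esub> f x"
proof -
  have "f (\<ominus>\<^bsub>M\<^esub> x) \<oplus>\<^bsub>N\<^esub> f x = \<zero>\<^bsub>N\<^esub>"
    using assms module_hom_add[OF assms(1), of "\<ominus>\<^bsub>M\<^esub> x" x] module_hom_zero[OF assms(1)]
    by (simp add: M.M.l_neg)
  then show ?thesis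
    using assms module_hom_closed[OF assms(1)] by (simp add: N.M.minus_equality)
qed

lemma module_hom_minus:
  assumes "f \<in> module_hom R M N" "x \<in> carrier M" "y \<in> carrier M"
  shows "f (x \<ominus>\<^bsub>M\<^esub> y) = f x \<ominus>\<^bsub>N\<^esub> f y"
  using assms module_hom_add[OF assms(1)] module_hom_a_inv[OF assms(1)]
  by (simp add: a_minus_def)

lemma module_hom_plus_hom:
  assumes "f \<in> module_hom R M N" "g \<in> module_hom R M N"
  shows "(\<lambda>x. f x \<oplus>\<^bsub>N\<^esub> g x) \<in> module_hom R M N"
  using module_homE[OF assms(1)] module_homE[OF assms(2)]
  by (intro module_homI) (auto simp: N.M.a_ac N.smult_r_distr)

lemma module_hom_minus_hom:
  assumes "f \<in> module_hom R M N" "g \<in> module_hom R M N"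
  shows "(\<lambda>x. f x \<ominus>\<^bsub>N\<^esub> g x) \<in> module_hom R M N"
  using module_homE[OF assms(1)] module_homE[OF assms(2)]
  by (intro module_homI)
    (auto simp: a_minus_def N.M.a_ac N.smult_r_distr N.M.minus_add N.smult_r_minus)

lemma module_hom_smult_hom:
  assumes "f \<in> module_hom R M N" "r \<in> carrier R"
  shows "(\<lambda>x. r \<odot>\<^bsub>N\<^esub> f x) \<in> module_hom R M N"
  using assms(2) module_homE[OF assms(1)]
  by (intro module_homI) (auto simp: N.smult_r_distr N.M.a_ac M.R.m_comm simp flip: N.smult_assoc1)

lemma module_hom_zero_hom: "(\<lambda>x. \<zero>\<^bsub>N\<^esub>) \<in> module_hom R M N"
  by (intro module_homI) auto

lemma module_hom_inj_on:
  assumes f: "f \<in> module_hom R M N"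
    and ker: "\<And>x. x \<in> carrier M \<Longrightarrow> f x = \<zero>\<^bsub>N\<^esub> \<Longrightarrow> x = \<zero>\<^bsub>M\<^esub>"
  shows "inj_on f (carrier M)"
proof (rule inj_onI)
  fix x y assume xy: "x \<in> carrier M" "y \<in> carrier M" "f x = f y"
  then have "f (x \<ominus>\<^bsub>M\<^esub> y) = \<zero>\<^bsub>N\<^esub>"
    using module_hom_minus[OF f xy(1,2)] module_hom_closed[OF f]
    by (simp add: a_minus_def N.M.r_neg)
  then have "x \<ominus>\<^bsub>M\<^esub> y = \<zero>\<^bsub>M\<^esub>" using ker xy by auto
  then show "x = y" using xy(1,2)
    by (metis M.M.minus_equality M.M.minus_minus M.M.a_inv_closed a_minus_def)
qed

lemma submodule_kernel:
  assumes f: "f \<in> module_hom R M N"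
  shows "submodule {x \<in> carrier M. f x = \<zero>\<^bsub>N\<^esub>} R M"
  using module_homE[OF f] module_hom_zero[OF f] module_hom_a_inv[OF f]
  by (intro M.submoduleI) auto

lemma submodule_image:
  assumes f: "f \<in> module_hom R M N" and P: "submodule P R M"
  shows "submodule (f ` P) R N"
proof (intro N.submoduleI)
  note P' = M.submoduleE[OF P]
  have sub: "\<And>x. x \<in> P \<Longrightarrow> x \<in> carrier M" using P'(1) by auto
  show "f ` P \<subseteq> carrier N" using sub module_hom_closed[OF f] by auto
  have "\<zero>\<^bsub>M\<^esub> \<in> P" using P' by (metis M.M.r_neg all_not_in_conv sub)
  then show "\<zero>\<^bsub>N\<^esub> \<in> f ` P" using module_hom_zero[OF f] by force
  show "\<ominus>\<^bsub>N\<^esub> a \<in> f ` P" if "a \<in> f ` P" for a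
    using that P'(3) sub module_hom_a_inv[OF f] by (metis (no_types, lifting) image_iff)
  show "a \<oplus>\<^bsub>N\<^esub> b \<in> f ` P" if "a \<in> f ` P" "b \<in> f ` P" for a b
    using that P'(5) sub module_hom_add[OF f] by (smt (verit, best) image_iff)
  show "a \<odot>\<^bsub>N\<^esub> b \<in> f ` P" if "a \<in> carrier R" "b \<in> f ` P" for a b
    using that P'(4) sub module_hom_smult[OF f] by (smt (verit, best) image_iff)
qed

lemma module_hom_inv_into:
  assumes f: "f \<in> module_hom R M N" and bij: "bij_betw f (carrier M) (carrier N)"
  shows "inv_into (carrier M) f \<in> module_hom R N M"
proof -
  have inv: "\<And>y. y \<in> carrier N \<Longrightarrow> f (inv_into (carrier M) f y) = y"
    and cl: "\<And>y. y \<in> carrier N \<Longrightarrow> inv_into (carrier M) f y \<in> carrier M"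
    using bij by (auto simp: bij_betw_def f_inv_into_f inv_into_into)
  have inj: "inj_on f (carrier M)" using bij by (auto simp: bij_betw_def)
  show ?thesis
    by (intro module_homI inv_into_f_eq[OF inj] cl)
      (auto simp: cl inv module_hom_add[OF f] module_hom_smult[OF f])
qed

lemma module_isomorphic_sym:
  assumes "module_isomorphic R M N"
  shows "module_isomorphic R N M"
  using assms module_hom_inv_into bij_betw_inv_into unfolding module_isomorphic_def by blast

lemma module_isomorphicI:
  assumes f: "f \<in> module_hom R M N" and g: "g \<in> module_hom R N M"
    and "\<And>x. x \<in> carrier M \<Longrightarrow> g (f x) = x" "\<And>y. y \<in> carrier N \<Longrightarrow> f (g y) = y"
  shows "module_isomorphic R M N"
proof -
  have "bij_betw f (carrier M) (carrier N)"
    using assms(3,4) module_hom_closed[OF f] module_hom_closed[OF g]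
    by (intro bij_betw_byWitness[where f' = g]) auto
  then show ?thesis using f by (auto simp: module_isomorphic_def)
qed

end

lemma module_isomorphic_refl: "module_isomorphic R M M"
  unfolding module_isomorphic_def using module_hom_id by (metis bij_betw_id)

lemma module_isomorphic_trans:
  assumes "module_isomorphic R M N" "module_isomorphic R N P"
  shows "module_isomorphic R M P"
  using assms module_hom_compose bij_betw_trans unfolding module_isomorphic_def comp_def by metis

lemma module_isomorphicE:
  assumes "module_isomorphic R M N" "module R M" "module R N"
  obtains f g where "f \<in> module_hom R M N" "g \<in> module_hom R N M"
    "\<And>x. x \<in> carrier M \<Longrightarrow> g (f x) = x" "\<And>y. y \<in> carrier N \<Longrightarrow> f (g y) = y"
proof -
  obtain f where f: "f \<in> module_hom R M N" "bij_betw f (carrier M) (carrier N)"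
    using assms by (auto simp: module_isomorphic_def)
  show ?thesis
    by (rule that[OF f(1) module_hom_inv_into[OF assms(2,3) f]])
      (use f in \<open>auto simp: bij_betw_def f_inv_into_f\<close>)
qed

section \<open>Direct sums\<close>

lemma direct_sum_simps [simp]:
  "carrier (direct_sum M N) = carrier M \<times> carrier N"
  "\<zero>\<^bsub>direct_sum M N\<^esub> = (\<zero>\<^bsub>M\<^esub>, \<zero>\<^bsub>N\<^esub>)"
  "x \<oplus>\<^bsub>direct_sum M N\<^esub> y = (fst x \<oplus>\<^bsub>M\<^esub> fst y, snd x \<oplus>\<^bsub>N\<^esub> snd y)"
  "r \<odot>\<^bsub>direct_sum M N\<^esub> x = (r \<odot>\<^bsub>M\<^esub> fst x, r \<odot>\<^bsub>N\<^esub> snd x)"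
  by (auto simp: direct_sum_def)

lemma module_direct_sum:
  assumes "module R M" "module R N"
  shows "module R (direct_sum M N)"
proof -
  interpret M: module R M by fact
  interpret N: module R N by fact
  show ?thesis
  proof (intro moduleI)
    show "abelian_group (direct_sum M N)"
    proof (intro abelian_groupI)
      fix x assume x: "x \<in> carrier (direct_sum M N)"
      show "\<exists>y\<in>carrier (direct_sum M N). y \<oplus>\<^bsub>direct_sum M N\<^esub> x = \<zero>\<^bsub>direct_sum M N\<^esub>"
        using x by (intro bexI[of _ "(\<ominus>\<^bsub>M\<^esub> fst x, \<ominus>\<^bsub>N\<^esub> snd x)"]) (auto simp: M.M.l_neg N.M.l_neg)
    qed (auto simp: M.M.a_ac N.M.a_ac)
  qed (auto simp: M.R.cring_axioms M.smult_l_distr N.smult_l_distr M.smult_r_distr N.smult_r_distr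
      M.smult_assoc1 N.smult_assoc1 intro: M.R.is_cring)
qed

text \<open>Split injections and projections are carried as explicit maps, so that a decomposition
  of \<open>U\<close> can be used inside \<open>U\<close> itself, whatever its element type, without
  transport along an isomorphism to pairs.\<close>

definition biproduct ::
    "('a, 'r) ring_scheme \<Rightarrow> ('a, 'x, 'l) module_scheme \<Rightarrow> ('a, 'b, 'm) module_scheme \<Rightarrow>
     ('a, 'c, 'n) module_scheme \<Rightarrow> ('b \<Rightarrow> 'x) \<Rightarrow> ('c \<Rightarrow> 'x) \<Rightarrow> ('x \<Rightarrow> 'b) \<Rightarrow> ('x \<Rightarrow> 'c) \<Rightarrow> bool"
  where "biproduct R U A B i j p q \<longleftrightarrow>
    i \<in> module_hom R A U \<and> j \<in> module_hom R B U \<and> p \<in> module_hom R U A \<and> q \<in> module_hom R U B \<and>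
    (\<forall>a\<in>carrier A. p (i a) = a \<and> q (i a) = \<zero>\<^bsub>B\<^esub>) \<and>
    (\<forall>b\<in>carrier B. q (j b) = b \<and> p (j b) = \<zero>\<^bsub>A\<^esub>) \<and>
    (\<forall>x\<in>carrier U. i (p x) \<oplus>\<^bsub>U\<^esub> j (q x) = x)"

lemma biproductD:
  assumes "biproduct R U A B i j p q"
  shows "i \<in> module_hom R A U" "j \<in> module_hom R B U" "p \<in> module_hom R U A" "q \<in> module_hom R U B"
    "a \<in> carrier A \<Longrightarrow> p (i a) = a" "a \<in> carrier A \<Longrightarrow> q (i a) = \<zero>\<^bsub>B\<^esub>"
    "b \<in> carrier B \<Longrightarrow> q (j b) = b" "b \<in> carrier B \<Longrightarrow> p (j b) = \<zero>\<^bsub>A\<^esub>"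
    "x \<in> carrier U \<Longrightarrow> i (p x) \<oplus>\<^bsub>U\<^esub> j (q x) = x"
  using assms by (auto simp: biproduct_def)

lemma biproduct_imp_isomorphic:
  assumes U: "module R U" and A: "module R A" and B: "module R B"
    and bip: "biproduct R U A B i j p q"
  shows "module_isomorphic R U (direct_sum A B)"
proof -
  interpret U: module R U by fact
  interpret A: module R A by fact
  interpret B: module R B by fact
  note bp = biproductD[OF bip]
  note cl = bp(1-4)[THEN module_hom_closed]
  note ad = bp(1-4)[THEN module_hom_add]
  note sm = bp(1-4)[THEN module_hom_smult]
  show ?thesis
  proof (rule module_isomorphicI[OF U module_direct_sum[OF A B]])
    show "(\<lambda>x. (p x, q x)) \<in> module_hom R U (direct_sum A B)"
      by (intro module_homI) (auto simp: cl ad sm)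
    show "(\<lambda>y. i (fst y) \<oplus>\<^bsub>U\<^esub> j (snd y)) \<in> module_hom R (direct_sum A B) U"
      by (intro module_homI) (auto simp: cl ad sm U.M.a_ac U.smult_r_distr)
  qed (auto simp: ad cl bp)
qed

lemma biproduct_direct_sum:
  assumes A: "module R A" and B: "module R B"
  shows "biproduct R (direct_sum A B) A B (\<lambda>a. (a, \<zero>\<^bsub>B\<^esub>)) (\<lambda>b. (\<zero>\<^bsub>A\<^esub>, b)) fst snd"
proof -
  interpret A: module R A by fact
  interpret B: module R B by fact
  show ?thesis by (auto simp: biproduct_def intro!: module_homI)
qed

lemma isomorphic_imp_biproduct:
  assumes iso: "module_isomorphic R U (direct_sum A B)"
    and U: "module R U" and A: "module R A" and B: "module R B"
  obtains i j p q where "biproduct R U A B i j p q"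
proof -
  interpret A: module R A by fact
  interpret B: module R B by fact
  obtain f g where f: "f \<in> module_hom R U (direct_sum A B)" and g: "g \<in> module_hom R (direct_sum A B) U"
    and fg: "\<And>x. x \<in> carrier U \<Longrightarrow> g (f x) = x" "\<And>y. y \<in> carrier (direct_sum A B) \<Longrightarrow> f (g y) = y"
    using module_isomorphicE[OF iso U module_direct_sum[OF A B]] by blast
  note fE = module_homE[OF f] and gE = module_homE[OF g]
  have "biproduct R U A B (\<lambda>a. g (a, \<zero>\<^bsub>B\<^esub>)) (\<lambda>b. g (\<zero>\<^bsub>A\<^esub>, b)) (\<lambda>x. fst (f x)) (\<lambda>x. snd (f x))"
    unfolding biproduct_def
  proof (intro conjI ballI)
    note bp = biproductD[OF biproduct_direct_sum[OF A B]]
    show "(\<lambda>a. g (a, \<zero>\<^bsub>B\<^esub>)) \<in> module_hom R A U" by (rule module_hom_compose[OF bp(1) g])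
    show "(\<lambda>b. g (\<zero>\<^bsub>A\<^esub>, b)) \<in> module_hom R B U" by (rule module_hom_compose[OF bp(2) g])
    show "(\<lambda>x. fst (f x)) \<in> module_hom R U A" by (rule module_hom_compose[OF f bp(3)])
    show "(\<lambda>x. snd (f x)) \<in> module_hom R U B" by (rule module_hom_compose[OF f bp(4)])
    fix x assume x: "x \<in> carrier U"
    have cl: "fst (f x) \<in> carrier A" "snd (f x) \<in> carrier B"
      using fE(1)[OF x] by auto
    show "g (fst (f x), \<zero>\<^bsub>B\<^esub>) \<oplus>\<^bsub>U\<^esub> g (\<zero>\<^bsub>A\<^esub>, snd (f x)) = x"
      using gE(2)[of "(fst (f x), \<zero>\<^bsub>B\<^esub>)" "(\<zero>\<^bsub>A\<^esub>, snd (f x))"] cl fg(1)[OF x] by simp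
  qed (auto simp: fg(2))
  then show ?thesis by (rule that)
qed

lemma biproduct_swap:
  assumes bip: "biproduct R U A B i j p q" and U: "module R U"
  shows "biproduct R U B A j i q p"
proof -
  interpret U: module R U by fact
  note bp = biproductD[OF bip]
  have "j (q x) \<oplus>\<^bsub>U\<^esub> i (p x) = x" if "x \<in> carrier U" for x
    using bp(9)[OF that] that by (metis U.M.a_comm module_hom_closed bp(1-4))
  then show ?thesis
    using bp unfolding biproduct_def by blast
qed

lemma module_isomorphic_direct_sum_cong:
  assumes "module_isomorphic R A A'" "module_isomorphic R B B'"
  shows "module_isomorphic R (direct_sum A B) (direct_sum A' B')"
proof -
  obtain f g where f: "f \<in> module_hom R A A'" "bij_betw f (carrier A) (carrier A')"
    and g: "g \<in> module_hom R B B'" "bij_betw g (carrier B) (carrier B')"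
    using assms by (auto simp: module_isomorphic_def)
  have "map_prod f g \<in> module_hom R (direct_sum A B) (direct_sum A' B')"
    using module_homE[OF f(1)] module_homE[OF g(1)] by (intro module_homI) auto
  moreover have "bij_betw (map_prod f g) (carrier (direct_sum A B)) (carrier (direct_sum A' B'))"
    using bij_betw_map_prod[OF f(2) g(2)] by simp
  ultimately show ?thesis by (auto simp: module_isomorphic_def)
qed

lemma module_isomorphic_direct_sum_commute:
  assumes "module R A" "module R B"
  shows "module_isomorphic R (direct_sum A B) (direct_sum B A)"
  using biproduct_imp_isomorphic[OF _ _ _ biproduct_swap[OF biproduct_direct_sum]]
    module_direct_sum assms by blast

lemma module_isomorphic_direct_sum_assoc:
  "module_isomorphic R (direct_sum (direct_sum A B) C) (direct_sum A (direct_sum B C))"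
proof -
  have "(\<lambda>((a, b), c). (a, (b, c))) \<in> module_hom R (direct_sum (direct_sum A B) C) (direct_sum A (direct_sum B C))"
    by (intro module_homI) auto
  moreover have "bij_betw (\<lambda>((a, b), c). (a, (b, c))) (carrier (direct_sum (direct_sum A B) C))
      (carrier (direct_sum A (direct_sum B C)))"
    by (intro bij_betw_byWitness[where f' = "\<lambda>(a, (b, c)). ((a, b), c)"]) auto
  ultimately show ?thesis by (auto simp: module_isomorphic_def)
qed

lemma module_isomorphic_direct_sum_zero:
  assumes A: "module R A" and Z: "module R Z" "zero_module Z"
  shows "module_isomorphic R A (direct_sum A Z)"
proof -
  interpret A: module R A by fact
  interpret Z: module R Z by fact
  have "(\<lambda>a. (a, \<zero>\<^bsub>Z\<^esub>)) \<in> module_hom R A (direct_sum A Z)"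
    by (intro module_homI) auto
  moreover have "bij_betw (\<lambda>a. (a, \<zero>\<^bsub>Z\<^esub>)) (carrier A) (carrier (direct_sum A Z))"
    using Z(2) by (intro bij_betw_byWitness[where f' = fst]) (auto simp: zero_module_def)
  ultimately show ?thesis by (auto simp: module_isomorphic_def)
qed

lemma zero_module_isomorphic:
  assumes "module_isomorphic R M N" "zero_module M" "module R M" "module R N"
  shows "zero_module N"
proof -
  obtain f where "f \<in> module_hom R M N" "bij_betw f (carrier M) (carrier N)"
    using assms by (auto simp: module_isomorphic_def)
  then show ?thesis
    using assms module_hom_zero[OF assms(3,4)] by (auto simp: zero_module_def bij_betw_def)
qed

lemma submodule_zero_mem: "submodule P R M \<Longrightarrow> \<zero>\<^bsub>M\<^esub> \<in> P"
  using subgroup.one_closed[OF submodule.axioms(1)] by fastforce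

text \<open>The endomorphism \<open>i \<circ> r\<close> is idempotent, hence \<open>A\<close> is the
  sum of its image and its kernel; the image is a copy of \<open>W\<close>, and the kernel is that
  of \<open>r\<close>.\<close>

lemma retract_biproduct:
  assumes W: "module R W" and A: "module R A"
    and i: "i \<in> module_hom R W A" and r: "r \<in> module_hom R A W"
    and ri: "\<And>w. w \<in> carrier W \<Longrightarrow> r (i w) = w"
  defines "K \<equiv> A\<lparr>carrier := {a \<in> carrier A. r a = \<zero>\<^bsub>W\<^esub>}\<rparr>"
  shows "module R K" "biproduct R A W K i (\<lambda>x. x) r (\<lambda>a. a \<ominus>\<^bsub>A\<^esub> i (r a))"
proof -
  interpret A: module R A by fact
  interpret W: module R W by fact
  show K: "module R K"
    unfolding K_def
    by (rule submodule.submodule_is_module[OF submodule_kernel[OF A W r] A])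
  note cl = i[THEN module_hom_closed] r[THEN module_hom_closed]
  have ir: "(\<lambda>a. a \<ominus>\<^bsub>A\<^esub> i (r a)) \<in> module_hom R A A"
    by (intro module_hom_minus_hom A module_hom_id module_hom_compose[OF r i])
  have rk: "r (a \<ominus>\<^bsub>A\<^esub> i (r a)) = \<zero>\<^bsub>W\<^esub>" if "a \<in> carrier A" for a
    using that cl by (simp add: module_hom_minus[OF A W r] ri) (simp add: a_minus_def W.M.r_neg)
  show "biproduct R A W K i (\<lambda>x. x) r (\<lambda>a. a \<ominus>\<^bsub>A\<^esub> i (r a))"
    unfolding biproduct_def
  proof (intro conjI ballI i r)
    show "(\<lambda>x. x) \<in> module_hom R K A" by (intro module_homI) (auto simp: K_def)
    show "(\<lambda>a. a \<ominus>\<^bsub>A\<^esub> i (r a)) \<in> module_hom R A K"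
      using module_homE[OF ir] rk by (intro module_homI) (auto simp: K_def)
    fix w assume "w \<in> carrier W"
    then show "i w \<ominus>\<^bsub>A\<^esub> i (r (i w)) = \<zero>\<^bsub>K\<^esub>" using cl by (simp add: ri K_def a_minus_def A.M.r_neg)
  next
    fix b assume "b \<in> carrier K"
    then show "b \<ominus>\<^bsub>A\<^esub> i (r b) = b" using module_hom_zero[OF W A i]
      by (auto simp: K_def a_minus_def)
  next
    fix a assume a: "a \<in> carrier A"
    then show "i (r a) \<oplus>\<^bsub>A\<^esub> (a \<ominus>\<^bsub>A\<^esub> i (r a)) = a" using cl
      by (simp add: a_minus_def A.M.a_lcomm A.M.r_neg)
  qed (auto simp: ri K_def)
qed

lemma internal_direct_sum:
  assumes U: "module R U" and N1: "submodule N1 R U" and N2: "submodule N2 R U"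
    and sum: "\<And>x. x \<in> carrier U \<Longrightarrow> \<exists>a\<in>N1. \<exists>b\<in>N2. x = a \<oplus>\<^bsub>U\<^esub> b"
    and int: "N1 \<inter> N2 \<subseteq> {\<zero>\<^bsub>U\<^esub>}"
  shows "module_isomorphic R U (direct_sum (U\<lparr>carrier := N1\<rparr>) (U\<lparr>carrier := N2\<rparr>))"
proof -
  interpret U: module R U by fact
  note N1' = U.submoduleE[OF N1] and N2' = U.submoduleE[OF N2]
  have sub: "\<And>x. x \<in> N1 \<Longrightarrow> x \<in> carrier U" "\<And>x. x \<in> N2 \<Longrightarrow> x \<in> carrier U"
    using N1'(1) N2'(1) by auto
  have mods: "module R (U\<lparr>carrier := N1\<rparr>)" "module R (U\<lparr>carrier := N2\<rparr>)"
    using submodule.submodule_is_module[OF N1 U] submodule.submodule_is_module[OF N2 U] by auto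
  let ?D = "direct_sum (U\<lparr>carrier := N1\<rparr>) (U\<lparr>carrier := N2\<rparr>)"
  have D: "module R ?D" by (rule module_direct_sum[OF mods])
  define h where "h = (\<lambda>y. fst y \<oplus>\<^bsub>U\<^esub> snd y)"
  have h: "h \<in> module_hom R ?D U"
    unfolding h_def using sub by (intro module_homI) (auto simp: U.M.a_ac U.smult_r_distr)
  have "bij_betw h (carrier ?D) (carrier U)"
    unfolding bij_betw_def
  proof
    show "inj_on h (carrier ?D)"
    proof (rule module_hom_inj_on[OF D U h])
      fix y assume y: "y \<in> carrier ?D" "h y = \<zero>\<^bsub>U\<^esub>"
      then have "fst y = \<ominus>\<^bsub>U\<^esub> snd y" using sub by (auto simp: h_def U.M.minus_equality)
      then have "fst y = \<zero>\<^bsub>U\<^esub>" using y N2'(3) int by (cases y) auto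
      moreover from this have "snd y = \<zero>\<^bsub>U\<^esub>" using y sub by (auto simp: h_def)
      ultimately show "y = \<zero>\<^bsub>?D\<^esub>" by (cases y) auto
    qed
    show "h ` carrier ?D = carrier U"
    proof
      show "h ` carrier ?D \<subseteq> carrier U" using sub by (auto simp: h_def)
      show "carrier U \<subseteq> h ` carrier ?D"
      proof
        fix x assume "x \<in> carrier U"
        then obtain a b where "a \<in> N1" "b \<in> N2" "x = a \<oplus>\<^bsub>U\<^esub> b" using sum by blast
        then show "x \<in> h ` carrier ?D" by (intro image_eqI[of _ _ "(a, b)"]) (auto simp: h_def)
      qed
    qed
  qed
  then have "module_isomorphic R ?D U" using h by (auto simp: module_isomorphic_def)
  then show ?thesis by (rule module_isomorphic_sym[OF D U])
qed

section \<open>Finitely generated modules\<close>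

text \<open>This is \<open>P + R c1 + ... + R cn\<close> with an arbitrary submodule
  \<open>P\<close> at the bottom. The recursion lets a proof discard a single generator and keep a
  submodule behind it; \<open>P = {0}\<close> gives ordinary spans.\<close>

primrec adjoin ::
    "('a, 'r) ring_scheme \<Rightarrow> ('a, 'b, 'm) module_scheme \<Rightarrow> 'b set \<Rightarrow> 'b list \<Rightarrow> 'b set"
  where
    "adjoin R M P [] = P"
  | "adjoin R M P (c # cs) = {r \<odot>\<^bsub>M\<^esub> c \<oplus>\<^bsub>M\<^esub> x | r x. r \<in> carrier R \<and> x \<in> adjoin R M P cs}"

lemma adjoin_append: "adjoin R M P (cs @ ds) = adjoin R M (adjoin R M P ds) cs"
  by (induction cs) auto

context module
begin

lemma submodule_zero: "submodule {\<zero>\<^bsub>M\<^esub>} R M"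
  by (rule submoduleI) auto

lemma submodule_subset: "submodule N R M \<Longrightarrow> x \<in> N \<Longrightarrow> x \<in> carrier M"
  using submoduleE(1) by auto

lemma submodule_minus_closed:
  assumes "submodule N R M" "x \<in> N" "y \<in> N"
  shows "x \<ominus>\<^bsub>M\<^esub> y \<in> N"
  using submoduleE(3,5)[OF assms(1)] assms by (simp add: a_minus_def)

text \<open>The coefficient ideal is kept general for two uses: the whole ring yields
  \<open>adjoin\<close>, and the maximal ideal yields the submodule tested in
  \<open>nakayama\<close>.\<close>

lemma submodule_adjoin_ideal:
  assumes P: "submodule P R M" and I: "ideal I R" and c: "c \<in> carrier M"
  shows "submodule {r \<odot>\<^bsub>M\<^esub> c \<oplus>\<^bsub>M\<^esub> x | r x. r \<in> I \<and> x \<in> P} R M" (is "submodule ?Q R M")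
proof (rule submoduleI)
  interpret I: ideal I R by fact
  note sub = submodule_subset[OF P] and IR = I.a_Hcarr
  show "?Q \<subseteq> carrier M" using c sub IR by auto
  have "\<zero>\<^bsub>M\<^esub> = \<zero> \<odot>\<^bsub>M\<^esub> c \<oplus>\<^bsub>M\<^esub> \<zero>\<^bsub>M\<^esub>" using c by simp
  then show "\<zero>\<^bsub>M\<^esub> \<in> ?Q" using submodule_zero_mem[OF P] I.zero_closed by blast
  show "\<ominus>\<^bsub>M\<^esub> a \<in> ?Q" if aQ: "a \<in> ?Q" for a
  proof -
    obtain r x where a: "a = r \<odot>\<^bsub>M\<^esub> c \<oplus>\<^bsub>M\<^esub> x" "r \<in> I" "x \<in> P" using aQ by auto
    have "\<ominus>\<^bsub>M\<^esub> a = (\<ominus> r) \<odot>\<^bsub>M\<^esub> c \<oplus>\<^bsub>M\<^esub> (\<ominus>\<^bsub>M\<^esub> x)"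
      using a c sub IR by (simp add: M.minus_add smult_l_minus)
    then show ?thesis using a submoduleE(3)[OF P] I.a_inv_closed by blast
  qed
  show "a \<oplus>\<^bsub>M\<^esub> b \<in> ?Q" if ab: "a \<in> ?Q" "b \<in> ?Q" for a b
  proof -
    obtain r x where a: "a = r \<odot>\<^bsub>M\<^esub> c \<oplus>\<^bsub>M\<^esub> x" "r \<in> I" "x \<in> P" using ab by auto
    obtain s y where b: "b = s \<odot>\<^bsub>M\<^esub> c \<oplus>\<^bsub>M\<^esub> y" "s \<in> I" "y \<in> P" using ab by auto
    have "a \<oplus>\<^bsub>M\<^esub> b = (r \<oplus> s) \<odot>\<^bsub>M\<^esub> c \<oplus>\<^bsub>M\<^esub> (x \<oplus>\<^bsub>M\<^esub> y)"
      using a b c sub IR by (simp add: smult_l_distr M.a_ac)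
    then show ?thesis using a b submoduleE(5)[OF P] I.a_closed by blast
  qed
  show "a \<odot>\<^bsub>M\<^esub> b \<in> ?Q" if ab: "a \<in> carrier R" "b \<in> ?Q" for a b
  proof -
    obtain s y where b: "b = s \<odot>\<^bsub>M\<^esub> c \<oplus>\<^bsub>M\<^esub> y" "s \<in> I" "y \<in> P" using ab by auto
    have "a \<odot>\<^bsub>M\<^esub> b = (a \<otimes> s) \<odot>\<^bsub>M\<^esub> c \<oplus>\<^bsub>M\<^esub> (a \<odot>\<^bsub>M\<^esub> y)"
      using ab b c sub IR by (simp add: smult_r_distr smult_assoc1)
    then show ?thesis using ab b submoduleE(4)[OF P] I.I_l_closed by blast
  qed
qed

lemma submodule_adjoin:
  assumes "submodule P R M" "set cs \<subseteq> carrier M"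
  shows "submodule (adjoin R M P cs) R M"
  using assms(2)
proof (induction cs)
  case (Cons c cs)
  then show ?case
    using submodule_adjoin_ideal[OF _ R.oneideal, of "adjoin R M P cs" c] by auto
qed (simp add: assms)

lemma adjoin_superset:
  assumes "submodule P R M" "set cs \<subseteq> carrier M"
  shows "P \<subseteq> adjoin R M P cs"
  using assms(2)
proof (induction cs)
  case (Cons c cs)
  have "x = \<zero> \<odot>\<^bsub>M\<^esub> c \<oplus>\<^bsub>M\<^esub> x" if "x \<in> P" for x
    using that Cons.prems submodule_subset[OF assms(1)] by auto
  then show ?case using Cons by force
qed simp

lemma adjoin_mem:
  assumes "submodule P R M" "set cs \<subseteq> carrier M"
  shows "set cs \<subseteq> adjoin R M P cs"
  using assms(2)
proof (induction cs)
  case (Cons c cs)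
  then have sub: "submodule (adjoin R M P cs) R M" using submodule_adjoin assms by auto
  have "c = \<one> \<odot>\<^bsub>M\<^esub> c \<oplus>\<^bsub>M\<^esub> \<zero>\<^bsub>M\<^esub>" using Cons.prems by auto
  moreover have "x = \<zero> \<odot>\<^bsub>M\<^esub> c \<oplus>\<^bsub>M\<^esub> x" if "x \<in> set cs" for x
    using that Cons.prems by auto
  ultimately show ?case using Cons submodule_zero_mem[OF sub] by fastforce
qed simp

lemma adjoin_minimal:
  assumes N: "submodule N R M" and "P \<subseteq> N" "set cs \<subseteq> N"
  shows "adjoin R M P cs \<subseteq> N"
  using assms(3)
proof (induction cs)
  case (Cons c cs)
  then show ?case using submoduleE(4,5)[OF N] by auto
qed (use assms in simp)

lemma module_span_eq_adjoin:
  assumes "set cs \<subseteq> carrier M"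
  shows "module_span R M (set cs) = adjoin R M {\<zero>\<^bsub>M\<^esub>} cs"
proof
  show "module_span R M (set cs) \<subseteq> adjoin R M {\<zero>\<^bsub>M\<^esub>} cs"
    unfolding module_span_def
    using submodule_adjoin[OF submodule_zero] adjoin_mem[OF submodule_zero] assms by blast
  show "adjoin R M {\<zero>\<^bsub>M\<^esub>} cs \<subseteq> module_span R M (set cs)"
    unfolding module_span_def
    by (intro Inter_greatest, clarify, rule subsetD[OF adjoin_minimal])
      (auto intro: submodule_zero_mem)
qed

lemma unit_smult_mem:
  assumes "submodule N R M" "r \<in> Units R" "x \<in> carrier M" "r \<odot>\<^bsub>M\<^esub> x \<in> N"
  shows "x \<in> N"
proof -
  have "inv r \<odot>\<^bsub>M\<^esub> (r \<odot>\<^bsub>M\<^esub> x) = x"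
    using assms by (simp add: smult_assoc1[symmetric] R.Units_closed)
  then show ?thesis using submoduleE(4)[OF assms(1), of "inv r"] assms by force
qed

end

lemma adjoin_image:
  assumes M: "module R M" and N: "module R N" and f: "f \<in> module_hom R M N"
    and P: "submodule P R M" and cs: "set cs \<subseteq> carrier M"
  shows "f ` adjoin R M P cs = adjoin R N (f ` P) (map f cs)"
  using cs
proof (induction cs)
  case (Cons c cs)
  interpret M: module R M by fact
  have sub: "\<And>x. x \<in> adjoin R M P cs \<Longrightarrow> x \<in> carrier M"
    using M.submodule_subset[OF M.submodule_adjoin[OF P]] Cons.prems by auto
  have c: "c \<in> carrier M" using Cons.prems by auto
  have eq: "f (r \<odot>\<^bsub>M\<^esub> c \<oplus>\<^bsub>M\<^esub> x) = r \<odot>\<^bsub>N\<^esub> f c \<oplus>\<^bsub>N\<^esub> f x"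
    if "r \<in> carrier R" "x \<in> adjoin R M P cs" for r x
    using that sub c by (simp add: module_hom_add[OF f] module_hom_smult[OF f])
  have IH: "adjoin R N (f ` P) (map f cs) = f ` adjoin R M P cs" using Cons by simp
  show ?case
  proof (intro subset_antisym subsetI)
    fix y assume "y \<in> f ` adjoin R M P (c # cs)"
    then obtain r x where "r \<in> carrier R" "x \<in> adjoin R M P cs" "y = f (r \<odot>\<^bsub>M\<^esub> c \<oplus>\<^bsub>M\<^esub> x)" by auto
    then show "y \<in> adjoin R N (f ` P) (map f (c # cs))" using eq by (auto simp: IH)
  next
    fix y assume "y \<in> adjoin R N (f ` P) (map f (c # cs))"
    then obtain r x where "r \<in> carrier R" "x \<in> adjoin R M P cs" "y = r \<odot>\<^bsub>N\<^esub> f c \<oplus>\<^bsub>N\<^esub> f x"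
      by (auto simp: IH)
    then show "y \<in> f ` adjoin R M P (c # cs)"
      using eq by (intro image_eqI[of _ _ "r \<odot>\<^bsub>M\<^esub> c \<oplus>\<^bsub>M\<^esub> x"]) auto
  qed
qed simp

lemma fg_module_iff:
  "fg_module R M \<longleftrightarrow> module R M \<and> (\<exists>cs. set cs \<subseteq> carrier M \<and> adjoin R M {\<zero>\<^bsub>M\<^esub>} cs = carrier M)"
  unfolding fg_module_def by (metis finite_list finite_set module.module_span_eq_adjoin)

lemma fg_moduleI:
  assumes "module R M" "set cs \<subseteq> carrier M" "adjoin R M {\<zero>\<^bsub>M\<^esub>} cs = carrier M"
  shows "fg_module R M" "min_gens R M \<le> length cs"
proof -
  show "fg_module R M" using assms fg_module_iff by blast
  have "min_gens R M \<le> card (set cs)"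
    unfolding min_gens_def using assms module.module_span_eq_adjoin[OF assms(1,2)]
    by (intro Least_le exI[of _ "set cs"]) auto
  then show "min_gens R M \<le> length cs" using card_length le_trans by blast
qed

lemma fg_module_is_module: "fg_module R M \<Longrightarrow> module R M"
  by (simp add: fg_module_def)

lemma min_gens_list:
  assumes "fg_module R M"
  obtains cs where "set cs \<subseteq> carrier M" "adjoin R M {\<zero>\<^bsub>M\<^esub>} cs = carrier M"
    "length cs = min_gens R M"
proof -
  let ?P = "\<lambda>n. \<exists>A\<subseteq>carrier M. finite A \<and> card A = n \<and> module_span R M A = carrier M"
  have "\<exists>n. ?P n" using assms by (auto simp: fg_module_def)
  then have "?P (min_gens R M)" unfolding min_gens_def by (rule LeastI_ex)
  then obtain A where A: "A \<subseteq> carrier M" "finite A" "card A = min_gens R M"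
    "module_span R M A = carrier M" by auto
  obtain cs where "set cs = A" "length cs = card A"
    using finite_distinct_list[OF A(2)] distinct_card by metis
  then show ?thesis
    using A that module.module_span_eq_adjoin[OF fg_module_is_module[OF assms]] by metis
qed

lemma fg_module_image:
  assumes M: "fg_module R M" and N: "module R N" and f: "f \<in> module_hom R M N"
    and surj: "f ` carrier M = carrier N"
  shows "fg_module R N" "min_gens R N \<le> min_gens R M"
proof -
  obtain cs where cs: "set cs \<subseteq> carrier M" "adjoin R M {\<zero>\<^bsub>M\<^esub>} cs = carrier M"
    "length cs = min_gens R M" using min_gens_list[OF M] by blast
  note M' = fg_module_is_module[OF M]
  have "adjoin R N {\<zero>\<^bsub>N\<^esub>} (map f cs) = carrier N"
    using adjoin_image[OF M' N f module.submodule_zero[OF M'] cs(1)] cs(2) surj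
      module_hom_zero[OF M' N f] by simp
  moreover have "set (map f cs) \<subseteq> carrier N" using cs(1) surj by auto
  ultimately show "fg_module R N" "min_gens R N \<le> min_gens R M"
    using fg_moduleI[OF N] cs(3) by (metis length_map)+
qed

lemma fg_module_isomorphic:
  assumes "module_isomorphic R M N" "fg_module R M" "module R N"
  shows "fg_module R N"
  using assms fg_module_image unfolding module_isomorphic_def bij_betw_def by blast

lemma min_gens_isomorphic:
  assumes "module_isomorphic R M N" "fg_module R M" "module R N"
  shows "min_gens R M = min_gens R N"
proof (rule antisym)
  have *: "min_gens R B \<le> min_gens R A" if "module_isomorphic R A B" "fg_module R A" "module R B"
    for A :: "('a, 'x, 'l) module_scheme" and B :: "('a, 'y, 'k) module_scheme"
    using that fg_module_image(2) unfolding module_isomorphic_def bij_betw_def by blast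
  show "min_gens R N \<le> min_gens R M" by (rule *[OF assms])
  show "min_gens R M \<le> min_gens R N"
    using fg_module_image(2)[OF fg_module_isomorphic[OF assms]] assms fg_module_is_module
      module_isomorphic_sym unfolding module_isomorphic_def bij_betw_def by metis
qed

lemma biproduct_fg_summand:
  assumes bip: "biproduct R U A B i j p q" and U: "fg_module R U"
    and A: "module R A" and B: "module R B"
  shows "fg_module R A" "fg_module R B"
proof -
  note bp = biproductD[OF bip]
  note cl = bp(1-4)[THEN module_hom_closed]
  have "p ` carrier U = carrier A" "q ` carrier U = carrier B"
    using cl bp(5,7) by (auto simp: image_iff) metis+
  then show "fg_module R A" "fg_module R B"
    using fg_module_image[OF U] A B biproductD(3,4)[OF bip] by blast+
qed

lemma fg_direct_sum:
  assumes A: "fg_module R A" and B: "fg_module R B"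
  shows "fg_module R (direct_sum A B)"
    and "min_gens R (direct_sum A B) \<le> min_gens R A + min_gens R B"
proof -
  obtain as where as: "set as \<subseteq> carrier A" "adjoin R A {\<zero>\<^bsub>A\<^esub>} as = carrier A"
    "length as = min_gens R A" using min_gens_list[OF A] by blast
  obtain bs where bs: "set bs \<subseteq> carrier B" "adjoin R B {\<zero>\<^bsub>B\<^esub>} bs = carrier B"
    "length bs = min_gens R B" using min_gens_list[OF B] by blast
  note A' = fg_module_is_module[OF A] and B' = fg_module_is_module[OF B]
  let ?D = "direct_sum A B"
  have D: "module R ?D" by (rule module_direct_sum[OF A' B'])
  interpret A: module R A by fact
  interpret B: module R B by fact
  interpret D: module R ?D by fact
  define cs where "cs = map (\<lambda>a. (a, \<zero>\<^bsub>B\<^esub>)) as @ map (\<lambda>b. (\<zero>\<^bsub>A\<^esub>, b)) bs"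
  note bp = biproductD[OF biproduct_direct_sum[OF A' B']]
  have cs: "set cs \<subseteq> carrier ?D" using as bs by (auto simp: cs_def)
  have sub: "submodule (adjoin R ?D {\<zero>\<^bsub>?D\<^esub>} cs) R ?D"
    by (rule D.submodule_adjoin[OF D.submodule_zero cs])
  have incl: "f ` carrier C \<subseteq> adjoin R ?D {\<zero>\<^bsub>?D\<^esub>} cs"
    if C: "module R C" "f \<in> module_hom R C ?D" "set ds \<subseteq> carrier C"
      "adjoin R C {\<zero>\<^bsub>C\<^esub>} ds = carrier C" "f ` set ds \<subseteq> set cs"
    for C :: "('a, 'x, 'y) module_scheme" and f ds
  proof -
    interpret C: module R C by fact
    have "f ` carrier C = adjoin R ?D {\<zero>\<^bsub>?D\<^esub>} (map f ds)"
      using adjoin_image[OF C(1) D C(2) C.submodule_zero C(3)] C(4) module_hom_zero[OF C(1) D C(2)]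
      by simp
    also have "\<dots> \<subseteq> adjoin R ?D {\<zero>\<^bsub>?D\<^esub>} cs"
      using D.adjoin_mem[OF D.submodule_zero cs] submodule_zero_mem[OF sub] C(5)
      by (intro D.adjoin_minimal[OF sub]) auto
    finally show ?thesis .
  qed
  have 1: "(\<lambda>a. (a, \<zero>\<^bsub>B\<^esub>)) ` carrier A \<subseteq> adjoin R ?D {\<zero>\<^bsub>?D\<^esub>} cs"
    by (rule incl[OF A' bp(1) as(1,2)]) (auto simp: cs_def)
  have 2: "(\<lambda>b. (\<zero>\<^bsub>A\<^esub>, b)) ` carrier B \<subseteq> adjoin R ?D {\<zero>\<^bsub>?D\<^esub>} cs"
    by (rule incl[OF B' bp(2) bs(1,2)]) (auto simp: cs_def)
  have "carrier ?D \<subseteq> adjoin R ?D {\<zero>\<^bsub>?D\<^esub>} cs"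
  proof
    fix x assume x: "x \<in> carrier ?D"
    then have "(fst x, \<zero>\<^bsub>B\<^esub>) \<in> adjoin R ?D {\<zero>\<^bsub>?D\<^esub>} cs" "(\<zero>\<^bsub>A\<^esub>, snd x) \<in> adjoin R ?D {\<zero>\<^bsub>?D\<^esub>} cs"
      using 1 2 by auto
    from D.submoduleE(5)[OF sub this] show "x \<in> adjoin R ?D {\<zero>\<^bsub>?D\<^esub>} cs" using x by auto
  qed
  then have "adjoin R ?D {\<zero>\<^bsub>?D\<^esub>} cs = carrier ?D" using D.submoduleE(1)[OF sub] by blast
  from fg_moduleI[OF D cs this] show "fg_module R ?D" "min_gens R ?D \<le> min_gens R A + min_gens R B"
    using as(3) bs(3) by (auto simp: cs_def)
qed

lemma zero_module_min_gens:
  assumes "module R M" "zero_module M"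
  shows "fg_module R M" "min_gens R M = 0"
  using fg_moduleI[OF assms(1), of "[]"] assms(2) by (auto simp: zero_module_def)

lemma min_gens_0_zero_module:
  assumes "fg_module R M" "min_gens R M = 0"
  shows "zero_module M"
  using min_gens_list[OF assms(1)] assms(2) by (metis adjoin.simps(1) length_0_conv zero_module_def)

section \<open>Modules over Noetherian rings\<close>

text \<open>This is the colon ideal \<open>(T + P : c)\<close>: the coefficients with which
  \<open>c\<close> occurs in elements of \<open>T\<close> modulo \<open>P\<close>. It plays the part
  of the ideal of leading coefficients in Hilbert's basis theorem.\<close>

lemma (in module) ideal_transporter:
  assumes P: "submodule P R M" and T: "submodule T R M" and c: "c \<in> carrier M"
  shows "ideal {r \<in> carrier R. \<exists>x\<in>P. r \<odot>\<^bsub>M\<^esub> c \<oplus>\<^bsub>M\<^esub> x \<in> T} R" (is "ideal ?I R")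
proof (rule idealI[OF R.ring_axioms])
  note sub = submodule_subset[OF P]
  have smult: "s \<otimes> r \<in> ?I" if r: "r \<in> ?I" and s: "s \<in> carrier R" for r s
  proof -
    obtain x where x: "x \<in> P" "r \<odot>\<^bsub>M\<^esub> c \<oplus>\<^bsub>M\<^esub> x \<in> T" using r by auto
    have "s \<odot>\<^bsub>M\<^esub> (r \<odot>\<^bsub>M\<^esub> c \<oplus>\<^bsub>M\<^esub> x) = (s \<otimes> r) \<odot>\<^bsub>M\<^esub> c \<oplus>\<^bsub>M\<^esub> (s \<odot>\<^bsub>M\<^esub> x)"
      using r s x(1) sub c by (simp add: smult_r_distr smult_assoc1)
    then show ?thesis using submoduleE(4)[OF T s x(2)] submoduleE(4)[OF P s x(1)] r s by auto
  qed
  then show "x \<otimes> a \<in> ?I" "a \<otimes> x \<in> ?I" if "a \<in> ?I" "x \<in> carrier R" for a x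
    using that R.m_comm[of a x] by auto
  show "subgroup ?I (add_monoid R)"
  proof (intro R.add.subgroupI)
    show "?I \<noteq> {}"
      using submodule_zero_mem[OF P] submodule_zero_mem[OF T] c
      by (auto intro!: exI[of _ \<zero>] bexI[of _ "\<zero>\<^bsub>M\<^esub>"])
    show "\<ominus> a \<in> ?I" if "a \<in> ?I" for a
      using smult[OF that, of "\<ominus> \<one>"] that by (simp add: R.l_minus)
    show "a \<oplus> b \<in> ?I" if ab: "a \<in> ?I" "b \<in> ?I" for a b
    proof -
      obtain x where x: "x \<in> P" "a \<odot>\<^bsub>M\<^esub> c \<oplus>\<^bsub>M\<^esub> x \<in> T" using ab by auto
      obtain y where y: "y \<in> P" "b \<odot>\<^bsub>M\<^esub> c \<oplus>\<^bsub>M\<^esub> y \<in> T" using ab by auto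
      have "(a \<odot>\<^bsub>M\<^esub> c \<oplus>\<^bsub>M\<^esub> x) \<oplus>\<^bsub>M\<^esub> (b \<odot>\<^bsub>M\<^esub> c \<oplus>\<^bsub>M\<^esub> y) = (a \<oplus> b) \<odot>\<^bsub>M\<^esub> c \<oplus>\<^bsub>M\<^esub> (x \<oplus>\<^bsub>M\<^esub> y)"
        using ab x(1) y(1) sub c by (simp add: smult_l_distr M.a_ac)
      then show ?thesis
        using submoduleE(5)[OF T x(2) y(2)] submoduleE(5)[OF P x(1) y(1)] ab by auto
    qed
  qed auto
qed

text \<open>Induction on the generators of the ambient module. With \<open>P\<close> the span of the
  remaining ones, \<open>N \<inter> P\<close> is finitely generated by induction, and the
  coefficients of \<open>c\<close> in \<open>N\<close> form a finitely generated ideal, whose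
  generators are lifted to elements of \<open>N\<close>.\<close>

lemma noetherian_submodule_fg:
  assumes R: "noetherian_ring R" and M: "module R M"
    and N: "submodule N R M" "N \<subseteq> adjoin R M {\<zero>\<^bsub>M\<^esub>} cs" and cs: "set cs \<subseteq> carrier M"
  shows "\<exists>ds. set ds \<subseteq> carrier M \<and> N = adjoin R M {\<zero>\<^bsub>M\<^esub>} ds"
  using N cs
proof (induction cs arbitrary: N)
  case Nil
  then have "N = {\<zero>\<^bsub>M\<^esub>}" using submodule_zero_mem[OF Nil(1)] by auto
  then show ?case by (intro exI[of _ "[]"]) auto
next
  case (Cons c cs)
  interpret R: noetherian_ring R by fact
  interpret M: module R M by fact
  note N = Cons.prems(1)
  define P where "P = adjoin R M {\<zero>\<^bsub>M\<^esub>} cs"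
  have c: "c \<in> carrier M" and cs: "set cs \<subseteq> carrier M" using Cons.prems by auto
  have P: "submodule P R M" unfolding P_def by (rule M.submodule_adjoin[OF M.submodule_zero cs])
  note subP = M.submodule_subset[OF P] and subN = M.submodule_subset[OF N]
  have NP: "submodule (N \<inter> P) R M"
    using M.submoduleE[OF N] M.submoduleE[OF P] submodule_zero_mem[OF N] submodule_zero_mem[OF P]
    by (intro M.submoduleI) auto
  obtain ds where ds: "set ds \<subseteq> carrier M" "N \<inter> P = adjoin R M {\<zero>\<^bsub>M\<^esub>} ds"
    using Cons.IH[OF NP] cs unfolding P_def by auto
  let ?I = "\<lambda>T. {r \<in> carrier R. \<exists>x\<in>P. r \<odot>\<^bsub>M\<^esub> c \<oplus>\<^bsub>M\<^esub> x \<in> T}"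
  obtain A where A: "A \<subseteq> carrier R" "finite A" "?I N = genideal R A"
    using R.finetely_gen[OF M.ideal_transporter[OF P N c]] by auto
  have "A \<subseteq> ?I N" using R.genideal_self[OF A(1)] A(3) by simp
  then have "\<forall>a\<in>A. \<exists>x\<in>P. a \<odot>\<^bsub>M\<^esub> c \<oplus>\<^bsub>M\<^esub> x \<in> N" by auto
  then obtain x where x: "\<And>a. a \<in> A \<Longrightarrow> x a \<in> P \<and> a \<odot>\<^bsub>M\<^esub> c \<oplus>\<^bsub>M\<^esub> x a \<in> N" by metis
  obtain as where as: "set as = A" using finite_list[OF A(2)] by auto
  define es where "es = map (\<lambda>a. a \<odot>\<^bsub>M\<^esub> c \<oplus>\<^bsub>M\<^esub> x a) as"
  have es: "set es \<subseteq> N" "set es \<subseteq> carrier M" using x as subN by (auto simp: es_def)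
  define T where "T = adjoin R M (N \<inter> P) es"
  have T: "submodule T R M" unfolding T_def by (rule M.submodule_adjoin[OF NP es(2)])
  have TN: "T \<subseteq> N" unfolding T_def by (rule M.adjoin_minimal[OF N _ es(1)]) auto
  have "A \<subseteq> ?I T"
    using x as A(1) M.adjoin_mem[OF NP es(2)] unfolding T_def es_def by fastforce
  then have IT: "?I N \<subseteq> ?I T"
    using R.genideal_minimal[OF M.ideal_transporter[OF P T c]] A(3) by simp
  \<comment> \<open>For every \<open>y\<close> in \<open>N\<close> some element of \<open>T\<close>
    has the same coefficient at \<open>c\<close>; the difference is free of \<open>c\<close> and
    lies in \<open>N \<inter> P\<close>, hence in \<open>T\<close>.\<close>
  have "N \<subseteq> T"
  proof
    fix y assume y: "y \<in> N"
    then have "y \<in> adjoin R M {\<zero>\<^bsub>M\<^esub>} (c # cs)" using Cons.prems(2) by blast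
    then obtain r p where rp: "r \<in> carrier R" "p \<in> P" "y = r \<odot>\<^bsub>M\<^esub> c \<oplus>\<^bsub>M\<^esub> p"
      unfolding P_def by auto
    then have "r \<in> ?I T" using y IT by auto
    then obtain p' where p': "p' \<in> P" "r \<odot>\<^bsub>M\<^esub> c \<oplus>\<^bsub>M\<^esub> p' \<in> T" by auto
    let ?z = "r \<odot>\<^bsub>M\<^esub> c \<oplus>\<^bsub>M\<^esub> p'"
    have z: "?z \<in> N" using p' TN by auto
    have eq: "y \<ominus>\<^bsub>M\<^esub> ?z = p \<ominus>\<^bsub>M\<^esub> p'"
    proof -
      have "r \<odot>\<^bsub>M\<^esub> c \<oplus>\<^bsub>M\<^esub> p \<oplus>\<^bsub>M\<^esub> (\<ominus>\<^bsub>M\<^esub> (r \<odot>\<^bsub>M\<^esub> c) \<oplus>\<^bsub>M\<^esub> \<ominus>\<^bsub>M\<^esub> p') =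
          (r \<odot>\<^bsub>M\<^esub> c \<oplus>\<^bsub>M\<^esub> \<ominus>\<^bsub>M\<^esub> (r \<odot>\<^bsub>M\<^esub> c)) \<oplus>\<^bsub>M\<^esub> (p \<oplus>\<^bsub>M\<^esub> \<ominus>\<^bsub>M\<^esub> p')"
        using rp p' c subP by (simp add: M.M.a_ac)
      then show ?thesis using rp p' c subP
        by (simp add: a_minus_def M.M.minus_add M.M.r_neg)
    qed
    have "y \<ominus>\<^bsub>M\<^esub> ?z \<in> N \<inter> P"
      using M.submodule_minus_closed[OF N y z] M.submodule_minus_closed[OF P rp(2) p'(1)] eq by auto
    then have "y \<ominus>\<^bsub>M\<^esub> ?z \<in> T" using M.adjoin_superset[OF NP es(2)] unfolding T_def by auto
    from M.submoduleE(5)[OF T this p'(2)] show "y \<in> T"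
      using subN[OF y] subN[OF z] by (simp add: a_minus_def M.M.a_assoc M.M.l_neg)
  qed
  then have "N = adjoin R M {\<zero>\<^bsub>M\<^esub>} (es @ ds)"
    using TN ds(2) by (auto simp: adjoin_append T_def)
  then show ?case using es(2) ds(1) by (intro exI[of _ "es @ ds"]) auto
qed

lemma noetherian_chain_stable:
  assumes R: "noetherian_ring R" and M: "fg_module R M"
    and N: "\<And>n. submodule (N n) R M" "\<And>n. N n \<subseteq> N (Suc n)"
  shows "\<exists>n::nat. \<forall>m\<ge>n. N m = N n"
proof -
  interpret M: module R M using M by (rule fg_module_is_module)
  have mono: "N m \<subseteq> N n" if "m \<le> n" for m n using lift_Suc_mono_le[of N, OF N(2) that] .
  have U: "submodule (\<Union>n. N n) R M"
  proof (rule M.submoduleI)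
    show "(\<Union>n. N n) \<subseteq> carrier M" using M.submoduleE(1)[OF N(1)] by blast
    show "\<zero>\<^bsub>M\<^esub> \<in> (\<Union>n. N n)" using submodule_zero_mem[OF N(1)] by blast
    show "\<ominus>\<^bsub>M\<^esub> a \<in> (\<Union>n. N n)" if "a \<in> (\<Union>n. N n)" for a
      using that M.submoduleE(3)[OF N(1)] by blast
    show "r \<odot>\<^bsub>M\<^esub> a \<in> (\<Union>n. N n)" if "r \<in> carrier R" "a \<in> (\<Union>n. N n)" for r a
      using that M.submoduleE(4)[OF N(1)] by blast
    show "a \<oplus>\<^bsub>M\<^esub> b \<in> (\<Union>n. N n)" if ab: "a \<in> (\<Union>n. N n)" "b \<in> (\<Union>n. N n)" for a b
    proof -
      obtain m n where "a \<in> N m" "b \<in> N n" using ab by auto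
      then have "a \<in> N (max m n)" "b \<in> N (max m n)" using mono by (meson max.cobounded1 max.cobounded2 subsetD)+
      then show ?thesis using M.submoduleE(5)[OF N(1)] by blast
    qed
  qed
  obtain cs where cs: "set cs \<subseteq> carrier M" "adjoin R M {\<zero>\<^bsub>M\<^esub>} cs = carrier M"
    using M by (auto simp: fg_module_iff)
  obtain ds where ds: "set ds \<subseteq> carrier M" "(\<Union>n. N n) = adjoin R M {\<zero>\<^bsub>M\<^esub>} ds"
    using noetherian_submodule_fg[OF R M.module_axioms U _ cs(1)] M.submoduleE(1)[OF U] cs(2) by auto
  have "\<exists>n. set ds' \<subseteq> N n" if "set ds' \<subseteq> (\<Union>n. N n)" for ds'
    using that
  proof (induction ds')
    case (Cons d ds')
    then obtain m n where "d \<in> N m" "set ds' \<subseteq> N n" by auto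
    then show ?case
      using mono by (intro exI[of _ "max m n"]) (auto dest: subsetD[OF mono[OF max.cobounded1]] subsetD[OF mono[OF max.cobounded2]])
  qed auto
  then obtain n where n: "set ds \<subseteq> N n"
    using M.adjoin_mem[OF M.submodule_zero ds(1)] ds(2) by metis
  have "(\<Union>n. N n) \<subseteq> N n"
    unfolding ds(2) using n submodule_zero_mem[OF N(1)] by (intro M.adjoin_minimal[OF N(1)]) auto
  then have "N m = N n" if "m \<ge> n" for m using mono[OF that] by blast
  then show ?thesis by blast
qed

text \<open>The kernels of the powers of \<open>f\<close> stabilize at some \<open>n\<close>. If
  \<open>f x = 0\<close>, write \<open>x = f^n y\<close>; then \<open>y\<close> is in the kernel of
  \<open>f^(n+1)\<close>, hence in that of \<open>f^n\<close>, so \<open>x = 0\<close>.\<close>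

lemma noetherian_surj_endo_inj:
  assumes R: "noetherian_ring R" and M: "fg_module R M" and f: "f \<in> module_hom R M M"
    and surj: "f ` carrier M = carrier M"
  shows "inj_on f (carrier M)"
proof -
  note M' = fg_module_is_module[OF M]
  interpret M: module R M by fact
  have pw: "(f ^^ n) \<in> module_hom R M M" for n
  proof (induction n)
    case (Suc n)
    then show ?case using module_hom_compose[OF Suc f] by (simp add: comp_def)
  qed (simp add: module_hom_id flip: id_def)
  have pws: "(f ^^ n) ` carrier M = carrier M" for n
    by (induction n) (use surj in \<open>auto simp flip: image_image\<close>)
  let ?K = "\<lambda>n. {x \<in> carrier M. (f ^^ n) x = \<zero>\<^bsub>M\<^esub>}"
  have inc: "?K n \<subseteq> ?K (Suc n)" for n using module_hom_zero[OF M' M' f] by auto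
  have "\<exists>n. \<forall>m\<ge>n. ?K m = ?K n"
    by (rule noetherian_chain_stable[OF R M, where N = ?K, OF submodule_kernel[OF M' M' pw] inc])
  then obtain n where "\<forall>m\<ge>n. ?K m = ?K n" by (rule exE)
  then have n: "?K (Suc n) = ?K n" by (rule mp[OF spec[of _ "Suc n"]]) simp
  show ?thesis
  proof (rule module_hom_inj_on[OF M' M' f])
    fix x assume x: "x \<in> carrier M" "f x = \<zero>\<^bsub>M\<^esub>"
    then obtain y where y: "y \<in> carrier M" "(f ^^ n) y = x" using pws[of n] by (metis imageE)
    then have "y \<in> ?K (Suc n)" using x by simp
    then show "x = \<zero>\<^bsub>M\<^esub>" using y n by auto
  qed
qed

lemma noetherian_surj_endo_bij:
  assumes "noetherian_ring R" "fg_module R M" "f \<in> module_hom R M M" "f ` carrier M = carrier M"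
  shows "bij_betw f (carrier M) (carrier M)"
  using noetherian_surj_endo_inj[OF assms] assms(4) by (simp add: bij_betw_def)

section \<open>Noetherian local rings\<close>

locale noetherian_local_ring = noetherian_ring R + cring R for R (structure) +
  assumes local: "\<exists>!I. maximalideal I R"
begin

abbreviation "\<mm> \<equiv> max_ideal R"

lemma maximalideal_max_ideal: "maximalideal \<mm> R"
  unfolding max_ideal_def by (rule theI'[OF local])

lemma max_ideal_unique: "maximalideal I R \<Longrightarrow> I = \<mm>"
  using local maximalideal_max_ideal by blast

sublocale \<mm>: maximalideal \<mm> R
  by (rule maximalideal_max_ideal)

lemma proper_ideal_subset_max_ideal:
  assumes I: "ideal I R" "I \<noteq> carrier R"
  shows "I \<subseteq> \<mm>"
proof -
  let ?A = "{J. ideal J R \<and> I \<subseteq> J \<and> J \<noteq> carrier R}"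
  have "\<exists>J\<in>?A. \<forall>K\<in>?A. J \<subseteq> K \<longrightarrow> K = J"
  proof (rule subset_Zorn_nonempty)
    show "?A \<noteq> {}" using I by auto
    fix C assume C: "C \<noteq> {}" "subset.chain ?A C"
    \<comment> \<open>In a Noetherian ring the union of a nonempty chain of ideals is a member of
      the chain, so properness passes to the union at once.\<close>
    then have "\<Union>C \<in> C"
      by (intro ideal_chain_is_trivial) (auto simp: subset.chain_def)
    then show "\<Union>C \<in> ?A" using C(2) by (auto simp: subset.chain_def)
  qed
  then obtain J where J': "J \<in> ?A" and mx: "\<forall>K\<in>?A. J \<subseteq> K \<longrightarrow> K = J" by (rule bexE)
  then have J: "ideal J R" "I \<subseteq> J" "J \<noteq> carrier R" by auto
  have "maximalideal J R"
  proof (rule maximalidealI[OF J(1)])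
    show "carrier R \<noteq> J" using J(3) by simp
    fix K assume K: "ideal K R" "J \<subseteq> K" "K \<subseteq> carrier R"
    show "K = J \<or> K = carrier R"
    proof (cases "K = carrier R")
      case False
      then have "K \<in> ?A" using K J(2) by auto
      then show ?thesis using mx K(2) by blast
    qed simp
  qed
  then show ?thesis using J(2) max_ideal_unique by simp
qed

lemma max_ideal_iff_nonunit:
  assumes "r \<in> carrier R"
  shows "r \<in> \<mm> \<longleftrightarrow> r \<notin> Units R"
proof
  show "r \<notin> Units R" if "r \<in> \<mm>"
  proof
    assume "r \<in> Units R"
    then have "\<one> \<in> \<mm>" using \<mm>.I_r_closed[OF that, of "inv r"] by (simp add: Units_r_inv)
    then show False using \<mm>.one_imp_carrier \<mm>.I_notcarr by simp
  qed
  show "r \<in> \<mm>" if "r \<notin> Units R"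
  proof -
    have "PIdl r \<noteq> carrier R"
    proof
      assume "PIdl r = carrier R"
      then obtain s where "s \<in> carrier R" "\<one> = s \<otimes> r"
        using one_closed by (auto simp: cgenideal_def)
      then show False using that assms m_comm[of s r] by (auto simp: Units_def)
    qed
    then show ?thesis
      using proper_ideal_subset_max_ideal[OF cgenideal_ideal[OF assms]] cgenideal_self[OF assms] by auto
  qed
qed

lemma one_minus_max_ideal_unit:
  assumes "r \<in> \<mm>"
  shows "\<one> \<ominus> r \<in> Units R"
proof (rule ccontr)
  have r: "r \<in> carrier R" using assms by (rule \<mm>.a_Hcarr)
  assume "\<one> \<ominus> r \<notin> Units R"
  then have "\<one> \<ominus> r \<in> \<mm>" using max_ideal_iff_nonunit r by simp
  then have "(\<one> \<ominus> r) \<oplus> r \<in> \<mm>" using assms by simp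
  then have "\<one> \<in> \<mm>" using r by (simp add: a_minus_def a_assoc l_neg)
  then show False using \<mm>.one_imp_carrier \<mm>.I_notcarr by simp
qed

text \<open>The hypothesis \<open>N + \<mm> M = M\<close> is phrased through the submodules
  \<open>Q\<close> above both parts. Generators are discarded one at a time:
  \<open>c = r c + x\<close>, with \<open>r\<close> in \<open>\<mm>\<close> and \<open>x\<close> in
  the span of \<open>N\<close> and the other generators, gives \<open>(1 - r) c = x\<close>, and
  \<open>1 - r\<close> is a unit.\<close>

lemma nakayama:
  assumes M: "fg_module R M" and N: "submodule N R M"
    and gen: "\<And>Q. \<lbrakk>submodule Q R M; N \<subseteq> Q; \<And>r x. \<lbrakk>r \<in> \<mm>; x \<in> carrier M\<rbrakk> \<Longrightarrow> r \<odot>\<^bsub>M\<^esub> x \<in> Q\<rbrakk>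
      \<Longrightarrow> Q = carrier M"
  shows "N = carrier M"
proof -
  interpret M: module R M using M by (rule fg_module_is_module)
  have *: "adjoin R M N cs = carrier M \<Longrightarrow> set cs \<subseteq> carrier M \<Longrightarrow> N = carrier M" for cs
  proof (induction cs)
    case (Cons c cs)
    define P where "P = adjoin R M N cs"
    have c: "c \<in> carrier M" and cs: "set cs \<subseteq> carrier M" using Cons.prems by auto
    have P: "submodule P R M" unfolding P_def by (rule M.submodule_adjoin[OF N cs])
    note subP = M.submodule_subset[OF P]
    let ?Q = "{r \<odot>\<^bsub>M\<^esub> c \<oplus>\<^bsub>M\<^esub> x | r x. r \<in> \<mm> \<and> x \<in> P}"
    have PQ: "x \<in> ?Q" if "x \<in> P" for x
    proof -
      have "x = \<zero> \<odot>\<^bsub>M\<^esub> c \<oplus>\<^bsub>M\<^esub> x" using that subP c by simp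
      then show ?thesis using that \<mm>.zero_closed by blast
    qed
    have "?Q = carrier M"
    proof (rule gen)
      show "submodule ?Q R M" by (rule M.submodule_adjoin_ideal[OF P \<mm>.is_ideal c])
      show "N \<subseteq> ?Q" using PQ M.adjoin_superset[OF N cs] unfolding P_def by blast
      fix s y assume s: "s \<in> \<mm>" and "y \<in> carrier M"
      then have "y \<in> adjoin R M N (c # cs)" using Cons.prems(1) by simp
      then obtain r x where rx: "r \<in> carrier R" "x \<in> P" "y = r \<odot>\<^bsub>M\<^esub> c \<oplus>\<^bsub>M\<^esub> x"
        unfolding P_def by auto
      have "s \<odot>\<^bsub>M\<^esub> y = (s \<otimes> r) \<odot>\<^bsub>M\<^esub> c \<oplus>\<^bsub>M\<^esub> s \<odot>\<^bsub>M\<^esub> x"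
        using rx s subP c \<mm>.a_Hcarr by (simp add: M.smult_r_distr M.smult_assoc1)
      then show "s \<odot>\<^bsub>M\<^esub> y \<in> ?Q"
        using \<mm>.I_r_closed[OF s rx(1)] M.submoduleE(4)[OF P \<mm>.a_Hcarr[OF s] rx(2)] by blast
    qed
    then obtain r x where rx: "r \<in> \<mm>" "x \<in> P" "c = r \<odot>\<^bsub>M\<^esub> c \<oplus>\<^bsub>M\<^esub> x" using c by blast
    have r: "r \<in> carrier R" using rx \<mm>.a_Hcarr by auto
    have "(\<one> \<ominus> r) \<odot>\<^bsub>M\<^esub> c = (r \<odot>\<^bsub>M\<^esub> c \<oplus>\<^bsub>M\<^esub> x) \<ominus>\<^bsub>M\<^esub> r \<odot>\<^bsub>M\<^esub> c"
      using rx(3) r c by (simp add: a_minus_def M.smult_l_distr M.smult_l_minus)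
    also have "\<dots> = x" using r c subP[OF rx(2)]
      by (simp add: a_minus_def M.M.a_ac M.M.r_neg M.M.a_lcomm[of x])
    finally have "c \<in> P"
      using M.unit_smult_mem[OF P one_minus_max_ideal_unit[OF rx(1)] c] rx(2) by simp
    then have "adjoin R M N (c # cs) \<subseteq> P"
      using M.submoduleE(4,5)[OF P] by (auto simp: P_def[symmetric])
    then have "P = carrier M" using Cons.prems(1) M.submoduleE(1)[OF P] by blast
    then show ?case using Cons.IH cs unfolding P_def by blast
  qed simp
  obtain cs where cs: "set cs \<subseteq> carrier M" "adjoin R M {\<zero>\<^bsub>M\<^esub>} cs = carrier M"
    using M by (auto simp: fg_module_iff)
  have "carrier M \<subseteq> adjoin R M N cs"
    unfolding cs(2)[symmetric] using M.adjoin_superset[OF N cs(1)] submodule_zero_mem[OF N]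
    by (intro M.adjoin_minimal[OF M.submodule_adjoin[OF N cs(1)]] M.adjoin_mem[OF N cs(1)]) auto
  then have "adjoin R M N cs = carrier M"
    using M.submoduleE(1)[OF M.submodule_adjoin[OF N cs(1)]] by blast
  then show ?thesis using * cs(1) by blast
qed

end

section \<open>Surjections onto powers of a module\<close>

text \<open>A surjection onto a power of \<open>N\<close> in coordinates. Both the source
  \<open>P\<close>, a mere set, and the index set \<open>I\<close> can shrink, which is what the
  removal of generators requires.\<close>

definition jointly_onto :: "('a, 'c, 'n) module_scheme \<Rightarrow> 'b set \<Rightarrow> 'i set \<Rightarrow> ('i \<Rightarrow> 'b \<Rightarrow> 'c) \<Rightarrow> bool"
  where "jointly_onto N P I F \<longleftrightarrow> (\<forall>y\<in>I \<rightarrow> carrier N. \<exists>x\<in>P. \<forall>i\<in>I. F i x = y i)"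

lemma jointly_ontoD:
  assumes "jointly_onto N P I F" "\<And>i. i \<in> I \<Longrightarrow> y i \<in> carrier N"
  obtains x where "x \<in> P" "\<And>i. i \<in> I \<Longrightarrow> F i x = y i"
  using assms unfolding jointly_onto_def by (metis Pi_I)

lemma jointly_onto_bex:
  assumes "jointly_onto N P I F" "\<And>i. i \<in> I \<Longrightarrow> y i \<in> carrier N"
  shows "\<exists>x\<in>P. \<forall>i\<in>I. F i x = y i"
  using assms unfolding jointly_onto_def by (metis Pi_I)

lemma jointly_onto_subset:
  assumes "jointly_onto N P I F" "J \<subseteq> I" "module R N"
  shows "jointly_onto N P J F"
  unfolding jointly_onto_def
proof
  interpret N: module R N by fact
  fix y assume y: "y \<in> J \<rightarrow> carrier N"
  then have "\<exists>x\<in>P. \<forall>i\<in>I. F i x = (if i \<in> J then y i else \<zero>\<^bsub>N\<^esub>)"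
    by (intro jointly_onto_bex[OF assms(1)]) auto
  then show "\<exists>x\<in>P. \<forall>i\<in>J. F i x = y i" using assms(2) by (metis subsetD)
qed

definition surjects_onto_power ::
    "('a, 'r) ring_scheme \<Rightarrow> ('a, 'b, 'm) module_scheme \<Rightarrow> ('a, 'c, 'n) module_scheme \<Rightarrow> nat \<Rightarrow> bool"
  where "surjects_onto_power R N M n \<longleftrightarrow>
    (\<exists>F. (\<forall>i<n. F i \<in> module_hom R M N) \<and> jointly_onto N (carrier M) {..<n} F)"

lemma direct_power_simps [simp]:
  "carrier (direct_power N n) = {..<n} \<rightarrow>\<^sub>E carrier N"
  "\<zero>\<^bsub>direct_power N n\<^esub> = (\<lambda>i\<in>{..<n}. \<zero>\<^bsub>N\<^esub>)"
  "x \<oplus>\<^bsub>direct_power N n\<^esub> y = (\<lambda>i\<in>{..<n}. x i \<oplus>\<^bsub>N\<^esub> y i)"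
  "r \<odot>\<^bsub>direct_power N n\<^esub> x = (\<lambda>i\<in>{..<n}. r \<odot>\<^bsub>N\<^esub> x i)"
  by (auto simp: direct_power_def)

lemma module_direct_power:
  assumes N: "module R N"
  shows "module R (direct_power N n)"
proof -
  interpret N: module R N by fact
  show ?thesis
  proof (intro moduleI N.R.is_cring abelian_groupI)
    fix x assume x: "x \<in> carrier (direct_power N n)"
    show "\<exists>y\<in>carrier (direct_power N n). y \<oplus>\<^bsub>direct_power N n\<^esub> x = \<zero>\<^bsub>direct_power N n\<^esub>"
      using x by (intro bexI[of _ "\<lambda>i\<in>{..<n}. \<ominus>\<^bsub>N\<^esub> x i"]) (auto simp: N.M.l_neg fun_eq_iff PiE_iff)
    show "\<zero>\<^bsub>direct_power N n\<^esub> \<oplus>\<^bsub>direct_power N n\<^esub> x = x"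
      using x by (auto simp: fun_eq_iff PiE_iff extensional_def)
    show "\<one>\<^bsub>R\<^esub> \<odot>\<^bsub>direct_power N n\<^esub> x = x"
      using x by (auto simp: fun_eq_iff PiE_iff extensional_def)
  qed (auto simp: fun_eq_iff PiE_iff N.M.a_ac N.smult_l_distr N.smult_r_distr N.smult_assoc1)
qed

lemma module_hom_direct_powerI:
  assumes "\<And>i. i < n \<Longrightarrow> F i \<in> module_hom R M N"
  shows "(\<lambda>x. \<lambda>i\<in>{..<n}. F i x) \<in> module_hom R M (direct_power N n)"
  using assms[THEN module_hom_closed] assms[THEN module_hom_add] assms[THEN module_hom_smult]
  by (intro module_homI) (auto simp: fun_eq_iff)

lemma jointly_onto_image:
  assumes "jointly_onto N (carrier M) {..<n} F" "\<And>i. i < n \<Longrightarrow> F i \<in> module_hom R M N"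
  shows "(\<lambda>x. \<lambda>i\<in>{..<n}. F i x) ` carrier M = carrier (direct_power N n)"
proof
  show "(\<lambda>x. \<lambda>i\<in>{..<n}. F i x) ` carrier M \<subseteq> carrier (direct_power N n)"
    using module_hom_closed[OF module_hom_direct_powerI[of n F R M N, OF assms(2)]] by blast
  show "carrier (direct_power N n) \<subseteq> (\<lambda>x. \<lambda>i\<in>{..<n}. F i x) ` carrier M"
  proof
    fix y assume y: "y \<in> carrier (direct_power N n)"
    then have "\<And>i. i \<in> {..<n} \<Longrightarrow> y i \<in> carrier N" by auto
    then obtain x where "x \<in> carrier M" "\<And>i. i \<in> {..<n} \<Longrightarrow> F i x = y i"
      using jointly_ontoD[OF assms(1)] by blast
    then show "y \<in> (\<lambda>x. \<lambda>i\<in>{..<n}. F i x) ` carrier M"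
      using y by (intro image_eqI[of _ _ x]) (auto simp: fun_eq_iff PiE_iff extensional_def)
  qed
qed

lemma surjects_onto_power_iff:
  "surjects_onto_power R N M n \<longleftrightarrow>
    (\<exists>f\<in>module_hom R M (direct_power N n). f ` carrier M = carrier (direct_power N n))"
proof
  assume "surjects_onto_power R N M n"
  then obtain F where F: "\<And>i. i < n \<Longrightarrow> F i \<in> module_hom R M N" "jointly_onto N (carrier M) {..<n} F"
    unfolding surjects_onto_power_def by auto
  show "\<exists>f\<in>module_hom R M (direct_power N n). f ` carrier M = carrier (direct_power N n)"
    using jointly_onto_image[OF F(2,1)] module_hom_direct_powerI[of n F R M N, OF F(1)] by blast
next
  assume "\<exists>f\<in>module_hom R M (direct_power N n). f ` carrier M = carrier (direct_power N n)"
  then obtain f where f: "f \<in> module_hom R M (direct_power N n)"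
    and surj: "f ` carrier M = carrier (direct_power N n)" by auto
  have "(\<lambda>x. f x i) \<in> module_hom R M N" if "i < n" for i
    using module_homE[OF f] that by (intro module_homI) (auto simp: PiE_iff)
  moreover have "jointly_onto N (carrier M) {..<n} (\<lambda>i x. f x i)"
    unfolding jointly_onto_def
  proof
    fix y assume "y \<in> {..<n} \<rightarrow> carrier N"
    then have "restrict y {..<n} \<in> f ` carrier M" unfolding surj by auto
    then obtain x where "x \<in> carrier M" "f x = restrict y {..<n}" by (metis imageE)
    then show "\<exists>x\<in>carrier M. \<forall>i\<in>{..<n}. f x i = y i" by (intro bexI[of _ x]) simp_all
  qed
  ultimately show "surjects_onto_power R N M n"
    unfolding surjects_onto_power_def by (intro exI[of _ "\<lambda>i x. f x i"]) auto
qed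

lemma surj_num_eq: "surj_num R N M = (GREATEST n. surjects_onto_power R N M n)"
  unfolding surj_num_def surjects_onto_power_iff ..

lemma surjects_onto_powerI:
  assumes I: "finite I" "card I = n" and F: "\<And>i. i \<in> I \<Longrightarrow> F i \<in> module_hom R M N"
    and onto: "jointly_onto N (carrier M) I F"
  shows "surjects_onto_power R N M n"
proof -
  obtain b where b: "bij_betw b {..<n} I"
    using ex_bij_betw_nat_finite[OF I(1)] I(2) by (auto simp: atLeast0LessThan)
  have bI: "\<And>k. k < n \<Longrightarrow> b k \<in> I" using b by (auto simp: bij_betw_def)
  have "jointly_onto N (carrier M) {..<n} (\<lambda>k. F (b k))"
    unfolding jointly_onto_def
  proof
    fix y assume y: "y \<in> {..<n} \<rightarrow> carrier N"
    have inv: "inv_into {..<n} b i \<in> {..<n}" if "i \<in> I" for i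
      using that b by (metis bij_betw_def inv_into_into)
    then have "\<exists>x\<in>carrier M. \<forall>i\<in>I. F i x = y (inv_into {..<n} b i)"
      using inv y by (intro jointly_onto_bex[OF onto]) (auto simp: Pi_iff)
    then obtain x where "x \<in> carrier M" "\<And>i. i \<in> I \<Longrightarrow> F i x = y (inv_into {..<n} b i)" by blast
    then show "\<exists>x\<in>carrier M. \<forall>k\<in>{..<n}. F (b k) x = y k"
      using b bI by (intro bexI[of _ x]) (auto simp: bij_betw_def)
  qed
  then show ?thesis
    unfolding surjects_onto_power_def using F bI by (intro exI[of _ "\<lambda>k. F (b k)"]) auto
qed

lemma surjects_onto_power_0: "surjects_onto_power R N M 0" if "module R M"
proof -
  interpret module R M by fact
  show ?thesis
    unfolding surjects_onto_power_def jointly_onto_def by (auto intro: bexI[of _ "\<zero>\<^bsub>M\<^esub>"])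
qed

section \<open>Surjective numbers over a Noetherian local ring\<close>

context noetherian_local_ring
begin

text \<open>Choose \<open>r\<^sub>i c + p\<^sub>i\<close> with image \<open>F\<^sub>i c\<close> in coordinate \<open>i\<close> and \<open>0\<close> elsewhere. If some \<open>r\<^sub>i\<close> is a unit,
  then \<open>p\<^sub>i\<close> replaces \<open>c\<close> in all coordinates but \<open>i\<close>; otherwise \<open>1 - \<Sum> r\<^sub>i\<close> is a unit and \<open>\<Sum> p\<^sub>i\<close>
  replaces \<open>c\<close> in all coordinates.\<close>

lemma jointly_onto_drop:
  assumes M: "module R M" and N: "module R N" and P: "submodule P R M" and c: "c \<in> carrier M"
    and F: "\<And>i. i \<in> I \<Longrightarrow> F i \<in> module_hom R M N" and I: "finite I" "I \<noteq> {}"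
    and onto: "jointly_onto N (adjoin R M P [c]) I F"
  shows "\<exists>i\<in>I. jointly_onto N P (I - {i}) F"
proof -
  interpret M: module R M by fact
  interpret N: module R N by fact
  note subP = M.submodule_subset[OF P]
  note Fcl = F[THEN module_hom_closed]
  have Fadd: "F i (r \<odot>\<^bsub>M\<^esub> c \<oplus>\<^bsub>M\<^esub> x) = r \<odot>\<^bsub>N\<^esub> F i c \<oplus>\<^bsub>N\<^esub> F i x"
    if "i \<in> I" "r \<in> carrier R" "x \<in> carrier M" for i r x
    using that c by (simp add: module_hom_add[OF F] module_hom_smult[OF F])
  have "\<exists>r p. r \<in> carrier R \<and> p \<in> P \<and>
      (\<forall>j\<in>I. r \<odot>\<^bsub>N\<^esub> F j c \<oplus>\<^bsub>N\<^esub> F j p = (if j = i then F i c else \<zero>\<^bsub>N\<^esub>))" if i: "i \<in> I" for i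
  proof -
    obtain x where x: "x \<in> adjoin R M P [c]"
      "\<And>j. j \<in> I \<Longrightarrow> F j x = (if j = i then F i c else \<zero>\<^bsub>N\<^esub>)"
      by (rule jointly_ontoD[OF onto, of "\<lambda>j. if j = i then F i c else \<zero>\<^bsub>N\<^esub>"])
        (use Fcl[OF i c] in auto)
    then obtain r p where "r \<in> carrier R" "p \<in> P" "x = r \<odot>\<^bsub>M\<^esub> c \<oplus>\<^bsub>M\<^esub> p" by auto
    then show ?thesis using x(2) Fadd subP by (metis (no_types, lifting))
  qed
  then obtain r p where rp: "\<And>i. i \<in> I \<Longrightarrow> r i \<in> carrier R" "\<And>i. i \<in> I \<Longrightarrow> p i \<in> P"
    and eq: "\<And>i j. i \<in> I \<Longrightarrow> j \<in> I \<Longrightarrow> r i \<odot>\<^bsub>N\<^esub> F j c \<oplus>\<^bsub>N\<^esub> F j (p i) = (if j = i then F i c else \<zero>\<^bsub>N\<^esub>)"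
    by metis
  show ?thesis
  proof (cases "\<exists>i\<in>I. r i \<in> Units R")
    case True
    then obtain i where i: "i \<in> I" "r i \<in> Units R" by auto
    have "jointly_onto N P (I - {i}) F"
      unfolding jointly_onto_def
    proof
      fix y assume y: "y \<in> I - {i} \<rightarrow> carrier N"
      obtain x where x: "x \<in> adjoin R M P [c]"
        "\<And>j. j \<in> I \<Longrightarrow> F j x = (if j = i then \<zero>\<^bsub>N\<^esub> else y j)"
        by (rule jointly_ontoD[OF onto, of "\<lambda>j. if j = i then \<zero>\<^bsub>N\<^esub> else y j"]) (use y in auto)
      then obtain s q where sq: "s \<in> carrier R" "q \<in> P" "x = s \<odot>\<^bsub>M\<^esub> c \<oplus>\<^bsub>M\<^esub> q" by auto
      \<comment> \<open>With this \<open>t\<close>, \<open>?x\<close> is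
        \<open>x - s * inv (r i) * (r i * c + p i)\<close>: the multiples of \<open>c\<close>
        cancel, and only coordinate \<open>i\<close> is altered.\<close>
      define t where "t = \<ominus> (s \<otimes> inv (r i))"
      have t: "t \<in> carrier R" using sq i by (simp add: t_def)
      let ?x = "t \<odot>\<^bsub>M\<^esub> p i \<oplus>\<^bsub>M\<^esub> q"
      have "F j ?x = y j" if j: "j \<in> I - {i}" for j
      proof -
        have j': "j \<in> I" "j \<noteq> i" using j by auto
        have "F j (p i) = \<ominus>\<^bsub>N\<^esub> (r i \<odot>\<^bsub>N\<^esub> F j c)"
          using eq[OF i(1) j'(1)] j'(2) rp(1)[OF i(1)] rp(2)[OF i(1)] subP Fcl[OF j'(1)] c
          by (simp add: N.M.minus_equality N.M.a_comm)
        then have "t \<odot>\<^bsub>N\<^esub> F j (p i) = (s \<otimes> inv (r i) \<otimes> r i) \<odot>\<^bsub>N\<^esub> F j c"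
          using sq i rp(1)[OF i(1)] Fcl[OF j'(1)] c
          by (simp add: t_def N.smult_l_minus N.smult_r_minus N.smult_assoc1)
        also have "s \<otimes> inv (r i) \<otimes> r i = s" using sq i by (simp add: m_assoc Units_closed)
        finally have "F j ?x = F j x"
          using sq t rp(2)[OF i(1)] subP c j'(1)
          by (simp add: module_hom_add[OF F] module_hom_smult[OF F])
        then show ?thesis using x(2)[OF j'(1)] j'(2) by simp
      qed
      moreover have "?x \<in> P"
        using M.submoduleE(4)[OF P t rp(2)[OF i(1)]] M.submoduleE(5)[OF P] sq(2) by auto
      ultimately show "\<exists>x\<in>P. \<forall>j\<in>I - {i}. F j x = y j" by blast
    qed
    then show ?thesis using i by blast
  next
    case False
    then have rm: "r i \<in> \<mm>" if "i \<in> I" for i using rp(1)[OF that] max_ideal_iff_nonunit that by auto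
    \<comment> \<open>The chosen elements are summed over subsets \<open>J\<close>, so that the sum
      over all of \<open>I\<close> is reached by finite induction; coordinate \<open>j\<close> of
      the sum is \<open>F j c\<close> for \<open>j\<close> in \<open>J\<close> and zero for the
      others.\<close>
    have "\<exists>s q. s \<in> \<mm> \<and> q \<in> P \<and>
      (\<forall>j\<in>I. s \<odot>\<^bsub>N\<^esub> F j c \<oplus>\<^bsub>N\<^esub> F j q = (if j \<in> J then F j c else \<zero>\<^bsub>N\<^esub>))" if "J \<subseteq> I" for J
      using finite_subset[OF that I(1)] that
    proof (induction J rule: finite_induct)
      case empty
      show ?case
        using c Fcl module_hom_zero[OF M N F] submodule_zero_mem[OF P]
        by (intro exI[of _ \<zero>] exI[of _ "\<zero>\<^bsub>M\<^esub>"]) auto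
    next
      case (insert i J)
      then obtain s q where sq: "s \<in> \<mm>" "q \<in> P"
        "\<forall>j\<in>I. s \<odot>\<^bsub>N\<^esub> F j c \<oplus>\<^bsub>N\<^esub> F j q = (if j \<in> J then F j c else \<zero>\<^bsub>N\<^esub>)" by auto
      have i: "i \<in> I" using insert.prems by auto
      have s: "s \<in> carrier R" using sq(1) \<mm>.a_Hcarr by auto
      have "(s \<oplus> r i) \<odot>\<^bsub>N\<^esub> F j c \<oplus>\<^bsub>N\<^esub> F j (q \<oplus>\<^bsub>M\<^esub> p i) = (if j \<in> insert i J then F j c else \<zero>\<^bsub>N\<^esub>)"
        if j: "j \<in> I" for j
      proof -
        have "(s \<oplus> r i) \<odot>\<^bsub>N\<^esub> F j c \<oplus>\<^bsub>N\<^esub> F j (q \<oplus>\<^bsub>M\<^esub> p i) =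
          (s \<odot>\<^bsub>N\<^esub> F j c \<oplus>\<^bsub>N\<^esub> F j q) \<oplus>\<^bsub>N\<^esub> (r i \<odot>\<^bsub>N\<^esub> F j c \<oplus>\<^bsub>N\<^esub> F j (p i))"
          using s rp(1)[OF i] rp(2)[OF i] sq(2) subP Fcl[OF j] c
          by (simp add: module_hom_add[OF F[OF j]] N.smult_l_distr N.M.a_ac)
        also have "\<dots> = (if j \<in> J then F j c else \<zero>\<^bsub>N\<^esub>) \<oplus>\<^bsub>N\<^esub> (if j = i then F i c else \<zero>\<^bsub>N\<^esub>)"
          using sq(3) eq[OF i j] j by simp
        also have "\<dots> = (if j \<in> insert i J then F j c else \<zero>\<^bsub>N\<^esub>)"
          using insert.hyps Fcl[OF j] c by auto
        finally show ?thesis .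
      qed
      then show ?case
        using \<mm>.a_closed[OF sq(1) rm[OF i]] M.submoduleE(5)[OF P sq(2) rp(2)[OF i]] by blast
    qed
    from this[of I] obtain s q where sq: "s \<in> \<mm>" "q \<in> P"
      "\<And>j. j \<in> I \<Longrightarrow> s \<odot>\<^bsub>N\<^esub> F j c \<oplus>\<^bsub>N\<^esub> F j q = F j c" by auto
    have s: "s \<in> carrier R" and qM: "q \<in> carrier M" using sq(1,2) \<mm>.a_Hcarr subP by auto
    define u where "u = inv (\<one> \<ominus> s)"
    have u: "u \<in> carrier R" "u \<otimes> (\<one> \<ominus> s) = \<one>"
      using one_minus_max_ideal_unit[OF sq(1)] by (auto simp: u_def)
    have Fc: "F j c = F j (u \<odot>\<^bsub>M\<^esub> q)" if j: "j \<in> I" for j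
    proof -
      have cl: "F j c \<in> carrier N" "F j q \<in> carrier N" using Fcl[OF j] c qM by auto
      have "(\<one> \<ominus> s) \<odot>\<^bsub>N\<^esub> F j c = F j c \<ominus>\<^bsub>N\<^esub> s \<odot>\<^bsub>N\<^esub> F j c"
        using cl s by (simp add: a_minus_def N.smult_l_distr N.smult_l_minus)
      also have "\<dots> = (s \<odot>\<^bsub>N\<^esub> F j c \<oplus>\<^bsub>N\<^esub> F j q) \<ominus>\<^bsub>N\<^esub> s \<odot>\<^bsub>N\<^esub> F j c" using sq(3)[OF j] by simp
      also have "\<dots> = F j q" using cl s
        by (simp add: a_minus_def N.M.a_ac N.M.r_neg N.M.a_lcomm[of "F j q"])
      finally have "u \<odot>\<^bsub>N\<^esub> ((\<one> \<ominus> s) \<odot>\<^bsub>N\<^esub> F j c) = F j (u \<odot>\<^bsub>M\<^esub> q)"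
        using u(1) qM by (simp add: module_hom_smult[OF F[OF j]])
      then show ?thesis using u cl s by (simp add: N.smult_assoc1[symmetric])
    qed
    have "jointly_onto N P I F"
      unfolding jointly_onto_def
    proof
      fix y assume "y \<in> I \<rightarrow> carrier N"
      then obtain x where x: "x \<in> adjoin R M P [c]" "\<And>j. j \<in> I \<Longrightarrow> F j x = y j"
        using jointly_ontoD[OF onto, of y] by blast
      then obtain t w where tw: "t \<in> carrier R" "w \<in> P" "x = t \<odot>\<^bsub>M\<^esub> c \<oplus>\<^bsub>M\<^esub> w" by auto
      have "F j (t \<odot>\<^bsub>M\<^esub> (u \<odot>\<^bsub>M\<^esub> q) \<oplus>\<^bsub>M\<^esub> w) = y j" if j: "j \<in> I" for j
      proof -
        have "F j (t \<odot>\<^bsub>M\<^esub> (u \<odot>\<^bsub>M\<^esub> q) \<oplus>\<^bsub>M\<^esub> w) = F j x"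
          using tw subP u qM c Fc[OF j] j
          by (simp add: module_hom_add[OF F[OF j]] module_hom_smult[OF F[OF j]])
        then show ?thesis using x(2)[OF j] by simp
      qed
      moreover have "t \<odot>\<^bsub>M\<^esub> (u \<odot>\<^bsub>M\<^esub> q) \<oplus>\<^bsub>M\<^esub> w \<in> P"
        using tw u sq(2) M.submoduleE(4,5)[OF P] by auto
      ultimately show "\<exists>x\<in>P. \<forall>i\<in>I. F i x = y i" by blast
    qed
    then show ?thesis using I(2) jointly_onto_subset[OF _ _ N] by blast
  qed
qed

lemma jointly_onto_drop_list:
  assumes M: "module R M" and N: "module R N" and P: "submodule P R M" and cs: "set cs \<subseteq> carrier M"
    and F: "\<And>i. i \<in> I \<Longrightarrow> F i \<in> module_hom R M N" and I: "finite I"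
    and onto: "jointly_onto N (adjoin R M P cs) I F"
  shows "\<exists>J\<subseteq>I. card I \<le> card J + length cs \<and> jointly_onto N P J F"
  using cs F I onto
proof (induction cs arbitrary: I)
  case (Cons c cs)
  interpret M: module R M by fact
  show ?case
  proof (cases "I = {}")
    case True
    have "\<zero>\<^bsub>M\<^esub> \<in> P" by (rule submodule_zero_mem[OF P])
    then show ?thesis using True by (auto simp: jointly_onto_def)
  next
    case False
    have "jointly_onto N (adjoin R M (adjoin R M P cs) [c]) I F" using Cons.prems(4) by simp
    then obtain i where i: "i \<in> I" "jointly_onto N (adjoin R M P cs) (I - {i}) F"
      using jointly_onto_drop[OF M N M.submodule_adjoin[OF P], of cs c I F] Cons.prems False by auto
    then obtain J where J: "J \<subseteq> I - {i}" "card (I - {i}) \<le> card J + length cs" "jointly_onto N P J F"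
      using Cons.IH[of "I - {i}"] Cons.prems by auto
    then show ?thesis using i Cons.prems(3) by (intro exI[of _ J]) (auto simp: card_Diff_singleton)
  qed
qed auto

text \<open>Dropping all minimal generators leaves the zero submodule, which is jointly onto powers
  of a nonzero module for the empty index set only. The bound ensures that the
  \<open>GREATEST\<close> in \<open>surj_num\<close> is attained.\<close>

lemma surjects_onto_power_bound:
  assumes A: "fg_module R A" and N: "module R N" "\<not> zero_module N"
    and surj: "surjects_onto_power R N A n"
  shows "n \<le> min_gens R A"
proof -
  interpret A: module R A using A by (rule fg_module_is_module)
  interpret N: module R N by fact
  obtain cs where cs: "set cs \<subseteq> carrier A" "adjoin R A {\<zero>\<^bsub>A\<^esub>} cs = carrier A"
    "length cs = min_gens R A" using min_gens_list[OF A] by blast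
  obtain F where F: "\<And>i. i < n \<Longrightarrow> F i \<in> module_hom R A N" "jointly_onto N (carrier A) {..<n} F"
    using surj by (auto simp: surjects_onto_power_def)
  obtain J where J: "J \<subseteq> {..<n}" "n \<le> card J + length cs" "jointly_onto N {\<zero>\<^bsub>A\<^esub>} J F"
    using jointly_onto_drop_list[OF A.module_axioms N(1) A.submodule_zero cs(1), of "{..<n}" F] F cs(2)
    by auto
  have "J = {}"
  proof (rule ccontr)
    assume "J \<noteq> {}"
    then obtain i where i: "i \<in> J" by auto
    obtain y where y: "y \<in> carrier N" "y \<noteq> \<zero>\<^bsub>N\<^esub>" using N(2) by (auto simp: zero_module_def)
    obtain x where "x \<in> {\<zero>\<^bsub>A\<^esub>}" "\<And>i. i \<in> J \<Longrightarrow> F i x = y"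
      by (rule jointly_ontoD[OF J(3), of "\<lambda>_. y"]) (use y in auto)
    then show False using module_hom_zero[OF A.module_axioms N(1) F(1), of i] i J(1) y by auto
  qed
  then show ?thesis using J(2) cs(3) by simp
qed

lemma
  assumes A: "fg_module R A" and N: "module R N" "\<not> zero_module N"
  shows surjects_onto_power_surj_num: "surjects_onto_power R N A (surj_num R N A)"
    and surj_num_ge: "surjects_onto_power R N A n \<Longrightarrow> n \<le> surj_num R N A"
    and surj_num_le_min_gens: "surj_num R N A \<le> min_gens R A"
proof -
  have b: "\<And>n. surjects_onto_power R N A n \<Longrightarrow> n \<le> min_gens R A"
    by (rule surjects_onto_power_bound[OF A N])
  show "surjects_onto_power R N A (surj_num R N A)"
    unfolding surj_num_eq
    by (rule GreatestI_nat[of "surjects_onto_power R N A" 0, OF surjects_onto_power_0 b])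
      (rule fg_module_is_module[OF A])
  then show "surj_num R N A \<le> min_gens R A" by (rule b)
  show "surjects_onto_power R N A n \<Longrightarrow> n \<le> surj_num R N A"
    unfolding surj_num_eq by (rule Greatest_le_nat[OF _ b])
qed

lemma surjects_onto_power_image:
  assumes f: "f \<in> module_hom R A B" "f ` carrier A = carrier B" and surj: "surjects_onto_power R N B n"
  shows "surjects_onto_power R N A n"
proof -
  obtain F where F: "\<And>i. i < n \<Longrightarrow> F i \<in> module_hom R B N" "jointly_onto N (carrier B) {..<n} F"
    using surj by (auto simp: surjects_onto_power_def)
  have "jointly_onto N (carrier A) {..<n} (\<lambda>i x. F i (f x))"
    using F(2) unfolding jointly_onto_def f(2)[symmetric] by simp
  then show ?thesis
    unfolding surjects_onto_power_def using module_hom_compose[OF f(1) F(1)]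
    by (intro exI[of _ "\<lambda>i x. F i (f x)"]) auto
qed

lemma surj_num_image:
  assumes A: "fg_module R A" and B: "module R B" and N: "module R N" "\<not> zero_module N"
    and f: "f \<in> module_hom R A B" "f ` carrier A = carrier B"
  shows "surj_num R N B \<le> surj_num R N A"
  using surj_num_ge[OF A N] surjects_onto_power_image[OF f]
    surjects_onto_power_surj_num[OF fg_module_image(1)[OF A B f] N] by blast

lemma surj_num_isomorphic:
  assumes iso: "module_isomorphic R A B" and A: "fg_module R A" and B: "module R B"
    and N: "module R N" "\<not> zero_module N"
  shows "surj_num R N A = surj_num R N B"
proof (rule antisym)
  have *: "surj_num R N B \<le> surj_num R N A"
    if "module_isomorphic R A B" "fg_module R A" "module R B"
    for A :: "('a, 'x, 'l) module_scheme" and B :: "('a, 'y, 'k) module_scheme"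
    using that surj_num_image[OF that(2,3) N] unfolding module_isomorphic_def bij_betw_def by blast
  show "surj_num R N B \<le> surj_num R N A" by (rule *[OF iso A B])
  have *: "surj_num R N A \<le> surj_num R N B"
    if "module_isomorphic R B A" "fg_module R B" "module R A"
    using that surj_num_image[OF that(2,3) N] unfolding module_isomorphic_def bij_betw_def by blast
  show "surj_num R N A \<le> surj_num R N B"
    by (rule *[OF module_isomorphic_sym[OF fg_module_is_module[OF A] B iso]
          fg_module_isomorphic[OF iso A B] fg_module_is_module[OF A]])
qed

text \<open>\<open>U\<close> is generated by the image of \<open>A\<close> and the images of minimal
  generators of \<open>B\<close>. Dropping the latter loses at most one coordinate for each, and the
  coordinates that remain are already onto from \<open>A\<close>.\<close>

lemma surj_num_biproduct_le:
  assumes bip: "biproduct R U A B i j p q" and U: "fg_module R U" and A: "fg_module R A"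
    and B: "fg_module R B" and N: "module R N" "\<not> zero_module N"
  shows "surj_num R N U \<le> surj_num R N A + min_gens R B"
proof -
  interpret U: module R U using U by (rule fg_module_is_module)
  interpret A: module R A using A by (rule fg_module_is_module)
  interpret B: module R B using B by (rule fg_module_is_module)
  note bp = biproductD[OF bip]
  note cl = bp(1-4)[THEN module_hom_closed]
  obtain bs where bs: "set bs \<subseteq> carrier B" "adjoin R B {\<zero>\<^bsub>B\<^esub>} bs = carrier B"
    "length bs = min_gens R B" using min_gens_list[OF B] by blast
  define n where "n = surj_num R N U"
  obtain F where F: "\<And>k. k < n \<Longrightarrow> F k \<in> module_hom R U N" "jointly_onto N (carrier U) {..<n} F"
    using surjects_onto_power_surj_num[OF U N] by (auto simp: surjects_onto_power_def n_def)
  let ?P = "i ` carrier A" and ?cs = "map j bs"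
  have P: "submodule ?P R U"
    by (rule submodule_image[OF A.module_axioms U.module_axioms bp(1) A.carrier_is_submodule])
  have cs: "set ?cs \<subseteq> carrier U" using bs(1) cl by auto
  have Q: "submodule (adjoin R U ?P ?cs) R U" by (rule U.submodule_adjoin[OF P cs])
  have "j ` carrier B = adjoin R U {\<zero>\<^bsub>U\<^esub>} ?cs"
    using adjoin_image[OF B.module_axioms U.module_axioms bp(2) B.submodule_zero bs(1)] bs(2)
      module_hom_zero[OF B.module_axioms U.module_axioms bp(2)] by simp
  also have "\<dots> \<subseteq> adjoin R U ?P ?cs"
    using U.adjoin_mem[OF P cs] submodule_zero_mem[OF Q] by (intro U.adjoin_minimal[OF Q]) auto
  finally have "j b \<in> adjoin R U ?P ?cs" if "b \<in> carrier B" for b using that by auto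
  then have "i (p x) \<oplus>\<^bsub>U\<^esub> j (q x) \<in> adjoin R U ?P ?cs" if "x \<in> carrier U" for x
    using that U.submoduleE(5)[OF Q] U.adjoin_superset[OF P cs] cl(3,4)[OF that] by blast
  then have gen: "adjoin R U ?P ?cs = carrier U"
    using U.submoduleE(1)[OF Q] bp(9) by fastforce
  obtain J where J: "J \<subseteq> {..<n}" "n \<le> card J + length bs" "jointly_onto N ?P J F"
    using jointly_onto_drop_list[OF U.module_axioms N(1) P cs, of "{..<n}" F] F gen by auto
  have "jointly_onto N (carrier A) J (\<lambda>k x. F k (i x))"
    using J(3) unfolding jointly_onto_def by blast
  then have "surjects_onto_power R N A (card J)"
    using J(1) module_hom_compose[OF bp(1) F(1)]
    by (intro surjects_onto_powerI[of J _ "\<lambda>k x. F k (i x)"]) (auto intro: finite_subset)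
  then have "card J \<le> surj_num R N A" by (rule surj_num_ge[OF A N])
  then show ?thesis using J(2) bs(3) n_def by linarith
qed

lemma surj_num_biproduct_ge:
  assumes bip: "biproduct R U A B i j p q" and U: "fg_module R U" and A: "fg_module R A"
    and B: "fg_module R B" and N: "module R N" "\<not> zero_module N"
  shows "surj_num R N A + surj_num R N B \<le> surj_num R N U"
proof (rule surj_num_ge[OF U N])
  interpret U: module R U using U by (rule fg_module_is_module)
  interpret N: module R N by fact
  note A' = fg_module_is_module[OF A] and B' = fg_module_is_module[OF B]
  note bp = biproductD[OF bip]
  note cl = bp(1-4)[THEN module_hom_closed]
  define a b where "a = surj_num R N A" and "b = surj_num R N B"
  obtain F where F: "\<And>k. k < a \<Longrightarrow> F k \<in> module_hom R A N" "jointly_onto N (carrier A) {..<a} F"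
    using surjects_onto_power_surj_num[OF A N] by (auto simp: surjects_onto_power_def a_def)
  obtain G where G: "\<And>k. k < b \<Longrightarrow> G k \<in> module_hom R B N" "jointly_onto N (carrier B) {..<b} G"
    using surjects_onto_power_surj_num[OF B N] by (auto simp: surjects_onto_power_def b_def)
  define H where "H k = (if k < a then (\<lambda>x. F k (p x)) else (\<lambda>x. G (k - a) (q x)))" for k
  have H: "H k \<in> module_hom R U N" if "k < a + b" for k
    using that module_hom_compose[OF bp(3) F(1)] module_hom_compose[OF bp(4) G(1)]
    by (auto simp: H_def)
  have "jointly_onto N (carrier U) {..<a + b} H"
    unfolding jointly_onto_def
  proof
    fix y assume y: "y \<in> {..<a + b} \<rightarrow> carrier N"
    obtain x where x: "x \<in> carrier A" "\<And>k. k \<in> {..<a} \<Longrightarrow> F k x = y k"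
      by (rule jointly_ontoD[OF F(2), of y]) (use y in auto)
    obtain z where z: "z \<in> carrier B" "\<And>k. k \<in> {..<b} \<Longrightarrow> G k z = y (a + k)"
      by (rule jointly_ontoD[OF G(2), of "\<lambda>k. y (a + k)"]) (use y in auto)
    have "p (i x \<oplus>\<^bsub>U\<^esub> j z) = x" "q (i x \<oplus>\<^bsub>U\<^esub> j z) = z"
      using x z cl bp by (auto simp: module_hom_add[OF bp(3)] module_hom_add[OF bp(4)]
          module.axioms(2)[OF A', THEN abelian_group.axioms(1), THEN abelian_monoid.r_zero]
          module.axioms(2)[OF B', THEN abelian_group.axioms(1), THEN abelian_monoid.l_zero])
    then have "\<forall>k\<in>{..<a + b}. H k (i x \<oplus>\<^bsub>U\<^esub> j z) = y k" using x z by (auto simp: H_def)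
    then show "\<exists>x\<in>carrier U. \<forall>k\<in>{..<a + b}. H k x = y k" using x z cl by blast
  qed
  then show "surjects_onto_power R N U (surj_num R N A + surj_num R N B)"
    unfolding surjects_onto_power_def using H a_def b_def by blast
qed

text \<open>Here \<open>F\<close> identifies \<open>U\<close> with \<open>N^n\<close>. If more than
  \<open>n\<close> coordinates were possible, the first \<open>n\<close> of them would map
  \<open>U\<close> onto \<open>N^n\<close>, which amounts to a surjective and hence injective
  endomorphism of \<open>U\<close>; but it kills an element whose coordinate \<open>n\<close> is
  nonzero while all others vanish.\<close>

lemma surj_num_power:
  assumes N: "fg_module R N" "\<not> zero_module N" and U: "fg_module R U"
    and F: "\<And>i. i < n \<Longrightarrow> F i \<in> module_hom R U N"
    and onto: "jointly_onto N (carrier U) {..<n} F"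
    and inj: "\<And>x. \<lbrakk>x \<in> carrier U; \<And>i. i < n \<Longrightarrow> F i x = \<zero>\<^bsub>N\<^esub>\<rbrakk> \<Longrightarrow> x = \<zero>\<^bsub>U\<^esub>"
  shows "surj_num R N U = n"
proof (rule antisym)
  note N' = fg_module_is_module[OF N(1)] and U' = fg_module_is_module[OF U]
  note D = module_direct_power[OF N']
  interpret N: module R N by fact
  interpret U: module R U by fact
  show "n \<le> surj_num R N U"
    using F onto by (intro surj_num_ge[OF U N' N(2)]) (auto simp: surjects_onto_power_def)
  show "surj_num R N U \<le> n"
  proof (rule ccontr)
    assume "\<not> surj_num R N U \<le> n"
    then have lt: "n < surj_num R N U" by simp
    obtain G where G: "\<And>i. i < surj_num R N U \<Longrightarrow> G i \<in> module_hom R U N"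
      "jointly_onto N (carrier U) {..<surj_num R N U} G"
      using surjects_onto_power_surj_num[OF U N' N(2)] by (auto simp: surjects_onto_power_def)
    have Gn: "jointly_onto N (carrier U) {..<n} G"
      using lt by (intro jointly_onto_subset[OF G(2) _ N']) auto
    let ?f = "\<lambda>x. \<lambda>i\<in>{..<n}. F i x" and ?g = "\<lambda>x. \<lambda>i\<in>{..<n}. G i x"
    have f: "?f \<in> module_hom R U (direct_power N n)" by (rule module_hom_direct_powerI[OF F])
    have g: "?g \<in> module_hom R U (direct_power N n)"
      using G(1) lt by (intro module_hom_direct_powerI) auto
    have inj_f: "inj_on ?f (carrier U)"
    proof (rule module_hom_inj_on[OF U' D f])
      fix x assume x: "x \<in> carrier U" "?f x = \<zero>\<^bsub>direct_power N n\<^esub>"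
      have "F i x = \<zero>\<^bsub>N\<^esub>" if "i < n" for i using fun_cong[OF x(2), of i] that by simp
      then show "x = \<zero>\<^bsub>U\<^esub>" by (rule inj[OF x(1)])
    qed
    have bij: "bij_betw ?f (carrier U) (carrier (direct_power N n))"
      using inj_f jointly_onto_image[OF onto F] by (auto simp: bij_betw_def)
    have g_im: "?g ` carrier U = carrier (direct_power N n)"
      using G(1) lt by (intro jointly_onto_image[OF Gn, of R]) auto
    let ?h = "\<lambda>x. inv_into (carrier U) ?f (?g x)"
    have h: "?h \<in> module_hom R U U"
      by (rule module_hom_compose[OF g module_hom_inv_into[OF U' D f bij]])
    have "?h ` carrier U = inv_into (carrier U) ?f ` (?g ` carrier U)" by (simp add: image_image)
    also have "\<dots> = carrier U"
      unfolding g_im by (rule bij_betw_imp_surj_on[OF bij_betw_inv_into[OF bij]])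
    finally have inj_h: "inj_on ?h (carrier U)"
      by (rule noetherian_surj_endo_inj[OF noetherian_ring_axioms U h])
    obtain y where y: "y \<in> carrier N" "y \<noteq> \<zero>\<^bsub>N\<^esub>" using N(2) by (auto simp: zero_module_def)
    obtain x where x: "x \<in> carrier U"
      "\<And>i. i \<in> {..<surj_num R N U} \<Longrightarrow> G i x = (if i = n then y else \<zero>\<^bsub>N\<^esub>)"
      by (rule jointly_ontoD[OF G(2), of "\<lambda>i. if i = n then y else \<zero>\<^bsub>N\<^esub>"]) (use y in auto)
    have "?g x = ?g \<zero>\<^bsub>U\<^esub>"
      using x(2) lt module_hom_zero[OF U' N' G(1)] by (auto simp: fun_eq_iff)
    then have "x = \<zero>\<^bsub>U\<^esub>" using inj_onD[OF inj_h, of x "\<zero>\<^bsub>U\<^esub>"] x(1) by simp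
    then have "G n x = \<zero>\<^bsub>N\<^esub>" using module_hom_zero[OF U' N' G(1)] lt by simp
    then show False using x(2)[of n] lt y by simp
  qed
qed

end

section \<open>Endomorphisms of indecomposable modules over a Henselian local ring\<close>

primrec poly_act :: "('a, 'b, 'm) module_scheme \<Rightarrow> ('b \<Rightarrow> 'b) \<Rightarrow> 'a list \<Rightarrow> 'b \<Rightarrow> 'b"
  where
    "poly_act M f [] x = \<zero>\<^bsub>M\<^esub>"
  | "poly_act M f (a # as) x = a \<odot>\<^bsub>M\<^esub> (f ^^ length as) x \<oplus>\<^bsub>M\<^esub> poly_act M f as x"

locale module_endo = module R M for R (structure) and M (structure) +
  fixes f
  assumes endo: "f \<in> module_hom R M M"
begin

lemma funpow_hom: "f ^^ n \<in> module_hom R M M"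
proof (induction n)
  case (Suc n)
  then show ?case using module_hom_compose[OF Suc endo] by (simp add: comp_def)
qed (simp add: module_hom_id flip: id_def)

lemmas funpow_closed [simp] = module_hom_closed[OF funpow_hom]
lemmas funpow_plus = module_hom_add[OF funpow_hom]
lemmas funpow_smult = module_hom_smult[OF funpow_hom]
lemmas funpow_zero [simp] = module_hom_zero[OF module_axioms module_axioms funpow_hom]

lemma poly_act_hom:
  assumes "set as \<subseteq> carrier R"
  shows "poly_act M f as \<in> module_hom R M M"
  using assms
proof (induction as)
  case Nil
  then show ?case using module_hom_zero_hom[OF module_axioms module_axioms] by simp
next
  case (Cons a as)
  have "(\<lambda>x. a \<odot>\<^bsub>M\<^esub> (f ^^ length as) x \<oplus>\<^bsub>M\<^esub> poly_act M f as x) \<in> module_hom R M M"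
    using Cons by (intro module_hom_plus_hom module_hom_smult_hom module_axioms funpow_hom) auto
  then show ?case by (rule module_hom_cong) (auto intro: module_axioms)
qed

lemma poly_act_closed [simp]: "\<lbrakk>set as \<subseteq> carrier R; x \<in> carrier M\<rbrakk> \<Longrightarrow> poly_act M f as x \<in> carrier M"
  by (rule module_hom_closed[OF poly_act_hom])

lemma poly_act_funpow:
  assumes "set as \<subseteq> carrier R" "x \<in> carrier M"
  shows "poly_act M f as ((f ^^ n) x) = (f ^^ n) (poly_act M f as x)"
  using assms
proof (induction as)
  case (Cons a as)
  have "(f ^^ length as) ((f ^^ n) x) = (f ^^ n) ((f ^^ length as) x)"
    by (metis Nat.funpow_add add.commute comp_apply)
  then show ?case using Cons by (simp add: funpow_plus funpow_smult)
qed auto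

lemma map2_add_closed:
  "\<lbrakk>set as \<subseteq> carrier R; set bs \<subseteq> carrier R\<rbrakk> \<Longrightarrow> set (map2 (\<oplus>) as bs) \<subseteq> carrier R"
  by (auto elim!: in_set_zipE)

lemma poly_act_map2_add:
  assumes "length as = length bs" "set as \<subseteq> carrier R" "set bs \<subseteq> carrier R" "x \<in> carrier M"
  shows "poly_act M f (map2 (\<oplus>) as bs) x = poly_act M f as x \<oplus>\<^bsub>M\<^esub> poly_act M f bs x"
  using assms
proof (induction as bs rule: list_induct2)
  case (Cons a as b bs)
  then show ?case by (simp add: smult_l_distr M.a_ac)
qed auto

lemma poly_act_replicate_append:
  assumes "set as \<subseteq> carrier R" "x \<in> carrier M"
  shows "poly_act M f (replicate n \<zero> @ as) x = poly_act M f as x"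
  using assms by (induction n) auto

lemma poly_act_normalize:
  assumes "set as \<subseteq> carrier R" "x \<in> carrier M"
  shows "poly_act M f (R.normalize as) x = poly_act M f as x"
  using assms by (induction as) auto

lemma poly_act_append_replicate:
  assumes "set as \<subseteq> carrier R" "x \<in> carrier M"
  shows "poly_act M f (as @ replicate n \<zero>) x = (f ^^ n) (poly_act M f as x)"
  using assms
proof (induction as)
  case Nil
  then show ?case using poly_act_replicate_append[of "[]" x n] by simp
next
  case (Cons a as)
  have "(f ^^ (length as + n)) x = (f ^^ n) ((f ^^ length as) x)"
    by (simp add: add.commute Nat.funpow_add)
  then show ?case using Cons by (simp add: funpow_plus funpow_smult)
qed

lemma poly_act_map_mult:
  assumes "a \<in> carrier R" "set as \<subseteq> carrier R" "x \<in> carrier M"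
  shows "poly_act M f (map ((\<otimes>) a) as) x = a \<odot>\<^bsub>M\<^esub> poly_act M f as x"
  using assms by (induction as) (auto simp: smult_assoc1 smult_r_distr)

lemma poly_act_add:
  assumes "set as \<subseteq> carrier R" "set bs \<subseteq> carrier R" "x \<in> carrier M"
  shows "poly_act M f (R.poly_add as bs) x = poly_act M f as x \<oplus>\<^bsub>M\<^esub> poly_act M f bs x"
proof -
  have *: "poly_act M f (R.poly_add as bs) x = poly_act M f as x \<oplus>\<^bsub>M\<^esub> poly_act M f bs x"
    if "length bs \<le> length as" "set as \<subseteq> carrier R" "set bs \<subseteq> carrier R" for as bs
  proof -
    let ?bs = "replicate (length as - length bs) \<zero> @ bs"
    have bs: "length as = length ?bs" "set ?bs \<subseteq> carrier R" using that by auto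
    have "set (map2 (\<oplus>) as ?bs) \<subseteq> carrier R"
      by (rule map2_add_closed[OF that(2) bs(2)])
    then show ?thesis
      using that bs assms(3) poly_act_map2_add[OF bs(1) that(2) bs(2) assms(3)]
      by (simp add: poly_act_normalize poly_act_replicate_append)
  qed
  show ?thesis
  proof (cases "length bs \<le> length as")
    case False
    then have "R.poly_add as bs = R.poly_add bs as" by simp
    then show ?thesis using *[of as bs] assms False by (simp add: M.a_comm del: R.poly_add.simps)
  qed (use * assms in blast)
qed

lemma poly_act_mult:
  assumes "set as \<subseteq> carrier R" "set bs \<subseteq> carrier R" "x \<in> carrier M"
  shows "poly_act M f (R.poly_mult as bs) x = poly_act M f as (poly_act M f bs x)"
  using assms
proof (induction as)
  case (Cons a as)
  let ?cs = "map ((\<otimes>) a) bs @ replicate (length as) \<zero>"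
  have a: "a \<in> carrier R" "set as \<subseteq> carrier R" using Cons.prems by auto
  have cs: "set (map ((\<otimes>) a) bs) \<subseteq> carrier R" "set ?cs \<subseteq> carrier R" using a Cons.prems by auto
  have "R.poly_mult (a # as) bs = R.poly_add ?cs (R.poly_mult as bs)" by simp
  then show ?case
    using Cons a cs R.poly_mult_in_carrier[OF a(2) Cons.prems(2)]
    by (simp add: poly_act_add poly_act_append_replicate poly_act_map_mult funpow_smult
        del: R.poly_add.simps R.poly_mult.simps)
qed simp

lemma poly_act_snoc:
  assumes "set as \<subseteq> carrier R" "c \<in> carrier R" "x \<in> carrier M"
  shows "poly_act M f (as @ [c]) x = f (poly_act M f as x) \<oplus>\<^bsub>M\<^esub> c \<odot>\<^bsub>M\<^esub> x"
  using assms
proof (induction as)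
  case Nil
  then show ?case using funpow_zero[of 1] by simp
next
  case (Cons a as)
  have fE: "f (u \<oplus>\<^bsub>M\<^esub> v) = f u \<oplus>\<^bsub>M\<^esub> f v" "f (a \<odot>\<^bsub>M\<^esub> u) = a \<odot>\<^bsub>M\<^esub> f u" "f u \<in> carrier M"
    if "u \<in> carrier M" "v \<in> carrier M" for u v
    using that Cons.prems module_homE[OF endo] by auto
  show ?case using Cons by (simp add: fE M.a_assoc)
qed

lemma poly_act_commute:
  assumes "set as \<subseteq> carrier R" "set bs \<subseteq> carrier R" "x \<in> carrier M"
  shows "poly_act M f as (poly_act M f bs x) = poly_act M f bs (poly_act M f as x)"
  using assms(1)
proof (induction as)
  case Nil
  then show ?case using module_hom_zero[OF module_axioms module_axioms poly_act_hom[OF assms(2)]] by simp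
next
  case (Cons a as)
  then show ?case
    using assms poly_act_funpow[OF assms(2,3)]
    by (simp add: module_hom_add[OF poly_act_hom[OF assms(2)]] module_hom_smult[OF poly_act_hom[OF assms(2)]])
qed

lemma poly_act_in_submodule:
  assumes Q: "submodule Q R M" and "\<And>a y. \<lbrakk>a \<in> set as; y \<in> carrier M\<rbrakk> \<Longrightarrow> a \<odot>\<^bsub>M\<^esub> y \<in> Q"
    and "x \<in> carrier M"
  shows "poly_act M f as x \<in> Q"
  using assms(2)
proof (induction as)
  case Nil
  then show ?case using submodule_zero_mem[OF Q] by simp
next
  case (Cons a as)
  then show ?case using submoduleE(5)[OF Q] assms(3) by simp
qed

text \<open>Hensel's lemma is applied to a list that starts with \<open>\<one>\<close>. The
  normalization inside \<open>R.poly_mult\<close> hides this shape, so the product is assembled from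
  sums of lists of equal length.\<close>

lemma poly_act_monic_mult:
  assumes as: "set as \<subseteq> carrier R" and bs: "set bs \<subseteq> carrier R"
  shows "\<exists>cs. set cs \<subseteq> carrier R \<and>
    (\<forall>x\<in>carrier M. poly_act M f (\<one> # cs) x = poly_act M f (\<one> # as) (poly_act M f (\<one> # bs) x))"
proof -
  \<comment> \<open>The part of the product below the leading term of the first factor. Its exact
    length leaves the next higher place free for the coefficient \<open>\<one>\<close>.\<close>
  have "\<exists>cs. length cs = length as + length bs \<and> set cs \<subseteq> carrier R \<and>
    (\<forall>x\<in>carrier M. poly_act M f cs x = poly_act M f as (poly_act M f (\<one> # bs) x))"
    using as
  proof (induction as)
    case Nil
    show ?case
      using poly_act_replicate_append[of "[]" _ "length bs"]
      by (intro exI[of _ "replicate (length bs) \<zero>"]) auto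
  next
    case (Cons a as)
    then obtain cs where cs: "length cs = length as + length bs" "set cs \<subseteq> carrier R"
      "\<forall>x\<in>carrier M. poly_act M f cs x = poly_act M f as (poly_act M f (\<one> # bs) x)" by auto
    have a: "a \<in> carrier R" using Cons.prems by auto
    let ?ds = "map ((\<otimes>) a) (\<one> # bs) @ replicate (length as) \<zero>"
    have b1: "set (\<one> # bs) \<subseteq> carrier R" using bs by simp
    have m1: "set (map ((\<otimes>) a) (\<one> # bs)) \<subseteq> carrier R" using a bs by auto
    have ds: "set ?ds \<subseteq> carrier R" "length ?ds = length (\<zero> # cs)" "set (\<zero> # cs) \<subseteq> carrier R"
      using m1 cs(1,2) by auto
    have "poly_act M f (map2 (\<oplus>) ?ds (\<zero> # cs)) x =
        poly_act M f (a # as) (poly_act M f (\<one> # bs) x)" if x: "x \<in> carrier M" for x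
    proof -
      have "poly_act M f (map2 (\<oplus>) ?ds (\<zero> # cs)) x = poly_act M f ?ds x \<oplus>\<^bsub>M\<^esub> poly_act M f (\<zero> # cs) x"
        by (rule poly_act_map2_add[OF ds(2,1,3) x])
      also have "poly_act M f ?ds x = a \<odot>\<^bsub>M\<^esub> (f ^^ length as) (poly_act M f (\<one> # bs) x)"
        unfolding poly_act_append_replicate[OF m1 x] poly_act_map_mult[OF a b1 x]
        by (rule funpow_smult[OF a poly_act_closed[OF b1 x]])
      also have "poly_act M f (\<zero> # cs) x = poly_act M f as (poly_act M f (\<one> # bs) x)"
        using cs(2,3) x poly_act_closed[OF cs(2) x] by simp
      finally show ?thesis by simp
    qed
    moreover have "set (map2 (\<oplus>) ?ds (\<zero> # cs)) \<subseteq> carrier R"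
      by (rule map2_add_closed[OF ds(1,3)])
    moreover have "length (map2 (\<oplus>) ?ds (\<zero> # cs)) = length (a # as) + length bs"
      using cs(1) by simp
    ultimately show ?case by blast
  qed
  then obtain cs where cs: "length cs = length as + length bs" "set cs \<subseteq> carrier R"
    "\<And>x. x \<in> carrier M \<Longrightarrow> poly_act M f cs x = poly_act M f as (poly_act M f (\<one> # bs) x)" by auto
  let ?bs = "bs @ replicate (length as) \<zero>"
  have b: "set ?bs \<subseteq> carrier R" "length ?bs = length cs" using bs cs(1) by auto
  have "poly_act M f (\<one> # map2 (\<oplus>) ?bs cs) x =
      poly_act M f (\<one> # as) (poly_act M f (\<one> # bs) x)" if x: "x \<in> carrier M" for x
  proof -
    have b1: "set (\<one> # bs) \<subseteq> carrier R" using bs by simp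
    note cl = poly_act_closed[OF b1 x] poly_act_closed[OF bs x]
    have "poly_act M f (\<one> # map2 (\<oplus>) ?bs cs) x =
        (f ^^ (length bs + length as)) x \<oplus>\<^bsub>M\<^esub> ((f ^^ length as) (poly_act M f bs x) \<oplus>\<^bsub>M\<^esub> poly_act M f cs x)"
      using b cs x poly_act_map2_add[OF b(2,1) cs(2) x] poly_act_append_replicate[OF bs x] by simp
    also have "(f ^^ (length bs + length as)) x = (f ^^ length as) ((f ^^ length bs) x)"
      by (simp add: add.commute Nat.funpow_add)
    also have "\<dots> \<oplus>\<^bsub>M\<^esub> ((f ^^ length as) (poly_act M f bs x) \<oplus>\<^bsub>M\<^esub> poly_act M f cs x) =
        (f ^^ length as) (poly_act M f (\<one> # bs) x) \<oplus>\<^bsub>M\<^esub> poly_act M f cs x"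
      using x cl poly_act_closed[OF cs(2) x] by (simp add: funpow_plus M.a_assoc)
    also have "\<dots> = poly_act M f (\<one> # as) (poly_act M f (\<one> # bs) x)"
      using cs(3)[OF x] cl(1) by (simp del: poly_act.simps(2)) simp
    finally show ?thesis .
  qed
  moreover have "set (map2 (\<oplus>) ?bs cs) \<subseteq> carrier R"
    by (rule map2_add_closed[OF b(1) cs(2)])
  ultimately show ?thesis by blast
qed

lemma krylov_span:
  assumes x: "x \<in> carrier M" and y: "y \<in> adjoin R M {\<zero>\<^bsub>M\<^esub>} (map (\<lambda>i. (f ^^ i) x) (rev [0..<n]))"
  shows "\<exists>as. length as = n \<and> set as \<subseteq> carrier R \<and> y = poly_act M f as x"
  using y
proof (induction n arbitrary: y)
  case (Suc n)
  then obtain r z where r: "r \<in> carrier R"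
    and z: "z \<in> adjoin R M {\<zero>\<^bsub>M\<^esub>} (map (\<lambda>i. (f ^^ i) x) (rev [0..<n]))"
    and y: "y = r \<odot>\<^bsub>M\<^esub> (f ^^ n) x \<oplus>\<^bsub>M\<^esub> z" by auto
  from Suc.IH[OF z] obtain as where "length as = n" "set as \<subseteq> carrier R" "z = poly_act M f as x" by auto
  then show ?case using r y by (intro exI[of _ "r # as"]) auto
qed auto

text \<open>The spans of \<open>x, f x, ..., f^(n-1) x\<close> stabilize, which expresses some
  \<open>f^n x\<close> through lower powers; this replaces the theorem of Cayley and Hamilton. The
  product of the polynomials for finitely many generators kills all of them, since polynomials in
  \<open>f\<close> commute.\<close>

lemma monic_annihilator:
  assumes R: "noetherian_ring R" and M: "fg_module R M"
  obtains as where "set as \<subseteq> carrier R" "\<And>x. x \<in> carrier M \<Longrightarrow> poly_act M f (\<one> # as) x = \<zero>\<^bsub>M\<^esub>"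
proof -
  have single: "\<exists>as. set as \<subseteq> carrier R \<and> poly_act M f (\<one> # as) x = \<zero>\<^bsub>M\<^esub>" if x: "x \<in> carrier M" for x
  proof -
    let ?N = "\<lambda>n. adjoin R M {\<zero>\<^bsub>M\<^esub>} (map (\<lambda>i. (f ^^ i) x) (rev [0..<n]))"
    have cl: "set (map (\<lambda>i. (f ^^ i) x) (rev [0..<n])) \<subseteq> carrier M" for n using x by auto
    have N: "submodule (?N n) R M" for n by (rule submodule_adjoin[OF submodule_zero cl])
    have inc: "?N n \<subseteq> ?N (Suc n)" for n
      using adjoin_superset[OF N, of "[(f ^^ n) x]" n] x by simp
    have "\<exists>n. \<forall>m\<ge>n. ?N m = ?N n" by (rule noetherian_chain_stable[OF R M, where N = ?N, OF N inc])
    then obtain n where "\<forall>m\<ge>n. ?N m = ?N n" by (rule exE)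
    then have n: "?N (Suc n) = ?N n" by (rule mp[OF spec[of _ "Suc n"]]) simp
    have "(f ^^ n) x \<in> ?N n"
      unfolding n[symmetric] using adjoin_mem[OF N, of "[(f ^^ n) x]" n] x by simp
    then have "\<ominus>\<^bsub>M\<^esub> (f ^^ n) x \<in> ?N n" by (rule submoduleE(3)[OF N])
    then obtain as where "length as = n" "set as \<subseteq> carrier R" "\<ominus>\<^bsub>M\<^esub> (f ^^ n) x = poly_act M f as x"
      using krylov_span[OF x] by blast
    then show ?thesis using x M.r_neg[of "(f ^^ n) x"] by (intro exI[of _ as]) auto
  qed
  have list: "\<exists>as. set as \<subseteq> carrier R \<and> (\<forall>c\<in>set cs. poly_act M f (\<one> # as) c = \<zero>\<^bsub>M\<^esub>)"
    if "set cs \<subseteq> carrier M" for cs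
    using that
  proof (induction cs)
    case (Cons c cs)
    then obtain as where as: "set as \<subseteq> carrier R" "\<forall>c\<in>set cs. poly_act M f (\<one> # as) c = \<zero>\<^bsub>M\<^esub>" by auto
    obtain bs where bs: "set bs \<subseteq> carrier R" "poly_act M f (\<one> # bs) c = \<zero>\<^bsub>M\<^esub>"
      using single[of c] Cons.prems by auto
    obtain ds where ds: "set ds \<subseteq> carrier R"
      "\<And>x. x \<in> carrier M \<Longrightarrow> poly_act M f (\<one> # ds) x = poly_act M f (\<one> # as) (poly_act M f (\<one> # bs) x)"
      using poly_act_monic_mult[OF as(1) bs(1)] by auto
    have 1: "set (\<one> # as) \<subseteq> carrier R" "set (\<one> # bs) \<subseteq> carrier R" using as bs by auto
    note z = 1[THEN poly_act_hom, THEN module_hom_zero[OF module_axioms module_axioms]]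
    have "poly_act M f (\<one> # ds) x = \<zero>\<^bsub>M\<^esub>" if x: "x \<in> set (c # cs)" for x
    proof -
      have xM: "x \<in> carrier M" using x Cons.prems by auto
      show ?thesis
      proof (cases "x = c")
        case True
        then show ?thesis using ds(2)[OF xM] bs(2) z(1) by simp
      next
        case False
        then have "poly_act M f (\<one> # as) x = \<zero>\<^bsub>M\<^esub>" using x as by auto
        then show ?thesis using ds(2)[OF xM] poly_act_commute[OF 1 xM] z(2) by simp
      qed
    qed
    then show ?case using ds(1) by blast
  qed (auto intro: exI[of _ "[]"])
  obtain cs where cs: "set cs \<subseteq> carrier M" "adjoin R M {\<zero>\<^bsub>M\<^esub>} cs = carrier M"
    using M by (auto simp: fg_module_iff)
  obtain as where as: "set as \<subseteq> carrier R" "\<forall>c\<in>set cs. poly_act M f (\<one> # as) c = \<zero>\<^bsub>M\<^esub>"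
    using list[OF cs(1)] by blast
  have "set (\<one> # as) \<subseteq> carrier R" using as by auto
  note K = submodule_kernel[OF module_axioms module_axioms poly_act_hom[OF this]]
  have "carrier M \<subseteq> {x \<in> carrier M. poly_act M f (\<one> # as) x = \<zero>\<^bsub>M\<^esub>}"
    unfolding cs(2)[symmetric] using as(2) cs(1) submodule_zero_mem[OF K]
    by (intro adjoin_minimal[OF K[unfolded cs(2)[symmetric]]]) (auto simp: cs(2))
  then have "poly_act M f (\<one> # as) x = \<zero>\<^bsub>M\<^esub>" if "x \<in> carrier M" for x using that by blast
  then show ?thesis by (rule that[OF as(1)])
qed

text \<open>One descends from a power of \<open>f\<close> with image in \<open>Q\<close> to the
  power zero, the identity. Both applications verify the hypothesis of
  \<open>nakayama\<close>.\<close>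

lemma submodule_descent:
  assumes Q: "submodule Q R M"
    and large: "\<And>x. x \<in> carrier M \<Longrightarrow> (f ^^ n) x \<in> Q"
    and step: "\<And>k x. \<lbrakk>\<And>y. y \<in> carrier M \<Longrightarrow> (f ^^ Suc k) y \<in> Q; x \<in> carrier M\<rbrakk> \<Longrightarrow> (f ^^ k) x \<in> Q"
  shows "Q = carrier M"
proof -
  have "\<forall>x\<in>carrier M. (f ^^ (n - k)) x \<in> Q" if "k \<le> n" for k
    using that
  proof (induction k)
    case (Suc k)
    then have "Suc (n - Suc k) = n - k" by simp
    then show ?case using Suc step[of "n - Suc k"] by auto
  qed (use large in simp)
  from this[of n] have "carrier M \<subseteq> Q" by auto
  then show ?thesis using submoduleE(1)[OF Q] by auto
qed

end

text \<open>For a coefficient list with the leading term first, trailing zeros are a factor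
  \<open>X^n\<close>, and what precedes them has nonzero constant term.\<close>

lemma list_strip_trailing:
  assumes "xs \<noteq> []" "hd xs \<noteq> z"
  shows "\<exists>ys n. xs = ys @ replicate n z \<and> ys \<noteq> [] \<and> last ys \<noteq> z \<and> hd ys = hd xs"
  using assms
proof (induction xs rule: rev_induct)
  case (snoc a xs)
  show ?case
  proof (cases "a = z")
    case True
    then have "xs \<noteq> []" using snoc.prems by auto
    then obtain ys n where "xs = ys @ replicate n z" "ys \<noteq> []" "last ys \<noteq> z" "hd ys = hd xs"
      using snoc by auto
    then show ?thesis using True
      by (intro exI[of _ ys] exI[of _ "Suc n"]) (auto simp: replicate_append_same)
  next
    case False
    then show ?thesis by (intro exI[of _ "xs @ [a]"] exI[of _ 0]) auto
  qed
qed simp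

text \<open>Multiply the relation for \<open>x^n\<close> and \<open>h\<close> by the one for
  \<open>x\<close> and \<open>h\<close>; every term except \<open>A \<otimes> C\<close> is a
  multiple of \<open>h\<close>.\<close>

lemma comaximal_pow:
  assumes S: "cring S" and x: "x \<in> carrier S" and h: "h \<in> carrier S" and co: "comaximal S x h"
  shows "comaximal S (x [^]\<^bsub>S\<^esub> (n::nat)) h"
proof -
  interpret S: cring S by fact
  obtain u' v' where uv': "u' \<in> carrier S" "v' \<in> carrier S" "u' \<otimes>\<^bsub>S\<^esub> x \<oplus>\<^bsub>S\<^esub> v' \<otimes>\<^bsub>S\<^esub> h = \<one>\<^bsub>S\<^esub>"
    using co by (auto simp: comaximal_def)
  show ?thesis
  proof (induction n)
    case 0
    show ?case unfolding comaximal_def using h by (intro bexI[of _ "\<one>\<^bsub>S\<^esub>"] bexI[of _ "\<zero>\<^bsub>S\<^esub>"]) auto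
  next
    case (Suc n)
    then obtain u v where uv: "u \<in> carrier S" "v \<in> carrier S"
      "u \<otimes>\<^bsub>S\<^esub> x [^]\<^bsub>S\<^esub> n \<oplus>\<^bsub>S\<^esub> v \<otimes>\<^bsub>S\<^esub> h = \<one>\<^bsub>S\<^esub>" by (auto simp: comaximal_def)
    define A B C D where "A = u \<otimes>\<^bsub>S\<^esub> x [^]\<^bsub>S\<^esub> n" and "B = v \<otimes>\<^bsub>S\<^esub> h" and "C = u' \<otimes>\<^bsub>S\<^esub> x" and "D = v' \<otimes>\<^bsub>S\<^esub> h"
    have cl: "A \<in> carrier S" "B \<in> carrier S" "C \<in> carrier S" "D \<in> carrier S"
      using x h uv uv' by (auto simp: A_def B_def C_def D_def)
    have "\<one>\<^bsub>S\<^esub> = (A \<oplus>\<^bsub>S\<^esub> B) \<otimes>\<^bsub>S\<^esub> (C \<oplus>\<^bsub>S\<^esub> D)" using uv uv' by (simp add: A_def B_def C_def D_def)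
    also have "\<dots> = A \<otimes>\<^bsub>S\<^esub> (C \<oplus>\<^bsub>S\<^esub> D) \<oplus>\<^bsub>S\<^esub> B"
      using cl uv'(3) by (simp add: S.l_distr C_def[symmetric] D_def[symmetric] del: S.r_distr)
    also have "\<dots> = A \<otimes>\<^bsub>S\<^esub> C \<oplus>\<^bsub>S\<^esub> (A \<otimes>\<^bsub>S\<^esub> D \<oplus>\<^bsub>S\<^esub> B)"
      using cl by (simp add: S.r_distr S.a_assoc)
    also have "A \<otimes>\<^bsub>S\<^esub> C = (u \<otimes>\<^bsub>S\<^esub> u') \<otimes>\<^bsub>S\<^esub> x [^]\<^bsub>S\<^esub> Suc n"
      using uv uv' x by (simp add: A_def C_def S.m_ac)
    also have "A \<otimes>\<^bsub>S\<^esub> D \<oplus>\<^bsub>S\<^esub> B = (A \<otimes>\<^bsub>S\<^esub> v' \<oplus>\<^bsub>S\<^esub> v) \<otimes>\<^bsub>S\<^esub> h"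
      using cl uv uv' h by (simp add: B_def D_def S.m_ac S.l_distr S.r_distr)
    finally show ?case
      unfolding comaximal_def using cl uv uv'
      by (intro bexI[of _ "u \<otimes>\<^bsub>S\<^esub> u'"] bexI[of _ "A \<otimes>\<^bsub>S\<^esub> v' \<oplus>\<^bsub>S\<^esub> v"]) auto
  qed
qed

text \<open>Write \<open>h = h1 X + c\<close> with \<open>c \<noteq> 0\<close>. Then
  \<open>inv c * h - inv c * h1 * X = 1\<close>, so \<open>X\<close> and \<open>h\<close> are
  comaximal, and then so are \<open>X^n\<close> and \<open>h\<close>.\<close>

lemma (in field) comaximal_monom:
  assumes h: "polynomial (carrier R) h" "h \<noteq> []" "last h \<noteq> \<zero>"
  shows "comaximal (univ_poly R (carrier R)) (\<one> # replicate n \<zero>) h"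
proof -
  let ?P = "univ_poly R (carrier R)"
  interpret P: cring ?P by (rule univ_poly_is_cring[OF carrier_is_subring])
  obtain h1 c where h1: "h = h1 @ [c]" using h(2) by (metis append_butlast_last_id)
  have hR: "set h \<subseteq> carrier R" by (rule polynomial_incl[OF h(1)])
  have c: "c \<in> carrier R" "c \<noteq> \<zero>" "c \<in> Units R" using h hR h1 by (auto simp: field_Units)
  have p1: "polynomial (carrier R) h1" using h(1) h1 by (cases h1) (auto simp: polynomial_def)
  have hP: "h \<in> carrier ?P" "h1 \<in> carrier ?P" "[c] \<in> carrier ?P" "[inv c] \<in> carrier ?P"
    using h(1) p1 const_is_polynomial[of c "carrier R"] const_is_polynomial[of "inv c" "carrier R"] c
    by (auto simp: univ_poly_carrier[symmetric] field_Units[symmetric])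
  note X' = var_closed(1)[OF carrier_is_subring]
  have eq: "h = h1 \<otimes>\<^bsub>?P\<^esub> var R \<oplus>\<^bsub>?P\<^esub> [c]"
  proof (cases "h1 = []")
    \<comment> \<open>The empty list is the zero polynomial; its product with \<open>X\<close> is
      again the empty list, not a list with a zero appended.\<close>
    case True
    have "poly_add [] [c] = [c]" using c by simp
    moreover have "h1 \<otimes>\<^bsub>?P\<^esub> var R = []"
      using poly_mult_var[OF carrier_is_subring hP(2)] True by simp
    ultimately show ?thesis
      using True h1 by (simp add: univ_poly_add del: poly_add.simps)
  next
    case False
    have "poly_add (h1 @ [\<zero>]) [c] = normalize (h1 @ [c])"
      using poly_add_append_replicate[of h1 "[c]"] hR h1 by simp
    also have "\<dots> = h" using h1 normalize_polynomial[OF h(1)] by simp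
    finally show ?thesis using False
      by (simp add: poly_mult_var[OF carrier_is_subring hP(2)] univ_poly_add del: poly_add.simps)
  qed
  have one: "[inv c] \<otimes>\<^bsub>?P\<^esub> [c] = \<one>\<^bsub>?P\<^esub>"
    using c const_is_polynomial[of c "carrier R"]
    by (simp add: univ_poly_mult univ_poly_one
        poly_mult_const(1)[OF carrier_is_subring] field_Units[symmetric] del: poly_mult.simps)
  define v where "v = [inv c]"
  have v: "v \<in> carrier ?P" using hP v_def by simp
  have "(\<ominus>\<^bsub>?P\<^esub> (v \<otimes>\<^bsub>?P\<^esub> h1)) \<otimes>\<^bsub>?P\<^esub> var R \<oplus>\<^bsub>?P\<^esub> v \<otimes>\<^bsub>?P\<^esub> h =
      (\<ominus>\<^bsub>?P\<^esub> (v \<otimes>\<^bsub>?P\<^esub> h1)) \<otimes>\<^bsub>?P\<^esub> var R \<oplus>\<^bsub>?P\<^esub> (v \<otimes>\<^bsub>?P\<^esub> h1 \<otimes>\<^bsub>?P\<^esub> var R \<oplus>\<^bsub>?P\<^esub> v \<otimes>\<^bsub>?P\<^esub> [c])"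
    using v hP X' arg_cong[OF eq, of "\<lambda>z. v \<otimes>\<^bsub>?P\<^esub> z"] by (simp add: P.r_distr P.m_assoc)
  also have "\<dots> = v \<otimes>\<^bsub>?P\<^esub> [c]"
    using v hP X' by (simp add: P.l_minus P.a_assoc[symmetric] P.l_neg)
  also have "\<dots> = \<one>\<^bsub>?P\<^esub>" using one v_def by simp
  finally have "comaximal ?P (var R) h"
    unfolding comaximal_def using v hP X'
    by (intro bexI[of _ "\<ominus>\<^bsub>?P\<^esub> (v \<otimes>\<^bsub>?P\<^esub> h1)"] bexI[of _ v]) auto
  from comaximal_pow[OF P.is_cring X' hP(1) this] show ?thesis
    by (simp add: unitary_monom_eq_var_pow[OF carrier_is_subring, symmetric] monom_def)
qed

section \<open>Lifting factorizations from the residue field\<close>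

locale henselian_local_ring = noetherian_local_ring +
  assumes henselian: "henselian R"
begin

abbreviation "\<kappa> \<equiv> residue_field R"

lemma residue_field: "field \<kappa>"
  unfolding residue_field_def by (rule \<mm>.quotient_is_field[OF is_cring])

lemma residue_zero_one: "\<zero>\<^bsub>\<kappa>\<^esub> = \<mm>" "\<one>\<^bsub>\<kappa>\<^esub> = \<mm> +> \<one>"
  by (auto simp: residue_field_def FactRing_def)

lemma residue_closed: "a \<in> carrier R \<Longrightarrow> \<mm> +> a \<in> carrier \<kappa>"
  by (auto simp: residue_field_def FactRing_simps)

lemma residue_zero_iff: "a \<in> carrier R \<Longrightarrow> \<mm> +> a = \<mm> \<longleftrightarrow> a \<in> \<mm>"
  using \<mm>.rcos_const_imp_mem \<mm>.a_rcos_const by blast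

text \<open>Modulo \<open>\<mm>\<close> the polynomial is \<open>X^n * h0\<close> with
  \<open>h0\<close> of nonzero constant term. Lifting gives a monic factor whose lower coefficients
  are all in \<open>\<mm>\<close>, and a second factor whose constant term \<open>c\<close> is a
  unit.\<close>

lemma hensel_factor:
  assumes as: "set as \<subseteq> carrier R"
  obtains gs hs c where "set gs \<subseteq> \<mm>" "set hs \<subseteq> carrier R" "c \<in> Units R"
    "\<one> # as = poly_mult (\<one> # gs) (hs @ [c])"
proof -
  interpret K: field \<kappa> by (rule residue_field)
  let ?kX = "univ_poly \<kappa> (carrier \<kappa>)"
  let ?F = "reduce_poly R (\<one> # as)"
  have one: "\<one>\<^bsub>\<kappa>\<^esub> \<noteq> \<zero>\<^bsub>\<kappa>\<^esub>" by simp
  have F: "?F \<noteq> []" "hd ?F = \<one>\<^bsub>\<kappa>\<^esub>" "set ?F \<subseteq> carrier \<kappa>"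
    using as residue_closed by (auto simp: reduce_poly_def residue_zero_one)
  obtain h0 n where h0: "?F = h0 @ replicate n \<zero>\<^bsub>\<kappa>\<^esub>" "h0 \<noteq> []" "last h0 \<noteq> \<zero>\<^bsub>\<kappa>\<^esub>" "hd h0 = \<one>\<^bsub>\<kappa>\<^esub>"
    using list_strip_trailing[of ?F "\<zero>\<^bsub>\<kappa>\<^esub>"] F one by metis
  have h0p: "polynomial\<^bsub>\<kappa>\<^esub> (carrier \<kappa>) h0"
    using h0 F(3) one by (auto simp: polynomial_def)
  have one_R: "\<one> \<noteq> \<zero>" using \<mm>.one_imp_carrier \<mm>.I_notcarr \<mm>.zero_closed by metis
  have m1: "monic_poly R (\<one> # as)"
    using as one_R by (auto simp: monic_poly_def univ_poly_carrier[symmetric] polynomial_def)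
  have m2: "monic_poly \<kappa> (\<one>\<^bsub>\<kappa>\<^esub> # replicate n \<zero>\<^bsub>\<kappa>\<^esub>)"
    using one
    by (auto simp: monic_poly_def univ_poly_carrier[symmetric] polynomial_def)
  have m3: "monic_poly \<kappa> h0"
    using h0p h0 by (auto simp: monic_poly_def univ_poly_carrier[symmetric])
  have co: "comaximal ?kX (\<one>\<^bsub>\<kappa>\<^esub> # replicate n \<zero>\<^bsub>\<kappa>\<^esub>) h0"
    by (rule K.comaximal_monom[OF h0p h0(2,3)])
  have "?F = (\<one>\<^bsub>\<kappa>\<^esub> # replicate n \<zero>\<^bsub>\<kappa>\<^esub>) \<otimes>\<^bsub>?kX\<^esub> h0"
    using K.poly_mult_monom[OF h0p, of "\<one>\<^bsub>\<kappa>\<^esub>" n] h0 K.poly_mult_one(1)[OF K.carrier_is_subring h0p]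
    by (simp add: univ_poly_mult K.monom_def del: K.poly_mult.simps)
  then obtain g h where gh: "monic_poly R g" "monic_poly R h"
    "\<one> # as = g \<otimes>\<^bsub>univ_poly R (carrier R)\<^esub> h" "reduce_poly R g = \<one>\<^bsub>\<kappa>\<^esub> # replicate n \<zero>\<^bsub>\<kappa>\<^esub>" "reduce_poly R h = h0"
    using henselian m1 m2 m3 co unfolding henselian_def Let_def by blast
  have gR: "set g \<subseteq> carrier R" "g \<noteq> []" "hd g = \<one>" and hR: "set h \<subseteq> carrier R" "h \<noteq> []"
    using gh(1,2) by (auto simp: monic_poly_def univ_poly_carrier[symmetric] polynomial_def)
  obtain gs where gs: "g = \<one> # gs" using gR by (metis list.collapse)
  obtain hs c where hs: "h = hs @ [c]" using hR(2) by (metis append_butlast_last_id)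
  have "map ((+>) \<mm>) gs = replicate n \<zero>\<^bsub>\<kappa>\<^esub>"
    using gh(4) gs by (simp add: reduce_poly_def)
  then have "\<forall>a\<in>set gs. \<mm> +> a = \<mm>"
    by (metis (no_types, lifting) imageI in_set_replicate list.set_map residue_zero_one(1))
  then have "a \<in> \<mm>" if "a \<in> set gs" for a
    using residue_zero_iff[of a] gR(1) gs that by (metis list.set_intros(2) subsetD)
  then have "set gs \<subseteq> \<mm>" by blast
  moreover have "c \<in> Units R"
  proof -
    have c: "c \<in> carrier R" using hR hs by auto
    have "last (reduce_poly R h) = \<mm> +> c" by (simp add: reduce_poly_def hs)
    then have "\<mm> +> c \<noteq> \<mm>" using h0(3) unfolding gh(5) residue_zero_one(1) by metis
    then show ?thesis using residue_zero_iff[OF c] max_ideal_iff_nonunit[OF c] by auto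
  qed
  moreover have "\<one> # as = poly_mult (\<one> # gs) (hs @ [c])"
    using gh(3) gs hs by (simp add: univ_poly_mult del: poly_mult.simps)
  ultimately show ?thesis using that hR hs by auto
qed

text \<open>The factorization \<open>\<chi> = g h\<close> of a polynomial annihilating \<open>f\<close>, with \<open>g \<equiv> X ^ a\<close> and \<open>h(0)\<close> a unit,
  splits \<open>M\<close> as \<open>g(f) M \<oplus> h(f) M\<close>, the parts where \<open>f\<close> is topologically nilpotent and bijective.\<close>

lemma indecomposable_endo_local:
  assumes M: "fg_module R M" and indec: "indecomposable R M" and f: "f \<in> module_hom R M M"
  shows "bij_betw f (carrier M) (carrier M) \<or> bij_betw (\<lambda>x. x \<ominus>\<^bsub>M\<^esub> f x) (carrier M) (carrier M)"
proof -
  note M' = fg_module_is_module[OF M]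
  interpret module_endo R M f using M' f by (simp add: module_endo_def module_endo_axioms_def)
  obtain as where as: "set as \<subseteq> carrier R" "\<And>x. x \<in> carrier M \<Longrightarrow> poly_act M f (\<one> # as) x = \<zero>\<^bsub>M\<^esub>"
    using monic_annihilator[OF noetherian_ring_axioms M] by blast
  obtain gs hs c where gs: "set gs \<subseteq> \<mm>" and hs: "set hs \<subseteq> carrier R" and c: "c \<in> Units R"
    and eq: "\<one> # as = poly_mult (\<one> # gs) (hs @ [c])" using hensel_factor[OF as(1)] by blast
  have cR: "c \<in> carrier R" using c by (rule Units_closed)
  define g h where "g = poly_act M f (\<one> # gs)" and "h = poly_act M f (hs @ [c])"
  have gsR: "set gs \<subseteq> carrier R" using gs \<mm>.a_Hcarr by auto
  have gR: "set (\<one> # gs) \<subseteq> carrier R" "set (hs @ [c]) \<subseteq> carrier R" using gsR hs cR by auto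
  have g: "g \<in> module_hom R M M" and h: "h \<in> module_hom R M M"
    unfolding g_def h_def using gR by (auto intro!: poly_act_hom simp del: poly_act.simps)
  note gcl = module_hom_closed[OF g] and hcl = module_hom_closed[OF h]
  have gh: "g (h x) = \<zero>\<^bsub>M\<^esub>" if "x \<in> carrier M" for x
    using poly_act_mult[OF gR that] as(2)[OF that] unfolding g_def h_def eq by simp
  have hg: "h (g x) = \<zero>\<^bsub>M\<^esub>" if "x \<in> carrier M" for x
    using gh[OF that] poly_act_commute[OF gR that] unfolding g_def h_def by simp
  define a where "a = length gs"
  have g_eq: "g x = (f ^^ a) x \<oplus>\<^bsub>M\<^esub> poly_act M f gs x" if "x \<in> carrier M" for x
    using that by (simp add: g_def a_def)
  have h_eq: "h ((f ^^ k) x) = (f ^^ Suc k) (poly_act M f hs x) \<oplus>\<^bsub>M\<^esub> c \<odot>\<^bsub>M\<^esub> (f ^^ k) x"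
    if "x \<in> carrier M" for k x
    unfolding h_def poly_act_snoc[OF hs cR funpow_closed[OF that]] poly_act_funpow[OF hs that] by simp
  have low: "poly_act M f gs x \<in> Q"
    if "submodule Q R M" "\<And>r x. \<lbrakk>r \<in> \<mm>; x \<in> carrier M\<rbrakk> \<Longrightarrow> r \<odot>\<^bsub>M\<^esub> x \<in> Q" "x \<in> carrier M" for Q x
    using that gs by (intro poly_act_in_submodule) auto
  have carr: "submodule (carrier M) R M" by (rule carrier_is_submodule)
  define N1 N2 where "N1 = g ` carrier M" and "N2 = h ` carrier M"
  have N: "submodule N1 R M" "submodule N2 R M"
    unfolding N1_def N2_def by (rule submodule_image[OF M' M' g carr], rule submodule_image[OF M' M' h carr])
  define S where "S = {x \<oplus>\<^bsub>M\<^esub> y | x y. x \<in> N1 \<and> y \<in> N2}"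
  have N_sub: "\<And>x. x \<in> N1 \<Longrightarrow> x \<in> carrier M" "\<And>x. x \<in> N2 \<Longrightarrow> x \<in> carrier M"
    using submoduleE(1)[OF N(1)] submoduleE(1)[OF N(2)] by auto
  have S: "submodule S R M"
  proof (rule submoduleI)
    show "S \<subseteq> carrier M" using N_sub by (auto simp: S_def)
    show "\<zero>\<^bsub>M\<^esub> \<in> S" unfolding S_def using submodule_zero_mem[OF N(1)] submodule_zero_mem[OF N(2)]
      by (intro CollectI exI[of _ "\<zero>\<^bsub>M\<^esub>"]) auto
    fix u assume "u \<in> S"
    then obtain x y where xy: "u = x \<oplus>\<^bsub>M\<^esub> y" "x \<in> N1" "y \<in> N2" by (auto simp: S_def)
    have "\<ominus>\<^bsub>M\<^esub> u = \<ominus>\<^bsub>M\<^esub> x \<oplus>\<^bsub>M\<^esub> \<ominus>\<^bsub>M\<^esub> y" using xy N_sub by (simp add: M.minus_add)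
    then show "\<ominus>\<^bsub>M\<^esub> u \<in> S" using submoduleE(3)[OF N(1)] submoduleE(3)[OF N(2)] xy unfolding S_def by blast
    show "r \<odot>\<^bsub>M\<^esub> u \<in> S" if "r \<in> carrier R" for r
    proof -
      have "r \<odot>\<^bsub>M\<^esub> u = r \<odot>\<^bsub>M\<^esub> x \<oplus>\<^bsub>M\<^esub> r \<odot>\<^bsub>M\<^esub> y" using xy N_sub that by (simp add: smult_r_distr)
      then show ?thesis using submoduleE(4)[OF N(1) that] submoduleE(4)[OF N(2) that] xy unfolding S_def by blast
    qed
    fix v assume "v \<in> S"
    then obtain x' y' where xy': "v = x' \<oplus>\<^bsub>M\<^esub> y'" "x' \<in> N1" "y' \<in> N2" by (auto simp: S_def)
    have "u \<oplus>\<^bsub>M\<^esub> v = (x \<oplus>\<^bsub>M\<^esub> x') \<oplus>\<^bsub>M\<^esub> (y \<oplus>\<^bsub>M\<^esub> y')" using xy xy' N_sub by (simp add: M.a_ac)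
    then show "u \<oplus>\<^bsub>M\<^esub> v \<in> S" using submoduleE(5)[OF N(1)] submoduleE(5)[OF N(2)] xy xy' unfolding S_def by blast
  qed
  have NS: "N1 \<subseteq> S" "N2 \<subseteq> S"
  proof -
    have "x = x \<oplus>\<^bsub>M\<^esub> \<zero>\<^bsub>M\<^esub>" if "x \<in> N1" for x using N_sub that by simp
    then show "N1 \<subseteq> S" unfolding S_def using submodule_zero_mem[OF N(2)] by blast
    have "x = \<zero>\<^bsub>M\<^esub> \<oplus>\<^bsub>M\<^esub> x" if "x \<in> N2" for x using N_sub that by simp
    then show "N2 \<subseteq> S" unfolding S_def using submodule_zero_mem[OF N(1)] by blast
  qed
  \<comment> \<open>Modulo \<open>g(f) M + h(f) M\<close> and \<open>\<mm> M\<close>, the power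
    \<open>f^a\<close> vanishes because \<open>g\<close> is congruent to \<open>X^a\<close>. Since
    the constant term of \<open>h\<close> is a unit, vanishing of \<open>f^(k+1)\<close> forces that
    of \<open>f^k\<close>.\<close>
  have "S = carrier M"
  proof (rule nakayama[OF M S])
    fix Q assume Q: "submodule Q R M" "S \<subseteq> Q" "\<And>r x. \<lbrakk>r \<in> \<mm>; x \<in> carrier M\<rbrakk> \<Longrightarrow> r \<odot>\<^bsub>M\<^esub> x \<in> Q"
    show "Q = carrier M"
    proof (rule submodule_descent[OF Q(1)])
      fix x assume x: "x \<in> carrier M"
      have l: "poly_act M f gs x \<in> Q" by (rule low[OF Q(1,3) x])
      have "g x \<in> Q" using NS(1) Q(2) x by (auto simp: N1_def)
      from submodule_minus_closed[OF Q(1) this l] show "(f ^^ a) x \<in> Q"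
        using x gsR by (simp add: g_eq a_minus_def M.a_assoc M.r_neg)
    next
      fix k x assume up: "\<And>y. y \<in> carrier M \<Longrightarrow> (f ^^ Suc k) y \<in> Q" and x: "x \<in> carrier M"
      have fx: "(f ^^ k) x \<in> carrier M" using x by simp
      have "h ((f ^^ k) x) \<in> Q" using NS(2) Q(2) fx by (auto simp: N2_def)
      moreover have "(f ^^ Suc k) (poly_act M f hs x) \<in> Q" using up hs x poly_act_closed by blast
      ultimately have "h ((f ^^ k) x) \<ominus>\<^bsub>M\<^esub> (f ^^ Suc k) (poly_act M f hs x) \<in> Q"
        by (rule submodule_minus_closed[OF Q(1)])
      moreover have "h ((f ^^ k) x) \<ominus>\<^bsub>M\<^esub> (f ^^ Suc k) (poly_act M f hs x) = c \<odot>\<^bsub>M\<^esub> (f ^^ k) x"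
        unfolding h_eq[OF x] using fx cR funpow_closed[of "poly_act M f hs x" "Suc k"] hs x
        by (simp add: a_minus_def M.a_ac M.r_neg M.a_lcomm del: funpow.simps)
      ultimately show "(f ^^ k) x \<in> Q" using unit_smult_mem[OF Q(1) c fx] by simp
    qed
  qed
  then have sum: "\<exists>u\<in>N1. \<exists>v\<in>N2. x = u \<oplus>\<^bsub>M\<^esub> v" if "x \<in> carrier M" for x
    using that unfolding S_def by blast
  \<comment> \<open>As \<open>g h = 0\<close>, the map \<open>g\<close> kills \<open>N2\<close>, so
    its image of \<open>M = N1 + N2\<close> is already its image of \<open>N1\<close>. A surjective
    endomorphism of the finitely generated module \<open>N1\<close> is injective, hence
    \<open>N1\<close> meets \<open>N2\<close> only in zero.\<close>
  have gN1: "g ` N1 = N1"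
  proof
    show "g ` N1 \<subseteq> N1" using N_sub by (auto simp: N1_def)
    show "N1 \<subseteq> g ` N1"
    proof
      fix y assume "y \<in> N1"
      then obtain x where x: "x \<in> carrier M" "y = g x" by (auto simp: N1_def)
      obtain u v where uv: "u \<in> N1" "v \<in> N2" "x = u \<oplus>\<^bsub>M\<^esub> v" using sum[OF x(1)] by blast
      have "g v = \<zero>\<^bsub>M\<^esub>" using uv(2) gh by (auto simp: N2_def)
      then have "y = g u" using x uv N_sub gcl by (simp add: module_hom_add[OF g])
      then show "y \<in> g ` N1" using uv by blast
    qed
  qed
  have inj: "inj_on g N1"
  proof -
    have "fg_module R (M\<lparr>carrier := N1\<rparr>)"
    proof (rule fg_module_image(1)[OF M submodule.submodule_is_module[OF N(1) M']])
      show "g \<in> module_hom R M (M\<lparr>carrier := N1\<rparr>)"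
        using module_homE[OF g] by (intro module_homI) (auto simp: N1_def)
    qed (simp add: N1_def)
    moreover have "g \<in> module_hom R (M\<lparr>carrier := N1\<rparr>) (M\<lparr>carrier := N1\<rparr>)"
      using module_homE[OF g] N_sub by (intro module_homI) (auto simp: N1_def)
    ultimately show ?thesis
      using noetherian_surj_endo_inj[OF noetherian_ring_axioms, of "M\<lparr>carrier := N1\<rparr>" g] gN1 by simp
  qed
  have "N1 \<inter> N2 \<subseteq> {\<zero>\<^bsub>M\<^esub>}"
  proof
    fix x assume x: "x \<in> N1 \<inter> N2"
    then have "g x = \<zero>\<^bsub>M\<^esub>" using gh by (auto simp: N2_def)
    then have "g x = g \<zero>\<^bsub>M\<^esub>" using module_hom_zero[OF M' M' g] by simp
    then show "x \<in> {\<zero>\<^bsub>M\<^esub>}" using inj x submodule_zero_mem[OF N(1)] by (auto dest: inj_onD)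
  qed
  from internal_direct_sum[OF M' N sum this]
  have iso: "module_isomorphic R M (direct_sum (M\<lparr>carrier := N1\<rparr>) (M\<lparr>carrier := N2\<rparr>))" .
  have mods: "module R (M\<lparr>carrier := N1\<rparr>)" "module R (M\<lparr>carrier := N2\<rparr>)"
    using submodule.submodule_is_module[OF N(1) M'] submodule.submodule_is_module[OF N(2) M'] by auto
  obtain i j p q where "biproduct R M (M\<lparr>carrier := N1\<rparr>) (M\<lparr>carrier := N2\<rparr>) i j p q"
    by (rule isomorphic_imp_biproduct[OF iso M' mods])
  from biproduct_fg_summand[OF this M mods]
  have "zero_module (M\<lparr>carrier := N1\<rparr>) \<or> zero_module (M\<lparr>carrier := N2\<rparr>)"
    using indec iso unfolding indecomposable_def fg_modules_def by blast
  then consider "N1 = {\<zero>\<^bsub>M\<^esub>}" | "N2 = {\<zero>\<^bsub>M\<^esub>}" by (auto simp: zero_module_def)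
  then show ?thesis
  proof cases
    case 1
    \<comment> \<open>Now \<open>g(f) = 0\<close>, so \<open>f^a\<close> maps \<open>M\<close> into
      \<open>\<mm> M\<close>. Modulo the image of \<open>1 - f\<close> all powers of
      \<open>f\<close> agree with the identity, so Nakayama's lemma makes \<open>1 - f\<close>
      surjective.\<close>
    have e: "(\<lambda>x. x \<ominus>\<^bsub>M\<^esub> f x) \<in> module_hom R M M"
      by (rule module_hom_minus_hom[OF M' M' module_hom_id(2) f])
    have fcl: "\<And>x. x \<in> carrier M \<Longrightarrow> f x \<in> carrier M" by (rule module_hom_closed[OF f])
    have "(\<lambda>x. x \<ominus>\<^bsub>M\<^esub> f x) ` carrier M = carrier M"
    proof (rule nakayama[OF M submodule_image[OF M' M' e carr]])
      fix Q assume Q: "submodule Q R M" "(\<lambda>x. x \<ominus>\<^bsub>M\<^esub> f x) ` carrier M \<subseteq> Q"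
        "\<And>r x. \<lbrakk>r \<in> \<mm>; x \<in> carrier M\<rbrakk> \<Longrightarrow> r \<odot>\<^bsub>M\<^esub> x \<in> Q"
      show "Q = carrier M"
      proof (rule submodule_descent[OF Q(1)])
        fix x assume x: "x \<in> carrier M"
        have "\<ominus>\<^bsub>M\<^esub> poly_act M f gs x \<in> Q" by (rule submoduleE(3)[OF Q(1) low[OF Q(1,3) x]])
        moreover have "g x = \<zero>\<^bsub>M\<^esub>" using 1 x by (auto simp: N1_def)
        then have "(f ^^ a) x = \<ominus>\<^bsub>M\<^esub> poly_act M f gs x"
          using g_eq[OF x] x gsR by (simp add: M.minus_equality)
        ultimately show "(f ^^ a) x \<in> Q" by simp
      next
        fix k x assume up: "\<And>y. y \<in> carrier M \<Longrightarrow> (f ^^ Suc k) y \<in> Q" and x: "x \<in> carrier M"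
        have "(f ^^ k) x \<ominus>\<^bsub>M\<^esub> f ((f ^^ k) x) \<in> Q" using Q(2) x by auto
        from submoduleE(5)[OF Q(1) this up[OF x]] show "(f ^^ k) x \<in> Q"
          using x fcl by (simp add: a_minus_def M.a_assoc M.l_neg)
      qed
    qed
    then show ?thesis using noetherian_surj_endo_bij[OF noetherian_ring_axioms M e] by blast
  next
    case 2
    \<comment> \<open>Now \<open>h(f) = 0\<close>, which writes \<open>c x\<close> as
      \<open>- f y\<close> with \<open>y\<close> a polynomial in \<open>f\<close> applied to
      \<open>x\<close>; since \<open>c\<close> is a unit, \<open>x\<close> is in the image of
      \<open>f\<close>.\<close>
    have "f ` carrier M = carrier M"
    proof
      show "f ` carrier M \<subseteq> carrier M" using module_hom_closed[OF f] by auto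
      have fS: "submodule (f ` carrier M) R M" by (rule submodule_image[OF M' M' f carr])
      show "carrier M \<subseteq> f ` carrier M"
      proof
        fix x assume x: "x \<in> carrier M"
        let ?y = "poly_act M f hs x"
        have y: "?y \<in> carrier M" "f ?y \<in> carrier M" using hs x module_hom_closed[OF f] by auto
        have "h x = \<zero>\<^bsub>M\<^esub>" using 2 x by (auto simp: N2_def)
        then have "c \<odot>\<^bsub>M\<^esub> x = \<ominus>\<^bsub>M\<^esub> f ?y"
          using h_eq[OF x, of 0] y x cR by (simp add: M.minus_equality M.a_comm)
        also have "\<dots> \<in> f ` carrier M" using y by (intro submoduleE(3)[OF fS]) auto
        finally show "x \<in> f ` carrier M" by (rule unit_smult_mem[OF fS c x])
      qed
    qed
    then show ?thesis using noetherian_surj_endo_bij[OF noetherian_ring_axioms M f] by blast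
  qed
qed

end

section \<open>Transport to lists\<close>

lemma module_transport:
  fixes M :: "('a, 'b, 'm) module_scheme" and g :: "'b \<Rightarrow> 'c"
  assumes M: "module R M" and inj: "inj_on g (carrier M)"
  shows "\<exists>M' :: ('a, 'c) module. module R M' \<and> module_isomorphic R M M'"
proof -
  interpret M: module R M by fact
  define h where "h = inv_into (carrier M) g"
  have hg [simp]: "\<And>x. x \<in> carrier M \<Longrightarrow> h (g x) = x" using inj by (simp add: h_def)
  define M' :: "('a, 'c) module" where
    "M' = \<lparr>carrier = g ` carrier M, monoid.mult = undefined, monoid.one = undefined,
      ring.zero = g \<zero>\<^bsub>M\<^esub>, ring.add = (\<lambda>u v. g (h u \<oplus>\<^bsub>M\<^esub> h v)), smult = (\<lambda>r u. g (r \<odot>\<^bsub>M\<^esub> h u))\<rparr>"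
  have simps [simp]: "carrier M' = g ` carrier M" "\<zero>\<^bsub>M'\<^esub> = g \<zero>\<^bsub>M\<^esub>"
    "\<And>u v. u \<oplus>\<^bsub>M'\<^esub> v = g (h u \<oplus>\<^bsub>M\<^esub> h v)" "\<And>r u. r \<odot>\<^bsub>M'\<^esub> u = g (r \<odot>\<^bsub>M\<^esub> h u)"
    by (auto simp: M'_def)
  have "module R M'"
  proof (intro moduleI M.R.is_cring abelian_groupI)
    fix x assume "x \<in> carrier M'"
    then obtain y where y: "y \<in> carrier M" "x = g y" by auto
    then show "\<exists>z\<in>carrier M'. z \<oplus>\<^bsub>M'\<^esub> x = \<zero>\<^bsub>M'\<^esub>"
      by (intro bexI[of _ "g (\<ominus>\<^bsub>M\<^esub> y)"]) (auto simp: M.M.l_neg)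
  qed (auto simp: M.M.a_ac M.smult_l_distr M.smult_r_distr M.smult_assoc1)
  moreover have "g \<in> module_hom R M M'" by (intro module_homI) auto
  then have "module_isomorphic R M M'"
    using inj by (auto simp: module_isomorphic_def bij_betw_def)
  ultimately show ?thesis by blast
qed

fun lincomb :: "('a, 'b, 'm) module_scheme \<Rightarrow> 'a list \<Rightarrow> 'b list \<Rightarrow> 'b"
  where
    "lincomb M (r # rs) (c # cs) = r \<odot>\<^bsub>M\<^esub> c \<oplus>\<^bsub>M\<^esub> lincomb M rs cs"
  | "lincomb M _ _ = \<zero>\<^bsub>M\<^esub>"

lemma adjoin_zero_lincomb:
  "y \<in> adjoin R M {\<zero>\<^bsub>M\<^esub>} cs \<Longrightarrow> \<exists>rs. set rs \<subseteq> carrier R \<and> length rs = length cs \<and> y = lincomb M rs cs"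
proof (induction cs arbitrary: y)
  case (Cons c cs)
  then obtain r x where rx: "r \<in> carrier R" "x \<in> adjoin R M {\<zero>\<^bsub>M\<^esub>} cs" "y = r \<odot>\<^bsub>M\<^esub> c \<oplus>\<^bsub>M\<^esub> x" by auto
  from Cons.IH[OF rx(2)] obtain rs
    where "set rs \<subseteq> carrier R" "length rs = length cs" "x = lincomb M rs cs" by auto
  then show ?case using rx by (intro exI[of _ "r # rs"]) auto
qed auto

lemma ex_fg_modules_isomorphic:
  assumes "fg_module R M"
  shows "\<exists>M'. M' \<in> fg_modules R \<and> module_isomorphic R M M'"
proof -
  obtain cs where cs: "set cs \<subseteq> carrier M" "adjoin R M {\<zero>\<^bsub>M\<^esub>} cs = carrier M"
    using assms by (auto simp: fg_module_iff)
  define g where "g x = (SOME rs. x = lincomb M rs cs)" for x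
  have "x = lincomb M (g x) cs" if x: "x \<in> carrier M" for x
  proof -
    have "\<exists>rs. x = lincomb M rs cs" using adjoin_zero_lincomb[of x R M cs] x cs(2) by blast
    then show ?thesis unfolding g_def by (rule someI_ex)
  qed
  then have "inj_on g (carrier M)" by (metis inj_onI)
  from module_transport[OF fg_module_is_module[OF assms] this]
  obtain M' :: "('a, 'a list) module" where M': "module R M'" "module_isomorphic R M M'" by blast
  then show ?thesis using fg_module_isomorphic[OF M'(2) assms M'(1)] by (auto simp: fg_modules_def)
qed

lemma module_copy:
  assumes "fg_module R M"
  shows module_copy_mem: "module_copy R M \<in> fg_modules R"
    and module_copy_isomorphic: "module_isomorphic R M (module_copy R M)"
  using someI_ex[OF ex_fg_modules_isomorphic[OF assms]] by (auto simp: module_copy_def)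

lemma fg_modulesD: "M \<in> fg_modules R \<Longrightarrow> fg_module R M" "M \<in> fg_modules R \<Longrightarrow> module R M"
  by (auto simp: fg_modules_def fg_module_is_module)

lemma (in abelian_group) add_minus_cancel_left:
  "\<lbrakk>x \<in> carrier G; y \<in> carrier G\<rbrakk> \<Longrightarrow> (x \<oplus> y) \<ominus> x = y"
  by (simp add: a_minus_def a_comm[of x y] a_assoc r_neg)

section \<open>Cancellation and exchange for modules with local endomorphism ring\<close>

text \<open>For nonzero \<open>W\<close> this says that the endomorphism ring is local. The
  alternative between \<open>f\<close> and \<open>1 - f\<close> is the form in which locality is
  applied, both for cancellation and for exchange.\<close>

definition local_endo :: "('a, 'r) ring_scheme \<Rightarrow> ('a, 'b, 'm) module_scheme \<Rightarrow> bool"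
  where "local_endo R W \<longleftrightarrow> (\<forall>f\<in>module_hom R W W.
    bij_betw f (carrier W) (carrier W) \<or> bij_betw (\<lambda>x. x \<ominus>\<^bsub>W\<^esub> f x) (carrier W) (carrier W))"

text \<open>The hypothesis makes the image of \<open>i1\<close> a complement of the image of
  \<open>j2\<close>, which is the kernel of \<open>q1\<close>. So both \<open>N\<close> and
  \<open>M\<close> are isomorphic to the quotient of \<open>U\<close> by that copy of
  \<open>W\<close>.\<close>

lemma biproduct_complement_isomorphic:
  assumes U: "module R U" and W: "module R W" and M: "module R M" and N: "module R N"
    and bip1: "biproduct R U W M i1 i2 p1 p2" and bip2: "biproduct R U W N j1 j2 q1 q2"
    and bij: "bij_betw (\<lambda>w. q1 (i1 w)) (carrier W) (carrier W)"
  shows "module_isomorphic R N M"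
proof -
  interpret U: module R U by fact
  interpret W: module R W by fact
  interpret M: module R M by fact
  interpret N: module R N by fact
  note b1 = biproductD[OF bip1] and b2 = biproductD[OF bip2]
  note cl = b1(1-4)[THEN module_hom_closed] b2(1-4)[THEN module_hom_closed]
  have f: "(\<lambda>n. p2 (j2 n)) \<in> module_hom R N M" by (rule module_hom_compose[OF b2(2) b1(4)])
  have "bij_betw (\<lambda>n. p2 (j2 n)) (carrier N) (carrier M)"
    unfolding bij_betw_def
  proof
    show "inj_on (\<lambda>n. p2 (j2 n)) (carrier N)"
    proof (rule module_hom_inj_on[OF N M f])
      fix n assume n: "n \<in> carrier N" "p2 (j2 n) = \<zero>\<^bsub>M\<^esub>"
      define w where "w = p1 (j2 n)"
      have w: "w \<in> carrier W" using n cl by (simp add: w_def)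
      have "j2 n = i1 w \<oplus>\<^bsub>U\<^esub> i2 (p2 (j2 n))" using b1(9)[of "j2 n"] n cl by (simp add: w_def)
      then have jn: "j2 n = i1 w" using n(2) w cl module_hom_zero[OF M U b1(2)] by simp
      then have "q1 (i1 w) = q1 (i1 \<zero>\<^bsub>W\<^esub>)"
        using b2(8)[OF n(1)] module_hom_zero[OF W U b1(1)] module_hom_zero[OF U W b2(3)] by simp
      then have "w = \<zero>\<^bsub>W\<^esub>" using bij w by (auto simp: bij_betw_def dest: inj_onD)
      then have "j2 n = \<zero>\<^bsub>U\<^esub>" using jn module_hom_zero[OF W U b1(1)] by simp
      then show "n = \<zero>\<^bsub>N\<^esub>" using b2(7)[OF n(1)] module_hom_zero[OF U N b2(4)] by simp
    qed
    show "(\<lambda>n. p2 (j2 n)) ` carrier N = carrier M"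
    proof
      show "(\<lambda>n. p2 (j2 n)) ` carrier N \<subseteq> carrier M" using cl by auto
      show "carrier M \<subseteq> (\<lambda>n. p2 (j2 n)) ` carrier N"
      proof
        fix m assume m: "m \<in> carrier M"
        obtain w where w: "w \<in> carrier W" "q1 (i1 w) = q1 (i2 m)"
          using bij m cl by (metis bij_betw_def imageE)
        define x where "x = i2 m \<ominus>\<^bsub>U\<^esub> i1 w"
        have x: "x \<in> carrier U" using m w cl by (simp add: x_def)
        have "q1 x = \<zero>\<^bsub>W\<^esub>" using m w cl
          by (simp add: x_def module_hom_minus[OF U W b2(3)]) (simp add: a_minus_def W.M.r_neg)
        then have "x = j2 (q2 x)" using b2(9)[OF x] x cl module_hom_zero[OF W U b2(1)] by simp
        moreover have "p2 x = m" using m w cl b1(6,7)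
          by (simp add: x_def module_hom_minus[OF U M b1(4)]) (simp add: a_minus_def)
        ultimately show "m \<in> (\<lambda>n. p2 (j2 n)) ` carrier N" using x cl by (metis image_eqI)
      qed
    qed
  qed
  then show ?thesis using f by (auto simp: module_isomorphic_def)
qed

text \<open>The embedded copy of \<open>W\<close> is kept, and the complement \<open>N\<close> is
  replaced by the graph of \<open>- c\<close>. This alters the projection to \<open>W\<close>, and
  hence the composite tested in \<open>biproduct_complement_isomorphic\<close>.\<close>

lemma biproduct_shear:
  assumes U: "module R U" and W: "module R W" and N: "module R N"
    and bip: "biproduct R U W N j1 j2 q1 q2" and c: "c \<in> module_hom R N W"
  shows "biproduct R U W N j1 (\<lambda>n. j2 n \<ominus>\<^bsub>U\<^esub> j1 (c n)) (\<lambda>x. q1 x \<oplus>\<^bsub>W\<^esub> c (q2 x)) q2"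
proof -
  interpret U: module R U by fact
  interpret W: module R W by fact
  interpret N: module R N by fact
  note b = biproductD[OF bip]
  note cl = b(1-4)[THEN module_hom_closed] c[THEN module_hom_closed]
  show ?thesis
    unfolding biproduct_def
  proof (intro conjI ballI b(1,4))
    show "(\<lambda>n. j2 n \<ominus>\<^bsub>U\<^esub> j1 (c n)) \<in> module_hom R N U"
      by (intro module_hom_minus_hom N U b(2) module_hom_compose[OF c b(1)])
    show "(\<lambda>x. q1 x \<oplus>\<^bsub>W\<^esub> c (q2 x)) \<in> module_hom R U W"
      by (intro module_hom_plus_hom W U b(3) module_hom_compose[OF b(4) c])
    show "q1 (j1 a) \<oplus>\<^bsub>W\<^esub> c (q2 (j1 a)) = a" "q2 (j1 a) = \<zero>\<^bsub>N\<^esub>" if "a \<in> carrier W" for a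
      using that b(5,6) module_hom_zero[OF N W c] by auto
    fix n assume n: "n \<in> carrier N"
    have q: "q1 (j2 n \<ominus>\<^bsub>U\<^esub> j1 (c n)) = \<ominus>\<^bsub>W\<^esub> c n" "q2 (j2 n \<ominus>\<^bsub>U\<^esub> j1 (c n)) = n"
      using n cl b(5-8)
      by (simp_all add: module_hom_minus[OF U W b(3)] module_hom_minus[OF U N b(4)])
        (simp_all add: a_minus_def)
    then show "q2 (j2 n \<ominus>\<^bsub>U\<^esub> j1 (c n)) = n"
      "q1 (j2 n \<ominus>\<^bsub>U\<^esub> j1 (c n)) \<oplus>\<^bsub>W\<^esub> c (q2 (j2 n \<ominus>\<^bsub>U\<^esub> j1 (c n))) = \<zero>\<^bsub>W\<^esub>"
      using n cl by (simp_all add: W.M.l_neg)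
  next
    fix x assume x: "x \<in> carrier U"
    have "j1 (q1 x \<oplus>\<^bsub>W\<^esub> c (q2 x)) \<oplus>\<^bsub>U\<^esub> (j2 (q2 x) \<ominus>\<^bsub>U\<^esub> j1 (c (q2 x))) =
        (j1 (q1 x) \<oplus>\<^bsub>U\<^esub> j2 (q2 x)) \<oplus>\<^bsub>U\<^esub> (j1 (c (q2 x)) \<oplus>\<^bsub>U\<^esub> \<ominus>\<^bsub>U\<^esub> j1 (c (q2 x)))"
      using x cl by (simp add: module_hom_add[OF b(1)] a_minus_def U.M.a_ac)
    also have "\<dots> = x" using x cl b(9)[OF x] by (simp add: U.M.r_neg)
    finally show "j1 (q1 x \<oplus>\<^bsub>W\<^esub> c (q2 x)) \<oplus>\<^bsub>U\<^esub> (j2 (q2 x) \<ominus>\<^bsub>U\<^esub> j1 (c (q2 x))) = x" .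
  qed
qed

text \<open>Let \<open>a\<close> and \<open>b\<close> be the maps from \<open>W\<close> to itself
  that compare the two embeddings of \<open>W\<close>. If \<open>b a\<close> is bijective, so is
  \<open>a\<close>, and the complements are isomorphic. Otherwise \<open>1 - b a\<close> is
  bijective, and a shear of the second decomposition turns the composite into the identity.\<close>

lemma local_endo_cancel:
  assumes R: "noetherian_ring R" and W: "fg_module R W" "local_endo R W"
    and U: "module R U" and M: "module R M" and N: "module R N"
    and iso: "module_isomorphic R U (direct_sum W M)" "module_isomorphic R U (direct_sum W N)"
  shows "module_isomorphic R M N"
proof -
  note W' = fg_module_is_module[OF W(1)]
  interpret U: module R U by fact
  interpret W: module R W by fact
  obtain i1 i2 p1 p2 where bip1: "biproduct R U W M i1 i2 p1 p2"
    by (rule isomorphic_imp_biproduct[OF iso(1) U W' M])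
  obtain j1 j2 q1 q2 where bip2: "biproduct R U W N j1 j2 q1 q2"
    by (rule isomorphic_imp_biproduct[OF iso(2) U W' N])
  note b1 = biproductD[OF bip1] and b2 = biproductD[OF bip2]
  note cl = b1(1-4)[THEN module_hom_closed] b2(1-4)[THEN module_hom_closed]
  define a where "a = (\<lambda>w. q1 (i1 w))"
  define b where "b = (\<lambda>w. p1 (j1 w))"
  have a: "a \<in> module_hom R W W" unfolding a_def by (rule module_hom_compose[OF b1(1) b2(3)])
  have b: "b \<in> module_hom R W W" unfolding b_def by (rule module_hom_compose[OF b2(1) b1(3)])
  have ba: "(\<lambda>w. b (a w)) \<in> module_hom R W W" by (rule module_hom_compose[OF a b])
  have "module_isomorphic R N M"
  proof (cases "bij_betw (\<lambda>w. b (a w)) (carrier W) (carrier W)")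
    case True
    \<comment> \<open>Bijectivity of \<open>b a\<close> makes \<open>b\<close> surjective; finite
      generation over a Noetherian ring upgrades this to bijective, and then \<open>a\<close> is
      bijective as well.\<close>
    have "carrier W \<subseteq> b ` carrier W"
      using True module_hom_closed[OF a] unfolding bij_betw_def by blast
    then have "b ` carrier W = carrier W" using module_hom_closed[OF b] by auto
    from noetherian_surj_endo_bij[OF R W(1) b this] have "bij_betw b (carrier W) (carrier W)" .
    then have "bij_betw a (carrier W) (carrier W)"
      using bij_betw_comp_iff2[of b "carrier W" "carrier W" a "carrier W"] True
        module_hom_closed[OF a] by (auto simp: comp_def)
    then show ?thesis using biproduct_complement_isomorphic[OF U W' M N bip1 bip2] by (simp add: a_def)
  next
    case False
    define u where "u = (\<lambda>w. w \<ominus>\<^bsub>W\<^esub> b (a w))"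
    have u: "u \<in> module_hom R W W"
      unfolding u_def by (rule module_hom_minus_hom[OF W' W' module_hom_id(2) ba])
    have bu: "bij_betw u (carrier W) (carrier W)"
      using W(2) ba False unfolding local_endo_def u_def by blast
    define v where "v = inv_into (carrier W) u"
    have v: "v \<in> module_hom R W W" unfolding v_def by (rule module_hom_inv_into[OF W' W' u bu])
    have vu: "v (u w) = w" if "w \<in> carrier W" for w
      using that bu by (simp add: v_def bij_betw_def)
    have lk: "p1 (j2 (q2 (i1 w))) = u w" if w: "w \<in> carrier W" for w
    proof -
      have "w = p1 (j1 (q1 (i1 w)) \<oplus>\<^bsub>U\<^esub> j2 (q2 (i1 w)))"
        using b2(9)[of "i1 w"] w cl b1(5) by simp
      also have "\<dots> = b (a w) \<oplus>\<^bsub>W\<^esub> p1 (j2 (q2 (i1 w)))"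
        using w cl by (simp add: module_hom_add[OF b1(3)] a_def b_def)
      finally have eq: "w = b (a w) \<oplus>\<^bsub>W\<^esub> p1 (j2 (q2 (i1 w)))" .
      have c2: "b (a w) \<in> carrier W" "p1 (j2 (q2 (i1 w))) \<in> carrier W"
        using w cl module_hom_closed[OF ba] by auto
      have "u w = (b (a w) \<oplus>\<^bsub>W\<^esub> p1 (j2 (q2 (i1 w)))) \<ominus>\<^bsub>W\<^esub> b (a w)" using eq by (simp add: u_def)
      also have "\<dots> = p1 (j2 (q2 (i1 w)))"
        using c2 by (rule W.M.add_minus_cancel_left)
      finally show ?thesis by simp
    qed
    \<comment> \<open>Since \<open>v\<close> inverts \<open>u = p1 j2 q2 i1\<close>, this choice
      gives \<open>c (q2 (i1 w)) = w - a w\<close>, exactly what \<open>a\<close> lacks to be the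
      identity.\<close>
    define c where "c = (\<lambda>n. v (p1 (j2 n)) \<ominus>\<^bsub>W\<^esub> a (v (p1 (j2 n))))"
    have vl: "(\<lambda>n. v (p1 (j2 n))) \<in> module_hom R N W"
      by (intro module_hom_compose[OF module_hom_compose[OF b2(2) b1(3)] v])
    have c: "c \<in> module_hom R N W"
      unfolding c_def by (rule module_hom_minus_hom[OF N W' vl module_hom_compose[OF vl a]])
    have "q1 (i1 w) \<oplus>\<^bsub>W\<^esub> c (q2 (i1 w)) = w" if w: "w \<in> carrier W" for w
    proof -
      have "c (q2 (i1 w)) = w \<ominus>\<^bsub>W\<^esub> a w" using w by (simp add: c_def lk vu)
      moreover have "a w \<oplus>\<^bsub>W\<^esub> (w \<ominus>\<^bsub>W\<^esub> a w) = w"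
        using w module_hom_closed[OF a w] by (simp add: a_minus_def W.M.a_lcomm W.M.r_neg)
      ultimately show ?thesis by (simp add: a_def)
    qed
    then have "bij_betw (\<lambda>w. q1 (i1 w) \<oplus>\<^bsub>W\<^esub> c (q2 (i1 w))) (carrier W) (carrier W)"
      by (simp cong: bij_betw_cong add: bij_betw_id[unfolded id_def])
    from biproduct_complement_isomorphic[OF U W' M N bip1 biproduct_shear[OF U W' N bip2 c] this]
    show ?thesis .
  qed
  then show ?thesis by (rule module_isomorphic_sym[OF N M])
qed

lemma retract_summand:
  assumes W: "module R W" and A: "fg_module R A"
    and i: "i \<in> module_hom R W A" and s: "s \<in> module_hom R A W"
    and bij: "bij_betw (\<lambda>w. s (i w)) (carrier W) (carrier W)"
  shows "\<exists>K. fg_module R (A\<lparr>carrier := K\<rparr>) \<and> module_isomorphic R A (direct_sum W (A\<lparr>carrier := K\<rparr>))"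
proof -
  note A' = fg_module_is_module[OF A]
  let ?u = "\<lambda>w. s (i w)"
  have u: "?u \<in> module_hom R W W" by (rule module_hom_compose[OF i s])
  define r where "r = (\<lambda>x. inv_into (carrier W) ?u (s x))"
  have r: "r \<in> module_hom R A W"
    unfolding r_def by (rule module_hom_compose[OF s module_hom_inv_into[OF W W u bij]])
  have ri: "r (i w) = w" if "w \<in> carrier W" for w
    unfolding r_def by (rule inv_into_f_f[OF _ that]) (use bij in \<open>simp add: bij_betw_def\<close>)
  let ?K = "{x \<in> carrier A. r x = \<zero>\<^bsub>W\<^esub>}"
  note K = retract_biproduct[OF W A' i r ri]
  have "fg_module R (A\<lparr>carrier := ?K\<rparr>)" by (rule biproduct_fg_summand(2)[OF K(2) A W K(1)])
  moreover have "module_isomorphic R A (direct_sum W (A\<lparr>carrier := ?K\<rparr>))"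
    by (rule biproduct_imp_isomorphic[OF A' W K])
  ultimately show ?thesis by blast
qed

text \<open>The identity of \<open>W\<close> is the sum of an endomorphism that factors through
  \<open>A\<close> and one that factors through \<open>B\<close>. One of the two is bijective, and
  then \<open>W\<close> splits off the module through which it factors.\<close>

lemma local_endo_exchange:
  assumes W: "module R W" "local_endo R W" and U: "module R U" and Y: "module R Y"
    and A: "fg_module R A" and B: "fg_module R B"
    and iso: "module_isomorphic R U (direct_sum W Y)" "module_isomorphic R U (direct_sum A B)"
  shows "(\<exists>K. fg_module R (A\<lparr>carrier := K\<rparr>) \<and> module_isomorphic R A (direct_sum W (A\<lparr>carrier := K\<rparr>))) \<or>
    (\<exists>K. fg_module R (B\<lparr>carrier := K\<rparr>) \<and> module_isomorphic R B (direct_sum W (B\<lparr>carrier := K\<rparr>)))"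
proof -
  note A' = fg_module_is_module[OF A] and B' = fg_module_is_module[OF B]
  interpret U: module R U by fact
  interpret W: module R W by fact
  obtain i1 i2 p1 p2 where bip1: "biproduct R U W Y i1 i2 p1 p2"
    by (rule isomorphic_imp_biproduct[OF iso(1) U W(1) Y])
  obtain j1 j2 q1 q2 where bip2: "biproduct R U A B j1 j2 q1 q2"
    by (rule isomorphic_imp_biproduct[OF iso(2) U A' B'])
  note b1 = biproductD[OF bip1] and b2 = biproductD[OF bip2]
  note cl = b1(1-4)[THEN module_hom_closed] b2(1-4)[THEN module_hom_closed]
  define f where "f = (\<lambda>w. p1 (j1 (q1 (i1 w))))"
  have f: "f \<in> module_hom R W W"
    unfolding f_def by (intro module_hom_compose[OF module_hom_compose[OF module_hom_compose[OF b1(1) b2(3)] b2(1)] b1(3)])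
  have diff: "w \<ominus>\<^bsub>W\<^esub> f w = p1 (j2 (q2 (i1 w)))" if w: "w \<in> carrier W" for w
  proof -
    have "w = p1 (j1 (q1 (i1 w)) \<oplus>\<^bsub>U\<^esub> j2 (q2 (i1 w)))"
      using b2(9)[of "i1 w"] w cl b1(5) by simp
    also have "\<dots> = f w \<oplus>\<^bsub>W\<^esub> p1 (j2 (q2 (i1 w)))"
      using w cl by (simp add: module_hom_add[OF b1(3)] f_def)
    finally have eq: "w = f w \<oplus>\<^bsub>W\<^esub> p1 (j2 (q2 (i1 w)))" .
    have c2: "f w \<in> carrier W" "p1 (j2 (q2 (i1 w))) \<in> carrier W"
      using w cl module_hom_closed[OF f] by auto
    have "w \<ominus>\<^bsub>W\<^esub> f w = (f w \<oplus>\<^bsub>W\<^esub> p1 (j2 (q2 (i1 w)))) \<ominus>\<^bsub>W\<^esub> f w" using eq by simp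
    also have "\<dots> = p1 (j2 (q2 (i1 w)))"
      using c2 by (rule W.M.add_minus_cancel_left)
    finally show ?thesis .
  qed
  have "bij_betw (\<lambda>w. w \<ominus>\<^bsub>W\<^esub> f w) (carrier W) (carrier W) =
      bij_betw (\<lambda>w. p1 (j2 (q2 (i1 w)))) (carrier W) (carrier W)"
    by (rule bij_betw_cong[OF diff])
  then consider "bij_betw f (carrier W) (carrier W)"
    | "bij_betw (\<lambda>w. p1 (j2 (q2 (i1 w)))) (carrier W) (carrier W)"
    using W(2) f by (auto simp: local_endo_def)
  then show ?thesis
  proof cases
    case 1
    show ?thesis
      using retract_summand[OF W(1) A module_hom_compose[OF b1(1) b2(3)] module_hom_compose[OF b2(1) b1(3)]]
        1 unfolding f_def by blast
  next
    case 2
    show ?thesis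
      using retract_summand[OF W(1) B module_hom_compose[OF b1(1) b2(4)] module_hom_compose[OF b2(2) b1(3)]]
        2 by blast
  qed
qed

section \<open>Minimal numbers of generators of direct summands\<close>

text \<open>Either the expression for \<open>y\<close> can be solved for one of the generators, or
  all its coefficients lie in \<open>\<mm>\<close>. The second case, \<open>y \<in> \<mm> M\<close>,
  is stated through the submodules containing \<open>\<mm> M\<close>.\<close>

lemma (in noetherian_local_ring) adjoin_unit_coefficient:
  assumes M: "module R M" and cs: "set cs \<subseteq> carrier M" and y: "y \<in> adjoin R M {\<zero>\<^bsub>M\<^esub>} cs"
  shows "(\<exists>us c vs r z. cs = us @ c # vs \<and> r \<in> Units R \<and> z \<in> adjoin R M {\<zero>\<^bsub>M\<^esub>} (us @ vs) \<and>
      y = r \<odot>\<^bsub>M\<^esub> c \<oplus>\<^bsub>M\<^esub> z) \<or>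
    (\<forall>Q. submodule Q R M \<longrightarrow> (\<forall>r\<in>\<mm>. \<forall>x\<in>carrier M. r \<odot>\<^bsub>M\<^esub> x \<in> Q) \<longrightarrow> y \<in> Q)"
  using cs y
proof (induction cs arbitrary: y)
  case Nil
  then show ?case using submodule_zero_mem by auto
next
  case (Cons c cs)
  interpret M: module R M by fact
  obtain r x where rx: "r \<in> carrier R" "x \<in> adjoin R M {\<zero>\<^bsub>M\<^esub>} cs" "y = r \<odot>\<^bsub>M\<^esub> c \<oplus>\<^bsub>M\<^esub> x"
    using Cons.prems(2) by auto
  have c: "c \<in> carrier M" "set cs \<subseteq> carrier M" using Cons.prems(1) by auto
  show ?case
  proof (cases "r \<in> Units R")
    case True
    then show ?thesis using rx by (intro disjI1 exI[of _ "[]"]) auto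
  next
    case False
    then have r: "r \<in> \<mm>" using rx(1) max_ideal_iff_nonunit by auto
    from Cons.IH[OF c(2) rx(2)] consider us d vs s z where "cs = us @ d # vs" "s \<in> Units R"
        "z \<in> adjoin R M {\<zero>\<^bsub>M\<^esub>} (us @ vs)" "x = s \<odot>\<^bsub>M\<^esub> d \<oplus>\<^bsub>M\<^esub> z"
      | "\<forall>Q. submodule Q R M \<longrightarrow> (\<forall>r\<in>\<mm>. \<forall>x\<in>carrier M. r \<odot>\<^bsub>M\<^esub> x \<in> Q) \<longrightarrow> x \<in> Q" by blast
    then show ?thesis
    proof cases
      case 1
      have d: "d \<in> carrier M" "set (us @ vs) \<subseteq> carrier M" using c 1(1) by auto
      have z: "z \<in> carrier M"
        using M.submodule_subset[OF M.submodule_adjoin[OF M.submodule_zero d(2)] 1(3)] .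
      have "r \<odot>\<^bsub>M\<^esub> c \<oplus>\<^bsub>M\<^esub> z \<in> adjoin R M {\<zero>\<^bsub>M\<^esub>} ((c # us) @ vs)" using rx(1) 1(3) by auto
      moreover have "y = s \<odot>\<^bsub>M\<^esub> d \<oplus>\<^bsub>M\<^esub> (r \<odot>\<^bsub>M\<^esub> c \<oplus>\<^bsub>M\<^esub> z)"
        using rx(1,3) 1(2,4) c d z by (simp add: M.M.a_lcomm Units_closed)
      ultimately show ?thesis using 1(1,2)
        by (intro disjI1 exI[of _ "c # us"] exI[of _ d] exI[of _ vs]) auto
    next
      case 2
      have "y \<in> Q" if Q: "submodule Q R M" "\<forall>r\<in>\<mm>. \<forall>x\<in>carrier M. r \<odot>\<^bsub>M\<^esub> x \<in> Q" for Q
        using 2 Q r c rx(3) M.submoduleE(5)[OF Q(1)] by auto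
      then show ?thesis by blast
    qed
  qed
qed

text \<open>If the \<open>B\<close>-components of all generators of \<open>U\<close> were in
  \<open>\<mm> U\<close>, Nakayama's lemma would give \<open>B = 0\<close>. So some relation
  \<open>j (q e) = r c + z\<close> has a unit \<open>r\<close>. Projected to \<open>A\<close> its
  left side vanishes, which makes \<open>p c\<close> redundant among the images of the generators.
  The strict drop is the termination measure for decompositions.\<close>

lemma (in noetherian_local_ring) min_gens_summand_less:
  assumes U: "fg_module R U" and A: "module R A" and B: "module R B" "\<not> zero_module B"
    and iso: "module_isomorphic R U (direct_sum A B)"
  shows "min_gens R A < min_gens R U"
proof -
  note U' = fg_module_is_module[OF U]
  interpret U: module R U by fact
  interpret A: module R A by fact
  interpret B: module R B by fact
  obtain i j p q where bip: "biproduct R U A B i j p q"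
    by (rule isomorphic_imp_biproduct[OF iso U' A B(1)])
  note b = biproductD[OF bip]
  note cl = b(1-4)[THEN module_hom_closed]
  note fg = biproduct_fg_summand[OF bip U A B(1)]
  obtain cs where cs: "set cs \<subseteq> carrier U" "adjoin R U {\<zero>\<^bsub>U\<^esub>} cs = carrier U"
    "length cs = min_gens R U" using min_gens_list[OF U] by blast
  have "\<exists>e\<in>set cs. \<exists>us c vs r z. cs = us @ c # vs \<and> r \<in> Units R \<and> z \<in> adjoin R U {\<zero>\<^bsub>U\<^esub>} (us @ vs) \<and>
      j (q e) = r \<odot>\<^bsub>U\<^esub> c \<oplus>\<^bsub>U\<^esub> z" (is ?unit)
  proof (rule ccontr)
    assume no_unit: "\<not> ?unit"
    have *: "j (q e) \<in> Q" if e: "e \<in> set cs" and Q: "submodule Q R U" "\<forall>r\<in>\<mm>. \<forall>x\<in>carrier U. r \<odot>\<^bsub>U\<^esub> x \<in> Q"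
      for e Q
    proof -
      have "j (q e) \<in> adjoin R U {\<zero>\<^bsub>U\<^esub>} cs" using cl cs(1,2) e by auto
      from adjoin_unit_coefficient[OF U' cs(1) this] show ?thesis
      proof (rule disjE)
        assume "\<forall>Q. submodule Q R U \<longrightarrow> (\<forall>r\<in>\<mm>. \<forall>x\<in>carrier U. r \<odot>\<^bsub>U\<^esub> x \<in> Q) \<longrightarrow> j (q e) \<in> Q"
        then show ?thesis using Q by simp
      next
        assume "\<exists>us c vs r z. cs = us @ c # vs \<and> r \<in> Units R \<and> z \<in> adjoin R U {\<zero>\<^bsub>U\<^esub>} (us @ vs) \<and>
          j (q e) = r \<odot>\<^bsub>U\<^esub> c \<oplus>\<^bsub>U\<^esub> z"
        then have ?unit by (rule bexI[where x = e]) (rule e)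
        with no_unit show ?thesis by (rule notE)
      qed
    qed
    have "{\<zero>\<^bsub>B\<^esub>} = carrier B"
    proof (rule nakayama[OF fg(2) B.submodule_zero])
      fix Q assume Q: "submodule Q R B" "\<And>r x. \<lbrakk>r \<in> \<mm>; x \<in> carrier B\<rbrakk> \<Longrightarrow> r \<odot>\<^bsub>B\<^esub> x \<in> Q"
      let ?Q = "{x \<in> carrier U. q x \<in> Q}"
      have "submodule ?Q R U"
        using B.submoduleE[OF Q(1)] submodule_zero_mem[OF Q(1)] cl module_homE[OF b(4)]
          module_hom_zero[OF U' B(1) b(4)] module_hom_a_inv[OF U' B(1) b(4)]
        by (intro U.submoduleI) auto
      moreover have "\<forall>r\<in>\<mm>. \<forall>x\<in>carrier U. r \<odot>\<^bsub>U\<^esub> x \<in> ?Q"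
        using Q(2) cl \<mm>.a_Hcarr by (auto simp: module_hom_smult[OF b(4)])
      ultimately have Q': "j (q e) \<in> ?Q" if "e \<in> set cs" for e using * that by blast
      have "q e \<in> Q" if e: "e \<in> set cs" for e
        using Q'[OF e] b(7)[OF cl(4), of e] e cs(1) by auto
      then have "adjoin R B {\<zero>\<^bsub>B\<^esub>} (map q cs) \<subseteq> Q"
        using submodule_zero_mem[OF Q(1)] by (intro B.adjoin_minimal[OF Q(1)]) auto
      moreover have "adjoin R B {\<zero>\<^bsub>B\<^esub>} (map q cs) = q ` carrier U"
        using adjoin_image[OF U' B(1) b(4) U.submodule_zero cs(1)] cs(2)
          module_hom_zero[OF U' B(1) b(4)] by simp
      moreover have "carrier B \<subseteq> q ` carrier U"
      proof
        fix y assume y: "y \<in> carrier B"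
        show "y \<in> q ` carrier U" by (rule image_eqI[where x = "j y" and f = q]) (simp_all add: b(7)[OF y] cl(2)[OF y])
      qed
      ultimately have "carrier B \<subseteq> Q" by simp
      then show "Q = carrier B" by (rule subset_antisym[OF B.submoduleE(1)[OF Q(1)]])
    qed
    then show False using B(2) by (simp add: zero_module_def)
  qed
  then obtain e us c vs r z where e: "e \<in> set cs" and c: "cs = us @ c # vs" and r: "r \<in> Units R"
    and z: "z \<in> adjoin R U {\<zero>\<^bsub>U\<^esub>} (us @ vs)" and eq: "j (q e) = r \<odot>\<^bsub>U\<^esub> c \<oplus>\<^bsub>U\<^esub> z" by blast
  have sub: "set (us @ vs) \<subseteq> carrier U" "c \<in> carrier U" "e \<in> carrier U" using cs(1) c e by auto
  let ?ds = "map p (us @ vs)"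
  have ds: "set ?ds \<subseteq> carrier A" using sub cl by auto
  let ?T = "adjoin R A {\<zero>\<^bsub>A\<^esub>} ?ds"
  have T: "submodule ?T R A" by (rule A.submodule_adjoin[OF A.submodule_zero ds])
  have zU: "z \<in> carrier U"
    using U.submodule_subset[OF U.submodule_adjoin[OF U.submodule_zero sub(1)] z] .
  have "p z \<in> ?T"
    using adjoin_image[OF U' A b(3) U.submodule_zero sub(1)] z module_hom_zero[OF U' A b(3)] by auto
  then have "\<ominus>\<^bsub>A\<^esub> p z \<in> ?T" by (rule A.submoduleE(3)[OF T])
  moreover have "r \<odot>\<^bsub>A\<^esub> p c \<oplus>\<^bsub>A\<^esub> p z = \<zero>\<^bsub>A\<^esub>"
    using arg_cong[OF eq, of p] b(8)[OF cl(4)[OF sub(3)]] r sub zU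
    by (simp add: module_hom_add[OF b(3)] module_hom_smult[OF b(3)] Units_closed)
  then have "r \<odot>\<^bsub>A\<^esub> p c = \<ominus>\<^bsub>A\<^esub> p z"
    using r sub zU cl by (simp add: A.M.minus_equality Units_closed)
  ultimately have "p c \<in> ?T" using A.unit_smult_mem[OF T r cl(3)[OF sub(2)]] by simp
  then have "set (map p cs) \<subseteq> ?T" using A.adjoin_mem[OF A.submodule_zero ds] unfolding c by simp
  then have "adjoin R A {\<zero>\<^bsub>A\<^esub>} (map p cs) \<subseteq> ?T"
    using submodule_zero_mem[OF T] by (intro A.adjoin_minimal[OF T]) auto
  moreover have "adjoin R A {\<zero>\<^bsub>A\<^esub>} (map p cs) = p ` carrier U"
    using adjoin_image[OF U' A b(3) U.submodule_zero cs(1)] cs(2) module_hom_zero[OF U' A b(3)] by simp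
  moreover have "carrier A \<subseteq> p ` carrier U"
  proof
    fix y assume y: "y \<in> carrier A"
    show "y \<in> p ` carrier U" by (rule image_eqI[where x = "i y" and f = p]) (simp_all add: b(5)[OF y] cl(1)[OF y])
  qed
  ultimately have "carrier A \<subseteq> ?T" by simp
  then have "?T = carrier A" by (rule subset_antisym[OF A.submoduleE(1)[OF T]])
  from fg_moduleI(2)[OF A ds this] show ?thesis using cs(3) c by simp
qed

section \<open>Krull--Schmidt multiplicities\<close>

text \<open>One copy of \<open>W\<close> is split off at a time, which matches cancellation of a
  single copy and stays within the fixed universe of modules.\<close>

primrec has_power_summand ::
    "('a, 'r) ring_scheme \<Rightarrow> ('a, 'a list) module \<Rightarrow> nat \<Rightarrow> ('a, 'a list) module \<Rightarrow> bool"
  where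
    "has_power_summand R W 0 M \<longleftrightarrow> True"
  | "has_power_summand R W (Suc n) M \<longleftrightarrow> (\<exists>M'\<in>fg_modules R.
      module_isomorphic R M (direct_sum W M') \<and> has_power_summand R W n M')"

definition multiplicity_of ::
    "('a, 'r) ring_scheme \<Rightarrow> ('a, 'a list) module \<Rightarrow> ('a, 'a list) module \<Rightarrow> nat"
  where "multiplicity_of R W M = (GREATEST n. has_power_summand R W n M)"

lemma direct_sum_cong_fg_modules:
  assumes "A \<in> fg_modules R" "A' \<in> fg_modules R" "B \<in> fg_modules R" "M \<in> fg_modules R" "M' \<in> fg_modules R"
    and "module_isomorphic R A A'" "module_isomorphic R M M'" "module_isomorphic R M (direct_sum A B)"
  shows "module_isomorphic R M' (direct_sum A' B)"
proof -
  have "module_isomorphic R M' M"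
    using module_isomorphic_sym assms fg_modulesD by blast
  from module_isomorphic_trans[OF module_isomorphic_trans[OF this assms(8)]
      module_isomorphic_direct_sum_cong[OF assms(6) module_isomorphic_refl]]
  show ?thesis .
qed

lemma direct_sum_swap_fg_modules:
  assumes "A \<in> fg_modules R" "B \<in> fg_modules R" "module_isomorphic R M (direct_sum A B)"
  shows "module_isomorphic R M (direct_sum B A)"
  using assms module_isomorphic_trans[OF assms(3) module_isomorphic_direct_sum_commute] fg_modulesD by blast

text \<open>\<open>direct_sum\<close> changes the element type, so a sum is replaced by an
  isomorphic copy in the universe; the following constructions of sums and complements rely on such
  copies.\<close>

lemma ex_direct_sum_fg_modules:
  assumes "A \<in> fg_modules R" "B \<in> fg_modules R"
  shows "\<exists>M\<in>fg_modules R. module_isomorphic R M (direct_sum A B)"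
proof -
  have D: "fg_module R (direct_sum A B)" using fg_direct_sum(1) assms by (auto dest: fg_modulesD)
  then show ?thesis
    using module_copy[OF D] module_isomorphic_sym fg_module_is_module fg_modulesD by blast
qed

lemma direct_sum_assoc_fg_modules:
  assumes "A \<in> fg_modules R" "B \<in> fg_modules R" "W \<in> fg_modules R" "A' \<in> fg_modules R"
    "module_isomorphic R U (direct_sum A B)" "module_isomorphic R A (direct_sum W A')"
  shows "\<exists>U'\<in>fg_modules R. module_isomorphic R U (direct_sum W U') \<and> module_isomorphic R U' (direct_sum A' B)"
proof -
  obtain U' where U': "U' \<in> fg_modules R" "module_isomorphic R U' (direct_sum A' B)"
    using ex_direct_sum_fg_modules[OF assms(4,2)] by blast
  have "module_isomorphic R U (direct_sum (direct_sum W A') B)"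
    using module_isomorphic_trans[OF assms(5) module_isomorphic_direct_sum_cong[OF assms(6) module_isomorphic_refl]] .
  then have "module_isomorphic R U (direct_sum W (direct_sum A' B))"
    using module_isomorphic_trans module_isomorphic_direct_sum_assoc by blast
  moreover have "module_isomorphic R (direct_sum A' B) U'"
    using module_isomorphic_sym[OF _ _ U'(2)] module_direct_sum assms fg_modulesD U'(1) by blast
  then have "module_isomorphic R (direct_sum W (direct_sum A' B)) (direct_sum W U')"
    by (rule module_isomorphic_direct_sum_cong[OF module_isomorphic_refl])
  ultimately show ?thesis using U' module_isomorphic_trans by blast
qed

lemma ex_zero_fg_modules:
  assumes "M \<in> fg_modules R"
  shows "\<exists>Z\<in>fg_modules R. zero_module Z"
proof -
  interpret M: module R M using assms by (auto dest: fg_modulesD)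
  let ?Z = "M\<lparr>carrier := {\<zero>\<^bsub>M\<^esub>}\<rparr>"
  have "module R ?Z" by (rule submodule.submodule_is_module[OF M.submodule_zero M.module_axioms])
  then have "fg_module R ?Z" by (rule zero_module_min_gens) (simp add: zero_module_def)
  then show ?thesis by (intro bexI[of _ ?Z]) (auto simp: zero_module_def fg_modules_def)
qed

lemma iso_fg_modules_sym:
  "\<lbrakk>M \<in> fg_modules R; N \<in> fg_modules R; module_isomorphic R M N\<rbrakk> \<Longrightarrow> module_isomorphic R N M"
  using module_isomorphic_sym fg_modulesD by blast

lemma indecomposable_isomorphic:
  assumes "indecomposable R M" "module_isomorphic R M N" "M \<in> fg_modules R" "N \<in> fg_modules R"
  shows "indecomposable R N"
proof -
  have NM: "module_isomorphic R N M" by (rule iso_fg_modules_sym[OF assms(3,4,2)])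
  show ?thesis
    unfolding indecomposable_def
  proof (intro conjI ballI impI)
    show "\<not> zero_module N"
      using assms zero_module_isomorphic[OF NM] fg_modulesD unfolding indecomposable_def by blast
    fix A B assume "A \<in> fg_modules R" "B \<in> fg_modules R" "module_isomorphic R N (direct_sum A B)"
    then show "zero_module A \<or> zero_module B"
      using assms(1) module_isomorphic_trans[OF assms(2)] unfolding indecomposable_def by blast
  qed
qed

lemma has_power_summand_isomorphic:
  assumes "M \<in> fg_modules R" "N \<in> fg_modules R" "module_isomorphic R M N" "has_power_summand R W n M"
  shows "has_power_summand R W n N"
proof (cases n)
  case (Suc k)
  then obtain M' where "M' \<in> fg_modules R" "module_isomorphic R M (direct_sum W M')" "has_power_summand R W k M'"
    using assms(4) by auto
  then show ?thesis
    using module_isomorphic_trans[OF iso_fg_modules_sym[OF assms(1-3)]] Suc by auto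
qed simp

section \<open>Termination of decompositions and existence of indecomposable summands\<close>

context noetherian_local_ring
begin

lemma zero_module_summands:
  assumes "zero_module U" "U \<in> fg_modules R" "A \<in> fg_modules R" "B \<in> fg_modules R"
    "module_isomorphic R U (direct_sum A B)"
  shows "zero_module A"
proof -
  have "zero_module (direct_sum A B)"
    using zero_module_isomorphic[OF assms(5,1)] assms module_direct_sum fg_modulesD by blast
  then have "carrier A \<times> carrier B = {(\<zero>\<^bsub>A\<^esub>, \<zero>\<^bsub>B\<^esub>)}" by (simp add: zero_module_def)
  moreover have "\<zero>\<^bsub>B\<^esub> \<in> carrier B" "\<zero>\<^bsub>A\<^esub> \<in> carrier A"
    using assms(3,4) by (auto dest!: fg_modulesD(2) simp: module_def abelian_group_def abelian_monoid.zero_closed)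
  ultimately show ?thesis unfolding zero_module_def by blast
qed

lemma summand_min_gens_less:
  assumes "U \<in> fg_modules R" "A \<in> fg_modules R" "B \<in> fg_modules R" "\<not> zero_module A"
    "module_isomorphic R U (direct_sum A B)"
  shows "min_gens R B < min_gens R U"
  using min_gens_summand_less[OF _ _ _ assms(4) direct_sum_swap_fg_modules[OF assms(2,3,5)]] assms
  by (blast dest: fg_modulesD)

text \<open>Every copy of \<open>W\<close> that is split off lowers \<open>min_gens\<close>. The
  bound ensures that the \<open>GREATEST\<close> in \<open>multiplicity_of\<close> is
  attained.\<close>

lemma has_power_summand_bound:
  assumes W: "W \<in> fg_modules R" "\<not> zero_module W" and M: "M \<in> fg_modules R" "has_power_summand R W n M"
  shows "n \<le> min_gens R M"
  using M
proof (induction n arbitrary: M)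
  case (Suc n)
  then obtain M' where M': "M' \<in> fg_modules R" "module_isomorphic R M (direct_sum W M')"
    "has_power_summand R W n M'" by auto
  have "min_gens R M' < min_gens R M"
    by (rule summand_min_gens_less[OF Suc.prems(1) W(1) M'(1) W(2) M'(2)])
  then show ?case using Suc.IH[OF M'(1,3)] by simp
qed simp

lemma has_power_multiplicity_of:
  assumes W: "W \<in> fg_modules R" "\<not> zero_module W" and M: "M \<in> fg_modules R"
  shows "has_power_summand R W (multiplicity_of R W M) M"
    "has_power_summand R W n M \<Longrightarrow> n \<le> multiplicity_of R W M"
  unfolding multiplicity_of_def
  using GreatestI_nat[of "\<lambda>n. has_power_summand R W n M" 0 "min_gens R M"]
    Greatest_le_nat[of "\<lambda>n. has_power_summand R W n M" n "min_gens R M"]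
    has_power_summand_bound[OF W M] by auto

lemma multiplicity_of_isomorphic:
  assumes "M \<in> fg_modules R" "N \<in> fg_modules R" "module_isomorphic R M N"
  shows "multiplicity_of R W M = multiplicity_of R W N"
  unfolding multiplicity_of_def
  using has_power_summand_isomorphic assms iso_fg_modules_sym by metis

lemma multiplicity_of_eq_0_iff:
  assumes W: "W \<in> fg_modules R" "\<not> zero_module W" and M: "M \<in> fg_modules R"
  shows "multiplicity_of R W M = 0 \<longleftrightarrow> \<not> (\<exists>M'\<in>fg_modules R. module_isomorphic R M (direct_sum W M'))"
proof -
  have "has_power_summand R W 1 M \<longleftrightarrow> (\<exists>M'\<in>fg_modules R. module_isomorphic R M (direct_sum W M'))" by simp
  then show ?thesis
    using has_power_multiplicity_of(1)[OF W M] has_power_multiplicity_of(2)[OF W M, of 1]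
    by (cases "multiplicity_of R W M") auto
qed

text \<open>The existence half of the Krull--Schmidt theorem as an induction rule. Both the search
  for an indecomposable summand and the induction on the remainder terminate because
  \<open>min_gens\<close> drops strictly.\<close>

lemma decompose_induct [consumes 1, case_names zero summand]:
  assumes M: "M \<in> fg_modules R"
    and zero: "\<And>Z. \<lbrakk>Z \<in> fg_modules R; zero_module Z\<rbrakk> \<Longrightarrow> P Z"
    and summand: "\<And>M W N. \<lbrakk>M \<in> fg_modules R; W \<in> fg_modules R; N \<in> fg_modules R; indecomposable R W;
      module_isomorphic R M (direct_sum W N); P N\<rbrakk> \<Longrightarrow> P M"
  shows "P M"
  using M
proof (induction "min_gens R M" arbitrary: M rule: less_induct)
  case less
  have ex: "\<exists>W\<in>fg_modules R. \<exists>N\<in>fg_modules R. indecomposable R W \<and> module_isomorphic R M (direct_sum W N)"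
    if "M \<in> fg_modules R" "\<not> zero_module M" for M
    using that
  proof (induction "min_gens R M" arbitrary: M rule: less_induct)
    case less
    obtain Z where Z: "Z \<in> fg_modules R" "zero_module Z" using ex_zero_fg_modules less.prems by blast
    show ?case
    proof (cases "indecomposable R M")
      case True
      have "module_isomorphic R M (direct_sum M Z)"
        using module_isomorphic_direct_sum_zero fg_modulesD less.prems(1) Z by blast
      then show ?thesis using True less.prems Z by blast
    next
      case False
      then obtain A B where AB: "A \<in> fg_modules R" "B \<in> fg_modules R" "\<not> zero_module A" "\<not> zero_module B"
        "module_isomorphic R M (direct_sum A B)"
        using less.prems unfolding indecomposable_def by blast
      have "min_gens R A < min_gens R M"
        by (rule summand_min_gens_less[OF less.prems(1) AB(2,1,4) direct_sum_swap_fg_modules[OF AB(1,2,5)]])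
      from less.hyps[OF this AB(1,3)] obtain W N where WN: "W \<in> fg_modules R" "N \<in> fg_modules R"
        "indecomposable R W" "module_isomorphic R A (direct_sum W N)" by blast
      from direct_sum_assoc_fg_modules[OF AB(1,2) WN(1,2) AB(5) WN(4)] show ?thesis using WN by blast
    qed
  qed
  show ?case
  proof (cases "zero_module M")
    case False
    from ex[OF less.prems this] obtain W N where WN: "W \<in> fg_modules R" "N \<in> fg_modules R"
        "indecomposable R W" "module_isomorphic R M (direct_sum W N)" by blast
    then have "\<not> zero_module W" by (simp add: indecomposable_def)
    from summand_min_gens_less[OF less.prems WN(1,2) this WN(4)] less.hyps WN(2) have "P N" by blast
    then show ?thesis using summand[OF less.prems WN] by blast
  qed (use zero less.prems in blast)
qed

end

section \<open>Additivity of multiplicities\<close>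

context henselian_local_ring
begin

lemma indecomposable_local_endo:
  assumes "W \<in> fg_modules R" "indecomposable R W"
  shows "local_endo R W"
  using indecomposable_endo_local assms fg_modulesD unfolding local_endo_def by blast

context
  fixes W assumes W: "W \<in> fg_modules R" "indecomposable R W"
begin

lemma W_nonzero: "\<not> zero_module W"
  using W by (simp add: indecomposable_def)

text \<open>The largest number of copies may be realized by a different splitting, with another
  complement \<open>N\<close> of \<open>W\<close>; cancellation identifies \<open>N\<close> with
  \<open>M'\<close>.\<close>

lemma multiplicity_of_summand:
  assumes M: "M \<in> fg_modules R" "M' \<in> fg_modules R" "module_isomorphic R M (direct_sum W M')"
  shows "multiplicity_of R W M = Suc (multiplicity_of R W M')"
proof (rule antisym)
  note hp = has_power_multiplicity_of[OF W(1) W_nonzero]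
  have "has_power_summand R W (Suc (multiplicity_of R W M')) M"
    using hp(1)[OF M(2)] M by auto
  then show "Suc (multiplicity_of R W M') \<le> multiplicity_of R W M" by (rule hp(2)[OF M(1)])
  show "multiplicity_of R W M \<le> Suc (multiplicity_of R W M')"
  proof (cases "multiplicity_of R W M")
    case (Suc n)
    then obtain N where N: "N \<in> fg_modules R" "module_isomorphic R M (direct_sum W N)" "has_power_summand R W n N"
      using hp(1)[OF M(1)] by auto
    have "module_isomorphic R N M'"
      using local_endo_cancel[OF noetherian_ring_axioms _ indecomposable_local_endo[OF W] _ _ _ N(2) M(3)]
        W(1) M(1,2) N(1) by (blast dest: fg_modulesD)
    from has_power_summand_isomorphic[OF N(1) M(2) this N(3)] show ?thesis using Suc hp(2)[OF M(2)] by simp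
  qed simp
qed

text \<open>If \<open>W\<close> splits off \<open>A\<close> or \<open>B\<close>, remove one copy and
  use induction on \<open>min_gens\<close>. If it splits off neither, the exchange property shows
  that it does not split off \<open>U\<close>, and all three multiplicities are zero.\<close>

lemma multiplicity_of_direct_sum:
  assumes "U \<in> fg_modules R" "A \<in> fg_modules R" "B \<in> fg_modules R" "module_isomorphic R U (direct_sum A B)"
  shows "multiplicity_of R W U = multiplicity_of R W A + multiplicity_of R W B"
  using assms
proof (induction "min_gens R U" arbitrary: U A B rule: less_induct)
  case less
  note U = less.prems(1) and A = less.prems(2) and B = less.prems(3) and iso = less.prems(4)
  note eq0 = multiplicity_of_eq_0_iff[OF W(1) W_nonzero]
  have step: "multiplicity_of R W U = multiplicity_of R W A + multiplicity_of R W B"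
    if A: "A \<in> fg_modules R" and B: "B \<in> fg_modules R" and iso: "module_isomorphic R U (direct_sum A B)"
      and A': "A' \<in> fg_modules R" "module_isomorphic R A (direct_sum W A')" for A B A'
  proof -
    obtain U' where U': "U' \<in> fg_modules R" "module_isomorphic R U (direct_sum W U')"
      "module_isomorphic R U' (direct_sum A' B)"
      using direct_sum_assoc_fg_modules[OF A B W(1) A'(1) iso A'(2)] by blast
    have "min_gens R U' < min_gens R U" by (rule summand_min_gens_less[OF U W(1) U'(1) W_nonzero U'(2)])
    then have "multiplicity_of R W U' = multiplicity_of R W A' + multiplicity_of R W B"
      by (rule less.hyps[OF _ U'(1) A'(1) B U'(3)])
    then show ?thesis
      using multiplicity_of_summand[OF U U'(1,2)] multiplicity_of_summand[OF A A'] by simp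
  qed
  consider (A) A' where "A' \<in> fg_modules R" "module_isomorphic R A (direct_sum W A')"
    | (B) B' where "B' \<in> fg_modules R" "module_isomorphic R B (direct_sum W B')"
    | (none) "\<not> (\<exists>A'\<in>fg_modules R. module_isomorphic R A (direct_sum W A'))"
        "\<not> (\<exists>B'\<in>fg_modules R. module_isomorphic R B (direct_sum W B'))" by blast
  then show ?case
  proof cases
    case A
    then show ?thesis using step[OF less.prems(2-4)] by blast
  next
    case B
    then show ?thesis
      using step[OF less.prems(3,2) direct_sum_swap_fg_modules[OF less.prems(2-4)]] by (simp add: add.commute)
  next
    case none
    have "\<not> (\<exists>U'\<in>fg_modules R. module_isomorphic R U (direct_sum W U'))"
    proof
      assume "\<exists>U'\<in>fg_modules R. module_isomorphic R U (direct_sum W U')"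
      then obtain U' where U': "U' \<in> fg_modules R" "module_isomorphic R U (direct_sum W U')" by blast
      from local_endo_exchange[OF fg_modulesD(2)[OF W(1)] indecomposable_local_endo[OF W]
          fg_modulesD(2)[OF U] fg_modulesD(2)[OF U'(1)] fg_modulesD(1)[OF A] fg_modulesD(1)[OF B] U'(2) iso]
      show False using none by (auto simp: fg_modules_def)
    qed
    then have "multiplicity_of R W U = 0" using eq0[OF U] by blast
    moreover have "multiplicity_of R W A = 0" "multiplicity_of R W B = 0"
      using none eq0[OF A] eq0[OF B] by blast+
    ultimately show ?thesis by simp
  qed
qed

lemma multiplicity_of_zero:
  assumes "Z \<in> fg_modules R" "zero_module Z"
  shows "multiplicity_of R W Z = 0"
  using multiplicity_of_eq_0_iff[OF W(1) W_nonzero assms(1)]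
    zero_module_summands[OF assms(2,1) W(1)] W_nonzero by blast

lemma multiplicity_of_indecomposable:
  assumes V: "V \<in> fg_modules R" "indecomposable R V"
  shows "multiplicity_of R W V = (if module_isomorphic R W V then 1 else 0)"
proof (cases "\<exists>V'\<in>fg_modules R. module_isomorphic R V (direct_sum W V')")
  case True
  then obtain V' where V': "V' \<in> fg_modules R" "module_isomorphic R V (direct_sum W V')" by blast
  then have z: "zero_module V'" using V(2) W W_nonzero unfolding indecomposable_def by blast
  have "module_isomorphic R W (direct_sum W V')"
    using module_isomorphic_direct_sum_zero W(1) V'(1) z fg_modulesD by blast
  moreover have "module_isomorphic R (direct_sum W V') V"
    using module_isomorphic_sym[OF _ _ V'(2)] module_direct_sum W(1) V'(1) V(1) fg_modulesD by blast
  ultimately have "module_isomorphic R W V" by (rule module_isomorphic_trans)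
  then show ?thesis
    using multiplicity_of_summand[OF V(1) V'] multiplicity_of_zero[OF V'(1) z] by simp
next
  case False
  obtain Z where Z: "Z \<in> fg_modules R" "zero_module Z" using ex_zero_fg_modules V(1) by blast
  have "\<not> module_isomorphic R W V"
  proof
    assume "module_isomorphic R W V"
    then have "module_isomorphic R V W" by (rule iso_fg_modules_sym[OF W(1) V(1)])
    moreover have "module_isomorphic R W (direct_sum W Z)"
      using module_isomorphic_direct_sum_zero W(1) Z fg_modulesD by blast
    ultimately show False using False Z(1) module_isomorphic_trans by blast
  qed
  then show ?thesis using False multiplicity_of_eq_0_iff[OF W(1) W_nonzero V(1)] by simp
qed

end

subsection \<open>Isomorphism classes of indecomposables\<close>

abbreviation "iso_rel \<equiv> {(M, N). M \<in> fg_modules R \<and> N \<in> fg_modules R \<and> module_isomorphic R M N}"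

lemma class_rep_Ind:
  assumes "W \<in> Ind R"
  shows "class_rep W \<in> fg_modules R" "indecomposable R (class_rep W)"
    "W = iso_rel `` {class_rep W}"
proof -
  obtain M where M: "M \<in> fg_modules R" "indecomposable R M" "W = iso_rel `` {M}"
    using assms by (auto simp: Ind_def elim!: quotientE)
  have "M \<in> W" using M module_isomorphic_refl by auto
  then have "class_rep W \<in> W" unfolding class_rep_def by (rule someI)
  then have C: "class_rep W \<in> fg_modules R" "module_isomorphic R M (class_rep W)" using M(3) by auto
  then show "class_rep W \<in> fg_modules R" by simp
  show "indecomposable R (class_rep W)" by (rule indecomposable_isomorphic[OF M(2) C(2) M(1) C(1)])
  have "module_isomorphic R (class_rep W) M" by (rule iso_fg_modules_sym[OF M(1) C])
  then show "W = iso_rel `` {class_rep W}"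
    using M C module_isomorphic_trans by blast
qed

lemma class_rep_isomorphic_iff:
  assumes "W \<in> Ind R" "V \<in> Ind R"
  shows "module_isomorphic R (class_rep W) (class_rep V) \<longleftrightarrow> W = V"
proof
  assume iso: "module_isomorphic R (class_rep W) (class_rep V)"
  note W = class_rep_Ind[OF assms(1)] and V = class_rep_Ind[OF assms(2)]
  have "module_isomorphic R (class_rep V) (class_rep W)" by (rule iso_fg_modules_sym[OF W(1) V(1) iso])
  then have "iso_rel `` {class_rep W} = iso_rel `` {class_rep V}"
    using iso W(1) V(1) module_isomorphic_trans by blast
  then show "W = V" using W(3) V(3) by simp
qed (simp add: module_isomorphic_refl)

lemma ex_Ind_isomorphic:
  assumes "M \<in> fg_modules R" "indecomposable R M"
  shows "\<exists>W\<in>Ind R. module_isomorphic R M (class_rep W)"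
proof -
  let ?W = "iso_rel `` {M}"
  have "?W \<in> Ind R" unfolding Ind_def by (rule quotientI) (use assms in simp)
  moreover have "M \<in> ?W" using assms module_isomorphic_refl by auto
  then have "class_rep ?W \<in> ?W" unfolding class_rep_def by (rule someI)
  ultimately show ?thesis by auto
qed

text \<open>The value zero outside \<open>Ind R\<close> lets supports and equations between
  multiplicities range over all \<open>W\<close>, without membership hypotheses.\<close>

definition mult_Ind :: "('a, 'a list) module set \<Rightarrow> ('a, 'a list) module \<Rightarrow> nat"
  where "mult_Ind W M = (if W \<in> Ind R then multiplicity_of R (class_rep W) M else 0)"

lemma mult_Ind_direct_sum:
  assumes "U \<in> fg_modules R" "A \<in> fg_modules R" "B \<in> fg_modules R" "module_isomorphic R U (direct_sum A B)"
  shows "mult_Ind W U = mult_Ind W A + mult_Ind W B"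
  using multiplicity_of_direct_sum[OF class_rep_Ind(1,2) assms] by (simp add: mult_Ind_def)

lemma mult_Ind_zero: "\<lbrakk>Z \<in> fg_modules R; zero_module Z\<rbrakk> \<Longrightarrow> mult_Ind W Z = 0"
  using multiplicity_of_zero[OF class_rep_Ind(1,2)] by (simp add: mult_Ind_def)

lemma mult_Ind_isomorphic:
  "\<lbrakk>M \<in> fg_modules R; N \<in> fg_modules R; module_isomorphic R M N\<rbrakk> \<Longrightarrow> mult_Ind W M = mult_Ind W N"
  using multiplicity_of_isomorphic by (simp add: mult_Ind_def)

lemma mult_Ind_class_rep: "V \<in> Ind R \<Longrightarrow> mult_Ind W (class_rep V) = (if W = V then 1 else 0)"
  using multiplicity_of_indecomposable[OF class_rep_Ind(1,2) class_rep_Ind(1,2)[of V], of W]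
    class_rep_isomorphic_iff[of W V] by (auto simp: mult_Ind_def)

lemma Ind_decompose_induct [consumes 1, case_names zero summand]:
  assumes M: "M \<in> fg_modules R"
    and zero: "\<And>Z. \<lbrakk>Z \<in> fg_modules R; zero_module Z\<rbrakk> \<Longrightarrow> P Z"
    and summand: "\<And>M W N. \<lbrakk>M \<in> fg_modules R; W \<in> Ind R; N \<in> fg_modules R;
      module_isomorphic R M (direct_sum (class_rep W) N); P N\<rbrakk> \<Longrightarrow> P M"
  shows "P M"
  using M
proof (induction rule: decompose_induct)
  case (summand M V N)
  obtain W where W: "W \<in> Ind R" "module_isomorphic R V (class_rep W)"
    using ex_Ind_isomorphic[OF summand.hyps(2,4)] by blast
  from direct_sum_cong_fg_modules[OF summand.hyps(2) class_rep_Ind(1)[OF W(1)] summand.hyps(3,1,1) W(2)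
      module_isomorphic_refl summand.hyps(5)]
  show ?case by (rule assms(3)[OF summand.hyps(1) W(1) summand.hyps(3) _ summand.IH])
qed (rule zero)

lemma mult_Ind_finite_support:
  assumes "M \<in> fg_modules R"
  shows "finite {W. mult_Ind W M \<noteq> 0}"
  using assms
proof (induction rule: Ind_decompose_induct)
  case (summand M W N)
  have "mult_Ind V M = mult_Ind V (class_rep W) + mult_Ind V N" for V
    by (rule mult_Ind_direct_sum[OF summand.hyps(1) class_rep_Ind(1)[OF summand.hyps(2)] summand.hyps(3,4)])
  then have "{V. mult_Ind V M \<noteq> 0} \<subseteq> insert W {V. mult_Ind V N \<noteq> 0}"
    using mult_Ind_class_rep[OF summand.hyps(2)] by (auto split: if_splits)
  then show ?case using summand.IH finite_subset by blast
qed (simp add: mult_Ind_zero)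

lemma min_gens_le_sum_mult_Ind:
  assumes "M \<in> fg_modules R" "finite F" "{W. mult_Ind W M \<noteq> 0} \<subseteq> F"
  shows "min_gens R M \<le> (\<Sum>W\<in>F. mult_Ind W M * min_gens R (class_rep W))"
  using assms
proof (induction arbitrary: F rule: Ind_decompose_induct)
  case (zero Z)
  then show ?case using zero_module_min_gens(2) fg_modulesD by force
next
  case (summand M W N)
  note C = class_rep_Ind(1)[OF summand.hyps(2)]
  have m: "mult_Ind V M = (if V = W then 1 else 0) + mult_Ind V N" for V
    using mult_Ind_direct_sum[OF summand.hyps(1) C summand.hyps(3,4)] mult_Ind_class_rep[OF summand.hyps(2)] by simp
  have WF: "W \<in> F" using summand.prems(2) m[of W] by auto
  have "min_gens R M = min_gens R (direct_sum (class_rep W) N)"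
    using min_gens_isomorphic[OF summand.hyps(4)] summand.hyps(1,3) C module_direct_sum fg_modulesD by blast
  also have "\<dots> \<le> min_gens R (class_rep W) + min_gens R N"
    using fg_direct_sum(2) C summand.hyps(3) fg_modulesD(1) by blast
  also have "min_gens R N \<le> (\<Sum>V\<in>F. mult_Ind V N * min_gens R (class_rep V))"
    using summand.prems m by (intro summand.IH) (auto)
  also have "min_gens R (class_rep W) + (\<Sum>V\<in>F. mult_Ind V N * min_gens R (class_rep V)) =
      (\<Sum>V\<in>F. mult_Ind V M * min_gens R (class_rep V))"
    unfolding m add_mult_distrib sum.distrib using summand.prems(1) WF
    by (simp add: if_distrib[of "\<lambda>x. x * _"] sum.delta cong: if_cong)
  finally show ?case by simp
qed

lemma min_gens_Ind_pos: "W \<in> Ind R \<Longrightarrow> 1 \<le> min_gens R (class_rep W)"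
  using class_rep_Ind[of W] min_gens_0_zero_module[of R "class_rep W"] fg_modulesD(1)
  by (fastforce simp: indecomposable_def Suc_le_eq)

text \<open>The greatest common direct summand is collected one indecomposable at a time. It reduces
  a comparison of \<open>A\<close> and \<open>B\<close> to remainders that share no
  indecomposable.\<close>

lemma common_part:
  assumes "A \<in> fg_modules R" "B \<in> fg_modules R"
  shows "\<exists>C\<in>fg_modules R. \<exists>A'\<in>fg_modules R. \<exists>B'\<in>fg_modules R.
    module_isomorphic R A (direct_sum C A') \<and> module_isomorphic R B (direct_sum C B') \<and>
    (\<forall>W. mult_Ind W A' = 0 \<or> mult_Ind W B' = 0)"
  using assms
proof (induction "min_gens R A" arbitrary: A B rule: less_induct)
  case less
  note A = less.prems(1) and B = less.prems(2)
  show ?case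
  proof (cases "\<forall>W. mult_Ind W A = 0 \<or> mult_Ind W B = 0")
    case True
    obtain Z where Z: "Z \<in> fg_modules R" "zero_module Z" using ex_zero_fg_modules A by blast
    have "module_isomorphic R M (direct_sum Z M)" if "M \<in> fg_modules R" for M
      using direct_sum_swap_fg_modules[OF that Z(1)] module_isomorphic_direct_sum_zero Z that fg_modulesD by blast
    then show ?thesis using A B Z True by blast
  next
    case False
    then obtain W where W: "mult_Ind W A \<noteq> 0" "mult_Ind W B \<noteq> 0" by auto
    then have WI: "W \<in> Ind R" by (auto simp: mult_Ind_def split: if_splits)
    note V = class_rep_Ind[OF WI]
    have nz: "\<not> zero_module (class_rep W)" using V(2) by (simp add: indecomposable_def)
    obtain A1 B1 where AB: "A1 \<in> fg_modules R" "module_isomorphic R A (direct_sum (class_rep W) A1)"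
      "B1 \<in> fg_modules R" "module_isomorphic R B (direct_sum (class_rep W) B1)"
      using W multiplicity_of_eq_0_iff[OF V(1) nz A] multiplicity_of_eq_0_iff[OF V(1) nz B] WI
      by (auto simp: mult_Ind_def)
    have "min_gens R A1 < min_gens R A" by (rule summand_min_gens_less[OF A V(1) AB(1) nz AB(2)])
    from less.hyps[OF this AB(1,3)] obtain C A' B' where
      C: "C \<in> fg_modules R" "A' \<in> fg_modules R" "B' \<in> fg_modules R"
      "module_isomorphic R A1 (direct_sum C A')" "module_isomorphic R B1 (direct_sum C B')"
      "\<forall>W. mult_Ind W A' = 0 \<or> mult_Ind W B' = 0" by blast
    obtain C' where C': "C' \<in> fg_modules R" "module_isomorphic R C' (direct_sum (class_rep W) C)"
      using ex_direct_sum_fg_modules[OF V(1) C(1)] by blast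
    have "module_isomorphic R A (direct_sum C' A')"
      if A: "A \<in> fg_modules R" "A1 \<in> fg_modules R" "A' \<in> fg_modules R"
        "module_isomorphic R A (direct_sum (class_rep W) A1)" "module_isomorphic R A1 (direct_sum C A')"
      for A A1 A'
    proof -
      let ?W = "class_rep W"
      have mods: "module R ?W" "module R C" "module R A'" "module R C'"
        using V(1) C(1) A(3) C'(1) fg_modulesD by blast+
      have "module_isomorphic R A (direct_sum ?W (direct_sum C A'))"
        using module_isomorphic_trans[OF A(4) module_isomorphic_direct_sum_cong[OF module_isomorphic_refl A(5)]] .
      moreover have "module_isomorphic R (direct_sum ?W (direct_sum C A')) (direct_sum (direct_sum ?W C) A')"
        by (rule module_isomorphic_sym[OF module_direct_sum[OF module_direct_sum[OF mods(1,2)] mods(3)]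
              module_direct_sum[OF mods(1) module_direct_sum[OF mods(2,3)]]
              module_isomorphic_direct_sum_assoc])
      moreover have "module_isomorphic R (direct_sum ?W C) C'"
        by (rule module_isomorphic_sym[OF mods(4) module_direct_sum[OF mods(1,2)] C'(2)])
      then have "module_isomorphic R (direct_sum (direct_sum ?W C) A') (direct_sum C' A')"
        by (rule module_isomorphic_direct_sum_cong[OF _ module_isomorphic_refl])
      ultimately show ?thesis by (metis module_isomorphic_trans)
    qed
    from this[OF A AB(1) C(2) AB(2) C(4)] this[OF B AB(3) C(3) AB(4) C(5)]
    show ?thesis using C(2,3,6) C'(1) by blast
  qed
qed

lemma surj_num_direct_sum:
  assumes "U \<in> fg_modules R" "A \<in> fg_modules R" "B \<in> fg_modules R" "module_isomorphic R U (direct_sum A B)"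
    and N: "module R N" "\<not> zero_module N"
  shows "surj_num R N U \<le> surj_num R N A + min_gens R B"
    "surj_num R N A + surj_num R N B \<le> surj_num R N U"
proof -
  obtain i j p q where "biproduct R U A B i j p q"
    using isomorphic_imp_biproduct[OF assms(4)] assms fg_modulesD by metis
  then show "surj_num R N U \<le> surj_num R N A + min_gens R B"
    "surj_num R N A + surj_num R N B \<le> surj_num R N U"
    using surj_num_biproduct_le surj_num_biproduct_ge assms(1-3) N fg_modulesD(1) by blast+
qed

text \<open>With common part \<open>C\<close>, \<open>A\<close> exceeds \<open>C\<close> by at most
  \<open>min_gens R A'\<close>, and \<open>C\<close> is a summand of \<open>B\<close>. The
  difference of multiplicities is truncated, so the inequality includes monotonicity: the sum
  vanishes if no multiplicity of \<open>A\<close> exceeds that of \<open>B\<close>.\<close>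

lemma surj_num_mult_Ind_le:
  assumes A: "A \<in> fg_modules R" and B: "B \<in> fg_modules R" and N: "module R N" "\<not> zero_module N"
    and F: "finite F" "{W. mult_Ind W A \<noteq> 0} \<subseteq> F"
  shows "surj_num R N A \<le> surj_num R N B +
    (\<Sum>W\<in>F. (mult_Ind W A - mult_Ind W B) * min_gens R (class_rep W))"
proof -
  obtain C A' B' where C: "C \<in> fg_modules R" "A' \<in> fg_modules R" "B' \<in> fg_modules R"
      "module_isomorphic R A (direct_sum C A')" "module_isomorphic R B (direct_sum C B')"
      "\<forall>W. mult_Ind W A' = 0 \<or> mult_Ind W B' = 0" using common_part[OF A B] by blast
  \<comment> \<open>Since one of the two remainders has multiplicity zero at \<open>W\<close>, the
    common part has the minimum of both multiplicities, and truncated subtraction is exact.\<close>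
  have m: "mult_Ind W A' = mult_Ind W A - mult_Ind W B" for W
    using mult_Ind_direct_sum[OF A C(1,2,4), of W] mult_Ind_direct_sum[OF B C(1,3,5), of W] C(6)[rule_format, of W]
    by auto
  have "surj_num R N A \<le> surj_num R N C + min_gens R A'"
    by (rule surj_num_direct_sum(1)[OF A C(1,2,4) N])
  also have "surj_num R N C \<le> surj_num R N B"
    using surj_num_direct_sum(2)[OF B C(1,3,5) N] by simp
  also have "min_gens R A' \<le> (\<Sum>W\<in>F. mult_Ind W A' * min_gens R (class_rep W))"
    using F m by (intro min_gens_le_sum_mult_Ind[OF C(2) F(1)]) auto
  finally show ?thesis unfolding m by simp
qed

end

section \<open>Quotients of free abelian groups\<close>

definition frag_lin :: "('k \<Rightarrow> real) \<Rightarrow> ('k \<Rightarrow>\<^sub>0 int) \<Rightarrow> real"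
  where "frag_lin w y = (\<Sum>k\<in>Poly_Mapping.keys y. of_int (Poly_Mapping.lookup y k) * w k)"

lemma frag_lin_of [simp]: "frag_lin w (frag_of k) = w k"
  by (simp add: frag_lin_def)

lemma frag_lin_add: "frag_lin w (x + y) = frag_lin w x + frag_lin w y"
  unfolding frag_lin_def by (rule setsum_keys_plus_distrib) (auto simp: distrib_right)

lemma frag_lin_0 [simp]: "frag_lin w 0 = 0"
  by (simp add: frag_lin_def)

lemma frag_lin_minus: "frag_lin w (- x) = - frag_lin w x"
  using frag_lin_add[of w x "- x"] by simp

lemma frag_lin_diff: "frag_lin w (x - y) = frag_lin w x - frag_lin w y"
  using frag_lin_add[of w x "- y"] by (simp add: frag_lin_minus)

text \<open>The construction occurs twice: with the direct sum relations it gives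
  \<open>Theta_int R\<close>, and with the biadditivity relations it gives the real tensor
  product.\<close>

locale frag_quotient =
  fixes S :: "'k set" and gs :: "('k \<Rightarrow>\<^sub>0 int) set"
  assumes gs: "\<And>x. x \<in> gs \<Longrightarrow> Poly_Mapping.keys x \<subseteq> S"
begin

abbreviation "F \<equiv> free_Abelian_group S"
abbreviation "H \<equiv> generate F gs"

sublocale F: comm_group F
  by (rule abelian_free_Abelian_group)

lemma gs_carrier: "gs \<subseteq> carrier F"
  using gs by auto

lemma H_subgroup: "subgroup H F"
  by (rule F.generate_is_subgroup[OF gs_carrier])

lemma H_carrier: "x \<in> H \<Longrightarrow> Poly_Mapping.keys x \<subseteq> S"
  using subgroup.mem_carrier[OF H_subgroup] by simp

lemma H_diff: "x \<in> H \<Longrightarrow> y \<in> H \<Longrightarrow> x - y \<in> H"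
  using subgroup.m_closed[OF H_subgroup, of x "- y"] subgroup.m_inv_closed[OF H_subgroup, of y] H_carrier
  by simp

lemma H_uminus: "x \<in> H \<Longrightarrow> - x \<in> H"
  using subgroup.m_inv_closed[OF H_subgroup, of x] H_carrier by simp

lemma H_zero: "0 \<in> H"
  using subgroup.one_closed[OF H_subgroup] by simp

lemma mem_coset_iff: "y \<in> H #>\<^bsub>F\<^esub> x \<longleftrightarrow> y - x \<in> H"
  by (auto simp: r_coset_def) (metis add.commute diff_add_cancel)

lemma coset_eq_iff:
  "H #>\<^bsub>F\<^esub> x = H #>\<^bsub>F\<^esub> y \<longleftrightarrow> x - y \<in> H"
proof
  assume "H #>\<^bsub>F\<^esub> x = H #>\<^bsub>F\<^esub> y"
  moreover have "x \<in> H #>\<^bsub>F\<^esub> x" using H_zero by (simp add: mem_coset_iff)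
  ultimately show "x - y \<in> H" by (simp add: mem_coset_iff)
next
  assume xy: "x - y \<in> H"
  have "z - x \<in> H \<longleftrightarrow> z - y \<in> H" for z
    using H_diff[of "z - y" "x - y"] H_diff[of "z - x" "- (x - y)"] H_uminus[OF xy] xy by auto
  then show "H #>\<^bsub>F\<^esub> x = H #>\<^bsub>F\<^esub> y" by (auto simp: mem_coset_iff)
qed

lemma coset_gen: "x - y - z \<in> H \<Longrightarrow> H #>\<^bsub>F\<^esub> x = H #>\<^bsub>F\<^esub> (y + z)"
  by (simp add: coset_eq_iff diff_diff_eq)

lemma H_normal: "H \<lhd> F"
  by (rule F.subgroup_imp_normal[OF H_subgroup])

definition "Q = F Mod H"

sublocale Q: comm_group Q
  unfolding Q_def by (rule F.abelian_FactGroup[OF H_subgroup])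

lemma quotient_carrier: "Y \<in> carrier (Q) \<longleftrightarrow> (\<exists>x. Poly_Mapping.keys x \<subseteq> S \<and> Y = H #>\<^bsub>F\<^esub> x)"
  unfolding Q_def FactGroup_def RCOSETS_def by (auto, blast)

lemma coset_closed: "Poly_Mapping.keys x \<subseteq> S \<Longrightarrow> H #>\<^bsub>F\<^esub> x \<in> carrier (Q)"
  using quotient_carrier by blast

lemma quotient_one: "\<one>\<^bsub>Q\<^esub> = H #>\<^bsub>F\<^esub> 0"
proof -
  have "H #>\<^bsub>F\<^esub> 0 = H" by (auto simp: r_coset_def)
  then show ?thesis by (simp add: Q_def FactGroup_def)
qed

lemma quotient_mult:
  "\<lbrakk>Poly_Mapping.keys x \<subseteq> S; Poly_Mapping.keys y \<subseteq> S\<rbrakk> \<Longrightarrow>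
    (H #>\<^bsub>F\<^esub> x) \<otimes>\<^bsub>Q\<^esub> (H #>\<^bsub>F\<^esub> y) = H #>\<^bsub>F\<^esub> (x + y)"
  using normal.rcos_sum[OF H_normal, of x y] by (simp add: Q_def FactGroup_def)

lemma quotient_induct [consumes 1, case_names zero of diff]:
  assumes "Y \<in> carrier (Q)"
    and "P \<one>\<^bsub>Q\<^esub>" and "\<And>k. k \<in> S \<Longrightarrow> P (H #>\<^bsub>F\<^esub> frag_of k)"
    and diff: "\<And>Y Z. \<lbrakk>Y \<in> carrier (Q); Z \<in> carrier (Q); P Y; P Z\<rbrakk> \<Longrightarrow> P (Y \<otimes>\<^bsub>Q\<^esub> inv\<^bsub>Q\<^esub> Z)"
  shows "P Y"
proof -
  obtain x where x: "Poly_Mapping.keys x \<subseteq> S" "Y = H #>\<^bsub>F\<^esub> x" using assms(1) quotient_carrier by blast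
  have "P (H #>\<^bsub>F\<^esub> x)"
  proof (rule free_Abelian_group_induct[OF x(1), of "\<lambda>x. P (H #>\<^bsub>F\<^esub> x)"])
    show "P (H #>\<^bsub>F\<^esub> 0)" using assms(2) quotient_one by simp
    show "P (H #>\<^bsub>F\<^esub> frag_of k)" if "k \<in> S" for k by (rule assms(3)[OF that])
    fix x y assume xy: "Poly_Mapping.keys x \<subseteq> S" "Poly_Mapping.keys y \<subseteq> S" "P (H #>\<^bsub>F\<^esub> x)" "P (H #>\<^bsub>F\<^esub> y)"
    have xmy: "Poly_Mapping.keys (x - y) \<subseteq> S" using xy(1,2) keys_diff[of x y] by auto
    have "(H #>\<^bsub>F\<^esub> (x - y)) \<otimes>\<^bsub>Q\<^esub> (H #>\<^bsub>F\<^esub> y) = H #>\<^bsub>F\<^esub> x"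
      using quotient_mult[OF xmy xy(2)] by simp
    then have "H #>\<^bsub>F\<^esub> (x - y) = (H #>\<^bsub>F\<^esub> x) \<otimes>\<^bsub>Q\<^esub> inv\<^bsub>Q\<^esub> (H #>\<^bsub>F\<^esub> y)"
      using Q.inv_solve_right[OF coset_closed[OF xmy] coset_closed[OF xy(1)] coset_closed[OF xy(2)]] by simp
    then show "P (H #>\<^bsub>F\<^esub> (x - y))"
      using diff[OF coset_closed[OF xy(1)] coset_closed[OF xy(2)] xy(3,4)] by simp
  qed
  then show ?thesis using x by simp
qed

end

text \<open>A real functional on the quotient, evaluated at an arbitrary representative. By
  \<open>coset_val_coset\<close> the choice is immaterial once \<open>w\<close> vanishes on the
  generators of the relations.\<close>

definition coset_val :: "('k \<Rightarrow> real) \<Rightarrow> ('k \<Rightarrow>\<^sub>0 int) set \<Rightarrow> real"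
  where "coset_val w Y = frag_lin w (SOME y. y \<in> Y)"

context frag_quotient
begin

context
  fixes w assumes w: "\<And>x. x \<in> gs \<Longrightarrow> frag_lin w x = 0"
begin

lemma frag_lin_vanishes: "x \<in> H \<Longrightarrow> frag_lin w x = 0"
proof (induction rule: generate.induct)
  case (inv h)
  then show ?case using w gs by (simp add: frag_lin_minus)
qed (auto simp: w frag_lin_add)

lemma coset_val_coset: "coset_val w (H #>\<^bsub>F\<^esub> x) = frag_lin w x"
proof -
  have "x \<in> H #>\<^bsub>F\<^esub> x" using H_zero by (simp add: mem_coset_iff)
  then have "(SOME y. y \<in> H #>\<^bsub>F\<^esub> x) \<in> H #>\<^bsub>F\<^esub> x" by (rule someI)
  then have "frag_lin w ((SOME y. y \<in> H #>\<^bsub>F\<^esub> x) - x) = 0"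
    by (intro frag_lin_vanishes) (simp add: mem_coset_iff)
  then show ?thesis by (simp add: coset_val_def frag_lin_diff)
qed

lemma coset_val_mult:
  "\<lbrakk>Y \<in> carrier (Q); Z \<in> carrier (Q)\<rbrakk> \<Longrightarrow>
    coset_val w (Y \<otimes>\<^bsub>Q\<^esub> Z) = coset_val w Y + coset_val w Z"
  by (auto simp: quotient_carrier quotient_mult coset_val_coset frag_lin_add)

end

end

section \<open>Extension of scalars to the reals\<close>

locale real_extension = G?: comm_group G for G (structure)
begin

definition "tensor_gens =
    {frag_of (a + b, g) - frag_of (a, g) - frag_of (b, g) | (a :: real) b g. g \<in> carrier G} \<union>
     {frag_of (a, g \<otimes> h) - frag_of (a, g) - frag_of (a, h) | a g h.
        g \<in> carrier G \<and> h \<in> carrier G}"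

lemma tensor_gens_keys: "x \<in> tensor_gens \<Longrightarrow> Poly_Mapping.keys x \<subseteq> (UNIV :: real set) \<times> carrier G"
  unfolding tensor_gens_def
  by (auto dest!: subsetD[OF keys_diff])

sublocale T: frag_quotient "UNIV \<times> carrier G" tensor_gens
  by unfold_locales (rule tensor_gens_keys)

lemma tensor_rel_eq: "tensor_rel G = T.H" "tensor_free G = T.F"
  by (auto simp: tensor_rel_def tensor_free_def tensor_gens_def)

abbreviation "V \<equiv> real_tensor G"

lemma V_simps:
  "carrier V = carrier (T.Q)" "\<zero>\<^bsub>V\<^esub> = \<one>\<^bsub>T.Q\<^esub>"
  "x \<oplus>\<^bsub>V\<^esub> y = x \<otimes>\<^bsub>T.Q\<^esub> y"
  "c \<odot>\<^bsub>V\<^esub> Y = (\<Union>y\<in>Y. T.H #>\<^bsub>T.F\<^esub> frag_extend (\<lambda>(a, g). frag_of (c * a, g)) y)"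
  by (simp_all add: real_tensor_def tensor_rel_eq Let_def T.Q_def)

sublocale V: abelian_group V
proof (rule abelian_groupI)
  fix x assume "x \<in> carrier V"
  then show "\<exists>y\<in>carrier V. y \<oplus>\<^bsub>V\<^esub> x = \<zero>\<^bsub>V\<^esub>"
    unfolding V_simps by (intro bexI[of _ "inv\<^bsub>T.Q\<^esub> x"]) auto
qed (auto simp: V_simps T.Q.m_ac)

lemma V_a_inv:
  assumes "x \<in> carrier V"
  shows "\<ominus>\<^bsub>V\<^esub> x = inv\<^bsub>T.Q\<^esub> x"
  using assms by (intro V.minus_equality) (auto simp: V_simps)

text \<open>Scaling the real component maps each biadditivity relation to another one, so all cosets
  in the union that defines \<open>smult\<close> coincide.\<close>

lemma scale_H:
  "h \<in> T.H \<Longrightarrow> frag_extend (\<lambda>(a, g). frag_of (c * a, g)) h \<in> T.H"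
proof (induction rule: generate.induct)
  case one
  then show ?case using T.H_zero by simp
next
  case (incl h)
  then consider a b g where "g \<in> carrier G" "h = frag_of (a + b, g) - frag_of (a, g) - frag_of (b, g)"
    | a g g' where "g \<in> carrier G" "g' \<in> carrier G" "h = frag_of (a, g \<otimes> g') - frag_of (a, g) - frag_of (a, g')"
    unfolding tensor_gens_def by blast
  then show ?case
  proof cases
    case 1
    then have "frag_extend (\<lambda>(a, g). frag_of (c * a, g)) h \<in> tensor_gens"
      unfolding tensor_gens_def by (force simp: frag_extend_diff distrib_left)
    then show ?thesis by (rule generate.incl)
  next
    case 2
    then have "frag_extend (\<lambda>(a, g). frag_of (c * a, g)) h \<in> tensor_gens"
      unfolding tensor_gens_def by (force simp: frag_extend_diff)
    then show ?thesis by (rule generate.incl)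
  qed
next
  case (inv h)
  then consider a b g where "g \<in> carrier G" "h = frag_of (a + b, g) - frag_of (a, g) - frag_of (b, g)"
    | a g g' where "g \<in> carrier G" "g' \<in> carrier G" "h = frag_of (a, g \<otimes> g') - frag_of (a, g) - frag_of (a, g')"
    unfolding tensor_gens_def by blast
  then have "frag_extend (\<lambda>(a, g). frag_of (c * a, g)) h \<in> tensor_gens"
  proof cases
    case 1
    then show ?thesis unfolding tensor_gens_def by (force simp: frag_extend_diff distrib_left)
  next
    case 2
    then show ?thesis unfolding tensor_gens_def by (force simp: frag_extend_diff)
  qed
  then have "frag_extend (\<lambda>(a, g). frag_of (c * a, g)) h \<in> T.H" by (rule generate.incl)
  then show ?case using T.H_uminus inv tensor_gens_keys by (simp add: frag_extend_minus)
next
  case (eng h1 h2)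
  then show ?case using subgroup.m_closed[OF T.H_subgroup eng.IH] by (simp add: frag_extend_add)
qed

lemma smult_coset:
  "c \<odot>\<^bsub>V\<^esub> (T.H #>\<^bsub>T.F\<^esub> x) = T.H #>\<^bsub>T.F\<^esub> frag_extend (\<lambda>(a, g). frag_of (c * a, g)) x"
proof -
  have "T.H #>\<^bsub>T.F\<^esub> frag_extend (\<lambda>(a, g). frag_of (c * a, g)) y =
      T.H #>\<^bsub>T.F\<^esub> frag_extend (\<lambda>(a, g). frag_of (c * a, g)) x" if "y \<in> T.H #>\<^bsub>T.F\<^esub> x" for y
    using scale_H[of "y - x" c] that by (simp add: T.mem_coset_iff T.coset_eq_iff frag_extend_diff)
  moreover have "x \<in> T.H #>\<^bsub>T.F\<^esub> x" using T.H_zero by (simp add: T.mem_coset_iff)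
  ultimately show ?thesis unfolding V_simps by blast
qed

lemma pure_tensor_eq: "pure_tensor G a g = T.H #>\<^bsub>T.F\<^esub> frag_of (a, g)"
  by (simp add: pure_tensor_def tensor_rel_eq)

lemma pure_closed [simp]: "g \<in> carrier G \<Longrightarrow> pure_tensor G a g \<in> carrier V"
  unfolding pure_tensor_eq V_simps by (rule T.coset_closed) simp

lemma smult_pure: "c \<odot>\<^bsub>V\<^esub> pure_tensor G a g = pure_tensor G (c * a) g"
  by (simp add: pure_tensor_eq smult_coset)

lemma smult_V_closed [simp]: "x \<in> carrier V \<Longrightarrow> c \<odot>\<^bsub>V\<^esub> x \<in> carrier V"
proof -
  assume "x \<in> carrier V"
  then obtain y where y: "Poly_Mapping.keys y \<subseteq> UNIV \<times> carrier G" "x = T.H #>\<^bsub>T.F\<^esub> y"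
    by (auto simp: V_simps T.quotient_carrier)
  have "Poly_Mapping.keys (frag_extend (\<lambda>(a, g). frag_of (c * a, g)) y) \<subseteq> UNIV \<times> carrier G"
    using y(1) keys_frag_extend[of "\<lambda>(a, g). frag_of (c * a, g)" y] by fastforce
  then show ?thesis using y(2) smult_coset T.coset_closed V_simps(1) by simp
qed

lemma pure_add_left:
  assumes "g \<in> carrier G"
  shows "pure_tensor G (a + b) g = pure_tensor G a g \<oplus>\<^bsub>V\<^esub> pure_tensor G b g"
proof -
  have "frag_of (a + b, g) - frag_of (a, g) - frag_of (b, g) \<in> T.H"
    by (rule generate.incl) (use assms in \<open>auto simp: tensor_gens_def\<close>)
  then show ?thesis
    using T.coset_gen T.quotient_mult[of "frag_of (a, g)" "frag_of (b, g)"] assms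
    by (simp add: pure_tensor_eq V_simps)
qed

lemma pure_add_right:
  assumes "g \<in> carrier G" "h \<in> carrier G"
  shows "pure_tensor G a (g \<otimes> h) = pure_tensor G a g \<oplus>\<^bsub>V\<^esub> pure_tensor G a h"
proof -
  have "frag_of (a, g \<otimes> h) - frag_of (a, g) - frag_of (a, h) \<in> T.H"
    by (rule generate.incl) (use assms in \<open>auto simp: tensor_gens_def\<close>)
  then show ?thesis
    using T.coset_gen T.quotient_mult[of "frag_of (a, g)" "frag_of (a, h)"] assms
    by (simp add: pure_tensor_eq V_simps)
qed

lemma pure_zero [simp]: "g \<in> carrier G \<Longrightarrow> pure_tensor G 0 g = \<zero>\<^bsub>V\<^esub>"
  using pure_add_left[of g 0 0] pure_closed[of g 0] by (metis V.add.l_cancel_one add_0)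

lemma pure_one [simp]: "pure_tensor G a \<one> = \<zero>\<^bsub>V\<^esub>"
  using pure_add_right[of \<one> \<one> a] pure_closed[of \<one> a] by (metis G.l_one G.one_closed V.add.l_cancel_one)

lemma pure_minus: "g \<in> carrier G \<Longrightarrow> pure_tensor G (- a) g = \<ominus>\<^bsub>V\<^esub> pure_tensor G a g"
  using pure_add_left[of g "- a" a] by (simp add: V.minus_equality)

lemma pure_inv: "g \<in> carrier G \<Longrightarrow> pure_tensor G a (inv g) = \<ominus>\<^bsub>V\<^esub> pure_tensor G a g"
  using pure_add_right[of "inv g" g a] by (simp add: V.minus_equality)

lemma V_induct [consumes 1, case_names zero pure minus]:
  assumes "\<alpha> \<in> carrier V" and "P \<zero>\<^bsub>V\<^esub>" and "\<And>a g. g \<in> carrier G \<Longrightarrow> P (pure_tensor G a g)"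
    and "\<And>x y. \<lbrakk>x \<in> carrier V; y \<in> carrier V; P x; P y\<rbrakk> \<Longrightarrow> P (x \<ominus>\<^bsub>V\<^esub> y)"
  shows "P \<alpha>"
proof -
  have "\<alpha> \<in> carrier (T.Q)" using assms(1) V_simps by simp
  then show ?thesis
  proof (induction rule: T.quotient_induct)
    case zero
    then show ?case using assms(2) V_simps by simp
  next
    case (of k)
    then show ?case using assms(3) by (cases k) (auto simp: pure_tensor_eq)
  next
    case (diff Y Z)
    then show ?case
      using assms(4)[of Y Z] V_a_inv[of Z] by (simp add: V_simps a_minus_def)
  qed
qed

text \<open>The linear extension of an additive \<open>\<phi>\<close> through the universal
  property: the tensor of \<open>a\<close> and \<open>g\<close> goes to \<open>a * \<phi> g\<close>.
  Functionals of this kind yield the coordinates on Theta.\<close>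

definition tensor_lin :: "(_ \<Rightarrow> real) \<Rightarrow> _ \<Rightarrow> real"
  where "tensor_lin \<phi> = coset_val (\<lambda>(a, g). a * \<phi> g)"

context
  fixes \<phi> :: "_ \<Rightarrow> real" assumes \<phi>: "\<And>g h. \<lbrakk>g \<in> carrier G; h \<in> carrier G\<rbrakk> \<Longrightarrow> \<phi> (g \<otimes> h) = \<phi> g + \<phi> h"
begin

lemma tensor_gens_vanish: "x \<in> tensor_gens \<Longrightarrow> frag_lin (\<lambda>(a, g). a * \<phi> g) x = 0"
  unfolding tensor_gens_def using \<phi> by (auto simp: frag_lin_diff distrib_left distrib_right)

lemmas tensor_lin_coset = T.coset_val_coset[OF tensor_gens_vanish, folded tensor_lin_def]

lemma tensor_lin_pure: "tensor_lin \<phi> (pure_tensor G a g) = a * \<phi> g"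
  by (simp add: pure_tensor_eq tensor_lin_coset)

lemma tensor_lin_add:
  "\<lbrakk>x \<in> carrier V; y \<in> carrier V\<rbrakk> \<Longrightarrow> tensor_lin \<phi> (x \<oplus>\<^bsub>V\<^esub> y) = tensor_lin \<phi> x + tensor_lin \<phi> y"
  unfolding V_simps tensor_lin_def by (rule T.coset_val_mult[OF tensor_gens_vanish])

lemma tensor_lin_zero: "tensor_lin \<phi> \<zero>\<^bsub>V\<^esub> = 0"
  using tensor_lin_add[of "\<zero>\<^bsub>V\<^esub>" "\<zero>\<^bsub>V\<^esub>"] by simp

lemma tensor_lin_minus:
  "\<lbrakk>x \<in> carrier V; y \<in> carrier V\<rbrakk> \<Longrightarrow> tensor_lin \<phi> (x \<ominus>\<^bsub>V\<^esub> y) = tensor_lin \<phi> x - tensor_lin \<phi> y"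
  using tensor_lin_add[of "x \<ominus>\<^bsub>V\<^esub> y" y] by (simp add: a_minus_def V.a_assoc V.l_neg)

lemma tensor_lin_smult:
  assumes "x \<in> carrier V"
  shows "tensor_lin \<phi> (c \<odot>\<^bsub>V\<^esub> x) = c * tensor_lin \<phi> x"
proof -
  have *: "frag_lin (\<lambda>(a, g). a * \<phi> g) (frag_extend (\<lambda>(a, g). frag_of (c * a, g)) y) =
      c * frag_lin (\<lambda>(a, g). a * \<phi> g) y" for y :: "(real \<times> _) \<Rightarrow>\<^sub>0 int"
    using subset_UNIV
    by (induction y rule: frag_induction) (auto simp: frag_extend_diff frag_lin_diff algebra_simps)
  show ?thesis
    using assms by (auto simp: V_simps(1) T.quotient_carrier smult_coset tensor_lin_coset *)
qed

lemma tensor_lin_finsum: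
  assumes "finite A" "f \<in> A \<rightarrow> carrier V"
  shows "tensor_lin \<phi> (\<Oplus>\<^bsub>V\<^esub>i\<in>A. f i) = (\<Sum>i\<in>A. tensor_lin \<phi> (f i))"
  using assms by (induction A rule: finite_induct) (auto simp: tensor_lin_zero tensor_lin_add)

end

end

section \<open>Coordinates on Theta\<close>

lemma (in abelian_group) uminus_zero: "\<ominus> \<zero> = \<zero>"
  by (rule minus_equality) simp_all

lemma (in abelian_group) minus_plus_minus:
  assumes "a \<in> carrier G" "b \<in> carrier G" "c \<in> carrier G" "d \<in> carrier G"
  shows "(a \<ominus> b) \<oplus> (c \<ominus> d) = (a \<oplus> c) \<ominus> (b \<oplus> d)"
  using assms by (simp add: a_minus_def minus_add a_ac)

context henselian_local_ring
begin

definition "theta_gens = {frag_of M - frag_of M1 - frag_of M2 | M M1 M2.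
       M \<in> fg_modules R \<and> M1 \<in> fg_modules R \<and> M2 \<in> fg_modules R \<and>
       module_isomorphic R M (direct_sum M1 M2)}"

lemma theta_gens_keys: "x \<in> theta_gens \<Longrightarrow> Poly_Mapping.keys x \<subseteq> fg_modules R"
  unfolding theta_gens_def by (auto dest!: subsetD[OF keys_diff])

sublocale TI: frag_quotient "fg_modules R" theta_gens
  by unfold_locales (rule theta_gens_keys)

lemma Theta_int_eq: "theta_rel R = TI.H" "Theta_int R = TI.Q"
  unfolding Theta_int_def TI.Q_def by (simp_all add: theta_rel_def theta_gens_def)

sublocale RE: real_extension TI.Q ..

lemma Theta_eq: "Theta R = RE.V"
  by (simp add: Theta_def Theta_int_eq)

definition "cls M = TI.H #>\<^bsub>TI.F\<^esub> frag_of M"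

lemma cls_closed [simp]: "M \<in> fg_modules R \<Longrightarrow> cls M \<in> carrier TI.Q"
  unfolding cls_def by (rule TI.coset_closed) simp

lemma cls_direct_sum:
  assumes "U \<in> fg_modules R" "A \<in> fg_modules R" "B \<in> fg_modules R" "module_isomorphic R U (direct_sum A B)"
  shows "cls U = cls A \<otimes>\<^bsub>TI.Q\<^esub> cls B"
proof -
  have "frag_of U - frag_of A - frag_of B \<in> TI.H"
    by (rule generate.incl) (use assms in \<open>auto simp: theta_gens_def\<close>)
  then show ?thesis
    using TI.coset_gen TI.quotient_mult[of "frag_of A" "frag_of B"] assms by (simp add: cls_def)
qed

lemma cls_zero:
  assumes "Z \<in> fg_modules R" "zero_module Z"
  shows "cls Z = \<one>\<^bsub>TI.Q\<^esub>"
proof -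
  have "module_isomorphic R Z (direct_sum Z Z)"
    using module_isomorphic_direct_sum_zero assms fg_modulesD by blast
  from cls_direct_sum[OF assms(1,1,1) this] show ?thesis
    using cls_closed[OF assms(1)] by (metis TI.Q.l_cancel_one)
qed

lemma cls_isomorphic:
  assumes M: "M \<in> fg_modules R" and N: "N \<in> fg_modules R" and iso: "module_isomorphic R M N"
  shows "cls M = cls N"
proof -
  obtain Z where Z: "Z \<in> fg_modules R" "zero_module Z" using ex_zero_fg_modules M by blast
  have "module_isomorphic R N (direct_sum N Z)"
    using module_isomorphic_direct_sum_zero N Z fg_modulesD by blast
  then have "module_isomorphic R M (direct_sum N Z)" by (rule module_isomorphic_trans[OF iso])
  from cls_direct_sum[OF M N Z(1) this] show ?thesis using cls_zero[OF Z] N by simp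
qed

lemma theta_class_eq: "theta_class R M = pure_tensor TI.Q 1 (cls (module_copy R M))"
  by (simp add: theta_class_def Theta_int_eq cls_def)

lemma theta_class_closed: "fg_module R M \<Longrightarrow> theta_class R M \<in> carrier RE.V"
  by (simp add: theta_class_eq module_copy_mem)

lemma theta_class_fg_modules:
  assumes "M \<in> fg_modules R"
  shows "theta_class R M = pure_tensor TI.Q 1 (cls M)"
  using cls_isomorphic[OF assms module_copy_mem module_copy_isomorphic] fg_modulesD(1)[OF assms]
  by (simp add: theta_class_eq)

lemma smult_theta_class_rep:
  "W \<in> Ind R \<Longrightarrow> c \<odot>\<^bsub>RE.V\<^esub> theta_class R (class_rep W) = pure_tensor TI.Q c (cls (class_rep W))"
  using theta_class_fg_modules[OF class_rep_Ind(1)] RE.smult_pure by simp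

definition "int_mult W = coset_val (\<lambda>M. real (mult_Ind W M))"

text \<open>The Krull--Schmidt theorem enters Theta here: multiplicities are additive on direct
  sums, so they descend to the quotient by the relations.\<close>

lemma theta_gens_vanish: "x \<in> theta_gens \<Longrightarrow> frag_lin (\<lambda>M. real (mult_Ind W M)) x = 0"
  unfolding theta_gens_def by (auto simp: frag_lin_diff mult_Ind_direct_sum)

lemma int_mult_cls: "int_mult W (cls M) = real (mult_Ind W M)"
  by (simp add: int_mult_def cls_def TI.coset_val_coset[OF theta_gens_vanish])

lemma int_mult_mult:
  "\<lbrakk>g \<in> carrier TI.Q; h \<in> carrier TI.Q\<rbrakk> \<Longrightarrow> int_mult W (g \<otimes>\<^bsub>TI.Q\<^esub> h) = int_mult W g + int_mult W h"
  unfolding int_mult_def by (rule TI.coset_val_mult[OF theta_gens_vanish])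

definition "coeff_Ind W = RE.tensor_lin (int_mult W)"

lemmas coeff_Ind_pure = RE.tensor_lin_pure[where \<phi> = "int_mult W" for W, OF int_mult_mult, folded coeff_Ind_def]
  and coeff_Ind_add = RE.tensor_lin_add[where \<phi> = "int_mult W" for W, OF int_mult_mult, folded coeff_Ind_def]
  and coeff_Ind_minus = RE.tensor_lin_minus[where \<phi> = "int_mult W" for W, OF int_mult_mult, folded coeff_Ind_def]
  and coeff_Ind_smult = RE.tensor_lin_smult[where \<phi> = "int_mult W" for W, OF int_mult_mult, folded coeff_Ind_def]
  and coeff_Ind_finsum = RE.tensor_lin_finsum[where \<phi> = "int_mult W" for W, OF int_mult_mult, folded coeff_Ind_def]

lemma coeff_Ind_theta_class:
  "coeff_Ind W (theta_class R M) = real (mult_Ind W (module_copy R M))"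
  by (simp add: theta_class_eq coeff_Ind_pure int_mult_cls)

abbreviation "Ind_sum c A \<equiv> (\<Oplus>\<^bsub>RE.V\<^esub>W\<in>A. pure_tensor TI.Q (c W) (cls (class_rep W)))"

lemma Ind_sum_closed: "A \<subseteq> Ind R \<Longrightarrow> Ind_sum c A \<in> carrier RE.V"
  by (rule RE.V.finsum_closed) (auto simp: class_rep_Ind(1) subsetD)

text \<open>The functionals \<open>coeff_Ind W\<close> are dual to the classes of indecomposables,
  which expresses the linear independence of these classes.\<close>

lemma coeff_Ind_Ind_sum:
  assumes "finite A" "A \<subseteq> Ind R"
  shows "coeff_Ind W (Ind_sum c A) = (if W \<in> A then c W else 0)"
proof -
  have "coeff_Ind W (Ind_sum c A) = (\<Sum>V\<in>A. c V * real (mult_Ind W (class_rep V)))"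
    using assms by (subst coeff_Ind_finsum) (auto simp: coeff_Ind_pure int_mult_cls class_rep_Ind(1) subsetD)
  also have "\<dots> = (\<Sum>V\<in>A. if W = V then c V else 0)"
    using assms(2) by (intro sum.cong) (auto simp: mult_Ind_class_rep subsetD)
  also have "\<dots> = (if W \<in> A then c W else 0)" using assms(1) by (simp add: sum.delta)
  finally show ?thesis .
qed

lemma Ind_sum_superset:
  assumes "finite B" "A \<subseteq> B" "B \<subseteq> Ind R" "\<And>W. W \<in> B - A \<Longrightarrow> c W = 0"
  shows "Ind_sum c A = Ind_sum c B"
  using assms
  by (intro RE.V.add.finprod_mono_neutral_cong_left) (auto simp: class_rep_Ind(1) subsetD)

lemma Ind_sum_minus:
  assumes "finite A" "A \<subseteq> Ind R"
  shows "Ind_sum (\<lambda>W. c W - c' W) A = Ind_sum c A \<ominus>\<^bsub>RE.V\<^esub> Ind_sum c' A"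
  using assms
proof (induction A rule: finite_induct)
  case (insert V A)
  note cl = class_rep_Ind(1)[THEN cls_closed]
  have f: "(\<lambda>W. pure_tensor TI.Q (c W) (cls (class_rep W))) \<in> A \<rightarrow> carrier RE.V" for c
    using insert.prems cl by auto
  have p: "pure_tensor TI.Q (c V - c' V) (cls (class_rep V)) =
      pure_tensor TI.Q (c V) (cls (class_rep V)) \<ominus>\<^bsub>RE.V\<^esub> pure_tensor TI.Q (c' V) (cls (class_rep V))"
    using RE.pure_add_left[of "cls (class_rep V)" "c V" "- c' V"] RE.pure_minus insert.prems cl
    by (simp add: a_minus_def)
  have s: "Ind_sum c A \<in> carrier RE.V" "Ind_sum c' A \<in> carrier RE.V"
    using Ind_sum_closed insert.prems by auto
  have V: "pure_tensor TI.Q (c V) (cls (class_rep V)) \<in> carrier RE.V" for c :: "_ \<Rightarrow> real"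
    using insert.prems cl by simp
  have ins: "Ind_sum c (insert V A) = pure_tensor TI.Q (c V) (cls (class_rep V)) \<oplus>\<^bsub>RE.V\<^esub> Ind_sum c A" for c
    by (rule RE.V.finsum_insert[OF insert.hyps f V])
  have IH: "Ind_sum (\<lambda>W. c W - c' W) A = Ind_sum c A \<ominus>\<^bsub>RE.V\<^esub> Ind_sum c' A"
    using insert.IH insert.prems by simp
  show ?case
    unfolding ins IH p by (rule RE.V.minus_plus_minus[OF V V s])
qed (simp add: a_minus_def RE.V.uminus_zero)

text \<open>Combinations of classes of indecomposables are closed under differences, so by induction
  over both quotients only pure tensors with the class of a single module remain. These are handled
  by splitting off one indecomposable at a time.\<close>

lemma Theta_spanned:
  assumes "\<alpha> \<in> carrier RE.V"
  shows "\<exists>A c. finite A \<and> A \<subseteq> Ind R \<and> \<alpha> = Ind_sum c A"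
proof -
  let ?P = "\<lambda>\<alpha>. \<exists>A c. finite A \<and> A \<subseteq> Ind R \<and> \<alpha> = Ind_sum c A"
  have zero: "?P \<zero>\<^bsub>RE.V\<^esub>" by (intro exI[of _ "{}"]) simp
  have minus: "?P (x \<ominus>\<^bsub>RE.V\<^esub> y)" if x: "?P x" and y: "?P y" for x y
  proof -
    obtain A c where A: "finite A" "A \<subseteq> Ind R" "x = Ind_sum c A" using x by blast
    obtain B d where B: "finite B" "B \<subseteq> Ind R" "y = Ind_sum d B" using y by blast
    \<comment> \<open>Coefficients outside the index sets are arbitrary, so they are set to zero
      before both sums are extended to \<open>A \<union> B\<close>.\<close>
    let ?c = "\<lambda>W. if W \<in> A then c W else 0" and ?d = "\<lambda>W. if W \<in> B then d W else 0"
    have "x = Ind_sum ?c A"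
      unfolding A(3) using A by (intro RE.V.finsum_cong') (auto simp: class_rep_Ind(1) subsetD)
    also have "\<dots> = Ind_sum ?c (A \<union> B)" using A B by (intro Ind_sum_superset) auto
    finally have x: "x = Ind_sum ?c (A \<union> B)" .
    have "y = Ind_sum ?d B"
      unfolding B(3) using B by (intro RE.V.finsum_cong') (auto simp: class_rep_Ind(1) subsetD)
    also have "\<dots> = Ind_sum ?d (A \<union> B)" using A B by (intro Ind_sum_superset) auto
    finally have y: "y = Ind_sum ?d (A \<union> B)" .
    have "x \<ominus>\<^bsub>RE.V\<^esub> y = Ind_sum (\<lambda>W. ?c W - ?d W) (A \<union> B)"
      unfolding x y using A B by (intro Ind_sum_minus[symmetric]) auto
    then show ?thesis using A B by (intro exI[of _ "A \<union> B"] exI[of _ "\<lambda>W. ?c W - ?d W"]) auto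
  qed
  have closed: "x \<in> carrier RE.V" if "?P x" for x using that Ind_sum_closed by blast
  have plus: "?P (x \<oplus>\<^bsub>RE.V\<^esub> y)" if "?P x" "?P y" for x y
  proof -
    have "x \<oplus>\<^bsub>RE.V\<^esub> y = x \<ominus>\<^bsub>RE.V\<^esub> (\<zero>\<^bsub>RE.V\<^esub> \<ominus>\<^bsub>RE.V\<^esub> y)"
      using closed[OF that(1)] closed[OF that(2)] by (simp add: a_minus_def)
    then show ?thesis using minus[OF that(1) minus[OF zero that(2)]] by simp
  qed
  have mods: "?P (pure_tensor TI.Q a (cls M))" if "M \<in> fg_modules R" for a M
    using that
  proof (induction rule: Ind_decompose_induct)
    case (zero Z)
    then show ?case using \<open>?P \<zero>\<^bsub>RE.V\<^esub>\<close> cls_zero by simp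
  next
    case (summand M W N)
    note C = class_rep_Ind(1)[OF summand.hyps(2)]
    have "pure_tensor TI.Q a (cls M) =
        pure_tensor TI.Q a (cls (class_rep W)) \<oplus>\<^bsub>RE.V\<^esub> pure_tensor TI.Q a (cls N)"
      using cls_direct_sum[OF summand.hyps(1) C summand.hyps(3,4)] RE.pure_add_right C summand.hyps(3) by simp
    moreover have "?P (pure_tensor TI.Q a (cls (class_rep W)))"
      using summand.hyps(2) C by (intro exI[of _ "{W}"] exI[of _ "\<lambda>_. a"]) simp
    ultimately show ?case using plus summand.IH by simp
  qed
  have pure: "?P (pure_tensor TI.Q a g)" if "g \<in> carrier TI.Q" for a g
    using that
  proof (induction rule: TI.quotient_induct)
    case zero
    then show ?case using \<open>?P \<zero>\<^bsub>RE.V\<^esub>\<close> by simp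
  next
    case (of k)
    then show ?case using mods unfolding cls_def by blast
  next
    case (diff Y Z)
    then have "pure_tensor TI.Q a (Y \<otimes>\<^bsub>TI.Q\<^esub> inv\<^bsub>TI.Q\<^esub> Z) = pure_tensor TI.Q a Y \<ominus>\<^bsub>RE.V\<^esub> pure_tensor TI.Q a Z"
      by (simp add: RE.pure_add_right RE.pure_inv a_minus_def)
    then show ?case using minus[OF diff.IH] by simp
  qed
  show ?thesis
    using assms
  proof (induction rule: RE.V_induct)
    case (minus x y)
    show ?case by (rule \<open>\<And>x y. \<lbrakk>?P x; ?P y\<rbrakk> \<Longrightarrow> ?P (x \<ominus>\<^bsub>RE.V\<^esub> y)\<close>[OF minus.IH])
  qed (rule zero, rule pure)
qed

text \<open>Spanning gives the existence, and the dual functionals give the uniqueness, that the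
  \<open>THE\<close> in \<open>theta_coeff\<close> demands.\<close>

lemma
  assumes "\<alpha> \<in> carrier RE.V"
  shows theta_coeff_eq: "theta_coeff R \<alpha> = (\<lambda>W. if W \<in> Ind R then coeff_Ind W \<alpha> else 0)"
    and theta_coeff_finite: "finite {W. theta_coeff R \<alpha> W \<noteq> 0}"
    and theta_coeff_expansion: "\<alpha> = Ind_sum (theta_coeff R \<alpha>) {W. theta_coeff R \<alpha> W \<noteq> 0}"
proof -
  let ?c = "\<lambda>W. if W \<in> Ind R then coeff_Ind W \<alpha> else 0"
  let ?P = "\<lambda>c. {W. c W \<noteq> 0} \<subseteq> Ind R \<and> finite {W. c W \<noteq> 0} \<and>
    \<alpha> = (\<Oplus>\<^bsub>Theta R\<^esub>W\<in>{W. c W \<noteq> 0}. c W \<odot>\<^bsub>Theta R\<^esub> theta_class R (class_rep W))"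
  have sum_eq: "(\<Oplus>\<^bsub>Theta R\<^esub>W\<in>A. c W \<odot>\<^bsub>Theta R\<^esub> theta_class R (class_rep W)) = Ind_sum c A"
    if "A \<subseteq> Ind R" for c A
    unfolding Theta_eq using that
    by (intro RE.V.finsum_cong') (auto simp: smult_theta_class_rep class_rep_Ind(1) subsetD)
  obtain A c where A: "finite A" "A \<subseteq> Ind R" "\<alpha> = Ind_sum c A" using Theta_spanned[OF assms] by blast
  have c: "?c W = (if W \<in> A then c W else 0)" for W
    using coeff_Ind_Ind_sum[OF A(1,2)] A(2,3) by auto
  have sub: "{W. ?c W \<noteq> 0} \<subseteq> A" using c by (auto split: if_splits)
  have fin: "finite {W. ?c W \<noteq> 0}" by (rule finite_subset[OF sub A(1)])
  have "?c W = c W" if "W \<in> A" for W using c[of W] that by simp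
  then have "Ind_sum c A = Ind_sum ?c A"
    using A(2) by (intro RE.V.finsum_cong'[OF refl]) (auto simp: class_rep_Ind(1) subsetD)
  then have "\<alpha> = Ind_sum ?c A" by (rule trans[OF A(3)])
  also have "\<dots> = Ind_sum ?c {W. ?c W \<noteq> 0}"
    by (rule Ind_sum_superset[symmetric, OF A(1) sub A(2)]) auto
  finally have exp: "\<alpha> = Ind_sum ?c {W. ?c W \<noteq> 0}" .
  have I: "{W. ?c W \<noteq> 0} \<subseteq> Ind R" by auto
  have P: "?P ?c" using I fin exp sum_eq[OF I, of ?c] by simp
  have uniq: "c' = ?c" if "?P c'" for c'
  proof
    fix W
    have "\<alpha> = Ind_sum c' {W. c' W \<noteq> 0}" using that sum_eq[of "{W. c' W \<noteq> 0}" c'] by simp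
    then have "coeff_Ind W \<alpha> = c' W" using coeff_Ind_Ind_sum[of "{W. c' W \<noteq> 0}" W c'] that by auto
    then show "c' W = ?c W" using that by auto
  qed
  show eq: "theta_coeff R \<alpha> = ?c"
    unfolding theta_coeff_def using P uniq by (rule the_equality)
  show "finite {W. theta_coeff R \<alpha> W \<noteq> 0}" unfolding eq by (rule fin)
  show "\<alpha> = Ind_sum (theta_coeff R \<alpha>) {W. theta_coeff R \<alpha> W \<noteq> 0}" unfolding eq by (rule exp)
qed

lemma Theta_eqI:
  assumes "\<alpha> \<in> carrier RE.V" "\<beta> \<in> carrier RE.V" "\<And>W. W \<in> Ind R \<Longrightarrow> coeff_Ind W \<alpha> = coeff_Ind W \<beta>"
  shows "\<alpha> = \<beta>"
proof -
  have eq: "theta_coeff R \<alpha> = theta_coeff R \<beta>" using assms theta_coeff_eq by auto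
  have "\<alpha> = Ind_sum (theta_coeff R \<alpha>) {W. theta_coeff R \<alpha> W \<noteq> 0}"
    by (rule theta_coeff_expansion[OF assms(1)])
  also have "\<dots> = Ind_sum (theta_coeff R \<beta>) {W. theta_coeff R \<beta> W \<noteq> 0}" unfolding eq ..
  also have "\<dots> = \<beta>" by (rule theta_coeff_expansion[OF assms(2), symmetric])
  finally show ?thesis .
qed

lemma coeff_Ind_outside: "\<lbrakk>\<alpha> \<in> carrier RE.V; W \<notin> Ind R\<rbrakk> \<Longrightarrow> theta_coeff R \<alpha> W = 0"
  by (simp add: theta_coeff_eq)

text \<open>The zero module, available in a nonempty universe, starts the construction; copies of
  the class representatives are then added one at a time.\<close>

lemma ex_module_mult_Ind:
  assumes "fg_modules R \<noteq> {}" "finite A" "A \<subseteq> Ind R"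
  shows "\<exists>M\<in>fg_modules R. \<forall>W. mult_Ind W M = (if W \<in> A then n W else 0)"
  using assms(2,3)
proof (induction A rule: finite_induct)
  case empty
  obtain Z where "Z \<in> fg_modules R" "zero_module Z" using ex_zero_fg_modules assms(1) by blast
  then show ?case using mult_Ind_zero by auto
next
  case (insert V A)
  then obtain M where M: "M \<in> fg_modules R" "\<And>W. mult_Ind W M = (if W \<in> A then n W else 0)" by auto
  have V: "V \<in> Ind R" using insert.prems by auto
  have "\<exists>M\<in>fg_modules R. \<forall>W. mult_Ind W M = (if W \<in> A then n W else 0) + (if W = V then k else 0)" for k
  proof (induction k)
    case 0
    show ?case using M by (intro bexI[of _ M]) auto
  next
    case (Suc k)
    then obtain N where N: "N \<in> fg_modules R"
      "\<And>W. mult_Ind W N = (if W \<in> A then n W else 0) + (if W = V then k else 0)" by auto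
    obtain U where U: "U \<in> fg_modules R" "module_isomorphic R U (direct_sum (class_rep V) N)"
      using ex_direct_sum_fg_modules[OF class_rep_Ind(1)[OF V] N(1)] by blast
    show ?case
      using mult_Ind_direct_sum[OF U(1) class_rep_Ind(1)[OF V] N(1) U(2)] mult_Ind_class_rep[OF V] N(2) U(1)
      by (intro bexI[of _ U]) auto
  qed
  from this[of "n V"] obtain N where N: "N \<in> fg_modules R"
    "\<forall>W. mult_Ind W N = (if W \<in> A then n W else 0) + (if W = V then n V else 0)" by blast
  show ?case using insert.hyps(2) N by (intro bexI[of _ N]) auto
qed

text \<open>A module with the truncated floors of the coordinates as multiplicities has class
  \<open>theta_floor R \<alpha>\<close>. Since a class determines the multiplicities, whichever
  module the \<open>SOME\<close> in \<open>theta_module\<close> picks has the same ones.\<close>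

lemma
  assumes ne: "fg_modules R \<noteq> {}" and \<alpha>: "\<alpha> \<in> carrier RE.V"
  shows theta_module_mem: "theta_module R \<alpha> \<in> fg_modules R"
    and mult_Ind_theta_module: "mult_Ind W (theta_module R \<alpha>) = nat \<lfloor>theta_coeff R \<alpha> W\<rfloor>"
proof -
  let ?A = "{W. theta_coeff R \<alpha> W \<noteq> 0}"
  have A: "finite ?A" "?A \<subseteq> Ind R"
    using theta_coeff_finite[OF \<alpha>] coeff_Ind_outside[OF \<alpha>] by auto
  let ?c = "\<lambda>W. real_of_int (max 0 \<lfloor>theta_coeff R \<alpha> W\<rfloor>)"
  have fl: "theta_floor R \<alpha> = Ind_sum ?c ?A"
    unfolding theta_floor_def Theta_eq using A(2)
    by (intro RE.V.finsum_cong') (auto simp: smult_theta_class_rep class_rep_Ind(1) subsetD)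
  have flc: "theta_floor R \<alpha> \<in> carrier RE.V" unfolding fl by (rule Ind_sum_closed[OF A(2)])
  have cfl: "coeff_Ind W (theta_floor R \<alpha>) = real (nat \<lfloor>theta_coeff R \<alpha> W\<rfloor>)" for W
    unfolding fl coeff_Ind_Ind_sum[OF A] by (auto simp: max_def)
  obtain M where M: "M \<in> fg_modules R" "\<And>W. mult_Ind W M = (if W \<in> ?A then nat \<lfloor>theta_coeff R \<alpha> W\<rfloor> else 0)"
    using ex_module_mult_Ind[OF ne A, of "\<lambda>W. nat \<lfloor>theta_coeff R \<alpha> W\<rfloor>"] by auto
  have m: "coeff_Ind W (theta_class R N) = real (mult_Ind W N)" if "N \<in> fg_modules R" for N W
    using that mult_Ind_isomorphic[OF that module_copy_mem module_copy_isomorphic] fg_modulesD(1)[OF that]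
    by (simp add: coeff_Ind_theta_class)
  have "theta_class R M = theta_floor R \<alpha>"
    using M by (intro Theta_eqI theta_class_closed flc) (auto simp: m cfl fg_modulesD(1))
  then have "theta_module R \<alpha> \<in> fg_modules R \<and> theta_class R (theta_module R \<alpha>) = theta_floor R \<alpha>"
    unfolding theta_module_def using M(1) by (metis (mono_tags, lifting) someI_ex)
  then show "theta_module R \<alpha> \<in> fg_modules R" "mult_Ind W (theta_module R \<alpha>) = nat \<lfloor>theta_coeff R \<alpha> W\<rfloor>"
    using m[of "theta_module R \<alpha>" W] cfl[of W] by auto
qed

lemma theta_norm_eq:
  assumes \<alpha>: "\<alpha> \<in> carrier RE.V" and A: "finite A" "{W. theta_coeff R \<alpha> W \<noteq> 0} \<subseteq> A"
  shows "theta_norm R \<alpha> = (\<Sum>W\<in>A. \<bar>theta_coeff R \<alpha> W\<bar> * real (min_gens R (class_rep W)))"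
  unfolding theta_norm_def using A by (intro sum.mono_neutral_left) auto

lemma theta_coeff_minus:
  "\<lbrakk>\<alpha> \<in> carrier RE.V; \<beta> \<in> carrier RE.V\<rbrakk> \<Longrightarrow> theta_coeff R (\<alpha> \<ominus>\<^bsub>RE.V\<^esub> \<beta>) W = theta_coeff R \<alpha> W - theta_coeff R \<beta> W"
  by (simp add: theta_coeff_eq coeff_Ind_minus)

lemma theta_coeff_smult:
  "\<alpha> \<in> carrier RE.V \<Longrightarrow> theta_coeff R (c \<odot>\<^bsub>RE.V\<^esub> \<alpha>) W = c * theta_coeff R \<alpha> W"
  by (simp add: theta_coeff_eq coeff_Ind_smult)

lemma theta_coeff_theta_class:
  "fg_module R M \<Longrightarrow> theta_coeff R (theta_class R M) W = real (mult_Ind W (module_copy R M))"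
  by (simp add: theta_coeff_eq theta_class_closed coeff_Ind_theta_class mult_Ind_def)

end

section \<open>The Frobenius map\<close>

context cring
begin

lemma binomial:
  assumes a: "a \<in> carrier R" and b: "b \<in> carrier R"
  shows "(a \<oplus> b) [^] (n::nat) = (\<Oplus>k\<in>{..n}. [(n choose k)] \<cdot> (a [^] k \<otimes> b [^] (n - k)))"
proof (induction n)
  case 0
  show ?case using a b by simp
next
  case (Suc n)
  define m where "m k l = a [^] (k::nat) \<otimes> b [^] (l::nat)" for k l
  have m [simp]: "m k l \<in> carrier R" for k l using a b by (simp add: m_def)
  have am: "a \<otimes> m k l = m (Suc k) l" and bm: "b \<otimes> m k l = m k (Suc l)" for k l
    using a b by (simp_all add: m_def m_ac)
  define T where "T = (\<Oplus>k\<in>{..n}. [(n choose k)] \<cdot> m k (n - k))"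
  have T: "T \<in> carrier R" unfolding T_def by (rule finsum_closed) auto
  have "(a \<oplus> b) [^] Suc n = T \<otimes> (a \<oplus> b)" using Suc by (simp add: T_def m_def)
  also have "\<dots> = a \<otimes> T \<oplus> b \<otimes> T" using a b T by (simp add: l_distr r_distr m_comm)
  also have "a \<otimes> T = (\<Oplus>k\<in>{..n}. [(n choose k)] \<cdot> m (Suc k) (n - k))"
    unfolding T_def using a
    by (subst finsum_rdistr) (auto simp: add_pow_rdistr am intro!: finsum_cong')
  also have "b \<otimes> T = (\<Oplus>k\<in>{..n}. [(n choose k)] \<cdot> m k (Suc n - k))"
    unfolding T_def using b
    by (subst finsum_rdistr) (auto simp: add_pow_rdistr bm Suc_diff_le intro!: finsum_cong')
  \<comment> \<open>The added term has binomial coefficient zero; splitting off \<open>k = 0\<close>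
    afterwards aligns the two sums for Pascal's rule.\<close>
  also have "\<dots> = (\<Oplus>k\<in>{..Suc n}. [(n choose k)] \<cdot> m k (Suc n - k))"
    by (subst finsum_Suc) (auto simp: binomial_eq_0)
  also have "\<dots> = (\<Oplus>k\<in>{..n}. [(n choose Suc k)] \<cdot> m (Suc k) (n - k)) \<oplus> m 0 (Suc n)"
    by (subst finsum_Suc2) auto
  also have "(\<Oplus>k\<in>{..n}. [(n choose k)] \<cdot> m (Suc k) (n - k)) \<oplus>
      ((\<Oplus>k\<in>{..n}. [(n choose Suc k)] \<cdot> m (Suc k) (n - k)) \<oplus> m 0 (Suc n)) =
      (\<Oplus>k\<in>{..n}. [(n choose k)] \<cdot> m (Suc k) (n - k) \<oplus> [(n choose Suc k)] \<cdot> m (Suc k) (n - k)) \<oplus> m 0 (Suc n)"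
    by (subst finsum_addf) (auto simp: a_assoc)
  also have "(\<Oplus>k\<in>{..n}. [(n choose k)] \<cdot> m (Suc k) (n - k) \<oplus> [(n choose Suc k)] \<cdot> m (Suc k) (n - k)) =
      (\<Oplus>k\<in>{..n}. [(Suc n choose Suc k)] \<cdot> m (Suc k) (n - k))"
    by (intro finsum_cong') (auto simp: add.nat_pow_mult)
  also have "\<dots> \<oplus> m 0 (Suc n) = (\<Oplus>k\<in>{..Suc n}. [(Suc n choose k)] \<cdot> m k (Suc n - k))"
    by (subst finsum_Suc2) auto
  finally show ?case by (simp only: m_def)
qed

lemma char_prime_freshman:
  assumes p: "Factorial_Ring.prime p" and char: "has_characteristic R p"
    and a: "a \<in> carrier R" and b: "b \<in> carrier R"
  shows "(a \<oplus> b) [^] p = a [^] p \<oplus> b [^] p"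
proof -
  have p0: "0 < p" using p by (simp add: prime_gt_0_nat)
  let ?f = "\<lambda>k. [(p choose k)] \<cdot> (a [^] k \<otimes> b [^] (p - k))"
  have cl: "?f k \<in> carrier R" for k using a b by simp
  have zero: "?f k = \<zero>" if k: "k \<in> {..p} - {0, p}" for k
  proof -
    have "p dvd (p choose k)" using k p by (intro dvd_choose_prime) auto
    then have "[(p choose k)] \<cdot> \<one> = \<zero>" using char by (simp add: has_characteristic_def)
    moreover have "?f k = ([(p choose k)] \<cdot> \<one>) \<otimes> (a [^] k \<otimes> b [^] (p - k))"
      using a b by (subst add_pow_ldistr) auto
    ultimately show ?thesis using a b by simp
  qed
  have "(a \<oplus> b) [^] p = finsum R ?f {..p}" by (rule binomial[OF a b])
  also have "\<dots> = finsum R ?f {0, p}"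
    using zero cl by (intro add.finprod_mono_neutral_cong_right) auto
  also have "\<dots> = a [^] p \<oplus> b [^] p" using a b p0 by (simp add: a_comm)
  finally show ?thesis .
qed

lemma frobenius_add:
  assumes "Factorial_Ring.prime p" "has_characteristic R p" "a \<in> carrier R" "b \<in> carrier R"
  shows "(a \<oplus> b) [^] (p ^ e) = a [^] (p ^ e) \<oplus> b [^] (p ^ e)"
proof (induction e)
  case (Suc e)
  have "(x [^] (p ^ e)) [^] p = x [^] (p ^ Suc e)" if "x \<in> carrier R" for x
    using that by (simp add: nat_pow_pow mult.commute)
  then show ?case
    using char_prime_freshman[OF assms(1,2), of "a [^] (p ^ e)" "b [^] (p ^ e)"] Suc assms(3,4)
    by (metis a_closed nat_pow_closed)
qed (use assms in simp)

lemma frobenius_minus: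
  assumes p: "Factorial_Ring.prime p" "has_characteristic R p" and a: "a \<in> carrier R" and b: "b \<in> carrier R"
  shows "(a \<ominus> b) [^] (p ^ e) = a [^] (p ^ e) \<ominus> b [^] (p ^ e)"
proof -
  have "a [^] (p ^ e) = (a \<ominus> b) [^] (p ^ e) \<oplus> b [^] (p ^ e)"
    using frobenius_add[OF p, of "a \<ominus> b" b e] a b by (simp add: a_minus_def a_assoc l_neg)
  then show ?thesis using a b by (simp add: a_minus_def a_assoc r_neg)
qed

lemma zero_pow_prime_power: "Factorial_Ring.prime (p::nat) \<Longrightarrow> \<zero> [^] (p ^ e) = \<zero>"
  using prime_gt_0_nat[of p] by (simp add: nat_pow_zero)

end

lemma frob_module_simps [simp]:
  "carrier (frob_module R p e M) = carrier M" "\<zero>\<^bsub>frob_module R p e M\<^esub> = \<zero>\<^bsub>M\<^esub>"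
  "x \<oplus>\<^bsub>frob_module R p e M\<^esub> y = x \<oplus>\<^bsub>M\<^esub> y"
  "r \<odot>\<^bsub>frob_module R p e M\<^esub> x = (r [^]\<^bsub>R\<^esub> (p ^ e)) \<odot>\<^bsub>M\<^esub> x"
  by (auto simp: frob_module_def)

lemma regular_module_simps [simp]:
  "carrier (regular_module R) = carrier R" "\<zero>\<^bsub>regular_module R\<^esub> = \<zero>\<^bsub>R\<^esub>"
  "x \<oplus>\<^bsub>regular_module R\<^esub> y = x \<oplus>\<^bsub>R\<^esub> y" "r \<odot>\<^bsub>regular_module R\<^esub> x = r \<otimes>\<^bsub>R\<^esub> x"
  by (auto simp: regular_module_def)

lemma module_frob_module:
  assumes p: "Factorial_Ring.prime p" "has_characteristic R p" and M: "module R M"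
  shows "module R (frob_module R p e M)"
proof -
  interpret M: module R M by fact
  show ?thesis
  proof (intro moduleI M.R.is_cring abelian_groupI)
    fix x assume "x \<in> carrier (frob_module R p e M)"
    then show "\<exists>y\<in>carrier (frob_module R p e M). y \<oplus>\<^bsub>frob_module R p e M\<^esub> x = \<zero>\<^bsub>frob_module R p e M\<^esub>"
      by (intro bexI[of _ "\<ominus>\<^bsub>M\<^esub> x"]) (auto simp: M.M.l_neg)
  qed (auto simp: M.M.a_ac M.R.frobenius_add[OF p] M.smult_l_distr M.smult_r_distr M.smult_assoc1[symmetric]
      M.R.nat_pow_distrib)
qed

lemma module_regular_module: "cring R \<Longrightarrow> module R (regular_module R)"
proof -
  assume "cring R"
  then interpret cring R .
  show ?thesis
  proof (intro moduleI is_cring abelian_groupI)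
    fix x assume "x \<in> carrier (regular_module R)"
    then show "\<exists>y\<in>carrier (regular_module R). y \<oplus>\<^bsub>regular_module R\<^esub> x = \<zero>\<^bsub>regular_module R\<^esub>"
      by (intro bexI[of _ "\<ominus>\<^bsub>R\<^esub> x"]) (auto simp: l_neg)
  qed (auto simp: a_ac l_distr r_distr m_assoc)
qed

text \<open>If \<open>xs\<close> generates \<open>R\<close> over its \<open>p\<close>-th powers and
  \<open>ms\<close> generates \<open>M\<close> over \<open>R\<close>, the products of members of
  \<open>xs\<close> and \<open>ms\<close> generate \<open>M\<close> over the \<open>p\<close>-th
  powers.\<close>

lemma fg_frob_module_1:
  assumes p: "Factorial_Ring.prime p" "has_characteristic R p" and F: "F_finite R p" and M: "fg_module R M"
  shows "fg_module R (frob_module R p 1 M)"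
proof -
  note M' = fg_module_is_module[OF M]
  interpret M: module R M by fact
  let ?S = "frob_module R p 1 (regular_module R)" and ?M = "frob_module R p 1 M"
  interpret S: module R ?S by (rule module_frob_module[OF p module_regular_module[OF M.R.is_cring]])
  interpret FM: module R ?M by (rule module_frob_module[OF p M'])
  obtain xs where xs: "set xs \<subseteq> carrier R" "adjoin R ?S {\<zero>\<^bsub>R\<^esub>} xs = carrier R"
    using F unfolding F_finite_def fg_module_iff by auto
  obtain ms where ms: "set ms \<subseteq> carrier M" "adjoin R M {\<zero>\<^bsub>M\<^esub>} ms = carrier M"
    using M unfolding fg_module_iff by auto
  define gs where "gs = map (\<lambda>(x, m). x \<odot>\<^bsub>M\<^esub> m) (List.product xs ms)"
  have gs: "set gs \<subseteq> carrier ?M" using xs(1) ms(1) by (auto simp: gs_def)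
  let ?T = "adjoin R ?M {\<zero>\<^bsub>?M\<^esub>} gs"
  have T: "submodule ?T R ?M" by (rule FM.submodule_adjoin[OF FM.submodule_zero gs])
  note TE = FM.submoduleE[OF T, simplified]
  have T0: "\<zero>\<^bsub>M\<^esub> \<in> ?T" using submodule_zero_mem[OF T] by simp
  have gsT: "x \<odot>\<^bsub>M\<^esub> m \<in> ?T" if "x \<in> set xs" "m \<in> set ms" for x m
    using FM.adjoin_mem[OF FM.submodule_zero gs] that by (auto simp: gs_def)
  have Tneg: "\<ominus>\<^bsub>M\<^esub> a \<in> ?T" if "a \<in> ?T" for a
  proof -
    have aM: "a \<in> carrier M" using that TE(1) by auto
    have "\<ominus>\<^bsub>?M\<^esub> a = \<ominus>\<^bsub>M\<^esub> a"
      using aM by (intro FM.M.minus_equality) (auto simp: M.M.l_neg)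
    then show ?thesis using FM.submoduleE(3)[OF T that] by simp
  qed
  have rm: "r \<odot>\<^bsub>M\<^esub> m \<in> ?T" if r: "r \<in> carrier R" and m: "m \<in> set ms" for r m
  proof -
    have mM: "m \<in> carrier M" using m ms(1) by auto
    \<comment> \<open>For fixed \<open>m\<close> this set is stable under multiplication by
      \<open>p\<close>-th powers and contains \<open>xs\<close>, hence it is all of
      \<open>R\<close>.\<close>
    let ?I = "{r \<in> carrier R. r \<odot>\<^bsub>M\<^esub> m \<in> ?T}"
    have "submodule ?I R ?S"
    proof (rule S.submoduleI)
      show "\<ominus>\<^bsub>?S\<^esub> a \<in> ?I" if a: "a \<in> ?I" for a
      proof -
        have "\<ominus>\<^bsub>?S\<^esub> a = \<ominus>\<^bsub>R\<^esub> a"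
          using a by (intro S.M.minus_equality) (auto simp: M.R.l_neg)
        then show ?thesis using a Tneg mM by (simp add: M.smult_l_minus)
      qed
      show "a \<oplus>\<^bsub>?S\<^esub> b \<in> ?I" if "a \<in> ?I" "b \<in> ?I" for a b
        using that TE(5) mM by (auto simp: M.smult_l_distr)
      show "a \<odot>\<^bsub>?S\<^esub> b \<in> ?I" if "a \<in> carrier R" "b \<in> ?I" for a b
        using that TE(4) mM by (auto simp: M.smult_assoc1)
    qed (use T0 mM in auto)
    then have "adjoin R ?S {\<zero>\<^bsub>R\<^esub>} xs \<subseteq> ?I"
      using gsT[OF _ m] xs(1) T0 mM by (intro S.adjoin_minimal) auto
    then show ?thesis using xs(2) r by auto
  qed
  \<comment> \<open>Quantifying over \<open>r\<close> makes this a submodule for the original action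
    of \<open>R\<close>, whereas \<open>?T\<close> is a priori stable only under the Frobenius
    action.\<close>
  let ?J = "{y \<in> carrier M. \<forall>r\<in>carrier R. r \<odot>\<^bsub>M\<^esub> y \<in> ?T}"
  have "submodule ?J R M"
    using T0 Tneg TE(5)
    by (intro M.submoduleI) (auto simp: M.smult_r_minus M.smult_r_distr M.smult_assoc1[symmetric])
  then have "adjoin R M {\<zero>\<^bsub>M\<^esub>} ms \<subseteq> ?J"
    using rm ms(1) T0 by (intro M.adjoin_minimal) auto
  then have "\<one>\<^bsub>R\<^esub> \<odot>\<^bsub>M\<^esub> y \<in> ?T" if "y \<in> carrier M" for y
    using that ms(2) M.R.one_closed by blast
  then have "y \<in> ?T" if "y \<in> carrier M" for y using that by simp
  then have "?T = carrier ?M" using TE(1) by auto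
  then show ?thesis by (rule fg_moduleI(1)[OF FM.module_axioms gs])
qed

lemma frob_module_Suc_isomorphic:
  assumes p: "Factorial_Ring.prime p" and M: "module R M"
  shows "module_isomorphic R (frob_module R p 1 (frob_module R p e M)) (frob_module R p (Suc e) M)"
proof -
  interpret M: module R M by fact
  have "(\<lambda>x. x) \<in> module_hom R (frob_module R p 1 (frob_module R p e M)) (frob_module R p (Suc e) M)"
    by (intro module_homI) (auto simp: M.R.nat_pow_pow)
  moreover have "bij_betw (\<lambda>x. x) (carrier M) (carrier M)" using bij_betw_id[unfolded id_def] .
  ultimately show ?thesis by (auto simp: module_isomorphic_def)
qed

lemma fg_frob_module:
  assumes p: "Factorial_Ring.prime p" "has_characteristic R p" and F: "F_finite R p" and M: "fg_module R M"
  shows "fg_module R (frob_module R p e M)"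
proof (induction e)
  case 0
  note M' = fg_module_is_module[OF M]
  interpret M: module R M by fact
  have "(\<lambda>x. x) \<in> module_hom R M (frob_module R p 0 M)"
    by (intro module_homI) auto
  then have "module_isomorphic R M (frob_module R p 0 M)"
    using bij_betw_id[unfolded id_def] by (auto simp: module_isomorphic_def)
  then show ?case using fg_module_isomorphic M module_frob_module[OF p M'] by blast
next
  case (Suc e)
  note M' = fg_module_is_module[OF M]
  show ?case
    by (rule fg_module_isomorphic[OF frob_module_Suc_isomorphic[OF p(1) M'] fg_frob_module_1[OF p F Suc]
          module_frob_module[OF p M']])
qed

section \<open>The Artinian case\<close>

context noetherian_local_ring
begin

text \<open>An ideal that is maximal among those containing no power of \<open>r\<close> is prime.
  It would lie strictly below \<open>\<mm>\<close>, which gives a chain of primes of length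
  one.\<close>

lemma dim_0_nilpotent:
  assumes dim: "krull_dim R = enat 0" and r: "r \<in> \<mm>"
  shows "\<exists>n::nat. r [^] n = \<zero>"
proof (rule ccontr)
  assume "\<not> ?thesis"
  then have nil: "r [^] (n::nat) \<noteq> \<zero>" for n by auto
  have rR: "r \<in> carrier R" using r by (rule \<mm>.a_Hcarr)
  let ?A = "{J. ideal J R \<and> (\<forall>n::nat. r [^] n \<notin> J)}"
  have "\<exists>J\<in>?A. \<forall>K\<in>?A. J \<subseteq> K \<longrightarrow> K = J"
  proof (rule subset_Zorn_nonempty)
    show "?A \<noteq> {}" using zeroideal nil by auto
    fix C assume C: "C \<noteq> {}" "subset.chain ?A C"
    then have "\<Union>C \<in> C"
      by (intro ideal_chain_is_trivial) (auto simp: subset.chain_def)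
    then show "\<Union>C \<in> ?A" using C(2) by (auto simp: subset.chain_def)
  qed
  then obtain J where J': "J \<in> ?A" and mx: "\<forall>K\<in>?A. J \<subseteq> K \<longrightarrow> K = J" by (rule bexE)
  then have J: "ideal J R" "\<And>n::nat. r [^] n \<notin> J" by auto
  interpret J: ideal J R by (rule J(1))
  have ne: "J \<noteq> carrier R" using J(2)[of 0] by auto
  \<comment> \<open>By maximality of \<open>J\<close>, the ideal generated by \<open>J\<close> and
    \<open>a\<close> contains a power of \<open>r\<close>. The product of two such powers, for
    \<open>a\<close> and \<open>b\<close>, lies in \<open>J\<close> if \<open>a \<otimes> b\<close>
    does, which is what makes \<open>J\<close> prime.\<close>
  have big: "\<exists>n::nat. \<exists>j\<in>J. \<exists>s\<in>carrier R. r [^] n = j \<oplus> s \<otimes> a" if a: "a \<in> carrier R" "a \<notin> J" for a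
  proof -
    let ?K = "J <+>\<^bsub>R\<^esub> PIdl a"
    have K: "ideal ?K R" by (rule add_ideals[OF J(1) cgenideal_ideal[OF a(1)]])
    have z: "\<zero> \<in> PIdl a" using cgenideal_ideal[OF a(1)] by (simp add: ideal_def additive_subgroup.zero_closed)
    have JK: "J \<subseteq> ?K"
    proof
      fix j assume j: "j \<in> J"
      then have eq: "j = j \<oplus> \<zero>" using J.a_Hcarr by simp
      show "j \<in> ?K" unfolding set_add_def' using j z eq by blast
    qed
    have "a = \<zero> \<oplus> a" using a by simp
    then have "a \<in> ?K" using J.zero_closed cgenideal_self[OF a(1)] by (auto simp: set_add_def')
    then have "?K \<noteq> J" using a(2) by auto
    then have "?K \<notin> ?A" using mx JK by blast
    then obtain n :: nat where "r [^] n \<in> ?K" using K by auto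
    then show ?thesis by (auto simp: set_add_def' cgenideal_def)
  qed
  have "primeideal J R"
  proof (rule primeidealI[OF J(1) is_cring])
    show "carrier R \<noteq> J" using ne by simp
    fix a b assume ab: "a \<in> carrier R" "b \<in> carrier R" "a \<otimes> b \<in> J"
    show "a \<in> J \<or> b \<in> J"
    proof (rule ccontr)
      assume "\<not> ?thesis"
      then obtain n m :: nat and i j s t where
        i: "i \<in> J" "s \<in> carrier R" "r [^] n = i \<oplus> s \<otimes> a" and
        j: "j \<in> J" "t \<in> carrier R" "r [^] m = j \<oplus> t \<otimes> b"
        using big[OF ab(1)] big[OF ab(2)] by blast
      note c = J.a_Hcarr[OF i(1)] J.a_Hcarr[OF j(1)]
      have "r [^] (n + m) = (i \<oplus> s \<otimes> a) \<otimes> (j \<oplus> t \<otimes> b)"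
        using i j rR by (simp add: nat_pow_mult[symmetric])
      also have "\<dots> = i \<otimes> (j \<oplus> t \<otimes> b) \<oplus> (j \<otimes> (s \<otimes> a) \<oplus> (s \<otimes> t) \<otimes> (a \<otimes> b))"
        using c i(2) j(2) ab by (simp add: l_distr r_distr m_ac a_ac)
      also have "\<dots> \<in> J"
        using J.I_r_closed[OF i(1), of "j \<oplus> t \<otimes> b"] J.I_r_closed[OF j(1), of "s \<otimes> a"]
          J.I_l_closed[OF ab(3), of "s \<otimes> t"] c i(2) j(2) ab(1,2) by simp
      finally show False using J(2) by blast
    qed
  qed
  moreover have "primeideal \<mm> R" by (rule maximalideal_prime[OF maximalideal_max_ideal])
  moreover have "J \<subset> \<mm>" using proper_ideal_subset_max_ideal[OF J(1) ne] r J(2)[of 1] rR by auto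
  ultimately have "enat 1 \<le> krull_dim R"
    unfolding krull_dim_def
    by (intro Sup_upper CollectI exI[of _ 1] conjI refl exI[of _ "\<lambda>i. if i = 0 then J else \<mm>"]) auto
  then show False using dim by simp
qed

text \<open>For fixed \<open>e\<close> the elements with \<open>r^(p^e) = 0\<close> form an ideal,
  because the Frobenius map is additive. A common exponent for finitely many generators of
  \<open>\<mm>\<close> therefore serves all of \<open>\<mm>\<close>.\<close>

lemma dim_0_frobenius_nilpotent:
  assumes dim: "krull_dim R = enat 0" and p: "Factorial_Ring.prime p" "has_characteristic R p"
  shows "\<exists>e0. \<forall>e\<ge>e0. \<forall>r\<in>\<mm>. r [^] (p ^ e) = \<zero>"
proof -
  obtain A where A: "A \<subseteq> carrier R" "finite A" "\<mm> = Idl A" using finetely_gen[OF \<mm>.is_ideal] by blast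
  have "A \<subseteq> \<mm>" using genideal_self[OF A(1)] A(3) by simp
  then obtain n :: "'a \<Rightarrow> nat" where n: "\<And>a. a \<in> A \<Longrightarrow> a [^] n a = \<zero>"
    using dim_0_nilpotent[OF dim] by (metis subsetD)
  define e0 where "e0 = (\<Sum>a\<in>A. n a)"
  have "r [^] (p ^ e) = \<zero>" if e: "e0 \<le> e" and r: "r \<in> \<mm>" for e r
  proof -
    let ?I = "{r \<in> carrier R. r [^] (p ^ e) = \<zero>}"
    have mult: "x \<otimes> y \<in> ?I" if "x \<in> ?I" "y \<in> carrier R" for x y
      using that by (simp add: nat_pow_distrib)
    have "ideal ?I R"
    proof (rule idealI[OF ring_axioms])
      show "subgroup ?I (add_monoid R)"
      proof (intro add.subgroupI)
        show "?I \<noteq> {}" using zero_pow_prime_power[OF p(1)] zero_closed by blast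
        show "\<ominus> x \<in> ?I" if "x \<in> ?I" for x
        proof -
          have "\<ominus> x = x \<otimes> (\<ominus> \<one>)" using that by (simp add: r_minus)
          then show ?thesis using mult[OF that, of "\<ominus> \<one>"] by simp
        qed
      qed (auto simp: frobenius_add[OF p])
    qed (use mult m_comm in auto)
    moreover have "A \<subseteq> ?I"
    proof
      fix a assume a: "a \<in> A"
      then have aR: "a \<in> carrier R" using A(1) by auto
      have "n a \<le> e0" unfolding e0_def by (rule member_le_sum) (use a A(2) in auto)
      \<comment> \<open>The chain is \<open>e0 \<le> e < 2^e \<le> p^e\<close>, so the sum of the
        nilpotency exponents can serve as an exponent of \<open>p\<close>.\<close>
      also have "e0 \<le> p ^ e"
        using e less_exp[of e] power_mono[OF prime_ge_2_nat[OF p(1)], of e] by linarith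
      finally obtain k where "p ^ e = n a + k" using le_Suc_ex by blast
      then show "a \<in> ?I" using n[OF a] aR by (simp add: nat_pow_mult[symmetric])
    qed
    ultimately have "Idl A \<subseteq> ?I" by (rule genideal_minimal)
    then show ?thesis using r A(3) by auto
  qed
  then show ?thesis by blast
qed

end

section \<open>Perfect residue fields\<close>

context henselian_local_ring
begin

text \<open>A vanishing logarithm bounds the dimension of the residue field over its
  \<open>p\<close>-th powers by one, so every element of it is a \<open>p\<close>-th power;
  \<open>s\<close> lifts such a root.\<close>

lemma perfect_residue_field:
  assumes p: "Factorial_Ring.prime p" "has_characteristic R p" and F: "F_finite R p"
    and deg: "log (real p) (real (p_degree \<kappa> p)) = 0" and r: "r \<in> carrier R"
  shows "\<exists>s\<in>carrier R. r \<ominus> s [^] p \<in> \<mm>"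
proof -
  interpret K: field \<kappa> by (rule residue_field)
  interpret h: ring_hom_cring R \<kappa> "(+>) \<mm>"
    unfolding residue_field_def by (rule \<mm>.rcos_ring_hom_cring[OF is_cring])
  let ?h = "(+>) \<mm>"
  have hpow: "?h (x [^] n) = ?h x [^]\<^bsub>\<kappa>\<^esub> (n::nat)" if "x \<in> carrier R" for x n
    using that by (induction n) auto
  have onto: "\<exists>x\<in>carrier R. y = ?h x" if "y \<in> carrier \<kappa>" for y
    using that unfolding residue_field_def FactRing_def A_RCOSETS_def' by auto
  have p0: "0 < p" using p by (simp add: prime_gt_0_nat)
  have frob: "(a \<oplus>\<^bsub>\<kappa>\<^esub> b) [^]\<^bsub>\<kappa>\<^esub> p = a [^]\<^bsub>\<kappa>\<^esub> p \<oplus>\<^bsub>\<kappa>\<^esub> b [^]\<^bsub>\<kappa>\<^esub> p"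
    if ab: "a \<in> carrier \<kappa>" "b \<in> carrier \<kappa>" for a b
  proof -
    obtain x where x: "x \<in> carrier R" "a = ?h x" using onto[OF ab(1)] by blast
    obtain y where y: "y \<in> carrier R" "b = ?h y" using onto[OF ab(2)] by blast
    note xy = x(1) y(1) x(2) y(2)
    have "(a \<oplus>\<^bsub>\<kappa>\<^esub> b) [^]\<^bsub>\<kappa>\<^esub> p = ?h ((x \<oplus> y) [^] p)" using xy by (simp add: hpow)
    also have "\<dots> = ?h (x [^] p \<oplus> y [^] p)" by (simp only: char_prime_freshman[OF p xy(1,2)])
    also have "\<dots> = a [^]\<^bsub>\<kappa>\<^esub> p \<oplus>\<^bsub>\<kappa>\<^esub> b [^]\<^bsub>\<kappa>\<^esub> p" using xy by (simp add: hpow)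
    finally show ?thesis .
  qed
  let ?K = "{x [^]\<^bsub>\<kappa>\<^esub> p | x. x \<in> carrier \<kappa>}"
  have zeroK: "\<zero>\<^bsub>\<kappa>\<^esub> [^]\<^bsub>\<kappa>\<^esub> p = \<zero>\<^bsub>\<kappa>\<^esub>" using p0 by (simp add: K.nat_pow_zero)
  have negK: "\<ominus>\<^bsub>\<kappa>\<^esub> (x [^]\<^bsub>\<kappa>\<^esub> p) = (\<ominus>\<^bsub>\<kappa>\<^esub> x) [^]\<^bsub>\<kappa>\<^esub> p" if "x \<in> carrier \<kappa>" for x
    using frob[of "\<ominus>\<^bsub>\<kappa>\<^esub> x" x] that zeroK by (intro K.minus_equality) (auto simp: K.l_neg)
  have sf: "subfield ?K \<kappa>"
  proof (rule K.subfieldI')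
    show "subring ?K \<kappa>"
    proof (rule K.subringI)
      show "?K \<subseteq> carrier \<kappa>" by auto
      show "\<one>\<^bsub>\<kappa>\<^esub> \<in> ?K" by (intro CollectI exI[of _ "\<one>\<^bsub>\<kappa>\<^esub>"]) simp
      show "\<ominus>\<^bsub>\<kappa>\<^esub> x \<in> ?K" if "x \<in> ?K" for x using that negK by force
      show "x \<otimes>\<^bsub>\<kappa>\<^esub> y \<in> ?K" if "x \<in> ?K" "y \<in> ?K" for x y
        using that by (auto simp flip: K.nat_pow_distrib)
      show "x \<oplus>\<^bsub>\<kappa>\<^esub> y \<in> ?K" if "x \<in> ?K" "y \<in> ?K" for x y
        using that by (auto simp flip: frob)
    qed
    show "inv\<^bsub>\<kappa>\<^esub> k \<in> ?K" if k: "k \<in> ?K - {\<zero>\<^bsub>\<kappa>\<^esub>}" for k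
    proof -
      obtain x where x: "x \<in> carrier \<kappa>" "k = x [^]\<^bsub>\<kappa>\<^esub> p" using k by auto
      then have "x \<noteq> \<zero>\<^bsub>\<kappa>\<^esub>" using k zeroK by auto
      then have xu: "x \<in> Units \<kappa>" using x by (simp add: K.field_Units)
      have "k \<otimes>\<^bsub>\<kappa>\<^esub> (inv\<^bsub>\<kappa>\<^esub> x) [^]\<^bsub>\<kappa>\<^esub> p = \<one>\<^bsub>\<kappa>\<^esub>"
        using x xu by (simp flip: K.nat_pow_distrib)
      then have "inv\<^bsub>\<kappa>\<^esub> k = (inv\<^bsub>\<kappa>\<^esub> x) [^]\<^bsub>\<kappa>\<^esub> p" using x xu by (intro K.comm_inv_char) auto
      then show ?thesis using xu by blast
    qed
  qed
  let ?S = "frob_module R p 1 (regular_module R)"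
  interpret S: module R ?S by (rule module_frob_module[OF p module_regular_module[OF is_cring]])
  obtain xs where xs: "set xs \<subseteq> carrier R" "adjoin R ?S {\<zero>} xs = carrier R"
    using F unfolding F_finite_def fg_module_iff by auto
  \<comment> \<open>Generators of \<open>R\<close> over its \<open>p\<close>-th powers reduce to a
    spanning set of the residue field. This finiteness is what allows the \<open>dim\<close> in
    \<open>p_degree\<close> to be read as a dimension.\<close>
  have span: "?h y \<in> K.Span ?K (map ?h zs)" if "set zs \<subseteq> carrier R" "y \<in> adjoin R ?S {\<zero>} zs" for y zs
    using that
  proof (induction zs arbitrary: y)
    case Nil
    then show ?case using h.hom_zero by simp
  next
    case (Cons z zs)
    then obtain s x where sx: "s \<in> carrier R" "x \<in> adjoin R ?S {\<zero>} zs" "y = s [^] p \<otimes> z \<oplus> x" by auto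
    have "submodule (adjoin R ?S {\<zero>} zs) R ?S"
      using S.submodule_adjoin[OF S.submodule_zero, of zs] Cons.prems(1) by simp
    from S.submodule_subset[OF this sx(2)] have "x \<in> carrier R" by simp
    then have "?h y = (?h s [^]\<^bsub>\<kappa>\<^esub> p) \<otimes>\<^bsub>\<kappa>\<^esub> ?h z \<oplus>\<^bsub>\<kappa>\<^esub> ?h x"
      using sx Cons.prems by (simp add: hpow)
    moreover have "?h s [^]\<^bsub>\<kappa>\<^esub> p \<in> ?K" using sx by auto
    ultimately show ?case
      using Cons.IH[OF _ sx(2)] Cons.prems(1) K.line_extension_mem_iff by auto
  qed
  have gen: "K.Span ?K (map ?h xs) = carrier \<kappa>"
  proof
    have hx: "set (map ?h xs) \<subseteq> carrier \<kappa>" using xs(1) by auto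
    show "K.Span ?K (map ?h xs) \<subseteq> carrier \<kappa>"
      by (rule K.Span_in_carrier[OF _ hx]) auto
    show "carrier \<kappa> \<subseteq> K.Span ?K (map ?h xs)" using span[OF xs(1)] xs(2) onto by auto
  qed
  have "K.finite_dimension ?K (carrier \<kappa>)"
    using K.Span_finite_dimension[OF sf, of "map ?h xs"] gen xs(1) by auto
  from K.finite_dimensionE[OF sf this]
  have dimn: "K.dimension (p_degree \<kappa> p) ?K (carrier \<kappa>)" by (simp add: p_degree_def over_def)
  \<comment> \<open>The logarithm is used to exclude values above one; the value zero is disposed of
    below through the zero space.\<close>
  have "p_degree \<kappa> p = 0 \<or> p_degree \<kappa> p = 1"
  proof (rule ccontr)
    assume "\<not> ?thesis"
    then have "1 < p_degree \<kappa> p" by linarith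
    then have "0 < log (real p) (real (p_degree \<kappa> p))"
      using prime_gt_1_nat[OF p(1)] by (intro zero_less_log_cancel_iff[THEN iffD2]) auto
    then show False using deg by simp
  qed
  then have "carrier \<kappa> \<subseteq> ?K"
  proof
    assume "p_degree \<kappa> p = 0"
    then have "carrier \<kappa> = {\<zero>\<^bsub>\<kappa>\<^esub>}" using K.dimension_zero[OF sf] dimn by simp
    then show ?thesis using zeroK by force
  next
    assume "p_degree \<kappa> p = 1"
    then have "K.dimension (Suc 0) ?K (carrier \<kappa>)" using dimn by simp
    from K.dimension_backwards[OF sf this] obtain v E
      where v: "v \<in> carrier \<kappa>" "K.dimension 0 ?K E" "carrier \<kappa> = K.line_extension ?K v E" by blast
    have E: "E = {\<zero>\<^bsub>\<kappa>\<^esub>}" by (rule K.dimension_zero[OF sf v(2)])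
    note KE = subfieldE(3)[OF sf]
    have mem: "\<exists>k\<in>?K. y = k \<otimes>\<^bsub>\<kappa>\<^esub> v" if y: "y \<in> carrier \<kappa>" for y
    proof -
      have "y \<in> K.line_extension ?K v E" using y v(3) by simp
      then obtain k where k: "k \<in> ?K" "y = k \<otimes>\<^bsub>\<kappa>\<^esub> v \<oplus>\<^bsub>\<kappa>\<^esub> \<zero>\<^bsub>\<kappa>\<^esub>"
        unfolding K.line_extension_mem_iff E by blast
      have "k \<in> carrier \<kappa>" using KE k(1) by (rule subsetD)
      then have "y = k \<otimes>\<^bsub>\<kappa>\<^esub> v" using k(2) v(1) by simp
      then show ?thesis using k(1) by (rule bexI)
    qed
    \<comment> \<open>Writing \<open>1 = b v\<close> with \<open>b\<close> a \<open>p\<close>-th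
      power shows that the spanning vector \<open>v\<close> is the inverse of a \<open>p\<close>-th
      power, hence a \<open>p\<close>-th power itself.\<close>
    obtain b where b: "b \<in> ?K" "\<one>\<^bsub>\<kappa>\<^esub> = b \<otimes>\<^bsub>\<kappa>\<^esub> v" using mem[of "\<one>\<^bsub>\<kappa>\<^esub>"] by auto
    have bc: "b \<in> carrier \<kappa>" using b KE by auto
    have "b \<noteq> \<zero>\<^bsub>\<kappa>\<^esub>" using b v by auto
    then have "inv\<^bsub>\<kappa>\<^esub> b \<in> ?K" using K.subfield_m_inv(1)[OF sf] b by auto
    moreover have "inv\<^bsub>\<kappa>\<^esub> b = v" using b v bc by (intro K.comm_inv_char) auto
    ultimately have vK: "v \<in> ?K" by simp
    show ?thesis
    proof
      fix y assume "y \<in> carrier \<kappa>"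
      then obtain k where "k \<in> ?K" "y = k \<otimes>\<^bsub>\<kappa>\<^esub> v" using mem by blast
      then show "y \<in> ?K" using vK subringE(6)[OF subfieldE(1)[OF sf]] by simp
    qed
  qed
  then obtain y where y: "y \<in> carrier \<kappa>" "?h r = y [^]\<^bsub>\<kappa>\<^esub> p" using r by auto
  obtain s where s: "s \<in> carrier R" "y = ?h s" using onto[OF y(1)] by blast
  have "?h r = ?h (s [^] p)" using y s by (simp add: hpow)
  then have "r \<ominus> s [^] p \<in> \<mm>"
    using quotient_eq_iff_same_a_r_cos[OF \<mm>.is_ideal r, of "s [^] p"] s by simp
  then show ?thesis using s by blast
qed

text \<open>If \<open>r\<close> is congruent to \<open>s^(p^e)\<close> and \<open>s\<close> to
  \<open>t^p\<close>, then the \<open>p^e\<close>-th power of the second congruence, by additivity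
  of the Frobenius map, shows that \<open>r\<close> is congruent to
  \<open>t^(p^(e+1))\<close>.\<close>

lemma perfect_residue_field_pow:
  assumes p: "Factorial_Ring.prime p" "has_characteristic R p" and F: "F_finite R p"
    and deg: "log (real p) (real (p_degree \<kappa> p)) = 0" and r: "r \<in> carrier R"
  shows "\<exists>s\<in>carrier R. r \<ominus> s [^] (p ^ e) \<in> \<mm>"
  using r
proof (induction e arbitrary: r)
  case 0
  then show ?case by (intro bexI[of _ r]) (auto simp: a_minus_def r_neg)
next
  case (Suc e)
  obtain s where s: "s \<in> carrier R" "r \<ominus> s [^] (p ^ e) \<in> \<mm>" using Suc by blast
  obtain t where t: "t \<in> carrier R" "s \<ominus> t [^] p \<in> \<mm>" using perfect_residue_field[OF p F deg s(1)] by blast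
  have "(s \<ominus> t [^] p) [^] (p ^ e) \<in> \<mm>"
  proof -
    obtain k where "p ^ e = Suc k" using prime_gt_0_nat[OF p(1)] by (metis gr0_implies_Suc zero_less_power)
    then show ?thesis using \<mm>.I_l_closed[OF t(2)] s t by simp
  qed
  then have "s [^] (p ^ e) \<ominus> t [^] (p ^ Suc e) \<in> \<mm>"
    using s t frobenius_minus[OF p s(1), of "t [^] p" e] by (simp add: nat_pow_pow)
  from \<mm>.a_closed[OF s(2) this] have "r \<ominus> t [^] (p ^ Suc e) \<in> \<mm>"
  proof (rule back_subst[of "\<lambda>x. x \<in> \<mm>"])
    have c: "s [^] (p ^ e) \<in> carrier R" "t [^] (p ^ Suc e) \<in> carrier R" using s t by auto
    show "(r \<ominus> s [^] (p ^ e)) \<oplus> (s [^] (p ^ e) \<ominus> t [^] (p ^ Suc e)) = r \<ominus> t [^] (p ^ Suc e)"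
      using Suc.prems c by (simp add: a_minus_def a_assoc l_neg del: nat_pow_Suc power_Suc)
        (simp add: a_assoc[symmetric] l_neg)
  qed
  then show ?case using t by blast
qed

end

section \<open>Modules killed by the maximal ideal\<close>

context module
begin

lemma lincomb_closed [simp]:
  "\<lbrakk>set rs \<subseteq> carrier R; set cs \<subseteq> carrier M\<rbrakk> \<Longrightarrow> lincomb M rs cs \<in> carrier M"
proof (induction rs arbitrary: cs)
  case (Cons r rs)
  then show ?case by (cases cs) auto
qed simp

lemma lincomb_add:
  assumes "length rs = length cs" "length cs = length ss"
    and "set rs \<subseteq> carrier R" "set ss \<subseteq> carrier R" "set cs \<subseteq> carrier M"
  shows "lincomb M (map2 (\<oplus>) rs ss) cs = lincomb M rs cs \<oplus>\<^bsub>M\<^esub> lincomb M ss cs"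
  using assms
proof (induction rs cs ss rule: list_induct3)
  case (Cons r rs c cs s ss)
  then show ?case by (simp add: smult_l_distr M.a_ac)
qed auto

lemma lincomb_smult:
  assumes "a \<in> carrier R" "set rs \<subseteq> carrier R" "set cs \<subseteq> carrier M"
  shows "lincomb M (map ((\<otimes>) a) rs) cs = a \<odot>\<^bsub>M\<^esub> lincomb M rs cs"
  using assms(2,3)
proof (induction rs arbitrary: cs)
  case (Cons r rs)
  then show ?case using assms(1) by (cases cs) (auto simp: smult_assoc1 smult_r_distr)
qed (simp add: assms(1))

lemma lincomb_replicate_zero:
  "set cs \<subseteq> carrier M \<Longrightarrow> lincomb M (replicate n \<zero>) cs = \<zero>\<^bsub>M\<^esub>"
proof (induction n arbitrary: cs)
  case (Suc n)
  then show ?case by (cases cs) auto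
qed simp

lemma lincomb_mem_adjoin:
  "\<lbrakk>length rs = length cs; set rs \<subseteq> carrier R\<rbrakk> \<Longrightarrow> lincomb M rs cs \<in> adjoin R M {\<zero>\<^bsub>M\<^esub>} cs"
  by (induction rs cs rule: list_induct2) auto

end

lemma (in ring) map2_add_closed:
  "\<lbrakk>set rs \<subseteq> carrier R; set ss \<subseteq> carrier R\<rbrakk> \<Longrightarrow> set (map2 (\<oplus>) rs ss) \<subseteq> carrier R"
  by (auto elim!: in_set_zipE)

context noetherian_local_ring
begin

lemma lincomb_unit_coefficient:
  assumes M: "module R M" and "length rs = length cs" "set rs \<subseteq> carrier R" "set cs \<subseteq> carrier M"
    and "\<exists>r\<in>set rs. r \<in> Units R"
  shows "\<exists>us c vs r z. cs = us @ c # vs \<and> r \<in> Units R \<and> z \<in> adjoin R M {\<zero>\<^bsub>M\<^esub>} (us @ vs) \<and>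
    lincomb M rs cs = r \<odot>\<^bsub>M\<^esub> c \<oplus>\<^bsub>M\<^esub> z"
  using assms(2-)
proof (induction rs cs rule: list_induct2)
  case (Cons r rs c cs)
  interpret M: module R M by fact
  have cl: "r \<in> carrier R" "c \<in> carrier M" "set rs \<subseteq> carrier R" "set cs \<subseteq> carrier M"
    using Cons.prems by auto
  show ?case
  proof (cases "r \<in> Units R")
    case True
    then show ?thesis
      using M.lincomb_mem_adjoin[OF Cons.hyps cl(3)] by (intro exI[of _ "[]"]) auto
  next
    case False
    then obtain us d vs s z where *: "cs = us @ d # vs" "s \<in> Units R"
      "z \<in> adjoin R M {\<zero>\<^bsub>M\<^esub>} (us @ vs)" "lincomb M rs cs = s \<odot>\<^bsub>M\<^esub> d \<oplus>\<^bsub>M\<^esub> z"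
      using Cons by auto
    have d: "d \<in> carrier M" "set (us @ vs) \<subseteq> carrier M" using cl *(1) by auto
    have z: "z \<in> carrier M"
      using M.submodule_subset[OF M.submodule_adjoin[OF M.submodule_zero d(2)] *(3)] .
    have "r \<odot>\<^bsub>M\<^esub> c \<oplus>\<^bsub>M\<^esub> z \<in> adjoin R M {\<zero>\<^bsub>M\<^esub>} ((c # us) @ vs)" using cl(1) *(3) by auto
    moreover have "lincomb M (r # rs) (c # cs) = s \<odot>\<^bsub>M\<^esub> d \<oplus>\<^bsub>M\<^esub> (r \<odot>\<^bsub>M\<^esub> c \<oplus>\<^bsub>M\<^esub> z)"
      using cl *(2,4) d z by (simp add: M.M.a_lcomm Units_closed)
    ultimately show ?thesis using *(1,2)
      by (intro exI[of _ "c # us"] exI[of _ d] exI[of _ vs]) auto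
  qed
qed simp

text \<open>A unit coefficient would express one generator through the others, against the
  minimality of their number.\<close>

lemma minimal_generators_relation:
  assumes M: "fg_module R M" and cs: "set cs \<subseteq> carrier M" "adjoin R M {\<zero>\<^bsub>M\<^esub>} cs = carrier M"
    "length cs = min_gens R M"
    and rs: "length rs = length cs" "set rs \<subseteq> carrier R" "lincomb M rs cs = \<zero>\<^bsub>M\<^esub>"
  shows "set rs \<subseteq> \<mm>"
proof (rule ccontr)
  assume "\<not> ?thesis"
  then have "\<exists>r\<in>set rs. r \<in> Units R" using rs(2) max_ideal_iff_nonunit by auto
  note M' = fg_module_is_module[OF M]
  interpret M: module R M by fact
  obtain us c vs r z where *: "cs = us @ c # vs" "r \<in> Units R" "z \<in> adjoin R M {\<zero>\<^bsub>M\<^esub>} (us @ vs)"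
    "\<zero>\<^bsub>M\<^esub> = r \<odot>\<^bsub>M\<^esub> c \<oplus>\<^bsub>M\<^esub> z"
    using lincomb_unit_coefficient[OF M' rs(1,2) cs(1) \<open>\<exists>r\<in>set rs. r \<in> Units R\<close>] rs(3) by auto
  have c: "c \<in> carrier M" "set (us @ vs) \<subseteq> carrier M" using cs(1) *(1) by auto
  let ?T = "adjoin R M {\<zero>\<^bsub>M\<^esub>} (us @ vs)"
  have T: "submodule ?T R M" by (rule M.submodule_adjoin[OF M.submodule_zero c(2)])
  have "r \<odot>\<^bsub>M\<^esub> c = \<ominus>\<^bsub>M\<^esub> z"
    using *(2,4) c M.submodule_subset[OF T *(3)] by (intro M.M.minus_equality[symmetric]) (auto simp: Units_closed)
  then have "c \<in> ?T" using M.unit_smult_mem[OF T *(2) c(1)] M.submoduleE(3)[OF T *(3)] by simp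
  then have "set cs \<subseteq> ?T" using M.adjoin_mem[OF M.submodule_zero c(2)] unfolding *(1) by simp
  then have "adjoin R M {\<zero>\<^bsub>M\<^esub>} cs \<subseteq> ?T"
    using submodule_zero_mem[OF T] by (intro M.adjoin_minimal[OF T]) auto
  then have "?T = carrier M" using M.submoduleE(1)[OF T] cs(2) by auto
  from fg_moduleI(2)[OF M' c(2) this] show False using cs(3) *(1) by simp
qed

text \<open>Such an \<open>M\<close> is a vector space over the residue field, so coefficients
  matter only modulo \<open>\<mm>\<close>.\<close>

lemma lincomb_cong_max_ideal:
  assumes M: "module R M" and killed: "\<And>r x. \<lbrakk>r \<in> \<mm>; x \<in> carrier M\<rbrakk> \<Longrightarrow> r \<odot>\<^bsub>M\<^esub> x = \<zero>\<^bsub>M\<^esub>"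
    and cs: "set cs \<subseteq> carrier M"
    and rs: "list_all2 (\<lambda>r s. r \<in> carrier R \<and> s \<in> carrier R \<and> r \<ominus> s \<in> \<mm>) rs ss"
  shows "lincomb M rs cs = lincomb M ss cs"
  using rs cs
proof (induction arbitrary: cs rule: list_all2_induct)
  case (Cons r rs s ss)
  interpret M: module R M by fact
  show ?case
  proof (cases cs)
    case (Cons c ds)
    have c: "c \<in> carrier M" using Cons.prems Cons by auto
    have rs: "r \<in> carrier R" "s \<in> carrier R" "r \<ominus> s \<in> \<mm>" using Cons.hyps by auto
    have "r = (r \<ominus> s) \<oplus> s" using rs by (simp add: a_minus_def a_assoc l_neg)
    then have "r \<odot>\<^bsub>M\<^esub> c = (r \<ominus> s) \<odot>\<^bsub>M\<^esub> c \<oplus>\<^bsub>M\<^esub> s \<odot>\<^bsub>M\<^esub> c"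
      using rs c by (metis M.smult_l_distr minus_closed)
    also have "\<dots> = s \<odot>\<^bsub>M\<^esub> c" using killed[OF rs(3) c] rs c by simp
    finally show ?thesis using Cons Cons.IH[of ds] Cons.prems by simp
  qed simp
qed simp

end

context henselian_local_ring
begin

text \<open>The isomorphism is \<open>\<Sum> r\<^sub>i c\<^sub>i \<mapsto> \<Sum> r\<^sub>i ^ (p ^ e) c\<^sub>i\<close> for minimal generators \<open>c\<^sub>i\<close>; it is onto because the
  residue field is perfect.\<close>

lemma frob_module_isomorphic_killed:
  assumes p: "Factorial_Ring.prime p" "has_characteristic R p" and F: "F_finite R p"
    and deg: "log (real p) (real (p_degree \<kappa> p)) = 0" and M: "fg_module R M"
    and killed: "\<And>r x. \<lbrakk>r \<in> \<mm>; x \<in> carrier M\<rbrakk> \<Longrightarrow> r \<odot>\<^bsub>M\<^esub> x = \<zero>\<^bsub>M\<^esub>"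
  shows "module_isomorphic R M (frob_module R p e M)"
proof -
  note M' = fg_module_is_module[OF M]
  interpret M: module R M by fact
  define q where "q = p ^ e"
  have FM: "module R (frob_module R p e M)" by (rule module_frob_module[OF p M'])
  obtain cs where cs: "set cs \<subseteq> carrier M" "adjoin R M {\<zero>\<^bsub>M\<^esub>} cs = carrier M" "length cs = min_gens R M"
    using min_gens_list[OF M] by blast
  let ?ok = "\<lambda>rs. length rs = length cs \<and> set rs \<subseteq> carrier R"
  define h where "h x = lincomb M (map (\<lambda>r. r [^] q) (SOME rs. set rs \<subseteq> carrier R \<and> length rs = length cs \<and> x = lincomb M rs cs)) cs" for x
  have pow_m: "r [^] q \<in> \<mm> \<longleftrightarrow> r \<in> \<mm>" if r: "r \<in> carrier R" for r
  proof
    obtain k where k: "q = Suc k"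
      unfolding q_def using prime_gt_0_nat[OF p(1)] by (metis gr0_implies_Suc zero_less_power)
    show "r [^] q \<in> \<mm>" if "r \<in> \<mm>" using \<mm>.I_l_closed[OF that] r k by simp
    show "r \<in> \<mm>" if "r [^] q \<in> \<mm>"
    proof (rule ccontr)
      assume "r \<notin> \<mm>"
      then have "r [^] q \<in> Units R" using r max_ideal_iff_nonunit Units_pow_closed by blast
      then show False using that max_ideal_iff_nonunit r by simp
    qed
  qed
  have ok_pow: "?ok (map (\<lambda>r. r [^] q) rs)" if "?ok rs" for rs using that by auto
  \<comment> \<open>Two coefficient lists of the same element differ by a relation among minimal
    generators, hence by elements of \<open>\<mm>\<close>. Their \<open>q\<close>-th powers then
    also differ by elements of \<open>\<mm>\<close>, which act as zero, so the choice in
    \<open>h\<close> is immaterial.\<close>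
  have h_eq: "h (lincomb M rs cs) = lincomb M (map (\<lambda>r. r [^] q) rs) cs" if rs: "?ok rs" for rs
  proof -
    define ss where "ss = (SOME ss. set ss \<subseteq> carrier R \<and> length ss = length cs \<and> lincomb M rs cs = lincomb M ss cs)"
    have "\<exists>ss. set ss \<subseteq> carrier R \<and> length ss = length cs \<and> lincomb M rs cs = lincomb M ss cs"
      using rs by blast
    then have "set ss \<subseteq> carrier R \<and> length ss = length cs \<and> lincomb M rs cs = lincomb M ss cs"
      unfolding ss_def by (rule someI_ex)
    then have ss: "?ok ss" "lincomb M rs cs = lincomb M ss cs" by auto
    define ts where "ts = map2 (\<oplus>) ss (map ((\<otimes>) (\<ominus> \<one>)) rs)"
    have neg: "?ok (map ((\<otimes>) (\<ominus> \<one>)) rs)" using rs by auto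
    have ts: "?ok ts" using ss(1) neg map2_add_closed[of ss "map ((\<otimes>) (\<ominus> \<one>)) rs"] by (simp add: ts_def)
    have "lincomb M ts cs = lincomb M ss cs \<oplus>\<^bsub>M\<^esub> (\<ominus> \<one>) \<odot>\<^bsub>M\<^esub> lincomb M rs cs"
      unfolding ts_def using ss(1) neg rs cs(1) by (simp add: M.lincomb_add M.lincomb_smult)
    also have "\<dots> = \<zero>\<^bsub>M\<^esub>" using ss rs cs(1) by (simp add: M.smult_l_minus M.M.r_neg)
    finally have tm: "set ts \<subseteq> \<mm>" using minimal_generators_relation[OF M cs] ts by blast
    have "list_all2 (\<lambda>r s. r \<in> carrier R \<and> s \<in> carrier R \<and> r \<ominus> s \<in> \<mm>)
        (map (\<lambda>r. r [^] q) ss) (map (\<lambda>r. r [^] q) rs)"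
      unfolding list_all2_conv_all_nth
    proof (intro conjI allI impI)
      fix i assume i: "i < length (map (\<lambda>r. r [^] q) ss)"
      then have l: "i < length cs" "i < length ss" "i < length rs" "i < length ts" using ss(1) rs ts by auto
      have c: "ss ! i \<in> carrier R" "rs ! i \<in> carrier R" using l ss(1) rs by auto
      have "ts ! i = ss ! i \<ominus> rs ! i" using l c by (simp add: ts_def a_minus_def l_minus)
      then have "ss ! i \<ominus> rs ! i \<in> \<mm>" using tm nth_mem[OF l(4)] by auto
      then have "(ss ! i \<ominus> rs ! i) [^] q \<in> \<mm>" using pow_m c by simp
      then show "map (\<lambda>r. r [^] q) ss ! i \<ominus> map (\<lambda>r. r [^] q) rs ! i \<in> \<mm>"
        using l frobenius_minus[OF p c, of e] by (simp add: q_def)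
      show "map (\<lambda>r. r [^] q) ss ! i \<in> carrier R" "map (\<lambda>r. r [^] q) rs ! i \<in> carrier R" using l c by auto
    qed (use ss(1) rs in simp)
    from lincomb_cong_max_ideal[OF M' killed cs(1) this] show ?thesis by (simp add: h_def ss_def)
  qed
  have ex: "\<exists>rs. ?ok rs \<and> x = lincomb M rs cs" if "x \<in> carrier M" for x
    using adjoin_zero_lincomb[of x R M cs] cs(2) that by auto
  have h: "h \<in> module_hom R M (frob_module R p e M)"
  proof (rule module_homI)
    fix x assume x: "x \<in> carrier M"
    obtain rs where rs: "?ok rs" "x = lincomb M rs cs" using ex[OF x] by blast
    show "h x \<in> carrier (frob_module R p e M)" using h_eq[OF rs(1)] rs ok_pow[OF rs(1)] cs(1) by simp
    show "h (a \<odot>\<^bsub>M\<^esub> x) = a \<odot>\<^bsub>frob_module R p e M\<^esub> h x" if a: "a \<in> carrier R" for a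
    proof -
      have "a \<odot>\<^bsub>M\<^esub> x = lincomb M (map ((\<otimes>) a) rs) cs" using a rs cs(1) by (simp add: M.lincomb_smult)
      moreover have "?ok (map ((\<otimes>) a) rs)" using a rs(1) by auto
      moreover have "map ((\<lambda>r. r [^] q) \<circ> (\<otimes>) a) rs = map ((\<otimes>) (a [^] q)) (map (\<lambda>r. r [^] q) rs)"
        using a rs(1) by (auto simp: nat_pow_distrib subsetD)
      ultimately have "h (a \<odot>\<^bsub>M\<^esub> x) = lincomb M (map ((\<otimes>) (a [^] q)) (map (\<lambda>r. r [^] q) rs)) cs"
        using h_eq[of "map ((\<otimes>) a) rs"] by (simp only: map_map)
      also have "\<dots> = a [^] q \<odot>\<^bsub>M\<^esub> h x"
        using M.lincomb_smult[OF nat_pow_closed[OF a] conjunct2[OF ok_pow[OF rs(1)]] cs(1)]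
          h_eq[OF rs(1)] rs(2) by simp
      finally show ?thesis by (simp add: q_def)
    qed
    fix y assume y: "y \<in> carrier M"
    obtain ss where ss: "?ok ss" "y = lincomb M ss cs" using ex[OF y] by blast
    have rs': "?ok (map2 (\<oplus>) rs ss)" using rs(1) ss(1) map2_add_closed[of rs ss] by simp
    have "map (\<lambda>r. r [^] q) (map2 (\<oplus>) rs ss) = map2 (\<oplus>) (map (\<lambda>r. r [^] q) rs) (map (\<lambda>r. r [^] q) ss)"
      using rs(1) ss(1) by (intro nth_equalityI) (auto simp: frobenius_add[OF p] q_def nth_mem subsetD)
    then have "h (lincomb M (map2 (\<oplus>) rs ss) cs) =
        lincomb M (map (\<lambda>r. r [^] q) rs) cs \<oplus>\<^bsub>M\<^esub> lincomb M (map (\<lambda>r. r [^] q) ss) cs"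
      using h_eq[OF rs'] ok_pow[OF rs(1)] ok_pow[OF ss(1)] cs(1) by (simp only: M.lincomb_add)
    then show "h (x \<oplus>\<^bsub>M\<^esub> y) = h x \<oplus>\<^bsub>frob_module R p e M\<^esub> h y"
      using rs ss h_eq cs(1) by (simp add: M.lincomb_add)
  qed
  have "bij_betw h (carrier M) (carrier (frob_module R p e M))"
    unfolding bij_betw_def
  proof
    show "inj_on h (carrier M)"
    proof (rule module_hom_inj_on[OF M' FM h])
      fix x assume x: "x \<in> carrier M" "h x = \<zero>\<^bsub>frob_module R p e M\<^esub>"
      obtain rs where rs: "?ok rs" "x = lincomb M rs cs" using ex[OF x(1)] by blast
      have "lincomb M (map (\<lambda>r. r [^] q) rs) cs = \<zero>\<^bsub>M\<^esub>" using x(2) h_eq[OF rs(1)] rs(2) by simp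
      then have "set (map (\<lambda>r. r [^] q) rs) \<subseteq> \<mm>"
        using minimal_generators_relation[OF M cs] ok_pow[OF rs(1)] by blast
      then have rm: "r \<in> \<mm>" if "r \<in> set rs" for r using pow_m[of r] rs(1) that by auto
      have "list_all2 (\<lambda>r s. r \<in> carrier R \<and> s \<in> carrier R \<and> r \<ominus> s \<in> \<mm>) rs (replicate (length rs) \<zero>)"
        using rs(1) rm by (auto simp: list_all2_conv_all_nth a_minus_def uminus_zero subsetD nth_mem)
      from lincomb_cong_max_ideal[OF M' killed cs(1) this]
      have "x = lincomb M (replicate (length rs) \<zero>) cs" using rs(2) by simp
      also have "\<dots> = \<zero>\<^bsub>M\<^esub>" by (rule M.lincomb_replicate_zero[OF cs(1)])
      finally show "x = \<zero>\<^bsub>M\<^esub>" .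
    qed
    show "h ` carrier M = carrier (frob_module R p e M)"
    proof
      show "h ` carrier M \<subseteq> carrier (frob_module R p e M)" using module_hom_closed[OF h] by blast
      show "carrier (frob_module R p e M) \<subseteq> h ` carrier M"
      proof
        fix y assume "y \<in> carrier (frob_module R p e M)"
        then obtain rs where rs: "?ok rs" "y = lincomb M rs cs" using ex by auto
        have "\<forall>r\<in>carrier R. \<exists>t. t \<in> carrier R \<and> r \<ominus> t [^] q \<in> \<mm>"
          using perfect_residue_field_pow[OF p F deg, of _ e] unfolding q_def by blast
        from bchoice[OF this] obtain s where s: "\<And>r. r \<in> carrier R \<Longrightarrow> s r \<in> carrier R \<and> r \<ominus> s r [^] q \<in> \<mm>"
          by blast
        have ok: "?ok (map s rs)" using rs(1) s by auto
        have "list_all2 (\<lambda>r s. r \<in> carrier R \<and> s \<in> carrier R \<and> r \<ominus> s \<in> \<mm>) rs (map (\<lambda>r. r [^] q) (map s rs))"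
          using rs(1) s by (auto simp: list_all2_conv_all_nth subsetD nth_mem)
        from lincomb_cong_max_ideal[OF M' killed cs(1) this]
        have "y = h (lincomb M (map s rs) cs)" using rs(2) h_eq[OF ok] by simp
        then show "y \<in> h ` carrier M" using ok cs(1) by (intro image_eqI[of y h]) auto
      qed
    qed
  qed
  then show ?thesis using h by (auto simp: module_isomorphic_def)
qed

lemma surj_num_mult_Ind_cong:
  assumes "A \<in> fg_modules R" "B \<in> fg_modules R" "module R N" "\<not> zero_module N"
    and "\<And>W. mult_Ind W A = mult_Ind W B"
  shows "surj_num R N A = surj_num R N B"
  using surj_num_mult_Ind_le[OF assms(1,2,3,4) mult_Ind_finite_support[OF assms(1)]]
    surj_num_mult_Ind_le[OF assms(2,1,3,4) mult_Ind_finite_support[OF assms(2)]] assms(5)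
  by simp

text \<open>A copy of \<open>N^n\<close> is built inside the universe from the copy \<open>E\<close>
  of \<open>N\<close>. Jointly bijective coordinate maps are carried along the induction, so that
  \<open>surj_num_power\<close> applies to the result.\<close>

lemma surj_num_multiple_self:
  assumes N: "fg_module R N" "\<not> zero_module N" and E: "E \<in> fg_modules R" "module_isomorphic R E N"
  shows "\<exists>P\<in>fg_modules R. (\<forall>W. mult_Ind W P = n * mult_Ind W E) \<and> surj_num R N P = n"
proof -
  note N' = fg_module_is_module[OF N(1)]
  interpret N: module R N by fact
  obtain f g where f: "f \<in> module_hom R E N" and g: "g \<in> module_hom R N E"
    and gf: "\<And>x. x \<in> carrier E \<Longrightarrow> g (f x) = x" and fg: "\<And>y. y \<in> carrier N \<Longrightarrow> f (g y) = y"
    using module_isomorphicE[OF E(2) fg_modulesD(2)[OF E(1)] N'] by blast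
  have "\<exists>P\<in>fg_modules R. (\<forall>W. mult_Ind W P = n * mult_Ind W E) \<and>
    (\<exists>F. (\<forall>i<n. F i \<in> module_hom R P N) \<and> jointly_onto N (carrier P) {..<n} F \<and>
      (\<forall>x\<in>carrier P. (\<forall>i<n. F i x = \<zero>\<^bsub>N\<^esub>) \<longrightarrow> x = \<zero>\<^bsub>P\<^esub>))"
  proof (induction n)
    case 0
    obtain Z where Z: "Z \<in> fg_modules R" "zero_module Z" using ex_zero_fg_modules E(1) by blast
    then show ?case
      using mult_Ind_zero by (intro bexI[of _ Z]) (auto simp: jointly_onto_def zero_module_def)
  next
    case (Suc n)
    then obtain P F where P: "P \<in> fg_modules R" "\<And>W. mult_Ind W P = n * mult_Ind W E"
      and F: "\<And>i. i < n \<Longrightarrow> F i \<in> module_hom R P N" and onto: "jointly_onto N (carrier P) {..<n} F"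
      and inj: "\<And>x. x \<in> carrier P \<Longrightarrow> (\<forall>i<n. F i x = \<zero>\<^bsub>N\<^esub>) \<Longrightarrow> x = \<zero>\<^bsub>P\<^esub>" by blast
    obtain U where U: "U \<in> fg_modules R" "module_isomorphic R U (direct_sum E P)"
      using ex_direct_sum_fg_modules[OF E(1) P(1)] by blast
    note mods = fg_modulesD(2)[OF U(1)] fg_modulesD(2)[OF E(1)] fg_modulesD(2)[OF P(1)]
    interpret U: module R U by (rule mods(1))
    interpret E: module R E by (rule mods(2))
    interpret P: module R P by (rule mods(3))
    obtain i j r s where bip: "biproduct R U E P i j r s"
      by (rule isomorphic_imp_biproduct[OF U(2) mods])
    note b = biproductD[OF bip]
    note cl = b(1-4)[THEN module_hom_closed]
    define F' where "F' k = (case k of 0 \<Rightarrow> (\<lambda>x. f (r x)) | Suc l \<Rightarrow> (\<lambda>x. F l (s x)))" for k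
    have "F' k \<in> module_hom R U N" if "k < Suc n" for k
      using that module_hom_compose[OF b(3) f] module_hom_compose[OF b(4) F] by (auto simp: F'_def split: nat.split)
    moreover have "jointly_onto N (carrier U) {..<Suc n} F'"
      unfolding jointly_onto_def
    proof
      fix y assume y: "y \<in> {..<Suc n} \<rightarrow> carrier N"
      then have y0: "y 0 \<in> carrier N" by auto
      obtain x where x: "x \<in> carrier P" "\<And>k. k \<in> {..<n} \<Longrightarrow> F k x = y (Suc k)"
        by (rule jointly_ontoD[OF onto, of "\<lambda>k. y (Suc k)"]) (use y in auto)
      have gy: "g (y 0) \<in> carrier E" by (rule module_hom_closed[OF g y0])
      have "r (i (g (y 0)) \<oplus>\<^bsub>U\<^esub> j x) = g (y 0)" "s (i (g (y 0)) \<oplus>\<^bsub>U\<^esub> j x) = x"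
        using x(1) gy cl b(5-8) by (simp_all add: module_hom_add[OF b(3)] module_hom_add[OF b(4)])
      then have "F' k (i (g (y 0)) \<oplus>\<^bsub>U\<^esub> j x) = y k" if "k < Suc n" for k
        using that x(2) fg[OF y0] by (auto simp: F'_def split: nat.split)
      then show "\<exists>x\<in>carrier U. \<forall>k\<in>{..<Suc n}. F' k x = y k"
        using x(1) gy cl by (intro bexI[of _ "i (g (y 0)) \<oplus>\<^bsub>U\<^esub> j x"]) auto
    qed
    moreover have "x = \<zero>\<^bsub>U\<^esub>" if x: "x \<in> carrier U" "\<forall>k<Suc n. F' k x = \<zero>\<^bsub>N\<^esub>" for x
    proof -
      have "f (r x) = \<zero>\<^bsub>N\<^esub>" using x(2)[rule_format, of 0] by (simp add: F'_def)
      then have "r x = \<zero>\<^bsub>E\<^esub>" using gf[of "r x"] cl(3)[OF x(1)] module_hom_zero[OF N' mods(2) g] by simp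
      moreover have "F k (s x) = \<zero>\<^bsub>N\<^esub>" if "k < n" for k using x(2)[rule_format, of "Suc k"] that by (simp add: F'_def)
      then have "s x = \<zero>\<^bsub>P\<^esub>" using inj cl(4)[OF x(1)] by blast
      ultimately show ?thesis
        using b(9)[OF x(1)] module_hom_zero[OF mods(2,1) b(1)] module_hom_zero[OF mods(3,1) b(2)] by simp
    qed
    moreover have "mult_Ind W U = Suc n * mult_Ind W E" for W
      using mult_Ind_direct_sum[OF U(1) E(1) P(1) U(2)] P(2) by simp
    ultimately show ?case using U(1) by blast
  qed
  then obtain P F where P: "P \<in> fg_modules R" "\<And>W. mult_Ind W P = n * mult_Ind W E"
    and F: "\<And>i. i < n \<Longrightarrow> F i \<in> module_hom R P N" "jointly_onto N (carrier P) {..<n} F"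
    "\<And>x. x \<in> carrier P \<Longrightarrow> (\<forall>i<n. F i x = \<zero>\<^bsub>N\<^esub>) \<Longrightarrow> x = \<zero>\<^bsub>P\<^esub>" by blast
  have "surj_num R N P = n"
    by (rule surj_num_power[OF N fg_modulesD(1)[OF P(1)] F(1,2)]) (use F(3) in blast)+
  then show ?thesis using P by blast
qed

text \<open>A preimage of \<open>y\<close> in \<open>P\<close> would be killed by \<open>r\<close>,
  although \<open>r y\<close> is nonzero.\<close>

lemma surj_num_killed:
  assumes N: "module R N" "\<not> zero_module N" and P: "fg_module R P"
    and killed: "\<And>r x. \<lbrakk>r \<in> \<mm>; x \<in> carrier P\<rbrakk> \<Longrightarrow> r \<odot>\<^bsub>P\<^esub> x = \<zero>\<^bsub>P\<^esub>"
    and r: "r \<in> \<mm>" "y \<in> carrier N" "r \<odot>\<^bsub>N\<^esub> y \<noteq> \<zero>\<^bsub>N\<^esub>"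
  shows "surj_num R N P = 0"
proof (rule ccontr)
  assume "surj_num R N P \<noteq> 0"
  then have pos: "0 < surj_num R N P" by simp
  obtain F where F: "\<And>i. i < surj_num R N P \<Longrightarrow> F i \<in> module_hom R P N"
    "jointly_onto N (carrier P) {..<surj_num R N P} F"
    using surjects_onto_power_surj_num[OF P N] by (auto simp: surjects_onto_power_def)
  obtain x where x: "x \<in> carrier P" "\<And>i. i \<in> {..<surj_num R N P} \<Longrightarrow> F i x = y"
    by (rule jointly_ontoD[OF F(2), of "\<lambda>_. y"]) (use r in auto)
  have "r \<odot>\<^bsub>N\<^esub> y = F 0 (r \<odot>\<^bsub>P\<^esub> x)"
    using x pos module_hom_smult[OF F(1)[OF pos] \<mm>.a_Hcarr[OF r(1)] x(1)] by simp
  also have "\<dots> = \<zero>\<^bsub>N\<^esub>"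
    using killed[OF r(1) x(1)] module_hom_zero[OF fg_module_is_module[OF P] N(1) F(1)[OF pos]] by simp
  finally show False using r(3) by simp
qed

text \<open>Being killed by \<open>\<mm>\<close> passes to direct sums, so every multiple of
  \<open>E\<close> falls under \<open>surj_num_killed\<close>.\<close>

lemma surj_num_multiple_killed:
  assumes N: "module R N" "\<not> zero_module N" and E: "E \<in> fg_modules R"
    and killed: "\<And>r x. \<lbrakk>r \<in> \<mm>; x \<in> carrier E\<rbrakk> \<Longrightarrow> r \<odot>\<^bsub>E\<^esub> x = \<zero>\<^bsub>E\<^esub>"
    and r: "r \<in> \<mm>" "y \<in> carrier N" "r \<odot>\<^bsub>N\<^esub> y \<noteq> \<zero>\<^bsub>N\<^esub>"
  shows "\<exists>P\<in>fg_modules R. (\<forall>W. mult_Ind W P = n * mult_Ind W E) \<and> surj_num R N P = 0"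
proof -
  have "\<exists>P\<in>fg_modules R. (\<forall>W. mult_Ind W P = n * mult_Ind W E) \<and>
      (\<forall>r\<in>\<mm>. \<forall>x\<in>carrier P. r \<odot>\<^bsub>P\<^esub> x = \<zero>\<^bsub>P\<^esub>)"
  proof (induction n)
    case 0
    obtain Z where Z: "Z \<in> fg_modules R" "zero_module Z" using ex_zero_fg_modules E(1) by blast
    interpret Z: module R Z using Z(1) by (rule fg_modulesD)
    show ?case
      using Z mult_Ind_zero \<mm>.a_Hcarr by (intro bexI[of _ Z]) (auto simp: zero_module_def)
  next
    case (Suc n)
    then obtain P where P: "P \<in> fg_modules R" "\<And>W. mult_Ind W P = n * mult_Ind W E"
      "\<And>r x. r \<in> \<mm> \<Longrightarrow> x \<in> carrier P \<Longrightarrow> r \<odot>\<^bsub>P\<^esub> x = \<zero>\<^bsub>P\<^esub>" by blast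
    obtain U where U: "U \<in> fg_modules R" "module_isomorphic R U (direct_sum E P)"
      using ex_direct_sum_fg_modules[OF E(1) P(1)] by blast
    note mods = fg_modulesD(2)[OF U(1)] fg_modulesD(2)[OF E(1)] fg_modulesD(2)[OF P(1)]
    interpret U: module R U by (rule mods(1))
    obtain i j a b where bip: "biproduct R U E P i j a b"
      by (rule isomorphic_imp_biproduct[OF U(2) mods])
    note bp = biproductD[OF bip]
    note cl = bp(1-4)[THEN module_hom_closed]
    have "r \<odot>\<^bsub>U\<^esub> x = \<zero>\<^bsub>U\<^esub>" if r: "r \<in> \<mm>" and x: "x \<in> carrier U" for r x
    proof -
      have rR: "r \<in> carrier R" using r by (rule \<mm>.a_Hcarr)
      have "r \<odot>\<^bsub>U\<^esub> x = r \<odot>\<^bsub>U\<^esub> (i (a x) \<oplus>\<^bsub>U\<^esub> j (b x))" using bp(9)[OF x] by simp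
      also have "\<dots> = i (r \<odot>\<^bsub>E\<^esub> a x) \<oplus>\<^bsub>U\<^esub> j (r \<odot>\<^bsub>P\<^esub> b x)"
        using x rR cl by (simp add: U.smult_r_distr module_hom_smult[OF bp(1)] module_hom_smult[OF bp(2)])
      also have "\<dots> = \<zero>\<^bsub>U\<^esub>"
        using killed[OF r] P(3)[OF r] x cl module_hom_zero[OF mods(2,1) bp(1)] module_hom_zero[OF mods(3,1) bp(2)]
        by simp
      finally show ?thesis .
    qed
    moreover have "mult_Ind W U = Suc n * mult_Ind W E" for W
      using mult_Ind_direct_sum[OF U(1) E(1) P(1) U(2)] P(2) by simp
    ultimately show ?case using U(1) by blast
  qed
  then show ?thesis using surj_num_killed[OF N fg_modulesD(1) _ r] by metis
qed

end

section \<open>The asymptotic surjective number and the Frobenius limit\<close>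

text \<open>Fekete's lemma for a real parameter; the limit is the supremum of
  \<open>g t / t\<close>, finite by the linear bound.\<close>

lemma superadditive_real_limit:
  fixes g :: "real \<Rightarrow> real"
  assumes super: "\<And>s t. \<lbrakk>0 \<le> s; 0 \<le> t\<rbrakk> \<Longrightarrow> g s + g t \<le> g (s + t)"
    and nonneg: "\<And>t. 0 \<le> t \<Longrightarrow> 0 \<le> g t" and bound: "\<And>t. 0 \<le> t \<Longrightarrow> g t \<le> C * t"
  shows "\<exists>L. ((\<lambda>t. g t / t) \<longlongrightarrow> L) at_top"
proof -
  let ?S = "(\<lambda>t. g t / t) ` {0<..}"
  have bdd: "bdd_above ?S" using bound by (intro bdd_aboveI[of _ C]) (auto simp: divide_le_eq)
  have mult: "real n * g s \<le> g (real n * s)" if "0 \<le> s" for n s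
  proof (induction n)
    case (Suc n)
    have "real (Suc n) * g s \<le> g (real n * s) + g s" using Suc by (simp add: algebra_simps)
    also have "\<dots> \<le> g (real n * s + s)" using that by (intro super) auto
    also have "real n * s + s = real (Suc n) * s" by (simp add: algebra_simps)
    finally show ?case .
  qed (simp add: nonneg)
  have "((\<lambda>t. g t / t) \<longlongrightarrow> Sup ?S) at_top"
  proof (rule order_tendstoI)
    fix a assume "a < Sup ?S"
    then obtain s where s: "0 < s" "a < g s / s" using less_cSup_iff[OF _ bdd, of a] by auto
    \<comment> \<open>An interval of length \<open>t\<close> contains at least
      \<open>t / s - 1\<close> full steps of length \<open>s\<close>, so superadditivity gives
      \<open>g t \<ge> (t / s - 1) * g s\<close>. Division by \<open>t\<close> turns this into the
      lower bound used here.\<close>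
    have "((\<lambda>t. g s / s - g s / t) \<longlongrightarrow> g s / s - 0) at_top"
      by (intro tendsto_diff tendsto_const tendsto_divide_0[OF tendsto_const] filterlim_at_top_imp_at_infinity filterlim_ident)
    then have "eventually (\<lambda>t. a < g s / s - g s / t) at_top"
      using s(2) by (intro order_tendstoD) auto
    then show "eventually (\<lambda>t. a < g t / t) at_top"
      using eventually_gt_at_top[of 0]
    proof eventually_elim
      case (elim t)
      define n where "n = nat \<lfloor>t / s\<rfloor>"
      have n: "real n \<le> t / s" "t / s - 1 \<le> real n" using elim(2) s(1) by (auto simp: n_def)
      have r: "0 \<le> t - real n * s" using n(1) s(1) by (simp add: pos_le_divide_eq)
      have "(t / s - 1) * g s \<le> real n * g s" using n(2) nonneg[of s] s(1) by (intro mult_right_mono) auto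
      also have "\<dots> \<le> g (real n * s) + g (t - real n * s)" using mult[of s n] nonneg[OF r] s(1) by simp
      also have "\<dots> \<le> g t" using super[OF _ r, of "real n * s"] s(1) by simp
      finally have "(t / s - 1) * g s / t \<le> g t / t" using elim(2) by (intro divide_right_mono) auto
      moreover have "(t / s - 1) * g s / t = g s / s - g s / t" using elim(2) s(1) by (simp add: field_simps)
      ultimately show ?case using elim(1) by simp
    qed
  next
    fix a assume a: "Sup ?S < a"
    show "eventually (\<lambda>t. g t / t < a) at_top"
      using eventually_gt_at_top[of 0]
    proof eventually_elim
      case (elim t)
      then have "g t / t \<le> Sup ?S" using bdd by (intro cSup_upper) auto
      then show ?case using a by simp
    qed
  qed
  then show ?thesis by blast
qed

lemma nat_floor_add_le:
  fixes c :: real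
  assumes "0 \<le> s" "0 \<le> t"
  shows "nat \<lfloor>s * c\<rfloor> + nat \<lfloor>t * c\<rfloor> \<le> nat \<lfloor>(s + t) * c\<rfloor>"
proof (cases "0 \<le> c")
  case True
  have "\<lfloor>s * c\<rfloor> + \<lfloor>t * c\<rfloor> \<le> \<lfloor>s * c + t * c\<rfloor>" by (rule le_floor_add)
  moreover have "0 \<le> \<lfloor>s * c\<rfloor>" "0 \<le> \<lfloor>t * c\<rfloor>" using True assms by auto
  ultimately show ?thesis by (simp add: algebra_simps nat_add_distrib[symmetric])
next
  case False
  then have "s * c \<le> 0" "t * c \<le> 0" using assms by (auto simp: mult_nonneg_nonpos)
  then have "\<lfloor>s * c\<rfloor> \<le> 0" "\<lfloor>t * c\<rfloor> \<le> 0" by linarith+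
  then show ?thesis by simp
qed

text \<open>For negative \<open>x\<close>, truncation at zero only moves closer to the natural
  number \<open>m\<close>, so the floor alone is responsible for the summand
  \<open>1\<close>.\<close>

lemma abs_nat_floor_le: "\<bar>real m - real (nat \<lfloor>x\<rfloor>)\<bar> \<le> \<bar>real m - x\<bar> + 1"
  by linarith

lemma null_sequence_bound:
  fixes f g :: "nat \<Rightarrow> real"
  assumes "\<And>n. \<bar>f n\<bar> \<le> g n" "g \<longlonglongrightarrow> 0"
  shows "f \<longlonglongrightarrow> 0"
proof (rule tendsto_0_le[OF assms(2), of f 1], intro always_eventually allI)
  show "norm (f n) \<le> norm (g n) * 1" for n using assms(1)[of n] by simp
qed

lemma nat_eqI_near:
  assumes "\<bar>real a - x\<bar> < 1 / 2" "\<bar>real b - x\<bar> < 1 / 2"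
  shows "a = b"
proof (rule linorder_cases[of a b])
  assume "a < b"
  then have "real a + 1 \<le> real b" by linarith
  then show ?thesis using assms by linarith
next
  assume "b < a"
  then have "real b + 1 \<le> real a" by linarith
  then show ?thesis using assms by linarith
qed

lemma log_nat_nonneg: "1 < b \<Longrightarrow> 0 \<le> log b (real n)"
  by (cases n) (auto simp: log_def)

section \<open>Continuity of surjective numbers on Theta\<close>

context henselian_local_ring
begin

lemma abs_surj_num_diff_le:
  assumes "A \<in> fg_modules R" "B \<in> fg_modules R" "module R N" "\<not> zero_module N"
    and F: "finite F" "{W. mult_Ind W A \<noteq> 0} \<subseteq> F" "{W. mult_Ind W B \<noteq> 0} \<subseteq> F"
  shows "\<bar>real (surj_num R N A) - real (surj_num R N B)\<bar>
    \<le> (\<Sum>W\<in>F. \<bar>real (mult_Ind W A) - real (mult_Ind W B)\<bar> * real (min_gens R (class_rep W)))"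
proof -
  have *: "real (surj_num R N A) \<le> real (surj_num R N B) +
      (\<Sum>W\<in>F. \<bar>real (mult_Ind W A) - real (mult_Ind W B)\<bar> * real (min_gens R (class_rep W)))"
    if "A \<in> fg_modules R" "B \<in> fg_modules R" "{W. mult_Ind W A \<noteq> 0} \<subseteq> F" for A B
  proof -
    have d: "real (a - b) \<le> \<bar>real a - real b\<bar>" for a b :: nat by linarith
    have "real (surj_num R N A) \<le>
        real (surj_num R N B + (\<Sum>W\<in>F. (mult_Ind W A - mult_Ind W B) * min_gens R (class_rep W)))"
      using surj_num_mult_Ind_le[OF that(1,2) assms(3,4) F(1) that(3)] by (simp only: of_nat_le_iff)
    also have "\<dots> = real (surj_num R N B) +
        (\<Sum>W\<in>F. real (mult_Ind W A - mult_Ind W B) * real (min_gens R (class_rep W)))" by simp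
    also have "\<dots> \<le> real (surj_num R N B) +
        (\<Sum>W\<in>F. \<bar>real (mult_Ind W A) - real (mult_Ind W B)\<bar> * real (min_gens R (class_rep W)))"
      by (intro add_left_mono sum_mono mult_right_mono d) simp
    finally show ?thesis .
  qed
  show ?thesis
    using *[OF assms(1,2) F(2)] *[OF assms(2,1) F(3)] by (simp add: abs_minus_commute)
qed

lemma
  assumes "fg_modules R \<noteq> {}" "\<alpha> \<in> carrier RE.V"
  shows multiple_theta_module_mem: "theta_module R (t \<odot>\<^bsub>RE.V\<^esub> \<alpha>) \<in> fg_modules R"
    and mult_Ind_multiple_theta_module:
      "mult_Ind W (theta_module R (t \<odot>\<^bsub>RE.V\<^esub> \<alpha>)) = nat \<lfloor>t * theta_coeff R \<alpha> W\<rfloor>"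
  using theta_module_mem[OF assms(1) RE.smult_V_closed[OF assms(2)]]
    mult_Ind_theta_module[OF assms(1) RE.smult_V_closed[OF assms(2)]] theta_coeff_smult[OF assms(2)]
  by auto

text \<open>Truncated floors are superadditive, and \<open>surj_num\<close> is superadditive on
  direct sums and monotone in the multiplicities. Hence Fekete's lemma applies, and the
  \<open>Lim\<close> in \<open>asn\<close> is a genuine limit.\<close>

lemma asn_tendsto:
  assumes ne: "fg_modules R \<noteq> {}" and \<alpha>: "\<alpha> \<in> carrier RE.V" and N: "module R N" "\<not> zero_module N"
  shows "((\<lambda>t::real. real (theta_surj R N (t \<odot>\<^bsub>RE.V\<^esub> \<alpha>)) / t) \<longlongrightarrow> asn R N \<alpha>) at_top"
proof -
  define T where "T t = theta_module R (t \<odot>\<^bsub>RE.V\<^esub> \<alpha>)" for t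
  define S where "S = {W. theta_coeff R \<alpha> W \<noteq> 0}"
  have S: "finite S" unfolding S_def by (rule theta_coeff_finite[OF \<alpha>])
  have T: "T t \<in> fg_modules R" for t unfolding T_def by (rule multiple_theta_module_mem[OF ne \<alpha>])
  have mult: "mult_Ind W (T t) = nat \<lfloor>t * theta_coeff R \<alpha> W\<rfloor>" for W t
    unfolding T_def by (rule mult_Ind_multiple_theta_module[OF ne \<alpha>])
  have super: "surj_num R N (T s) + surj_num R N (T t) \<le> surj_num R N (T (s + t))"
    if "0 \<le> s" "0 \<le> t" for s t
  proof -
    obtain U where U: "U \<in> fg_modules R" "module_isomorphic R U (direct_sum (T s) (T t))"
      using ex_direct_sum_fg_modules[OF T T] by blast
    have "mult_Ind W U \<le> mult_Ind W (T (s + t))" for W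
      unfolding mult_Ind_direct_sum[OF U(1) T T U(2)] mult using nat_floor_add_le[OF that] .
    \<comment> \<open>All truncated differences of multiplicities are zero, so the error sum in
      \<open>surj_num_mult_Ind_le\<close> disappears.\<close>
    then have "surj_num R N U \<le> surj_num R N (T (s + t))"
      using surj_num_mult_Ind_le[OF U(1) T N mult_Ind_finite_support[OF U(1)] order_refl, of "s + t"] by simp
    then show ?thesis using surj_num_direct_sum(2)[OF U(1) T T U(2) N] by simp
  qed
  have bound: "real (surj_num R N (T t)) \<le>
      (\<Sum>W\<in>S. \<bar>theta_coeff R \<alpha> W\<bar> * real (min_gens R (class_rep W))) * t" if "0 \<le> t" for t
  proof -
    have "surj_num R N (T t) \<le> (\<Sum>W\<in>S. mult_Ind W (T t) * min_gens R (class_rep W))"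
      using surj_num_le_min_gens[OF fg_modulesD(1)[OF T] N]
      by (rule order_trans) (rule min_gens_le_sum_mult_Ind[OF T S], auto simp: S_def mult)
    then have "real (surj_num R N (T t)) \<le> real (\<Sum>W\<in>S. mult_Ind W (T t) * min_gens R (class_rep W))"
      by (simp only: of_nat_le_iff)
    also have "\<dots> = (\<Sum>W\<in>S. real (nat \<lfloor>t * theta_coeff R \<alpha> W\<rfloor>) * real (min_gens R (class_rep W)))"
      by (simp add: mult)
    also have "\<dots> \<le> (\<Sum>W\<in>S. (t * \<bar>theta_coeff R \<alpha> W\<bar>) * real (min_gens R (class_rep W)))"
    proof (intro sum_mono mult_right_mono)
      fix W
      have "real (nat \<lfloor>t * theta_coeff R \<alpha> W\<rfloor>) \<le> \<bar>t * theta_coeff R \<alpha> W\<bar>" by linarith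
      then show "real (nat \<lfloor>t * theta_coeff R \<alpha> W\<rfloor>) \<le> t * \<bar>theta_coeff R \<alpha> W\<bar>" using that by (simp add: abs_mult)
    qed simp
    finally show ?thesis by (simp add: sum_distrib_left mult_ac)
  qed
  have "\<exists>L. ((\<lambda>t. real (surj_num R N (T t)) / t) \<longlongrightarrow> L) at_top"
    using super bound by (intro superadditive_real_limit) (simp_all flip: of_nat_add)
  then obtain L where L: "((\<lambda>t::real. real (theta_surj R N (t \<odot>\<^bsub>RE.V\<^esub> \<alpha>)) / t) \<longlongrightarrow> L) at_top"
    unfolding theta_surj_def T_def by blast
  then have "asn R N \<alpha> = L"
    unfolding asn_def Theta_eq by (intro tendsto_Lim) simp_all
  then show ?thesis using L by simp
qed

lemma theta_norm_nonneg: "0 \<le> theta_norm R \<alpha>"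
  unfolding theta_norm_def by (intro sum_nonneg) auto

text \<open>An indecomposable module needs at least one generator, so each weight in the norm is at
  least \<open>1\<close>. Limits in norm are therefore coordinatewise limits, uniformly in
  \<open>W\<close>, and are unique.\<close>

lemma abs_theta_coeff_le_norm:
  assumes \<alpha>: "\<alpha> \<in> carrier RE.V"
  shows "\<bar>theta_coeff R \<alpha> W\<bar> \<le> theta_norm R \<alpha>"
proof (cases "theta_coeff R \<alpha> W = 0")
  case False
  then have W: "W \<in> Ind R" using coeff_Ind_outside[OF \<alpha>] by blast
  have "\<bar>theta_coeff R \<alpha> W\<bar> * 1 \<le> \<bar>theta_coeff R \<alpha> W\<bar> * real (min_gens R (class_rep W))"
    using min_gens_Ind_pos[OF W] by (intro mult_left_mono) auto
  also have "\<dots> \<le> theta_norm R \<alpha>"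
    unfolding theta_norm_def
    by (rule member_le_sum[where f = "\<lambda>W. \<bar>theta_coeff R \<alpha> W\<bar> * real (min_gens R (class_rep W))"])
      (use False theta_coeff_finite[OF \<alpha>] in auto)
  finally show ?thesis by simp
qed (simp add: theta_norm_nonneg)

lemma theta_tendsto_coeff:
  assumes s: "\<And>e. s e \<in> carrier RE.V" and lim: "theta_tendsto R s \<alpha>"
  shows "(\<lambda>e. theta_coeff R (s e) W) \<longlonglongrightarrow> theta_coeff R \<alpha> W"
proof -
  have \<alpha>: "\<alpha> \<in> carrier RE.V" and n: "(\<lambda>e. theta_norm R (s e \<ominus>\<^bsub>RE.V\<^esub> \<alpha>)) \<longlonglongrightarrow> 0"
    using lim by (auto simp: theta_tendsto_def Theta_eq)
  have "(\<lambda>e. theta_coeff R (s e) W - theta_coeff R \<alpha> W) \<longlonglongrightarrow> 0"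
  proof (rule null_sequence_bound[OF _ n])
    fix e
    show "\<bar>theta_coeff R (s e) W - theta_coeff R \<alpha> W\<bar> \<le> theta_norm R (s e \<ominus>\<^bsub>RE.V\<^esub> \<alpha>)"
      using abs_theta_coeff_le_norm[OF RE.V.minus_closed[OF s[of e] \<alpha>], of W] theta_coeff_minus[OF s \<alpha>] by simp
  qed
  then show ?thesis by (rule LIM_zero_cancel)
qed

lemma theta_tendsto_unique:
  assumes s: "\<And>e. s e \<in> carrier RE.V" and lim: "theta_tendsto R s \<alpha>" "theta_tendsto R s \<beta>"
  shows "\<alpha> = \<beta>"
proof (rule Theta_eqI)
  show V: "\<alpha> \<in> carrier RE.V" "\<beta> \<in> carrier RE.V" using lim by (auto simp: theta_tendsto_def Theta_eq)
  fix W assume "W \<in> Ind R"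
  moreover have "theta_coeff R \<alpha> W = theta_coeff R \<beta> W"
    by (rule LIMSEQ_unique[OF theta_tendsto_coeff[OF s lim(1)] theta_tendsto_coeff[OF s lim(2)]])
  ultimately show "coeff_Ind W \<alpha> = coeff_Ind W \<beta>" using V by (simp add: theta_coeff_eq)
qed

text \<open>The first term on the right compares the multiplicities of \<open>E\<close> with the
  exact coordinates of \<open>q \<alpha>\<close>, and the second bounds the rounding of these
  coordinates. The latter depends on \<open>\<alpha>\<close> only, so it becomes negligible after
  division by a large \<open>q\<close>.\<close>

lemma surj_num_near_theta_surj:
  assumes E: "fg_module R E" and \<alpha>: "\<alpha> \<in> carrier RE.V" and N: "module R N" "\<not> zero_module N" and q: "0 < q"
  shows "\<bar>real (surj_num R N E) - real (theta_surj R N (q \<odot>\<^bsub>RE.V\<^esub> \<alpha>))\<bar> \<le>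
    q * theta_norm R ((1 / q) \<odot>\<^bsub>RE.V\<^esub> theta_class R E \<ominus>\<^bsub>RE.V\<^esub> \<alpha>) +
    (\<Sum>W\<in>{W. theta_coeff R \<alpha> W \<noteq> 0}. real (min_gens R (class_rep W)))"
proof -
  define S where "S = {W. theta_coeff R \<alpha> W \<noteq> 0}"
  define E' where "E' = module_copy R E"
  define T where "T = theta_module R (q \<odot>\<^bsub>RE.V\<^esub> \<alpha>)"
  define \<mu> where "\<mu> W = real (min_gens R (class_rep W))" for W
  define m where "m W = real (mult_Ind W E')" for W
  have E': "E' \<in> fg_modules R" unfolding E'_def by (rule module_copy_mem[OF E])
  then have ne: "fg_modules R \<noteq> {}" by blast
  have T: "T \<in> fg_modules R" unfolding T_def by (rule multiple_theta_module_mem[OF ne \<alpha>])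
  have multT: "mult_Ind W T = nat \<lfloor>q * theta_coeff R \<alpha> W\<rfloor>" for W
    unfolding T_def by (rule mult_Ind_multiple_theta_module[OF ne \<alpha>])
  define F where "F = {W. mult_Ind W E' \<noteq> 0} \<union> S"
  have S: "finite S" unfolding S_def by (rule theta_coeff_finite[OF \<alpha>])
  have F: "finite F" unfolding F_def using S mult_Ind_finite_support[OF E'] by simp
  have qE: "(1 / q) \<odot>\<^bsub>RE.V\<^esub> theta_class R E \<in> carrier RE.V"
    by (rule RE.smult_V_closed[OF theta_class_closed[OF E]])
  have c: "theta_coeff R ((1 / q) \<odot>\<^bsub>RE.V\<^esub> theta_class R E \<ominus>\<^bsub>RE.V\<^esub> \<alpha>) W = m W / q - theta_coeff R \<alpha> W" for W
    using theta_coeff_minus[OF qE \<alpha>] theta_coeff_smult[OF theta_class_closed[OF E]] theta_coeff_theta_class[OF E]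
    by (simp add: m_def E'_def)
  have "theta_norm R ((1 / q) \<odot>\<^bsub>RE.V\<^esub> theta_class R E \<ominus>\<^bsub>RE.V\<^esub> \<alpha>) = (\<Sum>W\<in>F. \<bar>m W / q - theta_coeff R \<alpha> W\<bar> * \<mu> W)"
    unfolding \<mu>_def c[symmetric]
    by (rule theta_norm_eq[OF RE.V.minus_closed[OF qE \<alpha>] F]) (auto simp: c F_def S_def m_def)
  then have norm: "q * theta_norm R ((1 / q) \<odot>\<^bsub>RE.V\<^esub> theta_class R E \<ominus>\<^bsub>RE.V\<^esub> \<alpha>) =
      (\<Sum>W\<in>F. \<bar>m W - q * theta_coeff R \<alpha> W\<bar> * \<mu> W)"
    using q by (simp add: sum_distrib_left abs_mult_pos' right_diff_distrib flip: mult.assoc)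
  have "surj_num R N E = surj_num R N E'"
    unfolding E'_def by (rule surj_num_isomorphic[OF module_copy_isomorphic[OF E] E fg_modulesD(2)[OF module_copy_mem[OF E]] N])
  then have "\<bar>real (surj_num R N E) - real (theta_surj R N (q \<odot>\<^bsub>RE.V\<^esub> \<alpha>))\<bar> =
      \<bar>real (surj_num R N E') - real (surj_num R N T)\<bar>"
    by (simp add: theta_surj_def T_def)
  also have "\<dots> \<le> (\<Sum>W\<in>F. \<bar>m W - real (mult_Ind W T)\<bar> * \<mu> W)"
    unfolding m_def \<mu>_def
    by (rule abs_surj_num_diff_le[OF E' T N F]) (auto simp: F_def S_def multT)
  \<comment> \<open>Where the coordinate of \<open>\<alpha>\<close> vanishes there is nothing to
    round, so the additional weight is charged on the support of \<open>\<alpha>\<close> only,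
    however many summands \<open>E\<close> has.\<close>
  also have "\<dots> \<le> (\<Sum>W\<in>F. \<bar>m W - q * theta_coeff R \<alpha> W\<bar> * \<mu> W + (if W \<in> S then \<mu> W else 0))"
  proof (rule sum_mono)
    fix W
    show "\<bar>m W - real (mult_Ind W T)\<bar> * \<mu> W \<le> \<bar>m W - q * theta_coeff R \<alpha> W\<bar> * \<mu> W + (if W \<in> S then \<mu> W else 0)"
    proof (cases "W \<in> S")
      case True
      have "\<bar>m W - real (mult_Ind W T)\<bar> * \<mu> W \<le> (\<bar>m W - q * theta_coeff R \<alpha> W\<bar> + 1) * \<mu> W"
        unfolding m_def multT by (intro mult_right_mono abs_nat_floor_le) (simp add: \<mu>_def)
      then show ?thesis using True by (simp add: algebra_simps)
    qed (simp add: S_def multT)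
  qed
  also have "\<dots> = (\<Sum>W\<in>F. \<bar>m W - q * theta_coeff R \<alpha> W\<bar> * \<mu> W) + (\<Sum>W\<in>S. \<mu> W)"
    using sum.inter_restrict[OF F, of \<mu> S] by (simp add: sum.distrib F_def Int_absorb1)
  finally show ?thesis unfolding norm by (simp add: S_def \<mu>_def)
qed

section \<open>The Frobenius sequence of \<open>M\<close>\<close>

context
  fixes p :: nat and M :: "('a, 'c, 'n) module_scheme" and \<alpha>
  assumes p: "Factorial_Ring.prime p" "has_characteristic R p" and F: "F_finite R p"
    and M: "fg_module R M" "\<not> zero_module M" and lim: "theta_tendsto R (frob_sequence R p M) \<alpha>"
begin

lemma frob_fg: "fg_module R (frob_module R p e M)"
  by (rule fg_frob_module[OF p F M(1)])

lemma frob_sequence_closed: "frob_sequence R p M e \<in> carrier RE.V"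
  unfolding frob_sequence_def Theta_eq by (rule RE.smult_V_closed[OF theta_class_closed[OF frob_fg]])

lemma FL_eq: "FL R p M = \<alpha>"
  unfolding FL_def
  by (rule the_equality, rule lim) (rule theta_tendsto_unique[OF frob_sequence_closed _ lim])

lemma frob_limit_closed: "\<alpha> \<in> carrier RE.V"
  using lim by (simp add: theta_tendsto_def Theta_eq)

lemma frob_limit_norm: "(\<lambda>e. theta_norm R (frob_sequence R p M e \<ominus>\<^bsub>RE.V\<^esub> \<alpha>)) \<longlonglongrightarrow> 0"
  using lim by (simp add: theta_tendsto_def Theta_eq)

text \<open>The parameter \<open>t\<close> in the limit of \<open>asn\<close> is specialized to the
  normalizing factor \<open>q e\<close>, which is possible because \<open>\<delta> > 0\<close> makes
  \<open>q e\<close> tend to infinity.\<close>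

lemma surj_num_frob_tendsto_pos:
  assumes \<delta>: "0 < frob_delta R p"
  shows "(\<lambda>e. real (surj_num R M (frob_module R p e M)) / real p powr (frob_delta R p * real e)) \<longlonglongrightarrow> asn R M \<alpha>"
proof -
  note N = fg_module_is_module[OF M(1)] M(2)
  note \<alpha> = frob_limit_closed
  have ne: "fg_modules R \<noteq> {}" using module_copy_mem[OF M(1)] by blast
  have p1: "1 < real p" using prime_gt_1_nat[OF p(1)] by simp
  define q where "q e = real p powr (frob_delta R p * real e)" for e
  have q: "0 < q e" for e using p1 by (simp add: q_def)
  have q_eq: "q = (\<lambda>e. exp ((frob_delta R p * ln (real p)) * real e))"
    using p1 by (simp add: fun_eq_iff q_def powr_def mult_ac)
  have q_top: "filterlim q at_top sequentially"
    unfolding q_eq using \<delta> p1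
    by (intro filterlim_compose[OF exp_at_top] filterlim_tendsto_pos_mult_at_top[OF tendsto_const] filterlim_real_sequentially) auto
  define C where "C = (\<Sum>W\<in>{W. theta_coeff R \<alpha> W \<noteq> 0}. real (min_gens R (class_rep W)))"
  let ?a = "\<lambda>e. real (surj_num R M (frob_module R p e M)) / q e"
    and ?b = "\<lambda>e. real (theta_surj R M (q e \<odot>\<^bsub>RE.V\<^esub> \<alpha>)) / q e"
  have "(\<lambda>e. ?a e - ?b e) \<longlonglongrightarrow> 0"
  proof (rule null_sequence_bound)
    fix e
    have "\<bar>real (surj_num R M (frob_module R p e M)) - real (theta_surj R M (q e \<odot>\<^bsub>RE.V\<^esub> \<alpha>))\<bar> \<le>
        q e * theta_norm R (frob_sequence R p M e \<ominus>\<^bsub>RE.V\<^esub> \<alpha>) + C"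
      using surj_num_near_theta_surj[OF frob_fg \<alpha> N q]
      unfolding frob_sequence_def Theta_eq C_def q_def .
    then show "\<bar>?a e - ?b e\<bar> \<le> theta_norm R (frob_sequence R p M e \<ominus>\<^bsub>RE.V\<^esub> \<alpha>) + C / q e"
      using q[of e] by (simp add: diff_divide_distrib[symmetric] pos_divide_le_eq algebra_simps)
  next
    have "(\<lambda>e. C / q e) \<longlonglongrightarrow> 0"
      by (intro tendsto_divide_0[OF tendsto_const] filterlim_at_top_imp_at_infinity q_top)
    from tendsto_add[OF frob_limit_norm this]
    show "(\<lambda>e. theta_norm R (frob_sequence R p M e \<ominus>\<^bsub>RE.V\<^esub> \<alpha>) + C / q e) \<longlonglongrightarrow> 0" by simp
  qed
  moreover have "?b \<longlonglongrightarrow> asn R M \<alpha>" by (rule filterlim_compose[OF asn_tendsto[OF ne \<alpha> N] q_top])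
  ultimately have "(\<lambda>e. (?a e - ?b e) + ?b e) \<longlonglongrightarrow> 0 + asn R M \<alpha>" by (rule tendsto_add)
  then show ?thesis by (simp add: q_def)
qed

text \<open>With \<open>\<delta> = 0\<close> the normalizing factor is \<open>1\<close>, so the
  coordinates of the sequence are natural numbers. The norm bounds all coordinate differences at
  once; hence beyond one \<open>e1\<close> all coordinates are within \<open>1 / 2\<close> of their
  limits and constant.\<close>

lemma frob_copy_multiplicity_eventually:
  assumes \<delta>: "frob_delta R p = 0"
  shows "\<exists>e1. \<forall>e\<ge>e1. \<forall>W. real (mult_Ind W (module_copy R (frob_module R p e M))) = theta_coeff R \<alpha> W"
proof -
  let ?m = "\<lambda>e W. real (mult_Ind W (module_copy R (frob_module R p e M)))"
  have p0: "p \<noteq> 0" using prime_gt_0_nat[OF p(1)] by simp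
  have coeff: "theta_coeff R (frob_sequence R p M e) W = ?m e W" for e W
    using theta_coeff_smult[OF theta_class_closed[OF frob_fg]] theta_coeff_theta_class[OF frob_fg] p0
    by (simp add: frob_sequence_def Theta_eq \<delta>)
  have near: "\<bar>?m e W - theta_coeff R \<alpha> W\<bar> \<le> theta_norm R (frob_sequence R p M e \<ominus>\<^bsub>RE.V\<^esub> \<alpha>)" for e W
    using abs_theta_coeff_le_norm[OF RE.V.minus_closed[OF frob_sequence_closed[of e] frob_limit_closed], of W]
      theta_coeff_minus[OF frob_sequence_closed[of e] frob_limit_closed, of W] coeff by simp
  have "eventually (\<lambda>e. theta_norm R (frob_sequence R p M e \<ominus>\<^bsub>RE.V\<^esub> \<alpha>) < 1 / 2) sequentially"
    by (rule order_tendstoD(2)[OF frob_limit_norm]) simp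
  then obtain e1 where e1: "\<And>e. e \<ge> e1 \<Longrightarrow> theta_norm R (frob_sequence R p M e \<ominus>\<^bsub>RE.V\<^esub> \<alpha>) < 1 / 2"
    by (auto simp: eventually_sequentially)
  have "?m e W = theta_coeff R \<alpha> W" if e: "e \<ge> e1" for e W
  proof -
    have near_half: "\<bar>?m e W - theta_coeff R \<alpha> W\<bar> < 1 / 2" if "e \<ge> e1" for e
      by (rule le_less_trans[OF near e1[OF that]])
    have const: "?m e' W = ?m e W" if "e' \<ge> e1" for e'
      using nat_eqI_near[OF near_half[OF that] near_half[OF e]] by simp
    have "(\<lambda>e'. ?m e' W) \<longlonglongrightarrow> ?m e W"
      by (rule tendsto_eventually) (use const in \<open>auto simp: eventually_sequentially\<close>)
    moreover have "(\<lambda>e'. ?m e' W) \<longlonglongrightarrow> theta_coeff R \<alpha> W"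
      using theta_tendsto_coeff[OF frob_sequence_closed lim, of W] unfolding coeff .
    ultimately show ?thesis by (rule LIMSEQ_unique)
  qed
  then show ?thesis by blast
qed

text \<open>If \<open>\<delta> = 0\<close>, then \<open>p powr (\<delta> * e) = 1\<close> and the rounding error does not vanish in the limit. But
  then \<open>R\<close> is Artinian with perfect residue field, so for large \<open>e\<close> the Frobenius pushforward of \<open>M\<close> is
  killed by \<open>\<mm>\<close>: it is isomorphic to \<open>M\<close> if \<open>\<mm> M = 0\<close>, and otherwise no direct sum of copies of it
  maps onto \<open>M\<close>.\<close>

lemma surj_num_frob_tendsto_zero:
  assumes dim: "krull_dim R = enat 0" and deg: "log (real p) (real (p_degree \<kappa> p)) = 0"
  shows "(\<lambda>e. real (surj_num R M (frob_module R p e M)) / real p powr (frob_delta R p * real e)) \<longlonglongrightarrow> asn R M \<alpha>"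
proof -
  note M' = fg_module_is_module[OF M(1)]
  interpret M: module R M by (rule M')
  have \<delta>: "frob_delta R p = 0" using dim deg by (simp add: frob_delta_def)
  have ne: "fg_modules R \<noteq> {}" using module_copy_mem[OF M(1)] by blast
  have p0: "p \<noteq> 0" using prime_gt_0_nat[OF p(1)] by simp
  obtain e1 where e1: "\<And>e W. e \<ge> e1 \<Longrightarrow> real (mult_Ind W (module_copy R (frob_module R p e M))) = theta_coeff R \<alpha> W"
    using frob_copy_multiplicity_eventually[OF \<delta>] by blast
  obtain e0 where e0: "\<And>e r. e \<ge> e0 \<Longrightarrow> r \<in> \<mm> \<Longrightarrow> r [^] (p ^ e) = \<zero>"
    using dim_0_frobenius_nilpotent[OF dim p] by blast
  \<comment> \<open>From \<open>e0\<close> on, the \<open>p^e\<close>-th powers of elements of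
    \<open>\<mm>\<close> vanish; from \<open>e1\<close> on, the multiplicities are the coordinates
    of \<open>\<alpha>\<close>. A single \<open>E\<close> then represents \<open>\<alpha>\<close>
    and all later pushforwards.\<close>
  define e where "e = max e0 e1"
  define E where "E = module_copy R (frob_module R p e M)"
  have E: "E \<in> fg_modules R" unfolding E_def by (rule module_copy_mem[OF frob_fg])
  have iso: "module_isomorphic R (frob_module R p e M) E" unfolding E_def by (rule module_copy_isomorphic[OF frob_fg])
  note FM = fg_module_is_module[OF frob_fg[of e]] and E' = fg_modulesD(2)[OF E]
  interpret E: module R E by (rule E')
  have mE: "real (mult_Ind W E) = theta_coeff R \<alpha> W" for W unfolding E_def by (rule e1) (simp add: e_def)
  have killed: "r \<odot>\<^bsub>E\<^esub> x = \<zero>\<^bsub>E\<^esub>" if r: "r \<in> \<mm>" and x: "x \<in> carrier E" for r x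
  proof -
    obtain f g where f: "f \<in> module_hom R (frob_module R p e M) E" and g: "g \<in> module_hom R E (frob_module R p e M)"
      and fg: "\<And>y. y \<in> carrier E \<Longrightarrow> f (g y) = y"
      by (rule module_isomorphicE[OF iso FM E']) (rule that; assumption)
    have gx: "g x \<in> carrier (frob_module R p e M)" by (rule module_hom_closed[OF g x])
    have "r \<odot>\<^bsub>E\<^esub> x = f (r \<odot>\<^bsub>frob_module R p e M\<^esub> g x)"
      using module_hom_smult[OF f \<mm>.a_Hcarr[OF r] gx] fg[OF x] by simp
    also have "r \<odot>\<^bsub>frob_module R p e M\<^esub> g x = \<zero>\<^bsub>frob_module R p e M\<^esub>"
      using e0[OF _ r, of e] gx by (simp add: e_def)
    also have "f \<dots> = \<zero>\<^bsub>E\<^esub>" by (rule module_hom_zero[OF FM E' f])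
    finally show ?thesis .
  qed
  \<comment> \<open>Here \<open>k\<close> is \<open>1\<close> or \<open>0\<close>. The case
    \<open>n = 1\<close> gives the Frobenius side, and general \<open>n\<close> gives
    \<open>theta_surj\<close> at integer multiples of \<open>\<alpha>\<close>; both depend on
    multiplicities only, so one suitable \<open>P\<close> for each \<open>n\<close>
    suffices.\<close>
  have "\<exists>k. \<forall>n. \<exists>P\<in>fg_modules R. (\<forall>W. mult_Ind W P = n * mult_Ind W E) \<and> surj_num R M P = n * k"
  proof (cases "\<forall>r\<in>\<mm>. \<forall>x\<in>carrier M. r \<odot>\<^bsub>M\<^esub> x = \<zero>\<^bsub>M\<^esub>")
    case True
    have "module_isomorphic R M (frob_module R p e M)"
      by (rule frob_module_isomorphic_killed[OF p F deg M(1)]) (use True in blast)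
    then have "module_isomorphic R E M"
      by (rule module_isomorphic_sym[OF M' E' module_isomorphic_trans[OF _ iso]])
    from surj_num_multiple_self[OF M E this] show ?thesis by (intro exI[of _ 1]) simp
  next
    case False
    then obtain r y where "r \<in> \<mm>" "y \<in> carrier M" "r \<odot>\<^bsub>M\<^esub> y \<noteq> \<zero>\<^bsub>M\<^esub>" by blast
    from surj_num_multiple_killed[OF M' M(2) E killed this] show ?thesis by (intro exI[of _ 0]) simp
  qed
  then obtain k where k: "\<And>n. \<exists>P\<in>fg_modules R. (\<forall>W. mult_Ind W P = n * mult_Ind W E) \<and> surj_num R M P = n * k"
    by blast
  have surj: "surj_num R M A = n * k" if "A \<in> fg_modules R" "\<And>W. mult_Ind W A = n * mult_Ind W E" for A n
  proof -
    obtain P where "P \<in> fg_modules R" "\<And>W. mult_Ind W P = n * mult_Ind W E" "surj_num R M P = n * k"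
      using k[of n] by blast
    then show ?thesis using surj_num_mult_Ind_cong[OF that(1) _ M' M(2), of P] that(2) by simp
  qed
  have "surj_num R M (frob_module R p e' M) = k" if "e' \<ge> e" for e'
  proof -
    have "real (mult_Ind W (module_copy R (frob_module R p e' M))) = real (mult_Ind W E)" for W
      using e1[of e' W] mE[of W] that by (simp add: e_def)
    then have "surj_num R M (module_copy R (frob_module R p e' M)) = 1 * k"
      by (intro surj[OF module_copy_mem[OF frob_fg]]) simp
    then show ?thesis
      using surj_num_isomorphic[OF module_copy_isomorphic[OF frob_fg] frob_fg
          fg_modulesD(2)[OF module_copy_mem[OF frob_fg]] M' M(2)] by simp
  qed
  then have "eventually (\<lambda>e'. surj_num R M (frob_module R p e' M) = k) sequentially"
    by (auto simp: eventually_sequentially)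
  then have lim_k: "(\<lambda>e'. real (surj_num R M (frob_module R p e' M)) / real p powr (frob_delta R p * real e')) \<longlonglongrightarrow> real k"
    using p0 by (intro tendsto_eventually) (auto simp: \<delta> elim!: eventually_mono)
  \<comment> \<open>Integer multiples of \<open>\<alpha>\<close> have integer coordinates, so
    nothing is rounded. As the limit in \<open>asn\<close> is known to exist, it may be computed
    along the integers.\<close>
  have "theta_surj R M (real n \<odot>\<^bsub>RE.V\<^esub> \<alpha>) = n * k" for n
    unfolding theta_surj_def
  proof (rule surj[OF multiple_theta_module_mem[OF ne frob_limit_closed]])
    fix W
    have "real n * theta_coeff R \<alpha> W = of_int (int (n * mult_Ind W E))" using mE[of W] by simp
    then show "mult_Ind W (theta_module R (real n \<odot>\<^bsub>RE.V\<^esub> \<alpha>)) = n * mult_Ind W E"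
      unfolding mult_Ind_multiple_theta_module[OF ne frob_limit_closed] by (simp only: floor_of_int nat_int)
  qed
  then have "(\<lambda>n. real (theta_surj R M (real n \<odot>\<^bsub>RE.V\<^esub> \<alpha>)) / real n) \<longlonglongrightarrow> real k"
    by (intro tendsto_eventually eventually_sequentiallyI[of 1]) simp
  moreover have "(\<lambda>n. real (theta_surj R M (real n \<odot>\<^bsub>RE.V\<^esub> \<alpha>)) / real n) \<longlonglongrightarrow> asn R M \<alpha>"
    by (rule filterlim_compose[OF asn_tendsto[OF ne frob_limit_closed M' M(2)] filterlim_real_sequentially])
  ultimately have "asn R M \<alpha> = real k" by (blast intro: LIMSEQ_unique)
  then show ?thesis using lim_k by simp
qed

lemma surj_num_frob_tendsto:
  assumes dim: "krull_dim R = enat d"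
  shows "(\<lambda>e. real (surj_num R M (frob_module R p e M)) / real p powr (frob_delta R p * real e)) \<longlonglongrightarrow> asn R M \<alpha>"
proof (cases "0 < frob_delta R p")
  case False
  \<comment> \<open>Both summands of \<open>\<delta>\<close> are nonnegative, so
    \<open>\<delta> \<le> 0\<close> forces each of them to vanish.\<close>
  have "0 \<le> log (real p) (real (p_degree \<kappa> p))"
    using prime_gt_1_nat[OF p(1)] by (intro log_nat_nonneg) simp
  then have "d = 0" "log (real p) (real (p_degree \<kappa> p)) = 0"
    using False dim by (auto simp: frob_delta_def)
  then show ?thesis using dim by (intro surj_num_frob_tendsto_zero) auto
qed (rule surj_num_frob_tendsto_pos)

end

end

theorem theorem3p4:
  fixes R :: "('a, 'r) ring_scheme"
    and M :: "('a, 'b, 'm) module_scheme"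
    and p d :: nat
    and \<delta> :: real
  assumes "Factorial_Ring.prime p"
    and "noetherian_ring R"
    and "local_ring R"
    and "henselian R"
    and "has_characteristic R p"
    and "F_finite R p"
    and "krull_dim R = enat d"
    and "\<delta> = real d + log (real p) (real (p_degree (residue_field R) p))"
    and "fg_module R M"
    and "\<not> zero_module M"
    and "\<exists>\<alpha>. theta_tendsto R (frob_sequence R p M) \<alpha>"
  shows "((\<lambda>e. real (surj_num R M (frob_module R p e M)) / real p powr (\<delta> * real e))
            \<longlonglongrightarrow> asn R M (FL R p M))
       \<and> dual_F_signature R p M = ereal (asn R M (FL R p M))"
proof -
  interpret noetherian_ring R by fact
  interpret cring R using assms(3) by (simp add: local_ring_def)
  interpret henselian_local_ring R
    by unfold_locales (use assms(3,4) in \<open>auto simp: local_ring_def\<close>)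
  obtain \<alpha> where \<alpha>: "theta_tendsto R (frob_sequence R p M) \<alpha>" using assms(11) by blast
  have \<delta>: "frob_delta R p = \<delta>" using assms(7,8) by (simp add: frob_delta_def)
  note frob = assms(1,5,6,9,10) \<alpha>
  have lim: "(\<lambda>e. real (surj_num R M (frob_module R p e M)) / real p powr (frob_delta R p * real e))
      \<longlonglongrightarrow> asn R M (FL R p M)"
    unfolding FL_eq[OF frob] by (rule surj_num_frob_tendsto[OF frob assms(7)])
  then have "dual_F_signature R p M = ereal (asn R M (FL R p M))"
    unfolding dual_F_signature_def by (intro lim_imp_Limsup tendsto_intros) simp_all
  then show ?thesis using lim \<delta> by simp
qed

end
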